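(* Let $n\ge2$ and let $A$ be a fixed real $n\times n$ matrix whose eigenvalues $\lambda_1,\ldots,\lambda_n$ satisfy $\lambda_1=0$ and $$m_2\lambda_2+\cdots+m_n\lambda_n\neq 0\quad\text{for all } (m_2,\ldots,m_n)\in\mathbb Z_+^{n-1}\text{ with } m_2+\cdots+m_n\ge 2.$$ Let $\mathfrak K$ be the set of analytic differential systems $\dot x=Ax+f(x)$ near the origin of $\mathbb R^n$, with this linear part $A$, where $f$ is analytic in a neighborhood of the origin and $f(x)=o(|x|)$. Let $\mathcal K$ be any finite dimensional (affine) subspace of $\mathfrak K$ such that the origin is a nonisolated singularity of every system in $\mathcal K$. Then the following statements hold. (a) If $\mathcal K$ contains an element which has a formal first integral but no analytic first integral in a neighborhood of the origin, then all elements of $\mathcal K$, except perhaps those in a pluripolar subset, also have this property. (b) If $\mathcal K$ has a nonpluripolar subset each of whose elements has an analytic first integral in a neighborhood of the origin, then all systems in $\mathcal K$ have an analytic first integral in a neighborhood of the origin.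
   Context: $\mathbb Z_+$ is the set of nonnegative integers; eigenvalues are complex and counted with multiplicity. The origin is a nonisolated singularity of $\dot x=Ax+f(x)$ if every neighborhood of the origin contains a zero of $Ax+f(x)$ other than the origin. An analytic first integral in a neighborhood of the origin is a nonconstant analytic function $H$ defined in some neighborhood of the origin with $\langle\nabla H(x),Ax+f(x)\rangle\equiv0$. A formal first integral is a nonconstant formal power series $H$ in $x$ satisfying the same identity formally (with $f$ replaced by its Taylor series). A finite dimensional (affine) subspace $\mathcal K$ of $\mathfrak K$ of dimension $m$ is a family of systems of the form $\dot x=\mathcal Y_0(x)+t_1\mathcal Y_1(x)+\cdots+t_m\mathcal Y_m(x)$, $t=(t_1,\ldots,t_m)\in\mathbb R^m$, where $\mathcal Y_0\in\mathfrak K$ (i.e. its vector field has linear part $Ax$) and $\mathcal Y_1,\ldots,\mathcal Y_m$ are linearly independent analytic vector fields near the origin which are $o(|x|)$. $\mathcal K$ is identified with $\mathbb R^m\subset\mathbb C^m$ through the parameter $t$, and a subset of $\mathcal K$ is called pluripolar (nonpluripolar) if the corresponding set of parameters $t$ is (is not) a pluripolar subset of $\mathbb C^m$. A subset $\Lambda\subset\mathbb C^m$ is pluripolar if for each $z\in\Lambda$ there exist a neighborhood $U_z$ of $z$ and a plurisubharmonic function $p$ on $U_z$ with $\Lambda\cap U_z\subset p^{-1}(-\infty)$. A function $p:\Omega\to[-\infty,\infty)$ on an open set $\Omega\subset\mathbb C^m$ is plurisubharmonic if it is upper semicontinuous, is not identically $-\infty$ on any connected component of $\Omega$, and satisfies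 $p(z)\le\frac1{2\pi}\int_0^{2\pi}p(z+e^{i\theta}r)\,d\theta$ for all $z\in\Omega$ and all $r\in\mathbb C^m$ such that $z+\sigma r\in\Omega$ for all $\sigma\in\mathbb C$ with $|\sigma|\le1$. *)

theory Defs
  imports
    "HOL-Analysis.Analysis"
    "HOL-Library.Landau_Symbols"
    "HOL-Computational_Algebra.Polynomial"
begin

section \<open>Characteristic polynomial\<close>

definition char_polynomial :: "real^'n^'n \<Rightarrow> complex poly" where
  "char_polynomial A =
     det (\<chi> i j. (if i = j then [:0, 1:] else 0) - [:complex_of_real (A $ i $ j):])"


section \<open>Power series in several variables and real analytic functions\<close>

text \<open>
  A multi-index is an element of \<open>nat^'n\<close>, and a formal power series in the coordinates of
  \<open>real^'n\<close> is its coefficient function.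
\<close>

type_synonym 'n mfps = "nat^'n \<Rightarrow> real"

definition has_power_series_at ::
    "(real^'n \<Rightarrow> real) \<Rightarrow> 'n mfps \<Rightarrow> real^'n \<Rightarrow> bool" where
  "has_power_series_at f a p \<longleftrightarrow>
     (\<exists>r>0. \<forall>x\<in>ball p r.
        ((\<lambda>\<alpha>. a \<alpha> * (\<Prod>i\<in>UNIV. (x $ i - p $ i) ^ (\<alpha> $ i))) has_sum f x) UNIV)"

definition real_analytic_on :: "(real^'n \<Rightarrow> real) \<Rightarrow> (real^'n) set \<Rightarrow> bool" where
  "real_analytic_on f U \<longleftrightarrow> (\<forall>p\<in>U. \<exists>a. has_power_series_at f a p)"

definition mfps_deriv :: "'n::finite \<Rightarrow> 'n mfps \<Rightarrow> 'n mfps" where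
  "mfps_deriv i H = (\<lambda>\<alpha>. real (\<alpha> $ i + 1) * H (\<alpha> + axis i 1))"

definition mfps_mult :: "'n::finite mfps \<Rightarrow> 'n mfps \<Rightarrow> 'n mfps" where
  "mfps_mult F G = (\<lambda>\<gamma>. \<Sum>(\<alpha>, \<beta>) \<in> {(\<alpha>, \<beta>). \<alpha> + \<beta> = \<gamma>}. F \<alpha> * G \<beta>)"

text \<open>The index set in the Cauchy product is finite, so that \<open>sum\<close> has its intended meaning.\<close>

lemma finite_mfps_mult_index: "finite {(\<alpha>, \<beta>). \<alpha> + \<beta> = (\<gamma> :: nat^'n)}"
proof -
  have "finite ((\<lambda>f. (\<chi> i. f i)) ` (\<Pi>\<^sub>E i\<in>UNIV. {..\<gamma> $ i}))" (is "finite ?B")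
    by (intro finite_imageI finite_PiE) auto
  have *: "\<alpha> \<in> ?B" if "\<forall>i. \<alpha> $ i \<le> \<gamma> $ i" for \<alpha> :: "nat^'n"
    using that by (intro image_eqI[of _ _ "vec_nth \<alpha>"]) auto
  have "{(\<alpha>, \<beta>). \<alpha> + \<beta> = \<gamma>} \<subseteq> ?B \<times> ?B"
  proof
    fix x assume "x \<in> {(\<alpha>, \<beta>). \<alpha> + \<beta> = \<gamma>}"
    then have "fst x + snd x = \<gamma>"
      by (simp add: case_prod_beta)
    then have "\<forall>i. fst x $ i \<le> \<gamma> $ i" "\<forall>i. snd x $ i \<le> \<gamma> $ i"
      by auto
    then have "fst x \<in> ?B" "snd x \<in> ?B"
      using * by blast+
    then show "x \<in> ?B \<times> ?B"
      by (simp add: mem_Times_iff)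
  qed
  with \<open>finite ?B\<close> show ?thesis
    by (meson finite_SigmaI finite_subset)
qed


section \<open>Analytic systems near the origin\<close>

text \<open>
  Vector fields near the origin are represented by total functions on \<open>real^'n\<close>; every notion
  below depends only on the germ of the function at the origin.
\<close>

definition analytic_near_origin :: "(real^'n \<Rightarrow> real^'n) \<Rightarrow> bool" where
  "analytic_near_origin F \<longleftrightarrow>
     (\<exists>U. open U \<and> 0 \<in> U \<and> (\<forall>i. real_analytic_on (\<lambda>x. F x $ i) U))"

definition higher_order_field :: "(real^'n \<Rightarrow> real^'n) \<Rightarrow> bool" where
  "higher_order_field f \<longleftrightarrow>
     analytic_near_origin f \<and> (\<lambda>x. norm (f x)) \<in> o[at 0](\<lambda>x. norm x)"

definition analytic_systems :: "real^'n^'n \<Rightarrow> (real^'n \<Rightarrow> real^'n) set" where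
  "analytic_systems A = {X. \<exists>f. higher_order_field f \<and> (\<forall>x. X x = A *v x + f x)}"

definition lin_indep_germs :: "('m::finite \<Rightarrow> real^'n \<Rightarrow> real^'n) \<Rightarrow> bool" where
  "lin_indep_germs Y \<longleftrightarrow>
     (\<forall>c. (\<forall>\<^sub>F x in nhds 0. (\<Sum>j\<in>UNIV. c j *\<^sub>R Y j x) = 0) \<longrightarrow> (\<forall>j. c j = 0))"

definition system_family ::
    "(real^'n \<Rightarrow> real^'n) \<Rightarrow> ('m::finite \<Rightarrow> real^'n \<Rightarrow> real^'n) \<Rightarrow> real^'m
      \<Rightarrow> real^'n \<Rightarrow> real^'n" where
  "system_family Y0 Y t = (\<lambda>x. Y0 x + (\<Sum>j\<in>UNIV. (t $ j) *\<^sub>R Y j x))"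

definition is_affine_family ::
    "real^'n^'n \<Rightarrow> (real^'n \<Rightarrow> real^'n) \<Rightarrow> ('m::finite \<Rightarrow> real^'n \<Rightarrow> real^'n) \<Rightarrow> bool" where
  "is_affine_family A Y0 Y \<longleftrightarrow>
     Y0 \<in> analytic_systems A \<and> (\<forall>j. higher_order_field (Y j)) \<and> lin_indep_germs Y"

definition origin_nonisolated_singularity :: "(real^'n \<Rightarrow> real^'n) \<Rightarrow> bool" where
  "origin_nonisolated_singularity X \<longleftrightarrow> 0 islimpt {x. X x = 0}"


section \<open>First integrals\<close>

text \<open>
  The neighbourhood is taken connected, so that being nonconstant on it is a property of the germ
  of \<open>H\<close> at the origin: on a disconnected open set, a locally constant function could be nonconstant.
\<close>

definition has_analytic_first_integral :: "(real^'n \<Rightarrow> real^'n) \<Rightarrow> bool" where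
  "has_analytic_first_integral X \<longleftrightarrow>
     (\<exists>U H. open U \<and> connected U \<and> 0 \<in> U \<and> real_analytic_on H U \<and> \<not> H constant_on U \<and>
        (\<forall>x\<in>U. \<exists>D. (GDERIV H x :> D) \<and> D \<bullet> X x = 0))"

text \<open>Here \<open>a i\<close> is the Taylor series at the origin of the \<open>i\<close>-th component of the vector field.\<close>

definition has_formal_first_integral :: "(real^'n \<Rightarrow> real^'n) \<Rightarrow> bool" where
  "has_formal_first_integral X \<longleftrightarrow>
     (\<exists>a H. (\<forall>i. has_power_series_at (\<lambda>x. X x $ i) (a i) 0) \<and>
        (\<exists>\<alpha>. \<alpha> \<noteq> 0 \<and> H \<alpha> \<noteq> 0) \<and>
        (\<forall>\<gamma>. (\<Sum>i\<in>UNIV. mfps_mult (mfps_deriv i H) (a i) \<gamma>) = 0))"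


section \<open>Plurisubharmonic functions and pluripolar sets\<close>

definition upper_semicontinuous_on :: "'a::topological_space set \<Rightarrow> ('a \<Rightarrow> ereal) \<Rightarrow> bool" where
  "upper_semicontinuous_on S p \<longleftrightarrow>
     (\<forall>z\<in>S. \<forall>c. p z < c \<longrightarrow> (\<forall>\<^sub>F w in at z within S. p w < c))"

text \<open>
  The mean of \<open>p\<close> over the circle \<open>z + e\<^sup>i\<^sup>\<theta> r\<close>, as the integral of the positive part minus that of
  the negative part (\<open>e2ennreal\<close> sends negative numbers to \<open>0\<close>). An upper semicontinuous
  \<open>p < \<infinity>\<close> is bounded above on the circle, so the first integral is finite and the difference is
  an element of \<open>[-\<infinity>, \<infinity>)\<close>.
\<close>

definition circle_mean :: "(complex^'m \<Rightarrow> ereal) \<Rightarrow> complex^'m \<Rightarrow> complex^'m \<Rightarrow> ereal" where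
  "circle_mean p z r = ereal (1 / (2 * pi)) *
     (enn2ereal (\<integral>\<^sup>+\<theta>\<in>{0..2 * pi}. e2ennreal (p (z + cis \<theta> *s r)) \<partial>lborel)
      - enn2ereal (\<integral>\<^sup>+\<theta>\<in>{0..2 * pi}. e2ennreal (- p (z + cis \<theta> *s r)) \<partial>lborel))"

definition plurisubharmonic_on :: "(complex^'m) set \<Rightarrow> (complex^'m \<Rightarrow> ereal) \<Rightarrow> bool" where
  "plurisubharmonic_on \<Omega> p \<longleftrightarrow>
     open \<Omega> \<and> (\<forall>z\<in>\<Omega>. p z < \<infinity>) \<and> upper_semicontinuous_on \<Omega> p \<and>
     (\<forall>C\<in>components \<Omega>. \<exists>z\<in>C. p z \<noteq> -\<infinity>) \<and>
     (\<forall>z\<in>\<Omega>. \<forall>r. (\<forall>\<sigma>. norm \<sigma> \<le> 1 \<longrightarrow> z + \<sigma> *s r \<in> \<Omega>) \<longrightarrow> p z \<le> circle_mean p z r)"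

definition pluripolar :: "(complex^'m) set \<Rightarrow> bool" where
  "pluripolar \<Lambda> \<longleftrightarrow>
     (\<forall>z\<in>\<Lambda>. \<exists>U p. open U \<and> z \<in> U \<and> plurisubharmonic_on U p \<and> (\<forall>w\<in>\<Lambda> \<inter> U. p w = -\<infinity>))"

definition complex_points :: "(real^'m) set \<Rightarrow> (complex^'m) set" where
  "complex_points S = (\<lambda>t. \<chi> j. complex_of_real (t $ j)) ` S"

end

(*
  Let v span the kernel of A and let l be the left null vector of A with l(v) = 1. By nonresonance, the
  derivation by A x is, in each degree d, invertible modulo l^d. Hence, degree by degree, there is a unique
  formal series H = l + ... whose restriction to the line of v is the coordinate and whose derivative along
  the system consists of multiples of powers of l. Nonisolatedness of the singularity forces these multiples
  to vanish, so H is a formal first integral, and every formal first integral is a power series in H.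
  If a convergent F = phi(H) is not constant, then H converges: on planes containing v, H solves
  phi(H) = F with H known on the line, which bounds its coefficients geometrically. So the system has an
  analytic first integral iff |H_alpha| <= K^|alpha| for some K.
  Along an affine family the coefficient H_alpha is a polynomial of degree at most |alpha| in the parameter.
  The set where such polynomials grow at most geometrically is either everything or pluripolar.
*)
theory Submission
  imports Defs "HOL-Complex_Analysis.Complex_Analysis"
    "HOL-Computational_Algebra.Fundamental_Theorem_Algebra"
    "Jordan_Normal_Form.Schur_Decomposition"
begin

text \<open>An analytic first integral is never unique, since functions of it are again first
  integrals, and its choice need not vary with the parameter in any controlled way. The normalized
  series H removes this freedom and turns convergence into a growth condition on countably many
  polynomials in the parameter. The cost lies in the passage from F = phi(H) back to H: phi' may
  vanish at 0, as for F = H^2, and dividing by phi' then loses powers of the coordinate s on the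
  line of v, which breaks an ordinary majorant argument. The degree bound in the parameter holds
  because each use of the perturbation, whose terms start in degree 2, raises the degree in x by at
  least one and the degree in the parameter by at most one. Pluripolarity rests on a weighted sum of
  logarithms of |P| / max |P|. That it is -infinity where the growth is geometric is easy; the
  obstacle is one finite value. It requires a single point at which infinitely many polynomials are
  all close to their maxima, with a loss controlled by the degree. Such a point is found among the
  real ones, one coordinate at a time, by averaging over [0, 1].\<close>

no_notation vec_index (infixl "$" 100)
no_notation fps_nth (infixl "$" 75)
hide_const (open) Order.top Module.module.smult
hide_fact (open) Matrix.vec_eq_iff Congruence.set_eqI
no_notation Infinite_Set_Sum.abs_summable_on (infix "abs'_summable'_on" 50)

section \<open>Mean values of logarithms of polynomials\<close>

text \<open>Only meaningful for \<open>x \<le> 1\<close>: for larger \<open>x\<close> the negative value is truncated to \<open>0\<close> by \<open>ennreal\<close>.\<close>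

definition nlog :: "real \<Rightarrow> real \<Rightarrow> ennreal" where
  "nlog c x = (if x \<le> 0 then top else ennreal (c * (- ln x)))"

lemma nlog_scale: "c > 0 \<Longrightarrow> nlog c x = ennreal c * nlog 1 x"
  by (cases "x \<le> 0"; cases "x \<le> 1")
     (auto simp: nlog_def ennreal_mult_top ennreal_mult[symmetric] ennreal_neg mult_nonneg_nonpos
        mult_nonneg_nonneg ln_ge_zero_iff ln_le_zero_iff ennreal_mult')

lemma nlog_gt_iff:
  assumes "c > 0" "l \<ge> 0"
  shows "ennreal l < nlog c x \<longleftrightarrow> x < exp (- l / c)"
proof (cases "x \<le> 0")
  case True
  then show ?thesis using assms by (auto simp: nlog_def intro: le_less_trans)
next
  case False
  then have "l < c * (- ln x) \<longleftrightarrow> ln x < - l / c"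
    using assms by (simp add: field_simps) linarith
  also have "\<dots> \<longleftrightarrow> x < exp (- l / c)"
    using False by (metis exp_less_cancel_iff exp_ln not_le)
  finally show ?thesis using False assms by (simp add: nlog_def ennreal_less_iff)
qed

text \<open>The value \<open>top\<close> at 0 is the limit of -c ln x, and the truncation beyond 1
  is continuous as well. So composites with polynomials are continuous and measurable across their
  zeros.\<close>

lemma isCont_nlog:
  assumes c: "c > 0"
  shows "isCont (nlog c) x"
proof -
  consider "x < 0" | "x = 0" | "x > 0" by linarith
  then show ?thesis
  proof cases
    case 1
    have "\<forall>\<^sub>F y in nhds x. nlog c y = top"
      using eventually_nhds_in_open[of "{..<0}" x] 1 by (auto elim!: eventually_mono simp: nlog_def)
    then show ?thesis
      by (subst isCont_cong) auto
  next
    case 2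
    have "(nlog c \<longlongrightarrow> top) (at 0)"
      unfolding tendsto_top_iff_ennreal
    proof (intro allI impI)
      fix l :: real assume l: "0 \<le> l"
      have "\<forall>\<^sub>F y in at 0. y \<in> {..<exp (- l / c)}"
        by (intro eventually_at_in_open') auto
      then show "\<forall>\<^sub>F y in at 0. ennreal l < nlog c y"
        by eventually_elim (simp add: nlog_gt_iff[OF c l])
    qed
    then show ?thesis using 2 by (simp add: isCont_def nlog_def)
  next
    case 3
    have "\<forall>\<^sub>F y in nhds x. nlog c y = ennreal (c * (- ln y))"
      using eventually_nhds_in_open[of "{0<..}" x] 3 by (auto elim!: eventually_mono simp: nlog_def)
    moreover have "isCont (\<lambda>y. ennreal (c * (- ln y))) x"
      using 3 unfolding isCont_def by (intro tendsto_ennrealI tendsto_intros) auto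
    ultimately show ?thesis
      by (subst isCont_cong) auto
  qed
qed

lemma continuous_on_nlog: "c > 0 \<Longrightarrow> continuous_on A (nlog c)"
  by (simp add: continuous_at_imp_continuous_on isCont_nlog)

lemma measurable_nlog [measurable]: "nlog 1 \<in> borel_measurable borel"
  by (intro borel_measurable_continuous_onI continuous_on_nlog) auto

lemma nlog_mult:
  assumes "0 \<le> x" "x \<le> 1" "0 \<le> y" "y \<le> 1"
  shows "nlog 1 (x * y) = nlog 1 x + nlog 1 y"
proof (cases "x = 0 \<or> y = 0")
  case False
  then have "x > 0" "y > 0" using assms by auto
  then show ?thesis
    using assms by (simp add: nlog_def ln_mult ennreal_plus[symmetric] mult_le_0_iff del: ennreal_plus)
qed (auto simp: nlog_def)

text \<open>Changing the normalizing constant adds a finite constant. This allows bounds from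
  different sources to be compared in [0, infinity], where subtraction is awkward.\<close>

lemma nlog_rescale:
  assumes "0 \<le> x" "x \<le> M" "0 < M" "M \<le> M'"
  shows "nlog 1 (x / M') = nlog 1 (x / M) + ennreal (ln (M' / M))"
proof -
  have "nlog 1 (x / M') = nlog 1 ((x / M) * (M / M'))" using assms by simp
  also have "\<dots> = nlog 1 (x / M) + nlog 1 (M / M')"
    using assms by (intro nlog_mult) (auto simp: field_simps)
  also have "nlog 1 (M / M') = ennreal (ln (M' / M))"
    using assms by (auto simp: nlog_def ln_div divide_le_0_iff)
  finally show ?thesis .
qed

text \<open>For |b| < 1 the function Ln(1 - b u) is holomorphic on the closed disc, since Re(1 - b
  u) > 0 there. Cauchy's formula makes its circle mean its value 0 at the centre, and its real part
  is ln|1 - b u|.\<close>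

lemma circle_mean_ln_unit:
  assumes b: "cmod b < 1"
  shows "((\<lambda>\<theta>. ln (cmod (1 - b * cis \<theta>))) has_integral 0) {0..2*pi}"
proof -
  define f where "f = (\<lambda>u. Ln (1 - b * u))"
  have nr: "1 - b * u \<notin> \<real>\<^sub>\<le>\<^sub>0" if "cmod u \<le> 1" for u
  proof
    assume "1 - b * u \<in> \<real>\<^sub>\<le>\<^sub>0"
    then have "Re (1 - b * u) \<le> 0" by (metis complex_nonpos_Reals_iff)
    moreover have "Re (b * u) \<le> cmod (b * u)" by (rule complex_Re_le_cmod)
    moreover have "cmod (b * u) \<le> cmod b * 1"
      unfolding norm_mult using that by (intro mult_left_mono) auto
    ultimately show False using b by simp
  qed
  have hol: "f holomorphic_on cball 0 1"
    unfolding f_def by (intro holomorphic_intros) (use nr in auto)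
  have "((\<lambda>u. f u / (u - 0)) has_contour_integral 2 * complex_of_real pi * \<i> * f 0) (circlepath 0 1)"
    by (rule Cauchy_integral_circlepath_simple[OF hol]) auto
  then have "((\<lambda>u. f u / u) has_contour_integral 0) (part_circlepath 0 1 0 (2 * pi))"
    by (simp add: circlepath_def f_def)
  then have "((\<lambda>t. f (0 + of_real 1 * cis t) / (0 + of_real 1 * cis t) * of_real 1 * \<i> * cis t) has_integral 0) {0..2*pi}"
    by (subst (asm) has_contour_integral_part_circlepath_iff) auto
  then have "((\<lambda>t. \<i> * f (cis t)) has_integral 0) {0..2*pi}"
    by (simp add: mult.commute)
  then have "((\<lambda>t. - \<i> * (\<i> * f (cis t))) has_integral - \<i> * 0) {0..2*pi}"
    by (rule has_integral_mult_right)
  then have "((\<lambda>t. f (cis t)) has_integral 0) {0..2*pi}"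
    by (simp add: mult.assoc[symmetric])
  from has_integral_linear[OF this bounded_linear_Re]
  have "((\<lambda>t. Re (f (cis t))) has_integral 0) {0..2*pi}" by (simp add: o_def)
  moreover have "Re (f (cis t)) = ln (cmod (1 - b * cis t))" for t
  proof -
    have "1 - b * cis t \<noteq> 0"
    proof
      assume "1 - b * cis t = 0"
      then show False using nr[of "cis t"] by (simp only: norm_cis) simp
    qed
    then show ?thesis unfolding f_def by (rule Re_Ln)
  qed
  ultimately show ?thesis by (simp only:)
qed

lemma borel_measurable_cis [measurable]: "cis \<in> borel_measurable borel"
  by (intro borel_measurable_continuous_onI continuous_intros)

lemma cmod_one_minus_le: "cmod (1 - b * cis \<theta>) \<le> 1 + cmod b"
  using norm_triangle_ineq4[of 1 "b * cis \<theta>"] by (simp add: norm_mult)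

lemma nn_integral_set_has_integral:
  fixes f :: "real \<Rightarrow> real"
  assumes I: "(f has_integral I) S" and nn: "\<And>x. f x \<ge> 0"
    and [measurable]: "f \<in> borel_measurable borel" "S \<in> sets borel"
  shows "(\<integral>\<^sup>+x\<in>S. ennreal (f x) \<partial>lborel) = ennreal I"
proof -
  have "(\<lambda>x. indicator S x * f x) = (\<lambda>x. if x \<in> S then f x else 0)"
    by (auto simp: fun_eq_iff indicator_def)
  with I have "((\<lambda>x. indicator S x * f x) has_integral I) UNIV"
    by (simp only: has_integral_restrict_UNIV)
  then have "integral\<^sup>N lborel (\<lambda>x. ennreal (indicator S x * f x)) = ennreal I"
    by (intro nn_integral_has_integral_lborel) (auto simp: nn)
  moreover have "(\<integral>\<^sup>+x\<in>S. ennreal (f x) \<partial>lborel) = integral\<^sup>N lborel (\<lambda>x. ennreal (indicator S x * f x))"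
  proof (rule nn_integral_cong)
    fix x
    show "ennreal (f x) * indicator S x = ennreal (indicator S x * f x)"
      by (cases "x \<in> S") (simp_all only: indicator_simps(1) indicator_simps(2) not_False_eq_True
          mult_1_left mult_1_right mult_zero_left mult_zero_right ennreal_0)
  qed
  ultimately show ?thesis by (rule trans[rotated])
qed

text \<open>The bound on \<open>K\<close> keeps the quotient in (0, 1], so \<open>nlog\<close> is
  not truncated and equals ln K - ln|1 - b u|; the second term has mean 0.\<close>

lemma circle_mean_nlog_unit_less:
  assumes b: "cmod b < 1" and K: "K \<ge> 1 + cmod b"
  shows "(\<integral>\<^sup>+\<theta>\<in>{0..2*pi}. nlog 1 (cmod (1 - b * cis \<theta>) / K) \<partial>lborel) = ennreal (2 * pi * ln K)"
proof -
  have K0: "K > 0" using K norm_ge_zero[of b] by linarith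
  have pos: "cmod (1 - b * cis \<theta>) > 0" for \<theta>
  proof -
    have "cmod 1 - cmod (b * cis \<theta>) \<le> cmod (1 - b * cis \<theta>)" by (rule norm_triangle_ineq2)
    then have "0 < cmod (1 - b * cis \<theta>)" using b by (simp add: norm_mult del: zero_less_norm_iff)
    then show ?thesis .
  qed
  define f where "f = (\<lambda>\<theta>. ln K - ln (cmod (1 - b * cis \<theta>)))"
  have f0: "f \<theta> \<ge> 0" for \<theta>
    using ln_le_cancel_iff[of "cmod (1 - b * cis \<theta>)" K] pos[of \<theta>] K0 cmod_one_minus_le[of b \<theta>] K
    unfolding f_def by linarith
  have nl: "nlog 1 (cmod (1 - b * cis \<theta>) / K) = ennreal (f \<theta>)" for \<theta>
    using pos[of \<theta>] K0 by (auto simp: nlog_def f_def ln_div divide_le_0_iff)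
  have "(f has_integral (2 * pi * ln K - 0)) {0..2*pi}"
    unfolding f_def
    using has_integral_const_real[of "ln K" 0 "2*pi"] circle_mean_ln_unit[OF b]
    by (intro has_integral_diff) auto
  then have "(f has_integral (2 * pi * ln K)) {0..2*pi}" by simp
  moreover have "f \<in> borel_measurable borel" unfolding f_def by measurable
  ultimately show ?thesis
    unfolding nl by (rule nn_integral_set_has_integral[OF _ f0]) auto
qed

text \<open>A zero on the circle itself is reached by the shrunken numbers (1 - 1/(n+1)) b and
  Fatou's lemma. This costs equality but keeps the inequality in the direction of
  subharmonicity.\<close>

lemma circle_mean_nlog_unit:
  assumes b: "cmod b \<le> 1" and K: "K \<ge> 1 + cmod b"
  shows "(\<integral>\<^sup>+\<theta>\<in>{0..2*pi}. nlog 1 (cmod (1 - b * cis \<theta>) / K) \<partial>lborel) \<le> ennreal (2 * pi * ln K)"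
proof -
  have K0: "K > 0" using K norm_ge_zero[of b] by linarith
  define s where "s = (\<lambda>n. 1 - 1 / real (Suc n))"
  have s: "0 \<le> s n" "s n < 1" for n by (auto simp: s_def)
  have slim: "s \<longlonglongrightarrow> 1"
    unfolding s_def using LIMSEQ_inverse_real_of_nat_add_minus[of 1] by (simp add: inverse_eq_divide)
  have bs: "cmod (of_real (s n) * b) < 1" "1 + cmod (of_real (s n) * b) \<le> K" for n
  proof -
    have "s n * cmod b \<le> s n * 1" "s n * cmod b \<le> 1 * cmod b"
      using b s[of n] by (intro mult_left_mono mult_right_mono; simp)+
    then show "cmod (of_real (s n) * b) < 1" "1 + cmod (of_real (s n) * b) \<le> K"
      using s[of n] K by (auto simp: norm_mult)
  qed
  let ?f = "\<lambda>n \<theta>. nlog 1 (cmod (1 - of_real (s n) * b * cis \<theta>) / K) * indicator {0..2*pi} \<theta>"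
  have "(\<lambda>n. ?f n \<theta>) \<longlonglongrightarrow> nlog 1 (cmod (1 - b * cis \<theta>) / K) * indicator {0..2*pi} \<theta>" for \<theta>
  proof -
    have "(\<lambda>n. cmod (1 - of_real (s n) * b * cis \<theta>) / K) \<longlonglongrightarrow> cmod (1 - of_real 1 * b * cis \<theta>) / K"
      using slim K0 by (intro tendsto_intros) auto
    then have "(\<lambda>n. nlog 1 (cmod (1 - of_real (s n) * b * cis \<theta>) / K)) \<longlonglongrightarrow> nlog 1 (cmod (1 - b * cis \<theta>) / K)"
      using isCont_tendsto_compose[OF isCont_nlog[of 1]] by auto
    then show ?thesis by (auto simp: indicator_def)
  qed
  then have "nlog 1 (cmod (1 - b * cis \<theta>) / K) * indicator {0..2*pi} \<theta> = liminf (\<lambda>n. ?f n \<theta>)" for \<theta>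
    using lim_imp_Liminf[OF sequentially_bot] by metis
  then have "(\<integral>\<^sup>+\<theta>\<in>{0..2*pi}. nlog 1 (cmod (1 - b * cis \<theta>) / K) \<partial>lborel)
      = (\<integral>\<^sup>+\<theta>. liminf (\<lambda>n. ?f n \<theta>) \<partial>lborel)" by simp
  also have "\<dots> \<le> liminf (\<lambda>n. integral\<^sup>N lborel (?f n))"
    by (rule nn_integral_liminf) measurable
  also have "\<dots> = liminf (\<lambda>n. ennreal (2 * pi * ln K))"
    using circle_mean_nlog_unit_less[OF bs] by simp
  also have "\<dots> = ennreal (2 * pi * ln K)" by (simp add: Liminf_const)
  finally show ?thesis .
qed

text \<open>This is the submean inequality of ln|u - a| at the centre 0, divided by 1 + |a| to keep
  all values in [0, 1]. For |a| >= 1 one has u - a = -a (1 - u/a). For 0 < |a| < 1 and |u| = 1, |u -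
  a| = |1 - cnj(a) u|, and the surplus -ln|a| on the right is positive.\<close>

lemma circle_mean_root:
  "(\<integral>\<^sup>+\<theta>\<in>{0..2*pi}. nlog 1 (cmod (cis \<theta> - a) / (1 + cmod a)) \<partial>lborel)
     \<le> ennreal (2 * pi) * nlog 1 (cmod a / (1 + cmod a))"
proof (cases "a = 0")
  case True
  then show ?thesis by (simp add: nlog_def ennreal_mult_top)
next
  case a0: False
  have a1: "cmod a > 0" "1 + cmod a > 0" using a0 by (auto intro: add_pos_nonneg)
  have "ln (cmod a / (1 + cmod a)) = ln (cmod a) - ln (1 + cmod a)"
    using a1 by (simp add: ln_div)
  moreover have q0: "\<not> cmod a / (1 + cmod a) \<le> 0"
    by (simp only: not_le divide_pos_pos[OF a1])
  ultimately have eq: "ennreal (2 * pi) * nlog 1 (cmod a / (1 + cmod a)) = ennreal (2 * pi * (ln (1 + cmod a) - ln (cmod a)))"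
    unfolding nlog_def if_not_P[OF q0] by (subst ennreal_mult'[symmetric]) simp_all
  show ?thesis
  proof (cases "cmod a \<ge> 1")
    case True
    define b where "b = 1 / a"
    have b: "cmod b \<le> 1" using True a0 by (simp add: b_def norm_divide divide_le_eq_1)
    have "cmod (cis \<theta> - a) = cmod a * cmod (1 - b * cis \<theta>)" for \<theta>
    proof -
      have "cis \<theta> - a = - a * (1 - b * cis \<theta>)" using a0 by (simp add: b_def field_simps)
      then show ?thesis by (simp only: norm_mult norm_minus_cancel)
    qed
    then have e: "cmod (cis \<theta> - a) / (1 + cmod a) = cmod (1 - b * cis \<theta>) / ((1 + cmod a) / cmod a)" for \<theta>
      by simp
    have "(1 + cmod a) / cmod a \<ge> 1 + cmod b"
      using a0 by (simp add: b_def norm_divide field_simps)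
    moreover have "ln ((1 + cmod a) / cmod a) = ln (1 + cmod a) - ln (cmod a)"
      using a1 by (simp add: ln_div)
    ultimately show ?thesis
      unfolding e eq using circle_mean_nlog_unit[OF b, of "(1 + cmod a) / cmod a"] by (simp only:)
  next
    case False
    have "cmod (cis \<theta> - a) = cmod (1 - cnj a * cis \<theta>)" for \<theta>
    proof -
      have "cmod (cis \<theta> - a) = cmod (cis \<theta> * (1 - cis (- \<theta>) * a))"
        by (simp add: algebra_simps mult.assoc[symmetric] cis_mult)
      also have "\<dots> = cmod (cnj (1 - cis (- \<theta>) * a))" by (simp only: norm_mult norm_cis complex_mod_cnj mult_1_left)
      also have "cnj (1 - cis (- \<theta>) * a) = 1 - cnj a * cis \<theta>" by (simp add: cis_cnj mult.commute)
      finally show ?thesis .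
    qed
    then have "(\<integral>\<^sup>+\<theta>\<in>{0..2*pi}. nlog 1 (cmod (cis \<theta> - a) / (1 + cmod a)) \<partial>lborel)
        \<le> ennreal (2 * pi * ln (1 + cmod a))"
      using circle_mean_nlog_unit[of "cnj a" "1 + cmod a"] False by simp
    also have "\<dots> \<le> ennreal (2 * pi * (ln (1 + cmod a) - ln (cmod a)))"
      using False a0 by (intro ennreal_leI mult_left_mono) (auto simp: ln_le_zero_iff)
    finally show ?thesis using eq by simp
  qed
qed

lemma prod_list_unit_interval:
  fixes f :: "'a \<Rightarrow> real"
  assumes "\<And>a. f a \<in> {0..1}"
  shows "(\<Prod>a\<leftarrow>ys. f a) \<in> {0..1}"
  using assms by (induction ys) (auto intro: mult_le_one)

lemma root_quotient_unit_interval: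
  assumes "cmod x \<le> 1"
  shows "cmod (x - a) / (1 + cmod a) \<in> {0..1}"
proof -
  have "cmod (x - a) \<le> 1 + cmod a" "1 + cmod a > 0"
    using norm_triangle_ineq4[of x a] assms norm_ge_zero[of a] by linarith+
  then show ?thesis by simp
qed

lemma circle_mean_root_prod:
  "(\<integral>\<^sup>+\<theta>\<in>{0..2*pi}. nlog 1 (\<Prod>a\<leftarrow>xs. cmod (cis \<theta> - a) / (1 + cmod a)) \<partial>lborel)
     \<le> ennreal (2 * pi) * nlog 1 (\<Prod>a\<leftarrow>xs. cmod a / (1 + cmod a))"
proof (induction xs)
  case Nil
  then show ?case by (simp add: nlog_def)
next
  case (Cons a xs)
  have q: "cmod (cis \<theta> - a) / (1 + cmod a) \<in> {0..1}" "cmod a / (1 + cmod a) \<in> {0..1}" for \<theta> a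
    using root_quotient_unit_interval[of "cis \<theta>" a] root_quotient_unit_interval[of 0 a] by auto
  have m: "nlog 1 (x * y) = nlog 1 x + nlog 1 y" if "x \<in> {0..1}" "y \<in> {0..1}" for x y
    using that by (auto intro: nlog_mult)
  have "(\<integral>\<^sup>+\<theta>\<in>{0..2*pi}. nlog 1 (\<Prod>a\<leftarrow>a # xs. cmod (cis \<theta> - a) / (1 + cmod a)) \<partial>lborel)
      = (\<integral>\<^sup>+\<theta>. nlog 1 (cmod (cis \<theta> - a) / (1 + cmod a)) * indicator {0..2*pi} \<theta>
          + nlog 1 (\<Prod>a\<leftarrow>xs. cmod (cis \<theta> - a) / (1 + cmod a)) * indicator {0..2*pi} \<theta> \<partial>lborel)"
    by (simp only: list.map prod_list.Cons m[OF q(1) prod_list_unit_interval[OF q(1)]] distrib_right)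
  also have "\<dots> = (\<integral>\<^sup>+\<theta>\<in>{0..2*pi}. nlog 1 (cmod (cis \<theta> - a) / (1 + cmod a)) \<partial>lborel)
      + (\<integral>\<^sup>+\<theta>\<in>{0..2*pi}. nlog 1 (\<Prod>a\<leftarrow>xs. cmod (cis \<theta> - a) / (1 + cmod a)) \<partial>lborel)"
  proof (rule nn_integral_add)
    have "(\<lambda>\<theta>. \<Prod>a\<leftarrow>xs. cmod (cis \<theta> - a) / (1 + cmod a)) \<in> borel_measurable borel"
      by (induction xs) auto
    then show "(\<lambda>\<theta>. nlog 1 (\<Prod>a\<leftarrow>xs. cmod (cis \<theta> - a) / (1 + cmod a)) * indicator {0..2*pi} \<theta>) \<in> borel_measurable lborel"
      by measurable
  qed measurable
  also have "\<dots> \<le> ennreal (2 * pi) * nlog 1 (cmod a / (1 + cmod a))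
      + ennreal (2 * pi) * nlog 1 (\<Prod>a\<leftarrow>xs. cmod a / (1 + cmod a))"
    by (intro add_mono circle_mean_root Cons.IH)
  also have "\<dots> = ennreal (2 * pi) * nlog 1 (\<Prod>a\<leftarrow>a # xs. cmod a / (1 + cmod a))"
    by (simp only: list.map prod_list.Cons m[OF q(2) prod_list_unit_interval[OF q(2)]] distrib_left)
  finally show ?case .
qed

lemma complex_poly_root_list:
  fixes q :: "complex poly"
  assumes "q \<noteq> 0"
  obtains xs where "length xs = degree q" "\<And>x. poly q x = lead_coeff q * (\<Prod>a\<leftarrow>xs. x - a)"
proof -
  obtain A where A: "size A = degree q" "q = smult (lead_coeff q) (\<Prod>x\<in>#A. [:- x, 1:])"
    using alg_closed_imp_factorization[OF assms] by blast
  obtain xs where xs: "mset xs = A" using ex_mset by blast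
  have "poly (\<Prod>x\<in>#A. [:- x, 1:]) x = (\<Prod>a\<leftarrow>xs. x - a)" for x
    unfolding xs[symmetric] mset_map[symmetric] prod_mset_prod_list by (induction xs) (auto simp: algebra_simps)
  then have "poly q x = lead_coeff q * (\<Prod>a\<leftarrow>xs. x - a)" for x
    using A(2) by (metis poly_smult)
  with A(1) xs show ?thesis by (intro that[of xs]) auto
qed

lemma ennreal_add_right_cancel: "x + c \<le> y + c \<Longrightarrow> c \<noteq> \<infinity> \<Longrightarrow> x \<le> (y::ennreal)"
  by (metis add.commute ennreal_add_left_cancel_le)

text \<open>Factoring q over its roots reduces the claim to \<open>circle_mean_root_prod\<close>.
  There the natural normalization is R, the modulus of the leading coefficient times the product of
  the 1 + |a|, while the hypothesis supplies M. Neither need dominate, so both are rescaled to their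
  maximum and the finite constant belonging to M is cancelled.\<close>

lemma jensen_poly:
  fixes q :: "complex poly"
  assumes M: "M > 0" and bd: "\<And>\<theta>. cmod (poly q (cis \<theta>)) \<le> M" "cmod (poly q 0) \<le> M" and c: "c > 0"
  shows "(\<integral>\<^sup>+\<theta>\<in>{0..2*pi}. nlog c (cmod (poly q (cis \<theta>)) / M) \<partial>lborel)
          \<le> ennreal (2 * pi) * nlog c (cmod (poly q 0) / M)"
proof (cases "q = 0")
  case True
  then show ?thesis by (simp add: nlog_def ennreal_mult_top)
next
  case False
  obtain xs where xs: "\<And>x. poly q x = lead_coeff q * (\<Prod>a\<leftarrow>xs. x - a)"
    using complex_poly_root_list[OF False] by blast
  define R where "R = cmod (lead_coeff q) * (\<Prod>a\<leftarrow>xs. 1 + cmod a)"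
  have Rp: "(\<Prod>a\<leftarrow>xs. 1 + cmod a) > 0" by (induction xs) (auto simp: add_pos_nonneg)
  then have R: "R > 0" using False by (simp add: R_def)
  have qR: "cmod (poly q x) / R = (\<Prod>a\<leftarrow>xs. cmod (x - a) / (1 + cmod a))" for x
  proof -
    have "cmod (\<Prod>a\<leftarrow>xs. x - a) = (\<Prod>a\<leftarrow>xs. cmod (x - a) / (1 + cmod a)) * (\<Prod>a\<leftarrow>xs. 1 + cmod a)"
    proof (induction xs)
      case (Cons a xs)
      have "1 + cmod a \<noteq> 0" using norm_ge_zero[of a] by linarith
      then show ?case using Cons by (simp add: norm_mult)
    qed simp
    note n = this
    have e: "c * (Q * P) / (c * P) = Q" if "c \<noteq> 0" "P > 0" for c P Q :: real using that by simp
    show ?thesis unfolding xs R_def norm_mult n by (rule e[OF _ Rp]) (use False in simp)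
  qed
  have qRle: "cmod (poly q x) / R \<le> 1" if "cmod x \<le> 1" for x
    using prod_list_unit_interval[of "\<lambda>a. cmod (x - a) / (1 + cmod a)" xs, OF root_quotient_unit_interval[OF that]]
    unfolding qR by simp
  define M' where "M' = max M R"
  have M': "M \<le> M'" "R \<le> M'" by (auto simp: M'_def)
  have rR: "nlog 1 (cmod (poly q x) / M') = nlog 1 (cmod (poly q x) / R) + ennreal (ln (M' / R))"
    if "cmod (poly q x) / R \<le> 1" for x
    using that R M' by (intro nlog_rescale) (auto simp: field_simps)
  have rM: "nlog 1 (cmod (poly q x) / M') = nlog 1 (cmod (poly q x) / M) + ennreal (ln (M' / M))"
    if "cmod (poly q x) \<le> M" for x
    using that M M' by (intro nlog_rescale) auto
  let ?I = "\<lambda>f. (\<integral>\<^sup>+\<theta>\<in>{0..2*pi}. f \<theta> \<partial>lborel)"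
  have [measurable]: "(\<lambda>\<theta>. poly q (cis \<theta>)) \<in> borel_measurable borel"
    by (intro borel_measurable_continuous_onI continuous_intros)
  have meas: "(\<lambda>\<theta>. nlog 1 (cmod (poly q (cis \<theta>)) / m) * indicator {0..2*pi} \<theta>) \<in> borel_measurable lborel" for m
    by measurable
  have add: "?I (\<lambda>\<theta>. nlog 1 (cmod (poly q (cis \<theta>)) / m) + ennreal e)
     = ?I (\<lambda>\<theta>. nlog 1 (cmod (poly q (cis \<theta>)) / m)) + ennreal (2 * pi) * ennreal e" for m e
    unfolding distrib_right
    by (subst nn_integral_add[OF meas]) (auto simp: nn_integral_cmult_indicator mult.commute)
  have "?I (\<lambda>\<theta>. nlog 1 (cmod (poly q (cis \<theta>)) / M)) + ennreal (2 * pi) * ennreal (ln (M' / M))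
      = ?I (\<lambda>\<theta>. nlog 1 (cmod (poly q (cis \<theta>)) / M'))"
    using add[of M] rM bd by simp
  also have "\<dots> = ?I (\<lambda>\<theta>. nlog 1 (cmod (poly q (cis \<theta>)) / R)) + ennreal (2 * pi) * ennreal (ln (M' / R))"
    using add[of R] rR qRle by simp
  also have "?I (\<lambda>\<theta>. nlog 1 (cmod (poly q (cis \<theta>)) / R)) \<le> ennreal (2 * pi) * nlog 1 (cmod (poly q 0) / R)"
    using circle_mean_root_prod[of xs] unfolding qR by simp
  also have "ennreal (2 * pi) * nlog 1 (cmod (poly q 0) / R) + ennreal (2 * pi) * ennreal (ln (M' / R))
      = ennreal (2 * pi) * nlog 1 (cmod (poly q 0) / M')"
    using rR qRle by (simp add: distrib_left)
  also have "\<dots> = ennreal (2 * pi) * nlog 1 (cmod (poly q 0) / M) + ennreal (2 * pi) * ennreal (ln (M' / M))"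
    using rM bd by (simp add: distrib_left)
  finally have "?I (\<lambda>\<theta>. nlog 1 (cmod (poly q (cis \<theta>)) / M)) + ennreal (2 * pi) * ennreal (ln (M' / M))
      \<le> ennreal (2 * pi) * nlog 1 (cmod (poly q 0) / M) + ennreal (2 * pi) * ennreal (ln (M' / M))"
    by (simp only: add_mono)
  moreover have "ennreal (2 * pi) * ennreal (ln (M' / M)) \<noteq> \<infinity>"
    by (simp add: ennreal_mult_eq_top_iff)
  ultimately have 1: "?I (\<lambda>\<theta>. nlog 1 (cmod (poly q (cis \<theta>)) / M)) \<le> ennreal (2 * pi) * nlog 1 (cmod (poly q 0) / M)"
    by (rule ennreal_add_right_cancel)
  have "?I (\<lambda>\<theta>. nlog c (cmod (poly q (cis \<theta>)) / M)) = ennreal c * ?I (\<lambda>\<theta>. nlog 1 (cmod (poly q (cis \<theta>)) / M))"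
    unfolding nlog_scale[OF c] mult.assoc by (rule nn_integral_cmult[OF meas])
  also have "\<dots> \<le> ennreal c * (ennreal (2 * pi) * nlog 1 (cmod (poly q 0) / M))"
    by (intro mult_left_mono 1) auto
  finally show ?thesis by (simp add: nlog_scale[OF c] mult.left_commute)
qed

section \<open>Pluripolar sets defined by geometric growth of polynomials\<close>

text \<open>The index is an upper bound for the degree, not the degree itself. The inductive form
  makes continuity and restriction to complex lines immediate inductions.\<close>

inductive poly_deg :: "nat \<Rightarrow> (complex^'m \<Rightarrow> complex) \<Rightarrow> bool" where
  const: "poly_deg 0 (\<lambda>_. c)"
| var: "poly_deg 1 (\<lambda>z. z $ j)"
| add: "poly_deg d p \<Longrightarrow> poly_deg d q \<Longrightarrow> poly_deg d (\<lambda>z. p z + q z)"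
| mult: "poly_deg d p \<Longrightarrow> poly_deg e q \<Longrightarrow> poly_deg (d + e) (\<lambda>z. p z * q z)"
| mono: "poly_deg d p \<Longrightarrow> d \<le> e \<Longrightarrow> poly_deg e p"

lemma poly_deg_const: "poly_deg d (\<lambda>_. c)"
  using poly_deg.mono[OF poly_deg.const] by blast

lemma continuous_on_poly_deg: "poly_deg d p \<Longrightarrow> continuous_on A p"
  by (induction rule: poly_deg.induct) (auto intro!: continuous_intros)

lemma poly_deg_line:
  "poly_deg d p \<Longrightarrow> \<exists>q. degree q \<le> d \<and> (\<forall>\<sigma>. p (z + \<sigma> *s r) = poly q \<sigma>)"
proof (induction rule: poly_deg.induct)
  case (const c)
  show ?case by (intro exI[of _ "[:c:]"]) auto
next
  case (var j)
  show ?case by (intro exI[of _ "[:z $ j, r $ j:]"]) auto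
next
  case (add d p q)
  then obtain p' q' where "degree p' \<le> d" "\<forall>\<sigma>. p (z + \<sigma> *s r) = poly p' \<sigma>"
     "degree q' \<le> d" "\<forall>\<sigma>. q (z + \<sigma> *s r) = poly q' \<sigma>" by blast
  then show ?case by (intro exI[of _ "p' + q'"]) (auto intro: degree_add_le)
next
  case (mult d p e q)
  then obtain p' q' where "degree p' \<le> d" "\<forall>\<sigma>. p (z + \<sigma> *s r) = poly p' \<sigma>"
     "degree q' \<le> e" "\<forall>\<sigma>. q (z + \<sigma> *s r) = poly q' \<sigma>" by blast
  then show ?case by (intro exI[of _ "p' * q'"]) (auto intro: order_trans[OF degree_mult_le])
qed (meson order_trans)

section \<open>A common real point at which all polynomials of a sequence are large\<close>

lemma nn_integral_inverse_sqrt_le: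
  fixes \<rho> :: real
  shows "(\<integral>\<^sup>+x\<in>{0..1}. ennreal (\<bar>x - \<rho>\<bar> powr (-1/2)) \<partial>lborel) \<le> 5"
proof -
  have half: "(\<integral>\<^sup>+x\<in>{0..1}. ennreal (x powr (-1/2)) \<partial>lborel) = 2"
  proof -
    have "((\<lambda>x. x powr (-1/2)) has_integral 2) {0..1::real}"
      using has_integral_powr_from_0[of "-1/2" 1] by simp
    then have "(\<integral>\<^sup>+x\<in>{0..1}. ennreal (x powr (-1/2)) \<partial>lborel) = ennreal 2"
      by (rule nn_integral_set_has_integral) auto
    then show ?thesis by simp
  qed
  define f where "f = (\<lambda>x::real. ennreal (x powr (-1/2)) * indicator {0..1} x)"
  have fm [measurable]: "f \<in> borel_measurable borel" unfolding f_def by measurable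
  have f2: "integral\<^sup>N lborel f = 2" using half by (simp add: f_def)
  have s1: "(\<integral>\<^sup>+x. f (x - \<rho>) \<partial>lborel) = 2"
    using nn_integral_real_affine[of f 1 "- \<rho>"] f2 by (simp add: algebra_simps)
  have s2: "(\<integral>\<^sup>+x. f (\<rho> - x) \<partial>lborel) = 2"
    using nn_integral_real_affine[of f "-1" "\<rho>"] f2 by (simp add: algebra_simps)
  \<comment> \<open>Within distance 1 of \<rho> the integrand is a translate or a reflection of
    x^(-1/2) on [0, 1], each of integral 2; elsewhere on [0, 1] it is at most 1. Hence the bound 5 =
    1 + 2 + 2, uniform in \<rho>.\<close>
  have pw: "ennreal (\<bar>x - \<rho>\<bar> powr (-1/2)) * indicator {0..1} x
      \<le> indicator {0..1} x + (f (x - \<rho>) + f (\<rho> - x))" for x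
  proof (cases "x \<in> {0..1}")
    case True
    consider "\<bar>x - \<rho>\<bar> \<ge> 1" | "0 \<le> x - \<rho>" "x - \<rho> < 1" | "0 \<le> \<rho> - x" "\<rho> - x < 1" by linarith
    then show ?thesis
    proof cases
      case 1
      then have "\<bar>x - \<rho>\<bar> powr (-1/2) \<le> 1 powr (-1/2)" by (intro powr_mono2') auto
      then have "ennreal (\<bar>x - \<rho>\<bar> powr (-1/2)) \<le> 1" by (simp add: ennreal_le_1)
      then show ?thesis using True by (simp add: add_increasing2)
    next
      case 2
      then have "ennreal (\<bar>x - \<rho>\<bar> powr (-1/2)) = f (x - \<rho>)" by (simp add: f_def)
      then show ?thesis using True by (simp add: add_increasing add_increasing2)
    next
      case 3
      then have "ennreal (\<bar>x - \<rho>\<bar> powr (-1/2)) = f (\<rho> - x)" by (simp add: f_def abs_if)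
      then show ?thesis using True by (simp add: add_increasing add_increasing2)
    qed
  qed auto
  have "(\<integral>\<^sup>+x\<in>{0..1}. ennreal (\<bar>x - \<rho>\<bar> powr (-1/2)) \<partial>lborel)
      \<le> (\<integral>\<^sup>+x. indicator {0..1} x + (f (x - \<rho>) + f (\<rho> - x)) \<partial>lborel)"
    by (intro nn_integral_mono pw)
  also have "\<dots> = 1 + (2 + 2)"
    by (subst nn_integral_add, simp, simp, subst nn_integral_add) (auto simp: s1 s2)
  finally show ?thesis by simp
qed

text \<open>With y = |x - Re r| <= |x - r|, the ratio |a - r| / |x - r| is at most 1 + (R + 1)/y.
  Writing (R + 1)/y = u^2 and using 1 + u^2 <= (1 + u)^2 <= exp(2 u) replaces the nonintegrable 1/y
  by an exponent of order y^(-1/2), which is integrable.\<close>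

lemma root_ratio_bound:
  fixes x :: real and a r :: complex
  assumes x: "x \<in> {0..1}" "x \<noteq> Re r" and a: "cmod a \<le> R"
  shows "cmod (a - r) \<le> cmod (of_real x - r) * exp (2 * sqrt (R + 1) * \<bar>x - Re r\<bar> powr (-1/2))"
proof -
  define y where "y = \<bar>x - Re r\<bar>"
  have y: "y > 0" using x by (simp add: y_def)
  have R: "R \<ge> 0" using a norm_ge_zero[of a] by linarith
  have yc: "y \<le> cmod (of_real x - r)"
    using abs_Re_le_cmod[of "of_real x - r"] by (simp add: y_def)
  then have c: "cmod (of_real x - r) > 0" using y by linarith
  define u where "u = sqrt (R + 1) * y powr (-1/2)"
  have u: "u \<ge> 0" "u\<^sup>2 = (R + 1) / y"
  proof -
    have "(y powr (-1/2))\<^sup>2 = y powr (-1)" using y by (simp add: powr_power)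
    then have "u\<^sup>2 = (sqrt (R + 1))\<^sup>2 * y powr (-1)" by (simp only: u_def power_mult_distrib)
    then show "u\<^sup>2 = (R + 1) / y" using R y by (simp add: powr_minus_divide)
  qed (use R in \<open>simp add: u_def\<close>)
  have "cmod (a - r) \<le> cmod (a - of_real x) + cmod (of_real x - r)"
    using norm_triangle_ineq[of "a - of_real x" "of_real x - r"] by simp
  also have "cmod (a - of_real x) \<le> R + 1"
    using norm_triangle_ineq4[of a "of_real x"] a x by simp
  also have "R + 1 = y * u\<^sup>2" using u y by simp
  also have "y * u\<^sup>2 \<le> cmod (of_real x - r) * u\<^sup>2" using yc by (intro mult_right_mono) auto
  finally have "cmod (a - r) \<le> cmod (of_real x - r) * (1 + u\<^sup>2)" by (simp add: algebra_simps)
  also have "1 + u\<^sup>2 \<le> (1 + u)\<^sup>2" using u by (simp add: power2_eq_square algebra_simps)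
  also have "(1 + u)\<^sup>2 \<le> (exp u)\<^sup>2" using u exp_ge_add_one_self[of u] by (intro power_mono) auto
  also have "(exp u)\<^sup>2 = exp (2 * u)" by (simp add: exp_double)
  finally show ?thesis using c by (simp add: u_def y_def mult.assoc)
qed

lemma ennreal_le_suminf: "f k \<le> (\<Sum>i. f i :: ennreal)"
  using sum_le_suminf[of f "{k}"] by simp

text \<open>Multiplying the bounds of \<open>root_ratio_bound\<close> over the roots of q_k leaves a
  constant times s_k(x) in the exponent, and s_k has integral at most 5 d_k over [0, 1]. A weighted
  sum of the s_k then has finite integral, so it is finite at almost every x, and one such x serves
  all k.\<close>

lemma common_large_point:
  fixes q :: "nat \<Rightarrow> complex poly" and a :: "nat \<Rightarrow> complex" and d :: "nat \<Rightarrow> nat"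
  assumes deg: "\<And>k. degree (q k) \<le> d k" and d: "\<And>k. d k \<ge> 1"
    and a: "\<And>k. cmod (a k) \<le> R" and nz: "\<And>k. poly (q k) (a k) \<noteq> 0"
  obtains x C :: real where "x \<in> {0..1}" "C \<ge> 0"
    "\<And>k. cmod (poly (q k) (a k)) \<le> cmod (poly (q k) (of_real x)) * exp (C * (2 ^ k * d k))"
proof -
  have R: "R \<ge> 0" using a[of 0] norm_ge_zero[of "a 0"] by linarith
  have "\<exists>xs. length xs = degree (q k) \<and> (\<forall>x. poly (q k) x = lead_coeff (q k) * (\<Prod>a\<leftarrow>xs. x - a))" for k
  proof -
    have "q k \<noteq> 0" using nz[of k] by auto
    then show ?thesis using complex_poly_root_list by metis
  qed
  then obtain xs where len: "\<And>k. length (xs k) = degree (q k)"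
    and xs: "\<And>k x. poly (q k) x = lead_coeff (q k) * (\<Prod>a\<leftarrow>xs k. x - a)"
    by metis
  define s where "s = (\<lambda>k x. \<Sum>r\<leftarrow>xs k. \<bar>x - Re r\<bar> powr (-1/2))"
  have s0: "s k x \<ge> 0" for k x unfolding s_def by (intro sum_list_nonneg) auto
  have sm [measurable]: "s k \<in> borel_measurable borel" for k
  proof -
    have "(\<lambda>x. \<Sum>r\<leftarrow>ys. \<bar>x - Re r\<bar> powr (-1/2)) \<in> borel_measurable borel" for ys
      by (induction ys) auto
    then show ?thesis unfolding s_def .
  qed
  have si: "(\<integral>\<^sup>+x\<in>{0..1}. ennreal (s k x) \<partial>lborel) \<le> ennreal (5 * d k)" for k
  proof -
    have "(\<integral>\<^sup>+x\<in>{0..1}. ennreal (\<Sum>r\<leftarrow>ys. \<bar>x - Re r\<bar> powr (-1/2)) \<partial>lborel) \<le> ennreal (5 * length ys)" for ys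
    proof (induction ys)
      case (Cons r ys)
      have [measurable]: "(\<lambda>x. \<Sum>r\<leftarrow>ys. \<bar>x - Re r\<bar> powr (-1/2)) \<in> borel_measurable borel"
        by (induction ys) auto
      have "(\<integral>\<^sup>+x\<in>{0..1}. ennreal (\<Sum>r\<leftarrow>r # ys. \<bar>x - Re r\<bar> powr (-1/2)) \<partial>lborel)
        = (\<integral>\<^sup>+x. ennreal (\<bar>x - Re r\<bar> powr (-1/2)) * indicator {0..1} x +
             ennreal (\<Sum>r\<leftarrow>ys. \<bar>x - Re r\<bar> powr (-1/2)) * indicator {0..1} x \<partial>lborel)"
      proof (rule nn_integral_cong)
        fix x :: real
        have nn: "(\<Sum>r\<leftarrow>ys. \<bar>x - Re r\<bar> powr (-1/2)) \<ge> 0" by (rule sum_list_nonneg) auto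
        show "ennreal (\<Sum>r\<leftarrow>r # ys. \<bar>x - Re r\<bar> powr (-1/2)) * indicator {0..1} x
          = ennreal (\<bar>x - Re r\<bar> powr (-1/2)) * indicator {0..1} x +
             ennreal (\<Sum>r\<leftarrow>ys. \<bar>x - Re r\<bar> powr (-1/2)) * indicator {0..1} x"
          by (simp only: list.map sum_list.Cons distrib_right[symmetric] ennreal_plus[OF powr_ge_zero nn])
      qed
      also have "\<dots> = (\<integral>\<^sup>+x\<in>{0..1}. ennreal (\<bar>x - Re r\<bar> powr (-1/2)) \<partial>lborel)
          + (\<integral>\<^sup>+x\<in>{0..1}. ennreal (\<Sum>r\<leftarrow>ys. \<bar>x - Re r\<bar> powr (-1/2)) \<partial>lborel)"
        by (intro nn_integral_add) measurable
      also have "\<dots> \<le> ennreal 5 + ennreal (5 * length ys)"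
        using nn_integral_inverse_sqrt_le Cons.IH by (intro add_mono) auto
      also have "\<dots> = ennreal (5 * length (r # ys))"
        by (subst ennreal_plus[symmetric]) auto
      finally show ?case .
    qed simp
    from this[of "xs k"] show ?thesis
      unfolding s_def using deg[of k] len[of k]
      by (elim order_trans) (intro ennreal_leI, simp)
  qed
  \<comment> \<open>The weights 1/(2^k d_k) turn the integrals 5 d_k into a convergent geometric
    series; this is the origin of the factor 2^k d_k in the conclusion.\<close>
  define F where "F = (\<lambda>x. \<Sum>k. ennreal (s k x / (2 ^ k * d k)) * indicator {0..1} x)"
  have "integral\<^sup>N lborel F = (\<Sum>k. \<integral>\<^sup>+x\<in>{0..1}. ennreal (s k x / (2 ^ k * d k)) \<partial>lborel)"
    unfolding F_def by (intro nn_integral_suminf) measurable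
  also have "\<dots> \<le> (\<Sum>k. ennreal (5 * (1/2) ^ k))"
  proof (intro suminf_le)
    fix k
    have dk: "real (d k) > 0" using d[of k] by simp
    have "(\<integral>\<^sup>+x\<in>{0..1}. ennreal (s k x / (2 ^ k * d k)) \<partial>lborel)
      = (\<integral>\<^sup>+x. ennreal (1 / (2 ^ k * d k)) * (ennreal (s k x) * indicator {0..1} x) \<partial>lborel)"
      by (simp add: mult.assoc[symmetric] ennreal_mult'[symmetric] s0)
    also have "\<dots> = ennreal (1 / (2 ^ k * d k)) * (\<integral>\<^sup>+x\<in>{0..1}. ennreal (s k x) \<partial>lborel)"
      by (intro nn_integral_cmult) measurable
    also have "\<dots> \<le> ennreal (1 / (2 ^ k * d k)) * ennreal (5 * d k)"
      by (intro mult_left_mono si) auto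
    also have "\<dots> = ennreal (5 * (1/2) ^ k)"
      using dk by (simp add: ennreal_mult'[symmetric] field_simps)
    finally show "(\<integral>\<^sup>+x\<in>{0..1}. ennreal (s k x / (2 ^ k * d k)) \<partial>lborel) \<le> ennreal (5 * (1/2) ^ k)" .
  qed auto
  also have "\<dots> < top"
  proof -
    have "summable (\<lambda>k. 5 * (1/2::real) ^ k)" by (intro summable_mult summable_geometric) auto
    then have "(\<Sum>k. ennreal (5 * (1/2) ^ k)) = ennreal (\<Sum>k. 5 * (1/2) ^ k)"
      by (intro suminf_ennreal2) auto
    then show ?thesis by simp
  qed
  finally have Fi: "integral\<^sup>N lborel F < top" .
  have Fm: "F \<in> borel_measurable lborel" unfolding F_def by measurable
  have ae1: "AE x in lborel. F x \<noteq> \<infinity>"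
    using nn_integral_PInf_AE[OF Fm] Fi by auto
  \<comment> \<open>The ratio bound excludes points x that are the real part of a root. Over all k
    these form a countable set, hence a null set.\<close>
  define Z where "Z = (\<Union>k. Re ` set (xs k))"
  have "countable Z" unfolding Z_def by (intro countable_UN countable_image) (auto intro: countable_finite)
  then have ae2: "AE x in lborel. x \<notin> Z"
    by (intro AE_not_in countable_imp_null_set_lborel)
  have "\<exists>x\<in>{0..1}. F x \<noteq> \<infinity> \<and> x \<notin> Z"
  proof (rule ccontr)
    assume no: "\<not> ?thesis"
    have "AE x in lborel. F x \<noteq> \<infinity> \<and> x \<notin> Z" using ae1 ae2 by (rule AE_conjI)
    then have "AE x in lborel. x \<notin> {0..1::real}" by (rule eventually_mono) (use no in blast)
    then have "{0..1::real} \<in> null_sets lborel" by (subst AE_iff_null_sets) auto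
    then show False by (auto simp: null_sets_def)
  qed
  then obtain x where x: "x \<in> {0..1}" "F x \<noteq> \<infinity>" "x \<notin> Z" by blast
  define T where "T = enn2real (F x)"
  have T: "s k x \<le> T * (2 ^ k * d k)" for k
  proof -
    have dk: "real (d k) > 0" using d[of k] by simp
    have "ennreal (s k x / (2 ^ k * d k)) * indicator {0..1} x \<le> F x"
      unfolding F_def by (rule ennreal_le_suminf)
    then have "ennreal (s k x / (2 ^ k * d k)) \<le> ennreal T"
      using x by (simp add: T_def top.not_eq_extremum)
    then have "s k x / (2 ^ k * d k) \<le> T" by (simp add: T_def ennreal_le_iff)
    then show ?thesis using dk by (simp add: field_simps)
  qed
  define c where "c = 2 * sqrt (R + 1)"
  have c: "c \<ge> 0" using R by (simp add: c_def)
  show ?thesis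
  proof (rule that[OF x(1)])
    show "c * T \<ge> 0" using c by (simp add: T_def)
    fix k
    have rt: "cmod (a k - r) \<le> cmod (of_real x - r) * exp (c * \<bar>x - Re r\<bar> powr (-1/2))" if "r \<in> set (xs k)" for r
      unfolding c_def using that x by (intro root_ratio_bound a) (auto simp: Z_def)
    have "cmod (\<Prod>r\<leftarrow>ys. a k - r) \<le> cmod (\<Prod>r\<leftarrow>ys. of_real x - r) * exp (c * (\<Sum>r\<leftarrow>ys. \<bar>x - Re r\<bar> powr (-1/2)))"
      if "set ys \<subseteq> set (xs k)" for ys using that
    proof (induction ys)
      case (Cons r ys)
      have "cmod (a k - r) * cmod (\<Prod>r\<leftarrow>ys. a k - r)
         \<le> (cmod (of_real x - r) * exp (c * \<bar>x - Re r\<bar> powr (-1/2))) *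
            (cmod (\<Prod>r\<leftarrow>ys. of_real x - r) * exp (c * (\<Sum>r\<leftarrow>ys. \<bar>x - Re r\<bar> powr (-1/2))))"
        using Cons by (intro mult_mono rt) auto
      then show ?case by (simp add: norm_mult exp_add distrib_left mult_ac)
    qed simp
    from this[of "xs k"]
    have "cmod (poly (q k) (a k)) \<le> cmod (poly (q k) (of_real x)) * exp (c * s k x)"
      unfolding xs norm_mult s_def by (simp add: mult.assoc mult_left_mono)
    also have "\<dots> \<le> cmod (poly (q k) (of_real x)) * exp (c * T * (2 ^ k * d k))"
      using mult_left_mono[OF T[of k] c] by (intro mult_left_mono) (auto simp: mult.assoc)
    finally show "cmod (poly (q k) (a k)) \<le> cmod (poly (q k) (of_real x)) * exp (c * T * (2 ^ k * d k))" .
  qed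
qed

text \<open>Coordinates are replaced one at a time, each step restricting P_k to a line in direction
  i. The base points z_k differ with k, but after coordinate i has been treated they all share the
  same real number there, so for I = UNIV a single real point remains.\<close>

lemma common_large_point_vec:
  fixes P :: "nat \<Rightarrow> complex^'m \<Rightarrow> complex" and z :: "nat \<Rightarrow> complex^'m" and d :: "nat \<Rightarrow> nat"
  assumes P: "\<And>k. poly_deg (d k) (P k)" and d: "\<And>k. d k \<ge> 1"
    and z: "\<And>k j. cmod (z k $ j) \<le> R" and nz: "\<And>k. P k (z k) \<noteq> 0"
  shows "finite I \<Longrightarrow> \<exists>\<zeta>::'m \<Rightarrow> real. (\<forall>j. \<zeta> j \<in> {0..1}) \<and> (\<exists>C::real. C \<ge> 0 \<and> (\<forall>k.
     cmod (P k (z k)) \<le> cmod (P k (\<chi> j. if j \<in> I then of_real (\<zeta> j) else z k $ j)) * exp (C * (2 ^ k * d k))))"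
proof (induction I rule: finite_induct)
  case empty
  show ?case by (intro exI[of _ "\<lambda>_. 0"] conjI exI[of _ "0::real"]) auto
next
  case (insert i I)
  then obtain \<zeta> and C :: real where \<zeta>: "\<And>j. \<zeta> j \<in> {0..1}" and C: "C \<ge> 0" and
    le: "\<And>k. cmod (P k (z k)) \<le> cmod (P k (\<chi> j. if j \<in> I then of_real (\<zeta> j) else z k $ j)) * exp (C * (2 ^ k * d k))"
    by blast
  define w where "w = (\<lambda>k. (\<chi> j. if j \<in> I then of_real (\<zeta> j) else z k $ j) :: complex^'m)"
  define b where "b = (\<lambda>k. (\<chi> j. if j = i then 0 else w k $ j) :: complex^'m)"
  have "\<exists>q. degree q \<le> d k \<and> (\<forall>\<sigma>. P k (b k + \<sigma> *s axis i 1) = poly q \<sigma>)" for k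
    by (rule poly_deg_line[OF P])
  then obtain q where q: "\<And>k. degree (q k) \<le> d k" "\<And>k \<sigma>. P k (b k + \<sigma> *s axis i 1) = poly (q k) \<sigma>"
    by metis
  have wb: "w k = b k + (z k $ i) *s axis i 1" for k
    using insert.hyps by (auto simp: vec_eq_iff b_def w_def axis_def)
  have qw: "poly (q k) (z k $ i) = P k (w k)" for k using q(2)[of k "z k $ i"] wb by simp
  \<comment> \<open>The inequality itself propagates nonvanishing: a zero at the new point would
    force P_k(z_k) = 0.\<close>
  have "P k (w k) \<noteq> 0" for k
    using le[of k] nz[of k] unfolding w_def by fastforce
  then have nz': "poly (q k) (z k $ i) \<noteq> 0" for k
    using qw by simp
  obtain x C' :: real where x: "x \<in> {0..1}" and C': "C' \<ge> 0" and
    le': "\<And>k. cmod (poly (q k) (z k $ i)) \<le> cmod (poly (q k) (of_real x)) * exp (C' * (2 ^ k * d k))"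
    using common_large_point[of q d "\<lambda>k. z k $ i" R, OF q(1) d z nz'] by blast
  define \<zeta>' where "\<zeta>' = \<zeta>(i := x)"
  have pt: "b k + of_real x *s axis i 1 = (\<chi> j. if j \<in> insert i I then of_real (\<zeta>' j) else z k $ j)" for k
    using insert.hyps by (auto simp: vec_eq_iff b_def w_def axis_def \<zeta>'_def)
  have "cmod (P k (z k)) \<le> cmod (P k (\<chi> j. if j \<in> insert i I then of_real (\<zeta>' j) else z k $ j)) *
       exp ((C + C') * (2 ^ k * d k))" for k
  proof -
    have "cmod (P k (z k)) \<le> cmod (P k (w k)) * exp (C * (2 ^ k * d k))" using le by (simp add: w_def)
    also have "\<dots> \<le> (cmod (poly (q k) (of_real x)) * exp (C' * (2 ^ k * d k))) * exp (C * (2 ^ k * d k))"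
      using le'[of k] qw by (intro mult_right_mono) auto
    also have "\<dots> = cmod (poly (q k) (of_real x)) * exp ((C + C') * (2 ^ k * d k))"
      by (simp add: distrib_right exp_add mult_ac)
    finally show ?thesis using q(2)[of k "of_real x"] pt[of k] by simp
  qed
  moreover have "\<forall>j. \<zeta>' j \<in> {0..1}" using \<zeta> x by (simp add: \<zeta>'_def)
  ultimately show ?case using C C' by (intro exI[of _ \<zeta>'] conjI exI[of _ "C + C'"]) auto
qed

section \<open>Construction of the plurisubharmonic function\<close>

lemma nlog_le:
  assumes "c > 0" "y \<ge> 0" "x \<ge> exp (- y)"
  shows "nlog c x \<le> ennreal (c * y)"
proof (rule ccontr)
  assume "\<not> nlog c x \<le> ennreal (c * y)"
  then have "ennreal (c * y) < nlog c x" by simp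
  then have "x < exp (- (c * y) / c)" using nlog_gt_iff[of c "c * y" x] assms by simp
  then show False using assms by simp
qed

lemma nlog_ge:
  assumes "c > 0" "x \<le> exp (- y)"
  shows "ennreal (c * y) \<le> nlog c x"
proof (cases "x \<le> 0")
  case False
  then have "ln x \<le> - y" using assms by (metis exp_le_cancel_iff exp_ln not_le)
  then have "c * y \<le> c * (- ln x)" using assms by (intro mult_left_mono) auto
  then show ?thesis unfolding nlog_def if_not_P[OF False] by (rule ennreal_leI)
qed (simp add: nlog_def)

lemma norm_vec_le_sum: "norm (x :: complex^'m) \<le> (\<Sum>j\<in>UNIV. norm (x $ j))"
  unfolding norm_vec_def by (intro L2_set_le_sum) auto

text \<open>
  The sum over \<open>k\<close> of \<open>4\<^sup>-\<^sup>k log (\<bar>P k\<bar> / M k) / d k\<close>, with \<open>M k\<close> the maximum of \<open>\<bar>P k\<bar>\<close> on a ball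
  containing \<open>t0\<close>, is \<open>-\<infinity>\<close> on the set, because there each summand is below a constant minus \<open>2\<^sup>k\<close>.
  It is not identically \<open>-\<infinity>\<close>: there is a point at which \<open>\<bar>P k\<bar>\<close> falls short of its maximum by at most
  \<open>exp (C 2\<^sup>k d k)\<close> for all \<open>k\<close> simultaneously.
\<close>

lemma pluripolar_fast_growth:
  fixes P :: "nat \<Rightarrow> complex^'m \<Rightarrow> complex" and d :: "nat \<Rightarrow> nat"
  assumes P: "\<And>k. poly_deg (d k) (P k)" and d: "\<And>k. d k \<ge> 1"
    and t0: "\<And>k. cmod (P k t0) \<ge> exp (8 ^ k * real (d k))"
  shows "pluripolar {z. \<exists>K. \<forall>k. cmod (P k z) \<le> K ^ d k}"
  unfolding pluripolar_def
proof
  fix z0 assume "z0 \<in> {z. \<exists>K. \<forall>k. cmod (P k z) \<le> K ^ d k}"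
  \<comment> \<open>The ball contains z0, t0 and, thanks to the dimension in the sum, every point
    whose coordinates lie in [0, 1].\<close>
  define R where "R = norm z0 + norm t0 + CARD('m) + 1"
  have R0: "R > 0" by (simp add: R_def add_nonneg_pos)
  define U where "U = ball (0 :: complex^'m) R"
  have contP: "continuous_on A (P k)" for A k by (rule continuous_on_poly_deg[OF P])
  have "\<exists>x\<in>cball 0 R. \<forall>y\<in>cball 0 R. cmod (P k y) \<le> cmod (P k x)" for k
    using R0 by (intro continuous_attains_sup continuous_on_norm contP) auto
  then obtain x where x: "\<And>k. x k \<in> cball 0 R" and xmax: "\<And>k y. y \<in> cball 0 R \<Longrightarrow> cmod (P k y) \<le> cmod (P k (x k))"
    by metis
  define M where "M = (\<lambda>k. cmod (P k (x k)))"
  have Mge: "M k \<ge> exp (8 ^ k * real (d k))" for k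
    using t0[of k] xmax[of t0 k] by (simp add: M_def R_def)
  have M0: "M k > 0" for k using Mge[of k] by (meson exp_gt_zero less_le_trans)
  have PM: "cmod (P k y) \<le> M k" if "y \<in> U" for k y using xmax[of y k] that by (simp add: M_def U_def)
  \<comment> \<open>The weights sit between two rates: against the growth 8^k d_k at t0 they leave
    2^k, which is unbounded, and against the loss 2^k d_k at the common large point they leave
    2^(-k), which is summable.\<close>
  define c where "c = (\<lambda>k. 1 / (4 ^ k * real (d k)))"
  have c0: "c k > 0" for k using d[of k] by (simp add: c_def)
  define S where "S = (\<lambda>w. \<Sum>k. nlog (c k) (cmod (P k w) / M k))"
  define p where "p = (\<lambda>w. - enn2ereal (S w))"
  have cont: "continuous_on A (\<lambda>w. nlog (c k) (cmod (P k w) / M k))" for A k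
    by (rule continuous_on_compose2[OF continuous_on_nlog[OF c0, of UNIV]])
       (use M0 in \<open>auto intro!: continuous_intros contP simp: less_imp_neq[symmetric]\<close>)
  have p_le: "p w \<le> 0" for w by (simp add: p_def)
  \<comment> \<open>S is a supremum of continuous partial sums, hence lower semicontinuous, and p =
    -S.\<close>
  have "upper_semicontinuous_on U p"
    unfolding upper_semicontinuous_on_def
  proof (intro ballI allI impI)
    fix z b assume z: "z \<in> U" and b: "p z < b"
    show "\<forall>\<^sub>F w in at z within U. p w < b"
    proof (cases "b > 0")
      case True
      then show ?thesis using p_le by (auto intro: always_eventually le_less_trans)
    next
      case False
      then have e: "enn2ereal (e2ennreal (- b)) = - b"
        by (intro enn2ereal_e2ennreal) (simp add: ereal_0_le_uminus_iff)
      have lt: "p w < b \<longleftrightarrow> e2ennreal (- b) < S w" for w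
        unfolding p_def less_ennreal.rep_eq e by (subst ereal_uminus_less_reorder) simp
      have "e2ennreal (- b) < (SUP N. \<Sum>k<N. nlog (c k) (cmod (P k z) / M k))"
        using b unfolding lt S_def suminf_eq_SUP .
      then obtain N where N: "e2ennreal (- b) < (\<Sum>k<N. nlog (c k) (cmod (P k z) / M k))"
        unfolding less_SUP_iff by blast
      have "continuous_on U (\<lambda>w. \<Sum>k<N. nlog (c k) (cmod (P k w) / M k))"
        by (intro continuous_on_sum cont)
      then have "((\<lambda>w. \<Sum>k<N. nlog (c k) (cmod (P k w) / M k)) \<longlongrightarrow> (\<Sum>k<N. nlog (c k) (cmod (P k z) / M k))) (at z within U)"
        unfolding continuous_on_def using z by blast
      from order_tendstoD(1)[OF this N] show ?thesis
        unfolding lt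
      proof eventually_elim
        case (elim w)
        also have "(\<Sum>k<N. nlog (c k) (cmod (P k w) / M k)) \<le> S w"
          unfolding S_def by (intro sum_le_suminf) auto
        finally show ?case .
      qed
    qed
  qed
  moreover have "\<forall>C\<in>components U. \<exists>z\<in>C. p z \<noteq> - \<infinity>"
  proof
    fix C assume "C \<in> components U"
    moreover have "connected U" by (simp add: U_def)
    moreover have "0 \<in> U" using R0 by (simp add: U_def)
    ultimately have C: "C = U"
      by (metis connected_component_eq_self components_iff connected_component_eq_UNIV)
    have "P k (x k) \<noteq> 0" for k using M0[of k] by (simp add: M_def)
    moreover have "cmod (x k $ j) \<le> R" for k j
      using x[of k] Finite_Cartesian_Product.norm_nth_le[of "x k" j] by simp
    ultimately obtain \<zeta> :: "'m \<Rightarrow> real" and K :: real where \<zeta>: "\<And>j. \<zeta> j \<in> {0..1}" and K: "K \<ge> 0"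
      "\<And>k. cmod (P k (x k)) \<le> cmod (P k (\<chi> j. if j \<in> UNIV then of_real (\<zeta> j) else x k $ j)) * exp (K * (2 ^ k * d k))"
      using common_large_point_vec[of d P x R UNIV, OF P d] by auto
    define w where "w = (\<chi> j. complex_of_real (\<zeta> j))"
    have Kw: "M k \<le> cmod (P k w) * exp (K * (2 ^ k * d k))" for k using K(2)[of k] by (simp add: M_def w_def)
    have "norm w \<le> (\<Sum>j\<in>(UNIV::'m set). 1)"
      using \<zeta> by (intro order_trans[OF norm_vec_le_sum] sum_mono) (auto simp: w_def)
    then have "norm w \<le> real CARD('m)" by simp
    then have "norm w < R"
      unfolding R_def using norm_ge_zero[of z0] norm_ge_zero[of t0] by linarith
    then have "w \<in> C" by (simp add: C U_def)
    moreover have "S w \<noteq> \<infinity>"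
    proof -
      have "S w \<le> (\<Sum>k. ennreal (K * (1/2) ^ k))"
        unfolding S_def
      proof (intro suminf_le)
        fix k
        have dk: "real (d k) > 0" using d[of k] by simp
        have "exp (- (K * (2 ^ k * d k))) * M k \<le> cmod (P k w)"
          using Kw[of k] by (simp add: exp_minus field_simps)
        then have "nlog (c k) (cmod (P k w) / M k) \<le> ennreal (c k * (K * (2 ^ k * d k)))"
          using M0[of k] K(1) by (intro nlog_le c0) (auto simp: field_simps)
        also have "c k * (K * (2 ^ k * d k)) = K * (1/2) ^ k"
        proof -
          have "(4::real) ^ k = 2 ^ k * 2 ^ k" by (simp add: power_mult_distrib[symmetric])
          then show ?thesis using dk by (simp add: c_def field_simps)
        qed
        finally show "nlog (c k) (cmod (P k w) / M k) \<le> ennreal (K * (1/2) ^ k)" .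
      qed auto
      moreover have "summable (\<lambda>k. K * (1/2::real) ^ k)" by (intro summable_mult summable_geometric) auto
      then have "(\<Sum>k. ennreal (K * (1/2) ^ k)) = ennreal (\<Sum>k. K * (1/2) ^ k)"
        using K(1) by (intro suminf_ennreal2) auto
      ultimately show ?thesis by (metis ennreal_neq_top infinity_ennreal_def top.extremum_uniqueI)
    qed
    ultimately show "\<exists>z\<in>C. p z \<noteq> - \<infinity>"
      by (intro bexI[of _ w]) (auto simp: p_def ereal_uminus_eq_reorder)
  qed
  moreover have "p z \<le> circle_mean p z r" if z: "z \<in> U" and r: "\<And>\<sigma>. norm \<sigma> \<le> 1 \<Longrightarrow> z + \<sigma> *s r \<in> U" for z r
  proof -
    let ?w = "\<lambda>\<theta>. z + cis \<theta> *s r"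
    have wc: "continuous_on A ?w" for A
      by (intro continuous_intros continuous_on_vec_lambda) (auto simp: vector_scalar_mult_def intro!: continuous_intros)
    have [measurable]: "(\<lambda>\<theta>. nlog (c k) (cmod (P k (?w \<theta>)) / M k)) \<in> borel_measurable borel" for k
      by (intro borel_measurable_continuous_onI continuous_on_compose2[OF cont[of UNIV k] wc]) auto
    define I where "I = (\<integral>\<^sup>+\<theta>\<in>{0..2*pi}. S (?w \<theta>) \<partial>lborel)"
    have "I = (\<integral>\<^sup>+\<theta>. (\<Sum>k. nlog (c k) (cmod (P k (?w \<theta>)) / M k) * indicator {0..2*pi} \<theta>) \<partial>lborel)"
      unfolding I_def S_def by (simp only: ennreal_suminf_multc)
    also have "\<dots> = (\<Sum>k. \<integral>\<^sup>+\<theta>\<in>{0..2*pi}. nlog (c k) (cmod (P k (?w \<theta>)) / M k) \<partial>lborel)"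
      by (intro nn_integral_suminf) measurable
    also have "\<dots> \<le> (\<Sum>k. ennreal (2 * pi) * nlog (c k) (cmod (P k z) / M k))"
    proof (intro suminf_le)
      fix k
      obtain q where q: "\<And>\<sigma>. P k (z + \<sigma> *s r) = poly q \<sigma>" using poly_deg_line[OF P] by metis
      have q0: "P k z = poly q 0" using q[of 0] by simp
      show "(\<integral>\<^sup>+\<theta>\<in>{0..2*pi}. nlog (c k) (cmod (P k (?w \<theta>)) / M k) \<partial>lborel)
         \<le> ennreal (2 * pi) * nlog (c k) (cmod (P k z) / M k)"
        unfolding q q0
      proof (rule jensen_poly[OF M0 _ _ c0])
        show "cmod (poly q (cis \<theta>)) \<le> M k" for \<theta> using PM[OF r, of "cis \<theta>" k] q by simp
        show "cmod (poly q 0) \<le> M k" using PM[OF z, of k] unfolding q0 .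
      qed
    qed auto
    also have "\<dots> = ennreal (2 * pi) * S z" unfolding S_def by (rule ennreal_suminf_cmult)
    finally have I: "I \<le> ennreal (2 * pi) * S z" .
    \<comment> \<open>Since p <= 0, its positive part vanishes, and \<open>circle_mean\<close> is
      minus the mean of S.\<close>
    have e1: "e2ennreal (p w) = 0" for w using p_le by (rule e2ennreal_neg)
    have e2: "e2ennreal (- p w) = S w" for w by (simp add: p_def)
    have cm: "circle_mean p z r = ereal (1 / (2 * pi)) * (0 - enn2ereal I)"
      unfolding circle_mean_def e1 e2 I_def by (simp add: zero_ennreal.rep_eq)
    show ?thesis
    proof (cases "S z = \<infinity>")
      case True
      then show ?thesis by (simp add: p_def)
    next
      case False
      then obtain s where s: "S z = ennreal s" "s \<ge> 0" by (cases "S z") auto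
      have I': "I \<le> ennreal (2 * pi * s)" using I s by (simp add: ennreal_mult'[symmetric])
      then obtain i where i: "I = ennreal i" "i \<ge> 0" by (cases I) (auto simp: top_unique)
      then have "i \<le> 2 * pi * s" using I' s by (simp add: ennreal_le_iff)
      then have le: "- s \<le> 1 / (2 * pi) * (0 - i)" by (simp add: field_simps)
      have "p z = ereal (- s)" using s by (simp add: p_def enn2ereal_ennreal)
      moreover have "circle_mean p z r = ereal (1 / (2 * pi) * (0 - i))"
        unfolding cm i(1) enn2ereal_ennreal[OF i(2)] by (simp add: zero_ereal_def)
      ultimately show ?thesis using le by (simp only: ereal_less_eq)
    qed
  qed
  moreover have "p w = - \<infinity>" if w: "\<exists>K. \<forall>k. cmod (P k w) \<le> K ^ d k" for w
  proof -
    obtain K0 where K0: "\<And>k. cmod (P k w) \<le> K0 ^ d k" using w by blast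
    define K where "K = max 1 \<bar>K0\<bar>"
    have K: "cmod (P k w) \<le> K ^ d k" for k
    proof -
      have "K0 ^ d k \<le> \<bar>K0\<bar> ^ d k" by (metis abs_ge_self power_abs)
      also have "\<dots> \<le> K ^ d k" by (intro power_mono) (auto simp: K_def)
      finally show ?thesis using K0[of k] by linarith
    qed
    have K1: "K \<ge> 1" by (simp add: K_def)
    define L where "L = ln K"
    have L: "L \<ge> 0" using K1 by (simp add: L_def)
    have tge: "ennreal (2 ^ k - L) \<le> S w" for k
    proof -
      have dk: "real (d k) > 0" using d[of k] by simp
      have "K ^ d k = exp (L * d k)" using K1 by (simp add: L_def exp_of_nat2_mult)
      then have "cmod (P k w) / M k \<le> exp (L * d k) / exp (8 ^ k * real (d k))"
        using K[of k] Mge[of k] M0[of k] by (intro frac_le) auto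
      also have "\<dots> = exp (- ((8 ^ k - L) * d k))" by (simp add: exp_diff[symmetric] algebra_simps)
      finally have n: "ennreal (c k * ((8 ^ k - L) * d k)) \<le> nlog (c k) (cmod (P k w) / M k)"
        by (intro nlog_ge c0)
      have e8: "(8::real) ^ k = 2 ^ k * 4 ^ k" by (simp add: power_mult_distrib[symmetric])
      have "c k * ((8 ^ k - L) * d k) = (8 ^ k - L) / 4 ^ k" using dk by (simp add: c_def)
      also have "\<dots> = 2 ^ k - L / 4 ^ k" by (simp add: e8 diff_divide_distrib)
      also have "\<dots> \<ge> 2 ^ k - L" using L by (simp add: divide_le_eq mult_right_mono) (simp add: mult_le_cancel_left1)
      finally have "ennreal (2 ^ k - L) \<le> nlog (c k) (cmod (P k w) / M k)"
        using n by (meson ennreal_leI order_trans)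
      also have "\<dots> \<le> S w" unfolding S_def by (rule ennreal_le_suminf)
      finally show ?thesis .
    qed
    have "S w = \<infinity>"
    proof (rule ccontr)
      assume "S w \<noteq> \<infinity>"
      then obtain s where s: "S w = ennreal s" "s \<ge> 0" by (cases "S w") auto
      obtain k where "s + L < 2 ^ k" using real_arch_pow[of 2 "s + L"] by auto
      moreover have "2 ^ k - L \<le> s" using tge[of k] s by (simp add: ennreal_le_iff)
      ultimately show False by linarith
    qed
    then show ?thesis by (simp add: p_def)
  qed
  moreover have "open U" "z0 \<in> U" by (auto simp: U_def R_def add_nonneg_pos)
  moreover have "\<forall>z\<in>U. p z < \<infinity>"
    by (intro ballI le_less_trans[OF p_le]) simp
  ultimately show "\<exists>U p. open U \<and> z0 \<in> U \<and> plurisubharmonic_on U p \<and>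
        (\<forall>w\<in>{z. \<exists>K. \<forall>k. cmod (P k z) \<le> K ^ d k} \<inter> U. p w = - \<infinity>)"
    unfolding plurisubharmonic_on_def by (intro exI[of _ U] exI[of _ p]) auto
qed

lemma pluripolar_subset: "pluripolar T \<Longrightarrow> S \<subseteq> T \<Longrightarrow> pluripolar S"
  unfolding pluripolar_def
proof
  fix z assume *: "\<forall>z\<in>T. \<exists>U p. open U \<and> z \<in> U \<and> plurisubharmonic_on U p \<and> (\<forall>w\<in>T \<inter> U. p w = - \<infinity>)"
    and ST: "S \<subseteq> T" and "z \<in> S"
  then have "z \<in> T" by blast
  from bspec[OF * this] obtain U p where
    "open U" "z \<in> U" "plurisubharmonic_on U p" "\<forall>w\<in>T \<inter> U. p w = - \<infinity>" by (elim exE conjE)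
  then show "\<exists>U p. open U \<and> z \<in> U \<and> plurisubharmonic_on U p \<and> (\<forall>w\<in>S \<inter> U. p w = - \<infinity>)"
    using ST by (intro exI[of _ U] exI[of _ p] conjI) blast+
qed

text \<open>If no K works at t0, then for every k some index i violates the bound with K = exp(8^k).
  Keeping only the indices so chosen can only enlarge the set of z that satisfy a geometric bound,
  and a subset of a pluripolar set is pluripolar.\<close>

lemma pluripolar_geometric_bound:
  fixes Q :: "'i \<Rightarrow> complex^'m \<Rightarrow> complex" and D :: "'i \<Rightarrow> nat"
  assumes Q: "\<And>i. i \<in> I \<Longrightarrow> poly_deg (D i) (Q i)" and D: "\<And>i. i \<in> I \<Longrightarrow> D i \<ge> 1"
    and t0: "\<not> (\<exists>K. \<forall>i\<in>I. cmod (Q i t0) \<le> K ^ D i)"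
  shows "pluripolar {z. \<exists>K. \<forall>i\<in>I. cmod (Q i z) \<le> K ^ D i}"
proof -
  have "\<exists>i\<in>I. cmod (Q i t0) > exp (8 ^ k) ^ D i" for k :: nat
    using t0 by (meson not_le)
  then obtain f where f: "\<And>k. f k \<in> I" "\<And>k. cmod (Q (f k) t0) > exp (8 ^ k) ^ D (f k)" by metis
  have "cmod (Q (f k) t0) \<ge> exp (8 ^ k * real (D (f k)))" for k
    using f(2)[of k] by (simp add: exp_of_nat2_mult)
  then have "pluripolar {z. \<exists>K. \<forall>k. cmod (Q (f k) z) \<le> K ^ D (f k)}"
    using f(1) Q D by (intro pluripolar_fast_growth[of "\<lambda>k. D (f k)" "\<lambda>k. Q (f k)" t0]) auto
  then show ?thesis
    by (rule pluripolar_subset) (use f(1) in blast)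
qed

section \<open>Formal power series and their homogeneous parts\<close>

definition mdeg :: "nat^'n \<Rightarrow> nat" where
  "mdeg \<alpha> = (\<Sum>i\<in>UNIV. \<alpha> $ i)"

text \<open>The values may lie in any commutative monoid: besides real and complex numbers,
  polynomials are substituted for the coordinates when a series is restricted to a plane.\<close>

definition mmon :: "('n::finite \<Rightarrow> 'a) \<Rightarrow> nat^'n \<Rightarrow> 'a::comm_monoid_mult" where
  "mmon e \<alpha> = (\<Prod>i\<in>UNIV. e i ^ (\<alpha> $ i))"

lemma mdeg_0 [simp]: "mdeg 0 = 0"
  by (simp add: mdeg_def)

lemma mdeg_add [simp]: "mdeg (\<alpha> + \<beta>) = mdeg \<alpha> + mdeg \<beta>"
  by (simp add: mdeg_def sum.distrib)

lemma mdeg_axis [simp]: "mdeg (axis i k) = k"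
  by (simp add: mdeg_def axis_def sum.delta if_distrib cong: if_cong)

lemma mdeg_eq_0_iff [simp]: "mdeg \<alpha> = 0 \<longleftrightarrow> \<alpha> = 0"
  by (simp add: mdeg_def vec_eq_iff)

lemma nth_le_mdeg: "\<alpha> $ i \<le> mdeg \<alpha>"
  unfolding mdeg_def by (rule member_le_sum) auto

lemma finite_box: "finite {\<alpha> :: nat^'n. \<forall>i. \<alpha> $ i \<le> d}"
proof -
  have "{\<alpha> :: nat^'n. \<forall>i. \<alpha> $ i \<le> d} \<subseteq> (\<lambda>f. \<chi> i. f i) ` (UNIV \<rightarrow>\<^sub>E {..d})"
  proof
    fix \<alpha> :: "nat^'n" assume "\<alpha> \<in> {\<alpha>. \<forall>i. \<alpha> $ i \<le> d}"
    then show "\<alpha> \<in> (\<lambda>f. \<chi> i. f i) ` (UNIV \<rightarrow>\<^sub>E {..d})"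
      by (intro image_eqI[of _ _ "vec_nth \<alpha>"]) auto
  qed
  then show ?thesis by (rule finite_subset) (intro finite_imageI finite_PiE, auto)
qed

lemma finite_mdeg_le: "finite {\<alpha> :: nat^'n. mdeg \<alpha> \<le> d}"
  by (rule finite_subset[OF _ finite_box[of d]]) (auto intro: order_trans[OF nth_le_mdeg])

lemma finite_mdeg [simp, intro]: "finite {\<alpha> :: nat^'n. mdeg \<alpha> = d}"
  by (rule finite_subset[OF _ finite_mdeg_le[of d]]) auto

lemma mmon_0 [simp]: "mmon e 0 = 1"
  by (simp add: mmon_def)

lemma mmon_add: "mmon e (\<alpha> + \<beta>) = mmon e \<alpha> * mmon e \<beta>"
  by (simp add: mmon_def power_add prod.distrib)

lemma mmon_axis [simp]: "mmon e (axis i k) = e i ^ k"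
proof -
  have "mmon e (axis i k) = (\<Prod>j\<in>UNIV. if j = i then e j ^ k else 1)"
    unfolding mmon_def axis_def by (intro prod.cong) auto
  then show ?thesis by simp
qed

lemma mmon_scale: "mmon (\<lambda>i. u * e i) \<alpha> = u ^ mdeg \<alpha> * mmon e \<alpha>"
  by (simp add: mmon_def mdeg_def power_mult_distrib prod.distrib power_sum)

lemma mmon_const: "mmon (\<lambda>i. u) \<alpha> = u ^ mdeg \<alpha>"
  by (simp add: mmon_def mdeg_def power_sum)

lemma norm_mmon: "norm (mmon e \<alpha>) = mmon (\<lambda>i. norm (e i :: 'a::{real_normed_field})) \<alpha>"
  by (simp add: mmon_def prod_norm[symmetric] norm_power)

lemma mmon_mono:
  "(\<And>i. 0 \<le> e i) \<Longrightarrow> (\<And>i. e i \<le> f i) \<Longrightarrow> mmon e \<alpha> \<le> mmon f (\<alpha> :: nat^'n)" for e f :: "'n::finite \<Rightarrow> real"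
  unfolding mmon_def by (intro prod_mono) (auto intro: power_mono)

lemma index_pos_decomp:
  fixes \<alpha> :: "nat^'n"
  assumes "\<alpha> $ i > 0"
  obtains \<beta> where "\<alpha> = \<beta> + axis i 1" "\<beta> $ i = \<alpha> $ i - 1"
  by (rule that[of "\<chi> j. if j = i then \<alpha> $ j - 1 else \<alpha> $ j"]) (use assms in \<open>auto simp: vec_eq_iff axis_def\<close>)

text \<open>The homogeneous part is taken as a function of the point, so that identities between
  forms become pointwise identities; \<open>hpart_eq_0_imp_coeff_0\<close> leads back to
  coefficients.\<close>

definition hpart :: "(nat^'n \<Rightarrow> 'a::comm_ring_1) \<Rightarrow> nat \<Rightarrow> ('n::finite \<Rightarrow> 'a) \<Rightarrow> 'a" where
  "hpart c d e = (\<Sum>\<alpha> | mdeg \<alpha> = d. c \<alpha> * mmon e \<alpha>)"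

text \<open>\<open>gmult\<close> and \<open>psderiv\<close> are \<open>mfps_mult\<close> and
  \<open>mfps_deriv\<close> over an arbitrary commutative ring, because the triangular coordinates
  for the linear part are complex.\<close>

definition gmult :: "(nat^'n::finite \<Rightarrow> 'a::comm_ring_1) \<Rightarrow> (nat^'n \<Rightarrow> 'a) \<Rightarrow> nat^'n \<Rightarrow> 'a" where
  "gmult F G = (\<lambda>\<gamma>. \<Sum>(\<alpha>, \<beta>)\<in>{(\<alpha>, \<beta>). \<alpha> + \<beta> = \<gamma>}. F \<alpha> * G \<beta>)"

definition psderiv :: "'n::finite \<Rightarrow> (nat^'n \<Rightarrow> 'a::comm_ring_1) \<Rightarrow> nat^'n \<Rightarrow> 'a" where
  "psderiv i H = (\<lambda>\<alpha>. of_nat (\<alpha> $ i + 1) * H (\<alpha> + axis i 1))"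

lemma mfps_mult_eq_gmult: "mfps_mult = gmult"
  by (simp add: fun_eq_iff mfps_mult_def gmult_def)

lemma mfps_deriv_eq_psderiv: "mfps_deriv = psderiv"
  by (simp add: fun_eq_iff mfps_deriv_def psderiv_def)

lemma hpart_gmult:
  fixes F G :: "nat^'n \<Rightarrow> 'a::comm_ring_1"
  shows "hpart (gmult F G) d e = (\<Sum>j\<le>d. hpart F j e * hpart G (d - j) e)"
proof -
  have "hpart (gmult F G) d e = (\<Sum>\<gamma> | mdeg \<gamma> = d. \<Sum>x\<in>{(\<alpha>, \<beta>). \<alpha> + \<beta> = \<gamma>}. F (fst x) * mmon e (fst x) * (G (snd x) * mmon e (snd x)))"
    unfolding hpart_def gmult_def sum_distrib_right
    by (intro sum.cong refl) (auto simp: mmon_add mult_ac)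
  also have "\<dots> = (\<Sum>(\<gamma>, x)\<in>(SIGMA \<gamma>:{\<gamma>. mdeg \<gamma> = d}. {(\<alpha>, \<beta>). \<alpha> + \<beta> = \<gamma>}). F (fst x) * mmon e (fst x) * (G (snd x) * mmon e (snd x)))"
    by (subst sum.Sigma) (auto simp: finite_mfps_mult_index)
  also have "\<dots> = (\<Sum>(j, x)\<in>(SIGMA j:{..d}. {\<alpha>. mdeg \<alpha> = j} \<times> {\<beta>. mdeg \<beta> = d - j}). F (fst x) * mmon e (fst x) * (G (snd x) * mmon e (snd x)))"
    by (rule sum.reindex_bij_witness[where i = "\<lambda>(j, x). (fst x + snd x, x)" and j = "\<lambda>(\<gamma>, x). (mdeg (fst x), x)"]) auto
  also have "\<dots> = (\<Sum>j\<le>d. \<Sum>x\<in>{\<alpha>. mdeg \<alpha> = j} \<times> {\<beta>. mdeg \<beta> = d - j}. F (fst x) * mmon e (fst x) * (G (snd x) * mmon e (snd x)))"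
    by (subst sum.Sigma) auto
  also have "\<dots> = (\<Sum>j\<le>d. hpart F j e * hpart G (d - j) e)"
    unfolding hpart_def by (simp add: sum_product sum.cartesian_product case_prod_beta)
  finally show ?thesis .
qed

text \<open>Restriction of a series to the line through \<open>e\<close>, as a series in the
  parameter u of the point u * e. Each restriction turns \<open>gmult\<close> into the product of
  univariate series, and together the restrictions determine the series
  (\<open>hfps_inject\<close>), so identities in several variables are checked in one.\<close>

definition hfps :: "(nat^'n \<Rightarrow> 'a::comm_ring_1) \<Rightarrow> ('n::finite \<Rightarrow> 'a) \<Rightarrow> 'a fps" where
  "hfps c e = Abs_fps (\<lambda>d. hpart c d e)"

lemma hfps_nth [simp]: "fps_nth (hfps c e) d = hpart c d e"
  by (simp add: hfps_def)

lemma hfps_gmult: "hfps (gmult F G) e = hfps F e * hfps G e"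
  by (simp add: fps_eq_iff fps_mult_nth hpart_gmult atLeast0AtMost)

lemma hpart_0 [simp]: "hpart (\<lambda>_. 0) d e = 0"
  by (simp add: hpart_def)

lemma hpart_add: "hpart (\<lambda>\<alpha>. F \<alpha> + G \<alpha>) d e = hpart F d e + hpart G d e"
  by (simp add: hpart_def distrib_right sum.distrib)

lemma hpart_diff: "hpart (\<lambda>\<alpha>. F \<alpha> - G \<alpha>) d e = hpart F d e - hpart G d e"
  by (simp add: hpart_def left_diff_distrib sum_subtractf)

lemma hpart_cmult: "hpart (\<lambda>\<alpha>. c * F \<alpha>) d e = c * hpart F d e"
  by (simp add: hpart_def sum_distrib_left mult.assoc)

lemma hpart_sum: "hpart (\<lambda>\<alpha>. \<Sum>i\<in>I. F i \<alpha>) d e = (\<Sum>i\<in>I. hpart (F i) d e)"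
  unfolding hpart_def sum_distrib_right by (rule sum.swap)

lemma hpart_cong: "(\<And>\<alpha>. mdeg \<alpha> = d \<Longrightarrow> F \<alpha> = G \<alpha>) \<Longrightarrow> hpart F d e = hpart G d e"
  unfolding hpart_def by (intro sum.cong) auto

lemma hpart_degree_0 [simp]: "hpart F 0 e = F 0"
proof -
  have "{\<alpha> :: nat^'n. mdeg \<alpha> = 0} = {0}" by auto
  then show ?thesis by (simp add: hpart_def)
qed

lemma mdeg_eq_1_iff: "mdeg \<alpha> = 1 \<longleftrightarrow> (\<exists>i. \<alpha> = axis i 1)"
proof
  assume 1: "mdeg \<alpha> = 1"
  then have "\<alpha> \<noteq> 0" by auto
  then obtain i where "\<alpha> $ i > 0" by (auto simp: vec_eq_iff)
  then obtain \<beta> where "\<alpha> = \<beta> + axis i 1" by (rule index_pos_decomp)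
  moreover from this 1 have "\<beta> = 0" by simp
  ultimately show "\<exists>i. \<alpha> = axis i 1" by auto
qed auto

lemma inj_axis_1: "inj (\<lambda>i. axis i (1::nat) :: nat^'n)"
  by (rule injI) (simp add: axis_eq_axis)

lemma hpart_degree_1: "hpart F 1 e = (\<Sum>i\<in>UNIV. F (axis i 1) * e i)"
proof -
  have eq: "{\<alpha> :: nat^'n. mdeg \<alpha> = 1} = range (\<lambda>i. axis i 1)"
    by (rule set_eqI) (simp only: mem_Collect_eq mdeg_eq_1_iff image_iff, blast)
  then show ?thesis
    unfolding hpart_def eq by (subst sum.reindex[OF inj_axis_1]) simp
qed

lemma hpart_scale: "hpart F d (\<lambda>i. u * e i) = u ^ d * hpart F d e"
  unfolding hpart_def sum_distrib_left by (intro sum.cong) (auto simp: mmon_scale)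

lemma sum_mdeg_shift:
  fixes f :: "nat^'n \<Rightarrow> 'a::comm_monoid_add"
  assumes "\<And>\<alpha>. mdeg \<alpha> = Suc d \<Longrightarrow> \<alpha> $ i = 0 \<Longrightarrow> f \<alpha> = 0"
  shows "(\<Sum>\<alpha> | mdeg \<alpha> = Suc d. f \<alpha>) = (\<Sum>\<beta> | mdeg \<beta> = d. f (\<beta> + axis i 1))"
proof -
  have "(\<Sum>\<beta> | mdeg \<beta> = d. f (\<beta> + axis i 1)) = sum f ((\<lambda>\<beta>. \<beta> + axis i 1) ` {\<beta>. mdeg \<beta> = d})"
    by (subst sum.reindex) (auto intro: inj_onI)
  also have "\<dots> = (\<Sum>\<alpha> | mdeg \<alpha> = Suc d. f \<alpha>)"
  proof (rule sum.mono_neutral_left)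
    show "\<forall>\<alpha>\<in>{\<alpha>. mdeg \<alpha> = Suc d} - (\<lambda>\<beta>. \<beta> + axis i 1) ` {\<beta>. mdeg \<beta> = d}. f \<alpha> = 0"
    proof
      fix \<alpha> assume \<alpha>: "\<alpha> \<in> {\<alpha>. mdeg \<alpha> = Suc d} - (\<lambda>\<beta>. \<beta> + axis i 1) ` {\<beta>. mdeg \<beta> = d}"
      have "\<alpha> $ i = 0"
      proof (rule ccontr)
        assume "\<alpha> $ i \<noteq> 0"
        then obtain \<beta> where "\<alpha> = \<beta> + axis i 1" using index_pos_decomp[of \<alpha> i] by auto
        then show False using \<alpha> by auto
      qed
      then show "f \<alpha> = 0" using assms \<alpha> by auto
    qed
  qed auto
  finally show ?thesis by simp
qed

lemma DERIV_mmon: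
  fixes e f :: "'n::finite \<Rightarrow> 'a::real_normed_field" and \<alpha> :: "nat^'n"
  shows "((\<lambda>s. mmon (\<lambda>i. e i + s * f i) \<alpha>) has_field_derivative
           (\<Sum>i\<in>UNIV. of_nat (\<alpha> $ i) * f i * mmon e (\<alpha> - axis i 1))) (at 0)"
proof -
  have D: "((\<lambda>s. mmon (\<lambda>i. e i + s * f i) \<alpha>) has_field_derivative
       (\<Sum>i\<in>UNIV. (of_nat (\<alpha> $ i) * e i ^ (\<alpha> $ i - 1) * f i) * (\<Prod>j\<in>UNIV - {i}. e j ^ (\<alpha> $ j)))) (at 0)"
    unfolding mmon_def
    by (rule has_field_derivative_prod[THEN DERIV_cong]) (auto intro!: derivative_eq_intros sum.cong)
  have "(of_nat (\<alpha> $ i) * e i ^ (\<alpha> $ i - 1) * f i) * (\<Prod>j\<in>UNIV - {i}. e j ^ (\<alpha> $ j))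
      = of_nat (\<alpha> $ i) * f i * mmon e (\<alpha> - axis i 1)" for i
  proof -
    have "mmon e (\<alpha> - axis i 1) = e i ^ ((\<alpha> - axis i 1) $ i) * (\<Prod>j\<in>UNIV - {i}. e j ^ ((\<alpha> - axis i 1) $ j))"
      unfolding mmon_def by (rule prod.remove) auto
    also have "(\<Prod>j\<in>UNIV - {i}. e j ^ ((\<alpha> - axis i 1) $ j)) = (\<Prod>j\<in>UNIV - {i}. e j ^ (\<alpha> $ j))"
      by (intro prod.cong) (auto simp: axis_def)
    finally show ?thesis by (simp add: axis_def mult_ac)
  qed
  with D show ?thesis by (simp only:)
qed

text \<open>This ties formal partial derivatives to derivatives of functions, so that Euler's
  identity and the Leibniz rule follow from uniqueness of derivatives instead of manipulations of
  multi-indices.\<close>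

lemma DERIV_hpart:
  fixes c :: "nat^'n \<Rightarrow> 'a::real_normed_field"
  shows "((\<lambda>s. hpart c (Suc d) (\<lambda>i. e i + s * f i)) has_field_derivative
           (\<Sum>i\<in>UNIV. f i * hpart (psderiv i c) d e)) (at 0)"
proof -
  have "((\<lambda>s. hpart c (Suc d) (\<lambda>i. e i + s * f i)) has_field_derivative
      (\<Sum>\<alpha> | mdeg \<alpha> = Suc d. c \<alpha> * (\<Sum>i\<in>UNIV. of_nat (\<alpha> $ i) * f i * mmon e (\<alpha> - axis i 1)))) (at 0)"
    unfolding hpart_def by (intro DERIV_sum DERIV_cmult DERIV_mmon)
  also have "(\<Sum>\<alpha> | mdeg \<alpha> = Suc d. c \<alpha> * (\<Sum>i\<in>UNIV. of_nat (\<alpha> $ i) * f i * mmon e (\<alpha> - axis i 1)))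
     = (\<Sum>i\<in>UNIV. \<Sum>\<alpha> | mdeg \<alpha> = Suc d. c \<alpha> * (of_nat (\<alpha> $ i) * f i * mmon e (\<alpha> - axis i 1)))"
    by (simp only: sum_distrib_left) (rule sum.swap)
  also have "\<dots> = (\<Sum>i\<in>UNIV. f i * hpart (psderiv i c) d e)"
  proof (rule sum.cong)
    fix i
    have "(\<Sum>\<alpha> | mdeg \<alpha> = Suc d. c \<alpha> * (of_nat (\<alpha> $ i) * f i * mmon e (\<alpha> - axis i 1)))
      = (\<Sum>\<beta> | mdeg \<beta> = d. c (\<beta> + axis i 1) * (of_nat ((\<beta> + axis i 1) $ i) * f i * mmon e (\<beta> + axis i 1 - axis i 1)))"
      by (rule sum_mdeg_shift) auto
    also have "\<dots> = f i * hpart (psderiv i c) d e"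
      unfolding hpart_def psderiv_def sum_distrib_left by (intro sum.cong) (auto simp: mult_ac)
    finally show "(\<Sum>\<alpha> | mdeg \<alpha> = Suc d. c \<alpha> * (of_nat (\<alpha> $ i) * f i * mmon e (\<alpha> - axis i 1))) = f i * hpart (psderiv i c) d e" .
  qed simp
  finally show ?thesis .
qed

text \<open>A form that vanishes everywhere has vanishing partial derivatives, and a coefficient
  with \<alpha>_i > 0 is, up to the nonzero factor \<alpha>_i, a coefficient of the i-th one, of
  lower degree.\<close>

lemma hpart_eq_0_imp_coeff_0:
  fixes c :: "nat^'n \<Rightarrow> 'a::real_normed_field"
  assumes "\<And>e. hpart c d e = 0" "mdeg \<alpha> = d"
  shows "c \<alpha> = 0"
  using assms
proof (induction d arbitrary: c \<alpha>)
  case 0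
  then show ?case by simp
next
  case (Suc d)
  then have "\<alpha> \<noteq> 0" by auto
  then obtain i where "\<alpha> $ i > 0" by (auto simp: vec_eq_iff)
  then obtain \<beta> where \<beta>: "\<alpha> = \<beta> + axis i 1" by (rule index_pos_decomp)
  have "hpart (psderiv i c) d e = 0" for e
  proof -
    have "((\<lambda>s. hpart c (Suc d) (\<lambda>j. e j + s * (if j = i then 1 else 0))) has_field_derivative
           (\<Sum>j\<in>UNIV. (if j = i then 1 else 0) * hpart (psderiv j c) d e)) (at 0)"
      by (rule DERIV_hpart)
    then have "((\<lambda>s. 0) has_field_derivative hpart (psderiv i c) d e) (at 0)"
      using Suc.prems(1) by (simp add: if_distrib if_distribR sum.delta cong: if_cong)
    then show ?thesis using DERIV_const DERIV_unique by blast
  qed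
  then have "psderiv i c \<beta> = 0" using Suc.IH[of "psderiv i c" \<beta>] Suc.prems(2) \<beta> by simp
  then show ?case by (simp add: psderiv_def \<beta> del: of_nat_Suc)
qed

text \<open>The product formula for the homogeneous part of degree d + 1 is differentiated as a
  function along coordinate i; pointwise equality then gives equality of coefficients.\<close>

lemma psderiv_gmult:
  fixes F G :: "nat^'n \<Rightarrow> 'a::real_normed_field"
  shows "psderiv i (gmult F G) = (\<lambda>\<alpha>. gmult (psderiv i F) G \<alpha> + gmult F (psderiv i G) \<alpha>)"
proof
  fix \<alpha> :: "nat^'n"
  let ?d = "mdeg \<alpha>"
  let ?f = "\<lambda>j. if j = i then 1 else 0 :: 'a"
  have D: "((\<lambda>s. hpart c (Suc d) (\<lambda>j. e j + s * ?f j)) has_field_derivative hpart (psderiv i c) d e) (at 0)" for c :: "nat^'n \<Rightarrow> 'a" and d e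
    using DERIV_hpart[of c d e ?f] by (simp add: if_distrib if_distribR sum.delta cong: if_cong)
  have D0: "((\<lambda>s. hpart c 0 (\<lambda>j. e j + s * ?f j)) has_field_derivative 0) (at 0)" for c :: "nat^'n \<Rightarrow> 'a" and e
    by simp
  have "hpart (\<lambda>\<alpha>. psderiv i (gmult F G) \<alpha> - (gmult (psderiv i F) G \<alpha> + gmult F (psderiv i G) \<alpha>)) ?d e = 0" for e
  proof -
    \<comment> \<open>The part of degree 0 has derivative 0; in positive degree j the derivative is
      a form of degree j - 1.\<close>
    define D' where "D' = (\<lambda>c j. if j = 0 then 0 else hpart (psderiv i c) (j - 1) e)"
    have DD: "((\<lambda>s. hpart c j (\<lambda>k. e k + s * ?f k)) has_field_derivative D' c j) (at 0)" for c j
      using D[of c "j - 1" e] D0[of c e] by (cases j) (auto simp: D'_def)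
    have "((\<lambda>s. hpart (gmult F G) (Suc ?d) (\<lambda>j. e j + s * ?f j)) has_field_derivative
        (\<Sum>j\<le>Suc ?d. D' F j * hpart G (Suc ?d - j) e + D' G (Suc ?d - j) * hpart F j e)) (at 0)"
      unfolding hpart_gmult
      by (intro DERIV_sum) (use DERIV_mult[OF DD DD] in simp)
    then have "hpart (psderiv i (gmult F G)) ?d e = (\<Sum>j\<le>Suc ?d. D' F j * hpart G (Suc ?d - j) e + D' G (Suc ?d - j) * hpart F j e)"
      using D DERIV_unique by blast
    also have "\<dots> = (\<Sum>j\<le>Suc ?d. D' F j * hpart G (Suc ?d - j) e) + (\<Sum>j\<le>Suc ?d. hpart F j e * D' G (Suc ?d - j))"
      by (simp only: sum.distrib mult.commute)
    also have "(\<Sum>j\<le>Suc ?d. D' F j * hpart G (Suc ?d - j) e) = hpart (gmult (psderiv i F) G) ?d e"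
      unfolding sum.atMost_Suc_shift by (simp add: D'_def hpart_gmult)
    also have "(\<Sum>j\<le>Suc ?d. hpart F j e * D' G (Suc ?d - j)) = hpart (gmult F (psderiv i G)) ?d e"
      by (simp add: D'_def hpart_gmult Suc_diff_le)
    finally show ?thesis
      by (simp only: hpart_diff hpart_add diff_self)
  qed
  from hpart_eq_0_imp_coeff_0[OF this refl]
  show "psderiv i (gmult F G) \<alpha> = gmult (psderiv i F) G \<alpha> + gmult F (psderiv i G) \<alpha>" by simp
qed


section \<open>Convergent power series in several variables\<close>

text \<open>Absolute convergence at the corner (r, ..., r), which dominates the series on the closed
  cube of half-width r. Cubes fit better than balls because monomials are bounded coordinate by
  coordinate.\<close>

definition mps_conv :: "(nat^'n::finite \<Rightarrow> real) \<Rightarrow> real \<Rightarrow> bool" where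
  "mps_conv a r \<longleftrightarrow> r > 0 \<and> (\<lambda>\<alpha>. \<bar>a \<alpha>\<bar> * r ^ mdeg \<alpha>) summable_on UNIV"

definition mps :: "(nat^'n::finite \<Rightarrow> real) \<Rightarrow> ('n \<Rightarrow> real) \<Rightarrow> real" where
  "mps a x = (\<Sum>\<^sub>\<infinity>\<alpha>. a \<alpha> * mmon x \<alpha>)"

lemma abs_mmon_le:
  fixes x :: "'n::finite \<Rightarrow> real"
  assumes "\<And>i. \<bar>x i\<bar> \<le> m"
  shows "\<bar>mmon x \<alpha>\<bar> \<le> m ^ mdeg \<alpha>"
  using mmon_mono[of "\<lambda>i. \<bar>x i\<bar>" "\<lambda>_. m" \<alpha>] assms norm_mmon[of x \<alpha>] by (simp add: mmon_const)

lemma mps_abs_summable: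
  assumes "mps_conv a r" "\<And>i. \<bar>x i\<bar> \<le> r"
  shows "(\<lambda>\<alpha>. a \<alpha> * mmon x \<alpha>) abs_summable_on UNIV"
proof (rule Infinite_Sum.abs_summable_on_comparison_test')
  show "(\<lambda>\<alpha>. \<bar>a \<alpha>\<bar> * r ^ mdeg \<alpha>) summable_on UNIV" using assms by (simp add: mps_conv_def)
  show "norm (a \<alpha> * mmon x \<alpha>) \<le> \<bar>a \<alpha>\<bar> * r ^ mdeg \<alpha>" for \<alpha>
    unfolding real_norm_def abs_mult by (intro mult_left_mono abs_mmon_le assms(2)) simp
qed

lemma mps_has_sum:
  assumes "mps_conv a r" "\<And>i. \<bar>x i\<bar> \<le> r"
  shows "((\<lambda>\<alpha>. a \<alpha> * mmon x \<alpha>) has_sum mps a x) UNIV"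
  unfolding mps_def
  by (rule has_sum_infsum[OF abs_summable_summable[OF mps_abs_summable[OF assms]]])

lemma mps_conv_mono: "mps_conv a r \<Longrightarrow> 0 < s \<Longrightarrow> s \<le> r \<Longrightarrow> mps_conv a s"
  unfolding mps_conv_def
  by (auto intro!: summable_on_comparison_test[of "\<lambda>\<alpha>. \<bar>a \<alpha>\<bar> * r ^ mdeg \<alpha>"] mult_left_mono power_mono)

lemma mps_conv_zero_outside: "mps_conv a r \<Longrightarrow> (\<And>\<alpha>. b \<alpha> = a \<alpha> \<or> b \<alpha> = 0) \<Longrightarrow> mps_conv b r"
  unfolding mps_conv_def
proof (elim conjE, intro conjI, assumption)
  assume r: "r > 0" and s: "(\<lambda>\<alpha>. \<bar>a \<alpha>\<bar> * r ^ mdeg \<alpha>) summable_on UNIV" and b: "\<And>\<alpha>. b \<alpha> = a \<alpha> \<or> b \<alpha> = 0"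
  show "(\<lambda>\<alpha>. \<bar>b \<alpha>\<bar> * r ^ mdeg \<alpha>) summable_on UNIV"
  proof (rule summable_on_comparison_test[OF s])
    fix \<alpha> show "\<bar>b \<alpha>\<bar> * r ^ mdeg \<alpha> \<le> \<bar>a \<alpha>\<bar> * r ^ mdeg \<alpha>" using b[of \<alpha>] r by auto
  qed (use r in auto)
qed

lemma mps_conv_add: "mps_conv a r \<Longrightarrow> mps_conv b r \<Longrightarrow> mps_conv (\<lambda>\<alpha>. a \<alpha> + b \<alpha>) r"
  unfolding mps_conv_def
proof (elim conjE, intro conjI, assumption)
  assume r: "r > 0" and s: "(\<lambda>\<alpha>. \<bar>a \<alpha>\<bar> * r ^ mdeg \<alpha>) summable_on UNIV" "(\<lambda>\<alpha>. \<bar>b \<alpha>\<bar> * r ^ mdeg \<alpha>) summable_on UNIV"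
  show "(\<lambda>\<alpha>. \<bar>a \<alpha> + b \<alpha>\<bar> * r ^ mdeg \<alpha>) summable_on UNIV"
  proof (rule summable_on_comparison_test[OF summable_on_add[OF s]])
    fix \<alpha> show "\<bar>a \<alpha> + b \<alpha>\<bar> * r ^ mdeg \<alpha> \<le> \<bar>a \<alpha>\<bar> * r ^ mdeg \<alpha> + \<bar>b \<alpha>\<bar> * r ^ mdeg \<alpha>"
      unfolding distrib_right[symmetric] using r by (intro mult_right_mono) auto
  qed (use r in auto)
qed

lemma mps_add:
  assumes "mps_conv a r" "mps_conv b r" "\<And>i. \<bar>x i\<bar> \<le> r"
  shows "mps (\<lambda>\<alpha>. a \<alpha> + b \<alpha>) x = mps a x + mps b x"
proof -
  have "((\<lambda>\<alpha>. a \<alpha> * mmon x \<alpha> + b \<alpha> * mmon x \<alpha>) has_sum mps a x + mps b x) UNIV"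
    using assms by (intro has_sum_add mps_has_sum)
  then show ?thesis unfolding mps_def by (simp add: distrib_right infsumI)
qed

lemma mps_conv_finite_support:
  assumes "finite {\<alpha>. a \<alpha> \<noteq> 0}" "r > 0"
  shows "mps_conv a r"
proof -
  have "(\<lambda>\<alpha>. \<bar>a \<alpha>\<bar> * r ^ mdeg \<alpha>) summable_on {\<alpha>. a \<alpha> \<noteq> 0}" using assms(1) by (rule summable_on_finite)
  then have "(\<lambda>\<alpha>. \<bar>a \<alpha>\<bar> * r ^ mdeg \<alpha>) summable_on UNIV"
    by (rule summable_on_cong_neutral[THEN iffD1, rotated 3]) auto
  then show ?thesis using assms(2) by (simp add: mps_conv_def)
qed

lemma mps_finite_support:
  assumes "finite A" "\<And>\<alpha>. \<alpha> \<notin> A \<Longrightarrow> a \<alpha> = 0"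
  shows "mps a x = (\<Sum>\<alpha>\<in>A. a \<alpha> * mmon x \<alpha>)"
proof -
  have "((\<lambda>\<alpha>. a \<alpha> * mmon x \<alpha>) has_sum (\<Sum>\<alpha>\<in>A. a \<alpha> * mmon x \<alpha>)) A" using assms by simp
  then have "((\<lambda>\<alpha>. a \<alpha> * mmon x \<alpha>) has_sum (\<Sum>\<alpha>\<in>A. a \<alpha> * mmon x \<alpha>)) UNIV"
    by (rule has_sum_cong_neutral[THEN iffD1, rotated 3]) (use assms in auto)
  then show ?thesis unfolding mps_def by (rule infsumI)
qed

lemma mps_conv_sum:
  assumes "finite I" "r > 0" "\<And>i. i \<in> I \<Longrightarrow> mps_conv (a i) r"
  shows "mps_conv (\<lambda>\<alpha>. \<Sum>i\<in>I. a i \<alpha>) r"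
  using assms by (induction I rule: finite_induct) (auto intro: mps_conv_add mps_conv_finite_support)

lemma mps_sum:
  assumes "finite I" "r > 0" "\<And>i. i \<in> I \<Longrightarrow> mps_conv (a i) r" "\<And>i. \<bar>x i\<bar> \<le> r"
  shows "mps (\<lambda>\<alpha>. \<Sum>i\<in>I. a i \<alpha>) x = (\<Sum>i\<in>I. mps (a i) x)"
  using assms
proof (induction I rule: finite_induct)
  case empty
  then show ?case by (simp add: mps_def)
next
  case (insert i I)
  then show ?case by (simp add: mps_add[of _ r] mps_conv_sum)
qed

text \<open>On the cube of half-width m <= r a term of degree at least k is at most (m/r)^k times
  its size at the corner of the cube of half-width r, so C is the absolute sum there divided by
  r^k.\<close>

lemma mps_remainder:
  fixes a :: "nat^'n \<Rightarrow> real"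
  assumes a: "mps_conv a r"
  obtains C where "C \<ge> 0"
    "\<And>x m. m \<le> r \<Longrightarrow> (\<And>i. \<bar>x i\<bar> \<le> m) \<Longrightarrow>
        \<bar>mps a x - (\<Sum>\<alpha> | mdeg \<alpha> < k. a \<alpha> * mmon x \<alpha>)\<bar> \<le> C * m ^ k"
proof -
  define b where "b = (\<lambda>\<alpha>. if mdeg \<alpha> < k then 0 else a \<alpha>)"
  define c where "c = (\<lambda>\<alpha>. if mdeg \<alpha> < k then a \<alpha> else 0)"
  have r: "r > 0" using a by (simp add: mps_conv_def)
  have b: "mps_conv b r" and c: "mps_conv c r"
    by (rule mps_conv_zero_outside[OF a]; simp add: b_def c_def)+
  have fin: "finite {\<alpha> :: nat^'n. mdeg \<alpha> < k}"
    by (rule finite_subset[OF _ finite_mdeg_le[of k]]) auto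
  have abc: "a = (\<lambda>\<alpha>. c \<alpha> + b \<alpha>)" by (auto simp: b_def c_def)
  define S where "S = (\<Sum>\<^sub>\<infinity>\<alpha>. \<bar>a \<alpha>\<bar> * r ^ mdeg \<alpha>)"
  have S: "((\<lambda>\<alpha>. \<bar>a \<alpha>\<bar> * r ^ mdeg \<alpha>) has_sum S) UNIV"
    unfolding S_def using a by (intro has_sum_infsum) (simp add: mps_conv_def)
  have S0: "S \<ge> 0" unfolding S_def using r by (intro infsum_nonneg) auto
  show ?thesis
  proof (rule that[of "S / r ^ k"])
    show "S / r ^ k \<ge> 0" using S0 r by simp
    fix x :: "'n \<Rightarrow> real" and m assume m: "m \<le> r" and x: "\<And>i. \<bar>x i\<bar> \<le> m"
    have m0: "m \<ge> 0" using x[of undefined] by linarith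
    have xr: "\<bar>x i\<bar> \<le> r" for i using x[of i] m by linarith
    have "mps a x = mps c x + mps b x"
      by (subst abc) (rule mps_add[OF c b xr])
    also have "mps c x = (\<Sum>\<alpha> | mdeg \<alpha> < k. c \<alpha> * mmon x \<alpha>)"
      by (rule mps_finite_support) (auto simp: c_def fin)
    also have "\<dots> = (\<Sum>\<alpha> | mdeg \<alpha> < k. a \<alpha> * mmon x \<alpha>)"
      by (intro sum.cong) (auto simp: c_def)
    finally have "\<bar>mps a x - (\<Sum>\<alpha> | mdeg \<alpha> < k. a \<alpha> * mmon x \<alpha>)\<bar> = \<bar>mps b x\<bar>" by simp
    also have "\<bar>mps b x\<bar> \<le> (\<Sum>\<^sub>\<infinity>\<alpha>. \<bar>b \<alpha> * mmon x \<alpha>\<bar>)"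
      using norm_infsum_bound[OF mps_abs_summable[OF b xr]] by (simp add: mps_def)
    also have "\<dots> \<le> (\<Sum>\<^sub>\<infinity>\<alpha>. (m / r) ^ k * (\<bar>a \<alpha>\<bar> * r ^ mdeg \<alpha>))"
    proof (rule infsum_mono)
      show "(\<lambda>\<alpha>. \<bar>b \<alpha> * mmon x \<alpha>\<bar>) summable_on UNIV" using mps_abs_summable[OF b xr] by simp
      show "(\<lambda>\<alpha>. (m / r) ^ k * (\<bar>a \<alpha>\<bar> * r ^ mdeg \<alpha>)) summable_on UNIV"
        using S by (intro summable_on_cmult_right) (auto simp: summable_on_def)
      fix \<alpha>
      show "\<bar>b \<alpha> * mmon x \<alpha>\<bar> \<le> (m / r) ^ k * (\<bar>a \<alpha>\<bar> * r ^ mdeg \<alpha>)"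
      proof (cases "mdeg \<alpha> < k")
        case True
        then show ?thesis using r m0 by (simp add: b_def)
      next
        case False
        have "\<bar>mmon x \<alpha>\<bar> \<le> m ^ mdeg \<alpha>" by (rule abs_mmon_le[OF x])
        also have "\<dots> = (m / r) ^ mdeg \<alpha> * r ^ mdeg \<alpha>" using r by (simp add: power_divide)
        also have "\<dots> \<le> (m / r) ^ k * r ^ mdeg \<alpha>"
          using False r m m0 by (intro mult_right_mono power_decreasing) auto
        finally have "\<bar>a \<alpha>\<bar> * \<bar>mmon x \<alpha>\<bar> \<le> \<bar>a \<alpha>\<bar> * ((m / r) ^ k * r ^ mdeg \<alpha>)"
          by (intro mult_left_mono) auto
        then show ?thesis using False by (simp add: b_def abs_mult mult_ac)
      qed
    qed
    also have "\<dots> = (m / r) ^ k * S" unfolding S_def by (rule infsum_cmult_right')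
    also have "\<dots> = S / r ^ k * m ^ k" by (simp add: power_divide)
    finally show "\<bar>mps a x - (\<Sum>\<alpha> | mdeg \<alpha> < k. a \<alpha> * mmon x \<alpha>)\<bar> \<le> S / r ^ k * m ^ k" .
  qed
qed

lemma sum_mdeg_less_Suc_lowest:
  assumes "\<And>\<alpha>. mdeg \<alpha> < d \<Longrightarrow> a \<alpha> = (0::real)"
  shows "(\<Sum>\<alpha> | mdeg \<alpha> < Suc d. a \<alpha> * mmon x \<alpha>) = hpart a d x"
  unfolding hpart_def
  by (rule sum.mono_neutral_right)
     (use assms in \<open>auto simp: less_Suc_eq intro: finite_subset[OF _ finite_mdeg_le[of d]]\<close>)

text \<open>If all coefficients of degree less than d vanish, then at u e the sum is u^d times the
  form of degree d plus O(u^(d+1)). Dividing by u^d and letting u tend to 0 kills the form.\<close>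

lemma mps_eq_0_imp_coeff_0:
  assumes a: "mps_conv a r" and z: "\<And>x. (\<And>i. \<bar>x i\<bar> \<le> r) \<Longrightarrow> mps a x = 0"
  shows "a \<alpha> = 0"
proof (induction "mdeg \<alpha>" arbitrary: \<alpha> rule: less_induct)
  case less
  define d where "d = mdeg \<alpha>"
  have r: "r > 0" using a by (simp add: mps_conv_def)
  obtain C where C: "C \<ge> 0" "\<And>x m. m \<le> r \<Longrightarrow> (\<And>i. \<bar>x i\<bar> \<le> m) \<Longrightarrow>
        \<bar>mps a x - (\<Sum>\<alpha> | mdeg \<alpha> < Suc d. a \<alpha> * mmon x \<alpha>)\<bar> \<le> C * m ^ Suc d"
    using mps_remainder[OF a] by blast
  have "hpart a d e = 0" for e
  proof -
    define M where "M = 1 + (\<Sum>i\<in>UNIV. \<bar>e i\<bar>)"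
    have M0: "M > 0" unfolding M_def by (intro add_pos_nonneg sum_nonneg) auto
    have M: "\<bar>e i\<bar> \<le> M" for i
      unfolding M_def using member_le_sum[of i UNIV "\<lambda>i. \<bar>e i\<bar>"] by simp
    have le: "\<bar>hpart a d e\<bar> \<le> (C * M ^ Suc d) * u" if u: "0 < u" "u * M \<le> r" for u
    proof -
      have b: "\<bar>u * e i\<bar> \<le> u * M" for i using M[of i] u by (simp add: abs_mult)
      have "\<bar>mps a (\<lambda>i. u * e i) - (\<Sum>\<alpha> | mdeg \<alpha> < Suc d. a \<alpha> * mmon (\<lambda>i. u * e i) \<alpha>)\<bar> \<le> C * (u * M) ^ Suc d"
        by (rule C(2)[OF u(2) b])
      moreover have "mps a (\<lambda>i. u * e i) = 0"
        by (rule z) (use b u(2) in \<open>meson order_trans\<close>)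
      moreover have "(\<Sum>\<alpha> | mdeg \<alpha> < Suc d. a \<alpha> * mmon (\<lambda>i. u * e i) \<alpha>) = hpart a d (\<lambda>i. u * e i)"
        by (rule sum_mdeg_less_Suc_lowest) (use less d_def in auto)
      ultimately have "u ^ d * \<bar>hpart a d e\<bar> \<le> u ^ d * ((C * M ^ Suc d) * u)"
        using u by (simp add: hpart_scale abs_mult power_mult_distrib mult_ac)
      then show ?thesis using u by simp
    qed
    have "((\<lambda>u. (C * M ^ Suc d) * u) \<longlongrightarrow> (C * M ^ Suc d) * 0) (at_right 0)"
      by (intro tendsto_intros)
    moreover have "\<forall>\<^sub>F u in at_right 0. \<bar>hpart a d e\<bar> \<le> (C * M ^ Suc d) * u"
    proof -
      have "\<forall>\<^sub>F u in at_right 0. u \<in> {0<..<r / M}"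
        using r M0 by (intro eventually_at_right_real) simp
      then show ?thesis by eventually_elim (use le M0 in \<open>auto simp: field_simps\<close>)
    qed
    ultimately have "\<bar>hpart a d e\<bar> \<le> (C * M ^ Suc d) * 0"
      by (intro tendsto_lowerbound) auto
    then show ?thesis by simp
  qed
  then show ?case by (rule hpart_eq_0_imp_coeff_0) (simp add: d_def)
qed

section \<open>Double series, summed by diagonals and by rows\<close>

lemma bij_betw_add_pairs:
  "bij_betw snd (SIGMA \<gamma>:UNIV. {(\<alpha>, \<beta>). \<alpha> + \<beta> = \<gamma>}) (UNIV :: ((nat^'n) \<times> (nat^'n)) set)"
  by (rule bij_betw_byWitness[where f' = "\<lambda>x. (fst x + snd x, x)"]) auto

lemma pairs_abs_summable_iff:
  fixes g :: "(nat^'n) \<times> (nat^'n) \<Rightarrow> real"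
  shows "g abs_summable_on UNIV \<longleftrightarrow> (\<lambda>\<gamma>. \<Sum>x\<in>{(\<alpha>, \<beta>). \<alpha> + \<beta> = \<gamma>}. \<bar>g x\<bar>) summable_on UNIV"
proof -
  have "g abs_summable_on UNIV \<longleftrightarrow> (\<lambda>x. g (snd x)) abs_summable_on (SIGMA \<gamma>:UNIV. {(\<alpha>, \<beta>). \<alpha> + \<beta> = \<gamma>})"
    using summable_on_reindex_bij_betw[OF bij_betw_add_pairs, of "\<lambda>x. norm (g x)"] by simp
  also have "\<dots> \<longleftrightarrow> (\<lambda>\<gamma>. \<Sum>x\<in>{(\<alpha>, \<beta>). \<alpha> + \<beta> = \<gamma>}. \<bar>g x\<bar>) summable_on UNIV"
    by (subst Infinite_Sum.abs_summable_on_Sigma_iff)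
       (simp add: infsum_finite[OF finite_mfps_mult_index] summable_on_finite[OF finite_mfps_mult_index] sum_nonneg)
  finally show ?thesis .
qed

lemma pairs_has_sum_diagonal:
  fixes g :: "(nat^'n) \<times> (nat^'n) \<Rightarrow> real"
  assumes "g abs_summable_on UNIV"
  shows "((\<lambda>\<gamma>. \<Sum>x\<in>{(\<alpha>, \<beta>). \<alpha> + \<beta> = \<gamma>}. g x) has_sum infsum g UNIV) UNIV"
proof -
  have "(g has_sum infsum g UNIV) UNIV"
    by (rule has_sum_infsum[OF abs_summable_summable[OF assms]])
  then have "((\<lambda>x. g (snd x)) has_sum infsum g UNIV) (SIGMA \<gamma>:UNIV. {(\<alpha>, \<beta>). \<alpha> + \<beta> = \<gamma>})"
    using has_sum_reindex_bij_betw[OF bij_betw_add_pairs, of g] by simp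
  then show ?thesis
    by (rule has_sum_Sigma[OF isUCont_plus]) (simp add: finite_mfps_mult_index)
qed

lemma pairs_has_sum_rows:
  fixes g :: "(nat^'n) \<times> (nat^'n) \<Rightarrow> real"
  assumes "g abs_summable_on UNIV"
  shows "((\<lambda>\<beta>. \<Sum>\<^sub>\<infinity>\<alpha>. g (\<alpha>, \<beta>)) has_sum infsum g UNIV) UNIV"
    and "(\<lambda>\<alpha>. g (\<alpha>, \<beta>)) abs_summable_on UNIV"
    and "(\<lambda>\<beta>. \<Sum>\<^sub>\<infinity>\<alpha>. \<bar>g (\<alpha>, \<beta>)\<bar>) summable_on UNIV"
proof -
  have b: "bij_betw prod.swap (UNIV \<times> UNIV) (UNIV :: ((nat^'n) \<times> (nat^'n)) set)"
    by (simp add: bij_swap)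
  have "(\<lambda>x. g (prod.swap x)) abs_summable_on UNIV \<times> UNIV"
    using summable_on_reindex_bij_betw[OF b, of "\<lambda>x. norm (g x)"] assms by simp
  then have s: "(\<forall>\<beta>. (\<lambda>\<alpha>. g (\<alpha>, \<beta>)) abs_summable_on UNIV) \<and>
     (\<lambda>\<beta>. \<Sum>\<^sub>\<infinity>\<alpha>. norm (g (\<alpha>, \<beta>))) abs_summable_on UNIV"
    by (subst (asm) Infinite_Sum.abs_summable_on_Sigma_iff) simp
  then show 2: "(\<lambda>\<alpha>. g (\<alpha>, \<beta>)) abs_summable_on UNIV" for \<beta> by blast
  show "(\<lambda>\<beta>. \<Sum>\<^sub>\<infinity>\<alpha>. \<bar>g (\<alpha>, \<beta>)\<bar>) summable_on UNIV"
    using s by (simp add: infsum_nonneg)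
  have "(g has_sum infsum g UNIV) UNIV"
    by (rule has_sum_infsum[OF abs_summable_summable[OF assms]])
  then have "((\<lambda>x. g (prod.swap x)) has_sum infsum g UNIV) (UNIV \<times> UNIV)"
    using has_sum_reindex_bij_betw[OF b, of g] by simp
  then show "((\<lambda>\<beta>. \<Sum>\<^sub>\<infinity>\<alpha>. g (\<alpha>, \<beta>)) has_sum infsum g UNIV) UNIV"
    by (rule has_sum_Sigma[OF isUCont_plus])
       (use has_sum_infsum[OF abs_summable_summable[OF 2]] in simp)
qed

lemma pairs_product_abs_summable:
  fixes f g :: "nat^'n \<Rightarrow> real"
  assumes "f abs_summable_on UNIV" "g abs_summable_on UNIV"
  shows "(\<lambda>(\<alpha>, \<beta>). f \<alpha> * g \<beta>) abs_summable_on UNIV"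
    and "infsum (\<lambda>(\<alpha>, \<beta>). f \<alpha> * g \<beta>) UNIV = infsum f UNIV * infsum g UNIV"
proof -
  have "(\<lambda>(\<alpha>, \<beta>). f \<alpha> * g \<beta>) abs_summable_on UNIV \<times> UNIV"
    unfolding Infinite_Sum.abs_summable_on_Sigma_iff using assms
    by (auto simp: abs_mult infsum_cmult_right' infsum_nonneg intro!: summable_on_cmult_right summable_on_cmult_left)
  then show s: "(\<lambda>(\<alpha>, \<beta>). f \<alpha> * g \<beta>) abs_summable_on UNIV" by simp
  have "((\<lambda>\<beta>. \<Sum>\<^sub>\<infinity>\<alpha>. f \<alpha> * g \<beta>) has_sum infsum (\<lambda>(\<alpha>, \<beta>). f \<alpha> * g \<beta>) UNIV) UNIV"
    using pairs_has_sum_rows(1)[OF s] by simp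
  then have "((\<lambda>\<beta>. infsum f UNIV * g \<beta>) has_sum infsum (\<lambda>(\<alpha>, \<beta>). f \<alpha> * g \<beta>) UNIV) UNIV"
    by (simp add: infsum_cmult_left')
  moreover have "((\<lambda>\<beta>. infsum f UNIV * g \<beta>) has_sum infsum f UNIV * infsum g UNIV) UNIV"
    by (intro has_sum_cmult_right has_sum_infsum[OF abs_summable_summable[OF assms(2)]])
  ultimately show "infsum (\<lambda>(\<alpha>, \<beta>). f \<alpha> * g \<beta>) UNIV = infsum f UNIV * infsum g UNIV"
    by (rule has_sum_unique)
qed

lemma gmult_mmon:
  "gmult a b \<gamma> * mmon x \<gamma> = (\<Sum>y\<in>{(\<alpha>, \<beta>). \<alpha> + \<beta> = \<gamma>}. case y of (\<alpha>, \<beta>) \<Rightarrow> (a \<alpha> * mmon x \<alpha>) * (b \<beta> * mmon x \<beta>))"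
  unfolding gmult_def sum_distrib_right by (intro sum.cong) (auto simp: mmon_add mult_ac)

lemma mps_mult:
  assumes "mps_conv a r" "mps_conv b r" "\<And>i. \<bar>x i\<bar> \<le> r"
  shows "mps (gmult a b) x = mps a x * mps b x"
proof -
  let ?g = "\<lambda>(\<alpha>, \<beta>). (a \<alpha> * mmon x \<alpha>) * (b \<beta> * mmon x \<beta>)"
  have s: "?g abs_summable_on UNIV"
    and i: "infsum ?g UNIV = mps a x * mps b x"
    unfolding mps_def
    by (intro pairs_product_abs_summable mps_abs_summable[OF assms(1,3)] mps_abs_summable[OF assms(2,3)])+
  from pairs_has_sum_diagonal[OF s] show ?thesis
    unfolding mps_def gmult_mmon i by (rule infsumI[of _ _ "_ * _", folded mps_def])
qed

lemma mps_conv_mult: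
  assumes "mps_conv a r" "mps_conv b r"
  shows "mps_conv (gmult a b) r"
proof -
  have r: "r > 0" using assms by (simp add: mps_conv_def)
  let ?g = "\<lambda>(\<alpha>, \<beta>). (\<bar>a \<alpha>\<bar> * mmon (\<lambda>_. r) \<alpha>) * (\<bar>b \<beta>\<bar> * mmon (\<lambda>_. r) \<beta>)"
  have s: "?g abs_summable_on UNIV"
    using assms r by (intro pairs_product_abs_summable) (auto simp: mps_conv_def mmon_const abs_mult)
  have "(\<lambda>\<gamma>. gmult (\<lambda>\<alpha>. \<bar>a \<alpha>\<bar>) (\<lambda>\<alpha>. \<bar>b \<alpha>\<bar>) \<gamma> * mmon (\<lambda>_. r) \<gamma>) summable_on UNIV"
    using pairs_has_sum_diagonal[OF s] unfolding gmult_mmon by (rule has_sum_imp_summable)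
  then have "(\<lambda>\<gamma>. \<bar>gmult a b \<gamma>\<bar> * r ^ mdeg \<gamma>) summable_on UNIV"
  proof (rule summable_on_comparison_test)
    fix \<gamma>
    have "\<bar>gmult a b \<gamma>\<bar> \<le> gmult (\<lambda>\<alpha>. \<bar>a \<alpha>\<bar>) (\<lambda>\<alpha>. \<bar>b \<alpha>\<bar>) \<gamma>"
      unfolding gmult_def by (rule order_trans[OF sum_abs]) (auto intro!: sum_mono simp: abs_mult)
    then show "\<bar>gmult a b \<gamma>\<bar> * r ^ mdeg \<gamma> \<le> gmult (\<lambda>\<alpha>. \<bar>a \<alpha>\<bar>) (\<lambda>\<alpha>. \<bar>b \<alpha>\<bar>) \<gamma> * mmon (\<lambda>_. r) \<gamma>"
      unfolding mmon_const using r by (intro mult_right_mono) auto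
  qed (use r in auto)
  then show ?thesis using r by (simp add: mps_conv_def)
qed

section \<open>Re-expansion at a nearby point\<close>

definition mbinom :: "nat^'n::finite \<Rightarrow> nat^'n \<Rightarrow> nat" where
  "mbinom \<gamma> \<beta> = (\<Prod>i\<in>UNIV. (\<gamma> $ i) choose (\<beta> $ i))"

text \<open>The coefficients of the partial derivative of order \<beta> divided by \<beta>
  factorial; evaluated at a point p, the series gives the Taylor coefficient of index \<beta> at
  p.\<close>

definition dcoef :: "nat^'n::finite \<Rightarrow> (nat^'n \<Rightarrow> real) \<Rightarrow> nat^'n \<Rightarrow> real" where
  "dcoef \<beta> a = (\<lambda>\<alpha>. real (mbinom (\<alpha> + \<beta>) \<beta>) * a (\<alpha> + \<beta>))"

lemma mmon_binomial:
  fixes p y :: "'n::finite \<Rightarrow> real" and \<gamma> :: "nat^'n"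
  shows "mmon (\<lambda>i. p i + y i) \<gamma> = (\<Sum>(\<alpha>, \<beta>)\<in>{(\<alpha>, \<beta>). \<alpha> + \<beta> = \<gamma>}. real (mbinom (\<alpha> + \<beta>) \<beta>) * mmon p \<alpha> * mmon y \<beta>)"
proof -
  have "mmon (\<lambda>i. p i + y i) \<gamma> = (\<Prod>i\<in>UNIV. \<Sum>k\<in>{..\<gamma> $ i}. real (\<gamma> $ i choose k) * p i ^ (\<gamma> $ i - k) * y i ^ k)"
    unfolding mmon_def
    by (intro prod.cong refl) (subst add.commute, subst binomial_ring, simp add: mult_ac)
  also have "\<dots> = (\<Sum>g\<in>PiE UNIV (\<lambda>i. {..\<gamma> $ i}). \<Prod>i\<in>UNIV. real (\<gamma> $ i choose g i) * p i ^ (\<gamma> $ i - g i) * y i ^ g i)"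
    by (rule prod_sum_PiE) auto
  also have "\<dots> = (\<Sum>(\<alpha>, \<beta>)\<in>{(\<alpha>, \<beta>). \<alpha> + \<beta> = \<gamma>}. real (mbinom (\<alpha> + \<beta>) \<beta>) * mmon p \<alpha> * mmon y \<beta>)"
  proof (rule sum.reindex_bij_witness[where j = "\<lambda>g. (\<chi> i. \<gamma> $ i - g i, \<chi> i. g i)" and i = "\<lambda>x. vec_nth (snd x)"], goal_cases)
    case (1 g)
    then show ?case by (auto simp: fun_eq_iff)
  next
    case (2 g)
    then show ?case by (auto simp: vec_eq_iff PiE_iff)
  next
    case (3 x)
    then show ?case by (auto simp: vec_eq_iff) (metis add_diff_cancel_right')
  next
    case (4 x)
    then show ?case by (auto simp: vec_eq_iff) (metis le_add2)
  next
    case (5 g)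
    then have "\<gamma> $ i - g i + g i = \<gamma> $ i" for i by (auto simp: PiE_iff)
    then show ?case by (simp add: mbinom_def mmon_def prod.distrib)
  qed
  finally show ?thesis .
qed

text \<open>Along the diagonal \<alpha> + \<beta> = \<gamma> the binomial theorem collapses the
  absolute values to |a_\<gamma>| times the monomial at |p| + |y|, which the corner of the cube
  dominates.\<close>

lemma reexpand_summable:
  fixes a :: "nat^'n \<Rightarrow> real"
  assumes a: "mps_conv a r" and py: "\<And>i. \<bar>p i\<bar> + \<bar>y i\<bar> \<le> r"
  shows "(\<lambda>(\<alpha>, \<beta>). dcoef \<beta> a \<alpha> * mmon p \<alpha> * mmon y \<beta>) abs_summable_on UNIV"
  unfolding pairs_abs_summable_iff
proof (rule summable_on_comparison_test)
  show "(\<lambda>\<gamma>. \<bar>a \<gamma>\<bar> * r ^ mdeg \<gamma>) summable_on UNIV" using a by (simp add: mps_conv_def)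
  fix \<gamma>
  have "(\<Sum>x\<in>{(\<alpha>, \<beta>). \<alpha> + \<beta> = \<gamma>}. \<bar>case x of (\<alpha>, \<beta>) \<Rightarrow> dcoef \<beta> a \<alpha> * mmon p \<alpha> * mmon y \<beta>\<bar>)
    = \<bar>a \<gamma>\<bar> * (\<Sum>(\<alpha>, \<beta>)\<in>{(\<alpha>, \<beta>). \<alpha> + \<beta> = \<gamma>}. real (mbinom (\<alpha> + \<beta>) \<beta>) * mmon (\<lambda>i. \<bar>p i\<bar>) \<alpha> * mmon (\<lambda>i. \<bar>y i\<bar>) \<beta>)"
    unfolding sum_distrib_left
    by (intro sum.cong) (auto simp: dcoef_def abs_mult norm_mmon[where 'a = real, simplified] mult_ac)
  also have "\<dots> = \<bar>a \<gamma>\<bar> * mmon (\<lambda>i. \<bar>p i\<bar> + \<bar>y i\<bar>) \<gamma>" by (simp add: mmon_binomial)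
  also have "\<dots> \<le> \<bar>a \<gamma>\<bar> * r ^ mdeg \<gamma>"
    using abs_mmon_le[of "\<lambda>i. \<bar>p i\<bar> + \<bar>y i\<bar>" r \<gamma>] py by (intro mult_left_mono) auto
  finally show "(\<Sum>x\<in>{(\<alpha>, \<beta>). \<alpha> + \<beta> = \<gamma>}. \<bar>case x of (\<alpha>, \<beta>) \<Rightarrow> dcoef \<beta> a \<alpha> * mmon p \<alpha> * mmon y \<beta>\<bar>)
      \<le> \<bar>a \<gamma>\<bar> * r ^ mdeg \<gamma>" .
qed (auto intro: sum_nonneg)

text \<open>With p = (s, ..., s) and y = (r - s, ..., r - s), a single row of the summable double
  series is the required series times the positive constant (r - s)^|\<beta>|.\<close>

lemma mps_conv_dcoef:
  assumes a: "mps_conv a r" and s: "0 < s" "s < r"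
  shows "mps_conv (dcoef \<beta> a) s"
proof -
  have "(\<lambda>(\<alpha>, \<beta>). dcoef \<beta> a \<alpha> * mmon (\<lambda>_. s) \<alpha> * mmon (\<lambda>_. r - s) \<beta>) abs_summable_on UNIV"
    by (rule reexpand_summable[OF a]) (use s in auto)
  from pairs_has_sum_rows(2)[OF this, of \<beta>]
  have "(\<lambda>\<alpha>. (\<bar>dcoef \<beta> a \<alpha>\<bar> * s ^ mdeg \<alpha>) * (r - s) ^ mdeg \<beta>) summable_on UNIV"
    using s by (simp add: mmon_const abs_mult)
  then have "(\<lambda>\<alpha>. (\<bar>dcoef \<beta> a \<alpha>\<bar> * s ^ mdeg \<alpha>) * (r - s) ^ mdeg \<beta> * (1 / (r - s) ^ mdeg \<beta>)) summable_on UNIV"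
    by (rule summable_on_cmult_left)
  then show ?thesis using s by (simp add: mps_conv_def)
qed

lemma mps_reexpand:
  assumes a: "mps_conv a r" and p: "\<And>i. \<bar>p i\<bar> \<le> s" and s: "0 \<le> s" "s < r"
  shows "mps_conv (\<lambda>\<beta>. mps (dcoef \<beta> a) p) (r - s)"
    and "(\<And>i. \<bar>y i\<bar> \<le> r - s) \<Longrightarrow> mps a (\<lambda>i. p i + y i) = mps (\<lambda>\<beta>. mps (dcoef \<beta> a) p) y"
proof -
  have sm: "(\<lambda>(\<alpha>, \<beta>). dcoef \<beta> a \<alpha> * mmon p \<alpha> * mmon y \<beta>) abs_summable_on UNIV"
    if "\<And>i. \<bar>y i\<bar> \<le> r - s" for y
  proof (rule reexpand_summable[OF a])
    show "\<bar>p i\<bar> + \<bar>y i\<bar> \<le> r" for i using p[of i] that[of i] by linarith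
  qed
  have "(\<lambda>\<beta>. \<Sum>\<^sub>\<infinity>\<alpha>. \<bar>dcoef \<beta> a \<alpha> * mmon p \<alpha> * mmon (\<lambda>_. r - s) \<beta>\<bar>) summable_on UNIV"
    using pairs_has_sum_rows(3)[OF sm[of "\<lambda>_. r - s"]] s by simp
  then have s2: "(\<lambda>\<beta>. (\<Sum>\<^sub>\<infinity>\<alpha>. \<bar>dcoef \<beta> a \<alpha> * mmon p \<alpha>\<bar>) * (r - s) ^ mdeg \<beta>) summable_on UNIV"
    using s by (simp add: abs_mult mmon_const infsum_cmult_left')
  have ab: "(\<lambda>\<alpha>. dcoef \<beta> a \<alpha> * mmon p \<alpha>) abs_summable_on UNIV" for \<beta>
  proof -
    \<comment> \<open>A positive radius strictly below r is required, and s may be 0; the midpoint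
      serves in every case.\<close>
    define s' where "s' = (s + r) / 2"
    have "mps_conv (dcoef \<beta> a) s'" using s by (intro mps_conv_dcoef[OF a]) (auto simp: s'_def)
    moreover have "\<bar>p i\<bar> \<le> s'" for i using p[of i] s by (auto simp: s'_def)
    ultimately show ?thesis by (rule mps_abs_summable)
  qed
  have "(\<lambda>\<beta>. \<bar>mps (dcoef \<beta> a) p\<bar> * (r - s) ^ mdeg \<beta>) summable_on UNIV"
    by (rule summable_on_comparison_test[OF s2])
       (use norm_infsum_bound[OF ab] s in \<open>auto simp: mps_def intro!: mult_right_mono\<close>)
  then show "mps_conv (\<lambda>\<beta>. mps (dcoef \<beta> a) p) (r - s)" using s by (simp add: mps_conv_def)
  assume y: "\<And>i. \<bar>y i\<bar> \<le> r - s"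
  let ?g = "\<lambda>(\<alpha>, \<beta>). dcoef \<beta> a \<alpha> * mmon p \<alpha> * mmon y \<beta>"
  have "(\<Sum>x\<in>{(\<alpha>, \<beta>). \<alpha> + \<beta> = \<gamma>}. ?g x) = a \<gamma> * mmon (\<lambda>i. p i + y i) \<gamma>" for \<gamma>
    unfolding mmon_binomial sum_distrib_left by (intro sum.cong) (auto simp: dcoef_def mult_ac)
  then have "((\<lambda>\<gamma>. a \<gamma> * mmon (\<lambda>i. p i + y i) \<gamma>) has_sum infsum ?g UNIV) UNIV"
    using pairs_has_sum_diagonal[OF sm[of y, OF y]] by simp
  then have "mps a (\<lambda>i. p i + y i) = infsum ?g UNIV" unfolding mps_def by (rule infsumI)
  moreover have "((\<lambda>\<beta>. mps (dcoef \<beta> a) p * mmon y \<beta>) has_sum infsum ?g UNIV) UNIV"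
    using pairs_has_sum_rows(1)[OF sm[of y, OF y]] by (simp add: mps_def infsum_cmult_left')
  then have "mps (\<lambda>\<beta>. mps (dcoef \<beta> a) p) y = infsum ?g UNIV" unfolding mps_def[of _ y] by (rule infsumI)
  ultimately show "mps a (\<lambda>i. p i + y i) = mps (\<lambda>\<beta>. mps (dcoef \<beta> a) p) y" by simp
qed

lemma dcoef_0 [simp]: "dcoef 0 a = a"
  by (simp add: dcoef_def mbinom_def)

lemma dcoef_at_0: "dcoef \<beta> a 0 = a \<beta>"
  by (simp add: dcoef_def mbinom_def)

lemma dcoef_axis: "dcoef (axis i 1) a = psderiv i a"
proof
  fix \<alpha> :: "nat^'a"
  have "mbinom (\<alpha> + axis i 1) (axis i 1) = (\<Prod>j\<in>UNIV. if j = i then \<alpha> $ i + 1 else 1)"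
    unfolding mbinom_def by (intro prod.cong) (auto simp: axis_def)
  then show "dcoef (axis i 1) a \<alpha> = psderiv i a \<alpha>" by (simp add: dcoef_def psderiv_def)
qed

lemma norm_le_card_mult:
  fixes x :: "real^'n"
  assumes "\<And>i. \<bar>x $ i\<bar> \<le> s"
  shows "norm x \<le> real CARD('n) * s"
  using order_trans[OF norm_le_l1_cart sum_bounded_above[of UNIV "\<lambda>i. \<bar>x $ i\<bar>" s]] assms by simp

text \<open>A small cube fits into the ball, corner included, and for real series summability at the
  corner is already absolute summability. Dividing R by one more than the dimension keeps the cube
  inside the open ball.\<close>

lemma has_power_series_at_iff:
  fixes f :: "real^'n \<Rightarrow> real"
  shows "has_power_series_at f a p \<longleftrightarrow>
    (\<exists>r. mps_conv a r \<and> (\<forall>x. (\<forall>i. \<bar>x $ i - p $ i\<bar> \<le> r) \<longrightarrow> f x = mps a (\<lambda>i. x $ i - p $ i)))"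
proof
  assume "has_power_series_at f a p"
  then obtain R where R: "R > 0" "\<And>x. x \<in> ball p R \<Longrightarrow> ((\<lambda>\<alpha>. a \<alpha> * mmon (\<lambda>i. x $ i - p $ i) \<alpha>) has_sum f x) UNIV"
    unfolding has_power_series_at_def mmon_def by blast
  define r where "r = R / (real CARD('n) + 1)"
  have r: "r > 0" using R by (simp add: r_def)
  have box: "x \<in> ball p R" if "\<And>i. \<bar>x $ i - p $ i\<bar> \<le> r" for x
  proof -
    have "norm (x - p) \<le> real CARD('n) * r"
      by (rule norm_le_card_mult) (simp add: that)
    also have "\<dots> < R" using R by (simp add: r_def field_simps)
    finally show ?thesis by (simp add: dist_norm norm_minus_commute)
  qed
  have "((\<lambda>\<alpha>. a \<alpha> * r ^ mdeg \<alpha>) has_sum f (\<chi> i. p $ i + r)) UNIV"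
    using R(2)[OF box, of "\<chi> i. p $ i + r"] r by (simp add: mmon_const)
  then have "(\<lambda>\<alpha>. a \<alpha> * r ^ mdeg \<alpha>) summable_on UNIV" by (rule has_sum_imp_summable)
  then have "(\<lambda>\<alpha>. norm (a \<alpha> * r ^ mdeg \<alpha>)) summable_on UNIV" by (rule summable_on_iff_abs_summable_on_real[THEN iffD1])
  then have "mps_conv a r" using r by (simp add: mps_conv_def abs_mult)
  moreover have "f x = mps a (\<lambda>i. x $ i - p $ i)" if "\<forall>i. \<bar>x $ i - p $ i\<bar> \<le> r" for x
    unfolding mps_def by (rule infsumI[symmetric], rule R(2), rule box) (use that in auto)
  ultimately show "\<exists>r. mps_conv a r \<and> (\<forall>x. (\<forall>i. \<bar>x $ i - p $ i\<bar> \<le> r) \<longrightarrow> f x = mps a (\<lambda>i. x $ i - p $ i))"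
    by blast
next
  assume "\<exists>r. mps_conv a r \<and> (\<forall>x. (\<forall>i. \<bar>x $ i - p $ i\<bar> \<le> r) \<longrightarrow> f x = mps a (\<lambda>i. x $ i - p $ i))"
  then obtain r where r: "mps_conv a r" "\<And>x. (\<And>i. \<bar>x $ i - p $ i\<bar> \<le> r) \<Longrightarrow> f x = mps a (\<lambda>i. x $ i - p $ i)"
    by blast
  have "((\<lambda>\<alpha>. a \<alpha> * mmon (\<lambda>i. x $ i - p $ i) \<alpha>) has_sum f x) UNIV" if "x \<in> ball p r" for x
  proof -
    have b: "\<bar>x $ i - p $ i\<bar> \<le> r" for i
      using component_le_norm_cart[of "x - p" i] that by (simp add: dist_norm norm_minus_commute)
    then show ?thesis using mps_has_sum[OF r(1) b] r(2)[of x] by simp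
  qed
  moreover have "r > 0" using r by (simp add: mps_conv_def)
  ultimately show "has_power_series_at f a p"
    unfolding has_power_series_at_def mmon_def by blast
qed

section \<open>Gradients of convergent series and the identity theorem\<close>

lemma mps_at_0 [simp]: "mps b (\<lambda>_. 0) = b 0"
proof -
  have "mps b (\<lambda>_. 0) = (\<Sum>\<^sub>\<infinity>\<alpha>\<in>{0}. b \<alpha> * mmon (\<lambda>_. 0) \<alpha>)"
    unfolding mps_def by (rule infsum_cong_neutral) (auto simp: mmon_const)
  then show ?thesis by simp
qed

lemma sum_mdeg_less_2:
  fixes b :: "nat^'n \<Rightarrow> real"
  shows "(\<Sum>\<alpha> | mdeg \<alpha> < 2. b \<alpha> * mmon x \<alpha>) = b 0 + (\<Sum>i\<in>UNIV. b (axis i 1) * x i)"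
proof -
  have "{\<alpha> :: nat^'n. mdeg \<alpha> < 2} = {\<alpha>. mdeg \<alpha> = 0} \<union> {\<alpha>. mdeg \<alpha> = 1}"
    by (auto simp: less_2_cases_iff)
  then have "(\<Sum>\<alpha> | mdeg \<alpha> < 2. b \<alpha> * mmon x \<alpha>) = hpart b 0 x + hpart b 1 x"
    unfolding hpart_def by (subst sum.union_disjoint[symmetric]) auto
  then show ?thesis unfolding hpart_degree_1 by simp
qed

lemma GDERIV_mps:
  fixes f :: "real^'n \<Rightarrow> real"
  assumes b: "mps_conv b \<rho>" and f: "\<And>y. (\<And>i. \<bar>y $ i\<bar> \<le> \<rho>) \<Longrightarrow> f (p + y) = mps b (\<lambda>i. y $ i)"
  shows "GDERIV f p :> (\<chi> i. b (axis i 1))"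
proof -
  let ?D = "\<chi> i. b (axis i 1)"
  have \<rho>: "\<rho> > 0" using b by (simp add: mps_conv_def)
  obtain C where C: "C \<ge> 0" "\<And>x m. m \<le> \<rho> \<Longrightarrow> (\<And>i. \<bar>x i\<bar> \<le> m) \<Longrightarrow>
        \<bar>mps b x - (\<Sum>\<alpha> | mdeg \<alpha> < 2. b \<alpha> * mmon x \<alpha>)\<bar> \<le> C * m ^ 2"
    using mps_remainder[OF b] by blast
  have fp: "f p = b 0" using f[of 0] \<rho> by simp
  have le: "norm (norm (f (p + h) - f p - h \<bullet> ?D) / norm h) \<le> C * norm h" if "norm h \<le> \<rho>" for h
  proof (cases "h = 0")
    case False
    have c: "\<bar>h $ i\<bar> \<le> norm h" for i by (rule component_le_norm_cart)
    have "\<bar>mps b (\<lambda>i. h $ i) - (\<Sum>\<alpha> | mdeg \<alpha> < 2. b \<alpha> * mmon (\<lambda>i. h $ i) \<alpha>)\<bar> \<le> C * norm h ^ 2"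
      using that c by (rule C(2))
    moreover have "f (p + h) = mps b (\<lambda>i. h $ i)" by (rule f) (use c that in \<open>meson order_trans\<close>)
    moreover have "h \<bullet> ?D = (\<Sum>i\<in>UNIV. b (axis i 1) * h $ i)" by (simp add: inner_vec_def mult.commute)
    ultimately have "\<bar>f (p + h) - f p - h \<bullet> ?D\<bar> \<le> C * norm h ^ 2"
      by (simp add: sum_mdeg_less_2 fp diff_diff_eq)
    then show ?thesis using False by (simp add: divide_le_eq power2_eq_square mult.assoc)
  qed simp
  have "((\<lambda>h. norm (f (p + h) - f p - h \<bullet> ?D) / norm h) \<longlongrightarrow> 0) (at 0)"
  proof (rule Lim_null_comparison)
    have "\<forall>\<^sub>F h in at 0. dist h (0 :: real^'n) < \<rho>"
      unfolding eventually_at using \<rho> by blast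
    then show "\<forall>\<^sub>F h in at 0. norm (norm (f (p + h) - f p - h \<bullet> ?D) / norm h) \<le> C * norm h"
      by eventually_elim (rule le, simp)
    have "((\<lambda>h :: real^'n. C * norm h) \<longlongrightarrow> C * norm (0 :: real^'n)) (at 0)" by (intro tendsto_intros)
    then show "((\<lambda>h :: real^'n. C * norm h) \<longlongrightarrow> 0) (at 0)" by simp
  qed
  then show ?thesis
    unfolding gderiv_def has_derivative_at by (intro conjI bounded_linear_inner_left)
qed

lemma mps_local_expansion:
  fixes f :: "real^'n \<Rightarrow> real"
  assumes a: "mps_conv a r" and f: "\<And>x. (\<And>i. \<bar>x $ i - p $ i\<bar> \<le> r) \<Longrightarrow> f x = mps a (\<lambda>i. x $ i - p $ i)"
    and q: "\<And>i. \<bar>q $ i - p $ i\<bar> \<le> s" and s: "0 \<le> s" "s < r"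
  shows "mps_conv (\<lambda>\<beta>. mps (dcoef \<beta> a) (\<lambda>i. q $ i - p $ i)) (r - s)"
    and "(\<And>i. \<bar>y $ i\<bar> \<le> r - s) \<Longrightarrow> f (q + y) = mps (\<lambda>\<beta>. mps (dcoef \<beta> a) (\<lambda>i. q $ i - p $ i)) (\<lambda>i. y $ i)"
proof -
  show "mps_conv (\<lambda>\<beta>. mps (dcoef \<beta> a) (\<lambda>i. q $ i - p $ i)) (r - s)"
    by (rule mps_reexpand(1)[OF a q s])
  assume y: "\<And>i. \<bar>y $ i\<bar> \<le> r - s"
  have "f (q + y) = mps a (\<lambda>i. (q + y) $ i - p $ i)"
  proof (rule f)
    show "\<bar>(q + y) $ i - p $ i\<bar> \<le> r" for i using q[of i] y[of i] by simp
  qed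
  also have "(\<lambda>i. (q + y) $ i - p $ i) = (\<lambda>i. (q $ i - p $ i) + y $ i)" by auto
  finally show "f (q + y) = mps (\<lambda>\<beta>. mps (dcoef \<beta> a) (\<lambda>i. q $ i - p $ i)) (\<lambda>i. y $ i)"
    using mps_reexpand(2)[OF a q s y] by simp
qed

lemma GDERIV_mps_near:
  fixes f :: "real^'n \<Rightarrow> real"
  assumes a: "mps_conv a r" and f: "\<And>x. (\<And>i. \<bar>x $ i - p $ i\<bar> \<le> r) \<Longrightarrow> f x = mps a (\<lambda>i. x $ i - p $ i)"
    and q: "\<And>i. \<bar>q $ i - p $ i\<bar> \<le> s" and s: "0 \<le> s" "s < r"
  shows "GDERIV f q :> (\<chi> i. mps (psderiv i a) (\<lambda>i. q $ i - p $ i))"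
  using GDERIV_mps[OF mps_local_expansion(1)[OF a f q s], of f q] mps_local_expansion(2)[OF a f q s]
  by (simp add: dcoef_axis[simplified])

lemma mps_continuous_at_0:
  fixes a :: "nat^'n \<Rightarrow> real"
  assumes "mps_conv a r" "\<epsilon> > 0"
  obtains \<delta> where "\<delta> > 0" "\<And>x. (\<And>i. \<bar>x i\<bar> \<le> \<delta>) \<Longrightarrow> \<bar>mps a x - a 0\<bar> < \<epsilon>"
proof -
  have r: "r > 0" using assms by (simp add: mps_conv_def)
  obtain C where C: "C \<ge> 0" "\<And>x m. m \<le> r \<Longrightarrow> (\<And>i. \<bar>x i\<bar> \<le> m) \<Longrightarrow>
        \<bar>mps a x - (\<Sum>\<alpha> | mdeg \<alpha> < 1. a \<alpha> * mmon x \<alpha>)\<bar> \<le> C * m ^ 1"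
    using mps_remainder[OF assms(1)] by blast
  define \<delta> where "\<delta> = min r (\<epsilon> / (C + 1))"
  have "{\<alpha> :: nat^'n. mdeg \<alpha> < 1} = {0}" by auto
  then have C': "\<bar>mps a x - a 0\<bar> \<le> C * m" if "m \<le> r" "\<And>i. \<bar>x i\<bar> \<le> m" for x m
    using C(2)[OF that] by simp
  show ?thesis
  proof (rule that[of \<delta>])
    show "\<delta> > 0" using r assms C by (simp add: \<delta>_def)
    fix x :: "'n \<Rightarrow> real" assume x: "\<And>i. \<bar>x i\<bar> \<le> \<delta>"
    have "\<bar>mps a x - a 0\<bar> \<le> C * \<delta>" by (rule C'[OF _ x]) (simp add: \<delta>_def)
    also have "\<dots> \<le> C * (\<epsilon> / (C + 1))" using C by (intro mult_left_mono) (auto simp: \<delta>_def)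
    also have "\<dots> < \<epsilon>" using C assms by (simp add: field_simps)
    finally show "\<bar>mps a x - a 0\<bar> < \<epsilon>" .
  qed
qed

lemma mps_locally_constant:
  fixes f :: "real^'n \<Rightarrow> real"
  assumes b: "mps_conv b \<rho>" and f: "\<And>y. (\<And>i. \<bar>y $ i\<bar> \<le> \<rho>) \<Longrightarrow> f (p + y) = mps b (\<lambda>i. y $ i)"
    and c: "open S" "p \<in> S" "\<And>x. x \<in> S \<Longrightarrow> f x = c"
    and \<beta>: "\<beta> \<noteq> 0"
  shows "b \<beta> = 0"
proof -
  have \<rho>: "\<rho> > 0" using b by (simp add: mps_conv_def)
  obtain e where e: "e > 0" "ball p e \<subseteq> S" using c by (meson openE)
  define s where "s = min \<rho> (e / (real CARD('n) + 1))"
  have s: "s > 0" "s \<le> \<rho>" using e \<rho> by (auto simp: s_def)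
  define b' where "b' = (\<lambda>\<alpha>. b \<alpha> + (if \<alpha> = 0 then - c else 0))"
  have fs: "mps_conv (\<lambda>\<alpha> :: nat^'n. if \<alpha> = 0 then - c else 0) s"
    by (rule mps_conv_finite_support) (auto intro: finite_subset[of _ "{0}"] s)
  have bs: "mps_conv b s" by (rule mps_conv_mono[OF b s])
  have "mps b' x = 0" if x: "\<And>i. \<bar>x i\<bar> \<le> s" for x
  proof -
    have "mps b' x = mps b x + mps (\<lambda>\<alpha> :: nat^'n. if \<alpha> = 0 then - c else 0) x"
      unfolding b'_def by (rule mps_add[OF bs fs x])
    also have "mps (\<lambda>\<alpha> :: nat^'n. if \<alpha> = 0 then - c else 0) x = - c"
      by (subst mps_finite_support[of "{0}"]) auto
    also have "mps b x = f (p + (\<chi> i. x i))"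
      using f[of "\<chi> i. x i"] x s by (simp add: order_trans[OF x s(2)])
    also have "f (p + (\<chi> i. x i)) = c"
    proof (rule c(3), rule subsetD[OF e(2)])
      have "norm (\<chi> i. x i) \<le> real CARD('n) * s"
        by (rule norm_le_card_mult) (simp add: x)
      also have "\<dots> \<le> real CARD('n) * (e / (real CARD('n) + 1))" unfolding s_def by (intro mult_left_mono min.cobounded2) simp
      also have "\<dots> < e" using e by (simp add: field_simps)
      finally show "p + (\<chi> i. x i) \<in> ball p e" by (simp add: dist_norm)
    qed
    finally show ?thesis by simp
  qed
  then have "b' \<beta> = 0" by (intro mps_eq_0_imp_coeff_0[of b' s]) (auto simp: b'_def intro: mps_conv_add bs fs)
  then show ?thesis using \<beta> by (simp add: b'_def)
qed

lemma has_power_series_atE: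
  fixes f :: "real^'n \<Rightarrow> real"
  assumes "has_power_series_at f a p"
  obtains r where "mps_conv a r" "\<And>x. (\<And>i. \<bar>x $ i - p $ i\<bar> \<le> r) \<Longrightarrow> f x = mps a (\<lambda>i. x $ i - p $ i)"
proof -
  from assms[unfolded has_power_series_at_iff] obtain r where
    r: "mps_conv a r \<and> (\<forall>x. (\<forall>i. \<bar>x $ i - p $ i\<bar> \<le> r) \<longrightarrow> f x = mps a (\<lambda>i. x $ i - p $ i))" ..
  show ?thesis by (rule that[of r]) (simp_all add: r)
qed

text \<open>The set E of points near which f is constant is open. It is closed in U: at a point p of
  its closure, each Taylor coefficient of index \<beta> \<noteq> 0 depends continuously on the point
  and vanishes on E, so it vanishes at p. Hence a nonconstant analytic first integral has a
  nonconstant Taylor series at the origin.\<close>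

lemma real_analytic_identity:
  fixes f :: "real^'n \<Rightarrow> real"
  assumes an: "real_analytic_on f U" and U: "open U" "connected U" "p0 \<in> U"
    and a0: "has_power_series_at f a0 p0" "\<And>\<alpha>. \<alpha> \<noteq> 0 \<Longrightarrow> a0 \<alpha> = 0"
  shows "f constant_on U"
proof -
  define E where "E = {p \<in> U. \<exists>S c. open S \<and> p \<in> S \<and> (\<forall>x\<in>S. f x = c)}"
  have box_open: "open {x :: real^'n. \<forall>i. \<bar>x $ i - p $ i\<bar> < r}" for p r
    unfolding Collect_all_eq by (intro open_INT finite ballI open_Collect_less continuous_intros)
  have const_near: "\<exists>S c. open S \<and> p \<in> S \<and> (\<forall>x\<in>S. f x = c)"
    if a: "mps_conv a r" "\<And>x. (\<And>i. \<bar>x $ i - p $ i\<bar> \<le> r) \<Longrightarrow> f x = mps a (\<lambda>i. x $ i - p $ i)"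
      and z: "\<And>\<alpha>. \<alpha> \<noteq> 0 \<Longrightarrow> a \<alpha> = 0" for a r p
  proof (intro exI conjI)
    show "open {x. \<forall>i. \<bar>x $ i - p $ i\<bar> < r}" by (rule box_open)
    show "p \<in> {x. \<forall>i. \<bar>x $ i - p $ i\<bar> < r}" using a by (simp add: mps_conv_def)
    show "\<forall>x\<in>{x. \<forall>i. \<bar>x $ i - p $ i\<bar> < r}. f x = a 0"
    proof
      fix x assume x: "x \<in> {x. \<forall>i. \<bar>x $ i - p $ i\<bar> < r}"
      then have "f x = mps a (\<lambda>i. x $ i - p $ i)" by (intro a(2)) (auto intro: less_imp_le)
      also have "\<dots> = a 0" by (subst mps_finite_support[of "{0}"]) (auto simp: z)
      finally show "f x = a 0" .
    qed
  qed
  obtain r0 where r0: "mps_conv a0 r0" "\<And>x. (\<And>i. \<bar>x $ i - p0 $ i\<bar> \<le> r0) \<Longrightarrow> f x = mps a0 (\<lambda>i. x $ i - p0 $ i)"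
    by (rule has_power_series_atE[OF a0(1)]) blast
  have p0E: "p0 \<in> E"
    unfolding E_def mem_Collect_eq
  proof
    show "\<exists>S c. open S \<and> p0 \<in> S \<and> (\<forall>x\<in>S. f x = c)"
    proof (rule const_near[where a = a0 and r = r0])
      show "f x = mps a0 (\<lambda>i. x $ i - p0 $ i)" if "\<And>i. \<bar>x $ i - p0 $ i\<bar> \<le> r0" for x
        by (rule r0(2)) (rule that)
    qed (fact r0(1), rule a0(2))
  qed (rule U(3))
  have oE: "open E"
  proof (subst open_subopen, rule ballI)
    fix p assume "p \<in> E"
    then obtain S c where S: "open S" "p \<in> S" "\<forall>x\<in>S. f x = c" "p \<in> U" by (auto simp: E_def)
    then show "\<exists>T. open T \<and> p \<in> T \<and> T \<subseteq> E"
      using U(1) by (intro exI[of _ "S \<inter> U"]) (auto simp: E_def)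
  qed
  have "p \<in> E" if p: "p \<in> U" "p \<in> closure E" for p
  proof -
    obtain a where "has_power_series_at f a p" using an p by (auto simp: real_analytic_on_def)
    then obtain r where a: "mps_conv a r" and fa: "\<And>x. (\<And>i. \<bar>x $ i - p $ i\<bar> \<le> r) \<Longrightarrow> f x = mps a (\<lambda>i. x $ i - p $ i)"
      by (rule has_power_series_atE) blast
    have r: "r > 0" using a by (simp add: mps_conv_def)
    have az: "a \<beta> = 0" if \<beta>: "\<beta> \<noteq> 0" for \<beta>
    proof (rule ccontr)
      assume nz: "a \<beta> \<noteq> 0"
      have "mps_conv (dcoef \<beta> a) (r / 2)" by (rule mps_conv_dcoef[OF a]) (use r in auto)
      then obtain \<delta> where \<delta>: "\<delta> > 0" "\<And>x. (\<And>i. \<bar>x i\<bar> \<le> \<delta>) \<Longrightarrow> \<bar>mps (dcoef \<beta> a) x - dcoef \<beta> a 0\<bar> < \<bar>a \<beta>\<bar>"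
        using mps_continuous_at_0[of "dcoef \<beta> a" "r / 2" "\<bar>a \<beta>\<bar>"] nz by auto
      define s where "s = min \<delta> (r / 2)"
      have s: "0 < s" "s < r" "s \<le> \<delta>" using \<delta> r by (auto simp: s_def)
      have "{x. \<forall>i. \<bar>x $ i - p $ i\<bar> < s} \<inter> E \<noteq> {}"
      proof -
        have "p \<in> {x. \<forall>i. \<bar>x $ i - p $ i\<bar> < s} \<inter> closure E" using p(2) s(1) by simp
        then show ?thesis by (subst open_Int_closure_eq_empty[OF box_open, symmetric]) blast
      qed
      then obtain q where q: "\<And>i. \<bar>q $ i - p $ i\<bar> < s" "q \<in> E" by blast
      then have q': "\<bar>q $ i - p $ i\<bar> \<le> s" for i by (meson less_imp_le)
      obtain S c where S: "open S" "q \<in> S" "\<And>x. x \<in> S \<Longrightarrow> f x = c" using q(2) by (auto simp: E_def)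
      have "mps (dcoef \<beta> a) (\<lambda>i. q $ i - p $ i) = 0"
        using mps_locally_constant[OF mps_local_expansion[OF a fa q' less_imp_le[OF s(1)] s(2)] S \<beta>] .
      moreover have "\<bar>mps (dcoef \<beta> a) (\<lambda>i. q $ i - p $ i) - dcoef \<beta> a 0\<bar> < \<bar>a \<beta>\<bar>"
        by (rule \<delta>(2)) (use q' s(3) in \<open>meson order_trans\<close>)
      ultimately show False by (simp add: dcoef_at_0)
    qed
    show ?thesis
      unfolding E_def mem_Collect_eq
    proof
      show "\<exists>S c. open S \<and> p \<in> S \<and> (\<forall>x\<in>S. f x = c)"
      proof (rule const_near[where a = a and r = r])
        show "f x = mps a (\<lambda>i. x $ i - p $ i)" if "\<And>i. \<bar>x $ i - p $ i\<bar> \<le> r" for x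
          by (rule fa) (rule that)
      qed (fact a, rule az)
    qed (rule p(1))
  qed
  then have "U \<inter> closure E \<subseteq> E" by blast
  moreover have EU: "E \<subseteq> U" by (auto simp: E_def)
  moreover have "E \<subseteq> closure E" by (rule closure_subset)
  ultimately have cl: "closedin (top_of_set U) E"
    unfolding closedin_closed by (intro exI[of _ "closure E"]) blast
  have "openin (top_of_set U) E"
    by (rule open_subset[OF EU oE])
  with cl have "E = {} \<or> E = U"
    using U(2) unfolding connected_clopen by (elim allE[of _ E]) simp
  then have EU': "E = U" using p0E by blast
  show ?thesis
  proof (rule locally_constant_imp_constant[OF U(2)])
    fix p assume "p \<in> U"
    then have "p \<in> E" by (simp only: EU')
    then obtain S c where "open S" "p \<in> S" "\<forall>x\<in>S. f x = c" by (auto simp: E_def)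
    then show "\<exists>T. openin (top_of_set U) T \<and> p \<in> T \<and> (\<forall>x\<in>T. f x = f p)"
      using \<open>p \<in> U\<close> by (intro exI[of _ "U \<inter> S"]) (auto simp: openin_open)
  qed
qed

section \<open>First integrals in terms of coefficients\<close>

definition lie :: "('n::finite \<Rightarrow> nat^'n \<Rightarrow> 'a) \<Rightarrow> (nat^'n \<Rightarrow> 'a::comm_ring_1) \<Rightarrow> nat^'n \<Rightarrow> 'a" where
  "lie a H = (\<lambda>\<gamma>. \<Sum>i\<in>UNIV. gmult (psderiv i H) (a i) \<gamma>)"

lemma mps_lie:
  assumes H: "mps_conv H r" and a: "\<And>i. mps_conv (a i) r" and s: "0 < s" "s < r"
  shows "mps_conv (lie a H) s"
    and "(\<And>i. \<bar>x i\<bar> \<le> s) \<Longrightarrow> mps (lie a H) x = (\<Sum>i\<in>UNIV. mps (psderiv i H) x * mps (a i) x)"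
proof -
  have D: "mps_conv (psderiv i H) s" for i
    using mps_conv_dcoef[OF H s, of "axis i 1"] by (simp only: dcoef_axis)
  have as: "mps_conv (a i) s" for i using mps_conv_mono[OF a] s by simp
  show "mps_conv (lie a H) s"
    unfolding lie_def by (intro mps_conv_sum mps_conv_mult D as s) auto
  assume x: "\<And>i. \<bar>x i\<bar> \<le> s"
  have "mps (lie a H) x = (\<Sum>i\<in>UNIV. mps (gmult (psderiv i H) (a i)) x)"
    unfolding lie_def by (intro mps_sum[of _ s] mps_conv_mult D as s x) auto
  also have "\<dots> = (\<Sum>i\<in>UNIV. mps (psderiv i H) x * mps (a i) x)"
    by (intro sum.cong refl mps_mult[OF D as x])
  finally show "mps (lie a H) x = (\<Sum>i\<in>UNIV. mps (psderiv i H) x * mps (a i) x)" .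
qed

lemma common_radius:
  fixes X :: "real^'n \<Rightarrow> real^'n"
  assumes "\<And>i. has_power_series_at (\<lambda>x. X x $ i) (a i) 0"
  obtains r where "r > 0" "\<And>i. mps_conv (a i) r"
    "\<And>x i. (\<And>j. \<bar>x $ j\<bar> \<le> r) \<Longrightarrow> X x $ i = mps (a i) (\<lambda>j. x $ j)"
proof -
  from assms obtain R where R: "\<And>i. mps_conv (a i) (R i)"
     "\<And>i x. (\<And>j. \<bar>x $ j\<bar> \<le> R i) \<Longrightarrow> X x $ i = mps (a i) (\<lambda>j. x $ j)"
    unfolding has_power_series_at_iff by (simp add: choice_iff) metis
  define r where "r = Min (range R)"
  have R0: "R i > 0" for i using R(1)[of i] by (simp add: mps_conv_def)
  have r: "r > 0" "r \<le> R i" for i using R0 by (auto simp: r_def)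
  show ?thesis
  proof (rule that[OF r(1)])
    show "mps_conv (a i) r" for i by (rule mps_conv_mono[OF R(1) r])
    fix x :: "real^'n" and i assume "\<And>j. \<bar>x $ j\<bar> \<le> r"
    then show "X x $ i = mps (a i) (\<lambda>j. x $ j)" using r(2)[of i] by (intro R(2)) (meson order_trans)
  qed
qed

text \<open>On a small cube the product of the gradient with the field is the sum of the convergent
  series \<open>lie a F\<close>; as it vanishes identically, so do all its coefficients.\<close>

lemma analytic_first_integral_coeffs:
  fixes X :: "real^'n \<Rightarrow> real^'n"
  assumes X: "\<And>i. has_power_series_at (\<lambda>x. X x $ i) (a i) 0" and "has_analytic_first_integral X"
  obtains F r where "mps_conv F r" "\<exists>\<alpha>. \<alpha> \<noteq> 0 \<and> F \<alpha> \<noteq> 0" "\<And>\<gamma>. lie a F \<gamma> = 0"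
proof -
  from assms(2) obtain U H where U: "open U" "connected U" "0 \<in> U" and H: "real_analytic_on H U" "\<not> H constant_on U"
     "\<And>x. x \<in> U \<Longrightarrow> \<exists>D. (GDERIV H x :> D) \<and> D \<bullet> X x = 0"
    unfolding has_analytic_first_integral_def by blast
  obtain F where F: "has_power_series_at H F 0" using H U by (auto simp: real_analytic_on_def)
  have nc: "\<exists>\<alpha>. \<alpha> \<noteq> 0 \<and> F \<alpha> \<noteq> 0"
    using real_analytic_identity[OF H(1) U F] H(2) by blast
  obtain r1 where r1': "mps_conv F r1" "\<And>x. (\<And>i. \<bar>x $ i - 0 $ i\<bar> \<le> r1) \<Longrightarrow> H x = mps F (\<lambda>i. x $ i - 0 $ i)"
    by (rule has_power_series_atE[OF F]) blast
  have "r1 > 0" using r1'(1) by (simp add: mps_conv_def)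
  note r1 = this r1'
  obtain r2 where r2: "r2 > 0" "\<And>i. mps_conv (a i) r2"
    "\<And>x i. (\<And>j. \<bar>x $ j\<bar> \<le> r2) \<Longrightarrow> X x $ i = mps (a i) (\<lambda>j. x $ j)"
    using common_radius[OF X] by blast
  obtain e where e: "e > 0" "ball 0 e \<subseteq> U" using U by (meson openE)
  define r where "r = min r1 r2"
  define s where "s = min (r / 2) (e / (real CARD('n) + 1))"
  have r: "r > 0" "r \<le> r1" "r \<le> r2" using r1 r2 by (auto simp: r_def)
  have s: "0 < s" "s < r" "s < r1" using r e by (auto simp: s_def)
  have sr: "s \<le> r1" "s \<le> r2" using s r by auto
  have Fr: "mps_conv F r" and ar: "mps_conv (a i) r" for i
    using mps_conv_mono[OF r1(2) r(1,2)] mps_conv_mono[OF r2(2) r(1,3)] by auto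
  have "mps (lie a F) y = 0" if y: "\<And>i. \<bar>y i\<bar> \<le> s" for y
  proof -
    define x where "x = (\<chi> i. y i)"
    have "norm x \<le> real CARD('n) * s"
      by (rule norm_le_card_mult) (simp add: y x_def)
    also have "\<dots> \<le> real CARD('n) * (e / (real CARD('n) + 1))" unfolding s_def by (intro mult_left_mono min.cobounded2) simp
    also have "\<dots> < e" using e by (simp add: field_simps)
    finally have "x \<in> U" using e by (intro subsetD[OF e(2)]) simp
    then obtain D where D: "GDERIV H x :> D" "D \<bullet> X x = 0" using H(3) by blast
    have xs: "\<bar>x $ i - 0 $ i\<bar> \<le> s" for i using y by (simp add: x_def)
    have D': "GDERIV H x :> (\<chi> i. mps (psderiv i F) (\<lambda>i. x $ i - 0 $ i))"
      by (rule GDERIV_mps_near[OF r1(2,3) xs less_imp_le[OF s(1)] s(3)])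
    have "D = (\<chi> i. mps (psderiv i F) y)"
    proof -
      have "(\<lambda>h. h \<bullet> D) = (\<lambda>h. h \<bullet> (\<chi> i. mps (psderiv i F) (\<lambda>i. x $ i - 0 $ i)))"
        using D(1) D' unfolding Inner_Product.gderiv_def by (rule has_derivative_unique)
      then have "\<forall>h. h \<bullet> D = h \<bullet> (\<chi> i. mps (psderiv i F) (\<lambda>i. x $ i - 0 $ i))" by (simp add: fun_eq_iff)
      then show ?thesis by (simp add: vector_eq_ldot x_def)
    qed
    moreover have "X x $ i = mps (a i) y" for i
    proof -
      have "\<bar>x $ j\<bar> \<le> r2" for j using order_trans[OF y sr(2)] by (simp add: x_def)
      then have "X x $ i = mps (a i) (\<lambda>j. x $ j)" by (rule r2(3))
      then show ?thesis by (simp add: x_def)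
    qed
    ultimately have "(\<Sum>i\<in>UNIV. mps (psderiv i F) y * mps (a i) y) = 0"
      using D(2) by (simp add: inner_vec_def)
    then show ?thesis unfolding mps_lie(2)[OF Fr ar s(1,2) y] .
  qed
  then have "lie a F \<gamma> = 0" for \<gamma>
    by (rule mps_eq_0_imp_coeff_0[OF mps_lie(1)[OF Fr ar s(1,2)]])
  then show ?thesis by (rule that[OF r1(2) nc])
qed

lemma convergent_first_integral:
  fixes X :: "real^'n \<Rightarrow> real^'n"
  assumes X: "\<And>i. has_power_series_at (\<lambda>x. X x $ i) (a i) 0"
    and H: "mps_conv H r1" "\<alpha>0 \<noteq> 0" "H \<alpha>0 \<noteq> 0" and lie: "\<And>\<gamma>. lie a H \<gamma> = 0"
  shows "has_analytic_first_integral X"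
proof -
  have r1: "r1 > 0" using H by (simp add: mps_conv_def)
  obtain r2 where r2: "r2 > 0" "\<And>i. mps_conv (a i) r2"
    "\<And>x i. (\<And>j. \<bar>x $ j\<bar> \<le> r2) \<Longrightarrow> X x $ i = mps (a i) (\<lambda>j. x $ j)"
    using common_radius[OF X] by blast
  define r where "r = min r1 r2"
  have r: "r > 0" "r \<le> r1" "r \<le> r2" using r1 r2 by (auto simp: r_def)
  have Hr: "mps_conv H r" and ar: "mps_conv (a i) r" for i
    using mps_conv_mono[OF H(1) r(1,2)] mps_conv_mono[OF r2(2) r(1,3)] by auto
  define f where "f = (\<lambda>x :: real^'n. mps H (\<lambda>i. x $ i))"
  \<comment> \<open>Half the radius leaves room for a re-expansion of the series at every point of
    the ball.\<close>
  define s where "s = r / 2"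
  have s: "0 < s" "s < r" using r by (auto simp: s_def)
  define U where "U = ball (0 :: real^'n) s"
  have Us: "\<bar>x $ i\<bar> \<le> s" if "x \<in> U" for x i
    using component_le_norm_cart[of x i] that by (simp add: U_def)
  have f: "f x = mps H (\<lambda>i. x $ i - 0 $ i)" for x by (simp add: f_def)
  have "real_analytic_on f U"
    unfolding real_analytic_on_def
  proof
    fix p assume "p \<in> U"
    then have ps: "\<bar>p $ i - 0 $ i\<bar> \<le> s" for i using Us by simp
    note e = mps_local_expansion[OF Hr f ps less_imp_le[OF s(1)] s(2)]
    have "has_power_series_at f (\<lambda>\<beta>. mps (dcoef \<beta> H) (\<lambda>i. p $ i - 0 $ i)) p"
      unfolding has_power_series_at_iff
    proof (intro exI conjI allI impI)
      fix x assume "\<forall>i. \<bar>x $ i - p $ i\<bar> \<le> r - s"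
      then show "f x = mps (\<lambda>\<beta>. mps (dcoef \<beta> H) (\<lambda>i. p $ i - 0 $ i)) (\<lambda>i. x $ i - p $ i)"
        using e(2)[of "x - p"] by simp
    qed (rule e(1))
    then show "\<exists>a. has_power_series_at f a p" by blast
  qed
  moreover have "\<not> f constant_on U"
  proof
    assume "f constant_on U"
    then obtain c where c: "\<And>x. x \<in> U \<Longrightarrow> f x = c" by (auto simp: constant_on_def)
    have "H \<alpha>0 = 0"
      by (rule mps_locally_constant[OF Hr, of f 0 U c]) (use c s H(2) in \<open>auto simp: f_def U_def\<close>)
    then show False using H(3) by simp
  qed
  moreover have "\<exists>D. (GDERIV f x :> D) \<and> D \<bullet> X x = 0" if "x \<in> U" for x
  proof (intro exI conjI)
    have xs: "\<bar>x $ i - 0 $ i\<bar> \<le> s" for i using Us[OF that] by simp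
    show "GDERIV f x :> (\<chi> i. mps (psderiv i H) (\<lambda>i. x $ i - 0 $ i))"
      by (rule GDERIV_mps_near[OF Hr f xs less_imp_le[OF s(1)] s(2)])
    have xs': "\<bar>x $ i\<bar> \<le> s" for i using Us[OF that] .
    have sr2: "s \<le> r2" using s r by simp
    have Xx: "X x $ i = mps (a i) (\<lambda>i. x $ i)" for i
      by (rule r2(3)) (rule order_trans[OF xs' sr2])
    have "(\<Sum>i\<in>UNIV. mps (psderiv i H) (\<lambda>i. x $ i) * mps (a i) (\<lambda>i. x $ i)) = mps (lie a H) (\<lambda>i. x $ i)"
      by (rule mps_lie(2)[OF Hr ar s xs', symmetric])
    also have "\<dots> = 0" by (simp add: mps_def lie)
    finally show "(\<chi> i. mps (psderiv i H) (\<lambda>i. x $ i - 0 $ i)) \<bullet> X x = 0"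
      by (simp add: inner_vec_def Xx)
  qed
  moreover have "open U" "connected U" "0 \<in> U" using s by (auto simp: U_def)
  ultimately show ?thesis unfolding has_analytic_first_integral_def by blast
qed

section \<open>The algebra of derivations and powers of formal series\<close>

lemma hfps_inject:
  fixes F G :: "nat^'n \<Rightarrow> 'a::real_normed_field"
  assumes "\<And>e. hfps F e = hfps G e"
  shows "F = G"
proof
  fix \<alpha> :: "nat^'n"
  have "hpart (\<lambda>\<alpha>. F \<alpha> - G \<alpha>) (mdeg \<alpha>) e = 0" for e :: "'n \<Rightarrow> 'a"
    using arg_cong[OF assms[of e], of "\<lambda>f. fps_nth f (mdeg \<alpha>)"] by (simp add: hpart_diff)
  from hpart_eq_0_imp_coeff_0[OF this refl] show "F \<alpha> = G \<alpha>" by simp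
qed

lemma hfps_add: "hfps (\<lambda>\<alpha>. F \<alpha> + G \<alpha>) e = hfps F e + hfps G e"
  by (simp add: fps_eq_iff hpart_add)

lemma hfps_cmult: "hfps (\<lambda>\<alpha>. c * F \<alpha>) e = fps_const c * hfps F e"
  by (simp add: fps_eq_iff hpart_cmult)

lemma hfps_sum: "hfps (\<lambda>\<alpha>. \<Sum>i\<in>I. F i \<alpha>) e = (\<Sum>i\<in>I. hfps (F i) e)"
  by (simp add: fps_eq_iff hpart_sum fps_sum_nth)

lemma hfps_lie: "hfps (lie a H) e = (\<Sum>i\<in>UNIV. hfps (psderiv i H) e * hfps (a i) e)"
  by (simp add: lie_def hfps_sum hfps_gmult)

lemma psderiv_add: "psderiv i (\<lambda>\<alpha>. F \<alpha> + G \<alpha>) = (\<lambda>\<alpha>. psderiv i F \<alpha> + psderiv i G \<alpha>)"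
  by (simp add: psderiv_def fun_eq_iff distrib_left)

lemma psderiv_cmult: "psderiv i (\<lambda>\<alpha>. c * F \<alpha>) = (\<lambda>\<alpha>. c * psderiv i F \<alpha>)"
  by (simp add: psderiv_def fun_eq_iff algebra_simps)

lemma psderiv_sum: "psderiv i (\<lambda>\<alpha>. \<Sum>j\<in>I. F j \<alpha>) = (\<lambda>\<alpha>. \<Sum>j\<in>I. psderiv i (F j) \<alpha>)"
  by (simp add: psderiv_def fun_eq_iff sum_distrib_left)

lemma psderiv_commute: "psderiv i (psderiv j F) = psderiv j (psderiv i F)"
  by (cases "i = j") (auto simp: psderiv_def fun_eq_iff axis_def add_ac mult_ac)

lemma gmult_add_left: "gmult (\<lambda>\<alpha>. F \<alpha> + G \<alpha>) H = (\<lambda>\<alpha>. gmult F H \<alpha> + gmult G H \<alpha>)"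
  by (simp add: gmult_def fun_eq_iff distrib_right case_prod_beta sum.distrib)

lemma gmult_cmult_left: "gmult (\<lambda>\<alpha>. c * F \<alpha>) H = (\<lambda>\<alpha>. c * gmult F H \<alpha>)"
  by (simp add: gmult_def fun_eq_iff sum_distrib_left case_prod_beta mult.assoc)

lemma gmult_sum_left: "gmult (\<lambda>\<alpha>. \<Sum>j\<in>I. F j \<alpha>) H = (\<lambda>\<alpha>. \<Sum>j\<in>I. gmult (F j) H \<alpha>)"
  by (simp add: gmult_def fun_eq_iff sum_distrib_right case_prod_beta, intro allI, rule sum.swap)

lemma lie_add: "lie a (\<lambda>\<alpha>. F \<alpha> + G \<alpha>) = (\<lambda>\<alpha>. lie a F \<alpha> + lie a G \<alpha>)"
  by (simp add: lie_def fun_eq_iff psderiv_add gmult_add_left sum.distrib)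

lemma lie_cmult: "lie a (\<lambda>\<alpha>. c * F \<alpha>) = (\<lambda>\<alpha>. c * lie a F \<alpha>)"
  by (simp add: lie_def fun_eq_iff psderiv_cmult gmult_cmult_left sum_distrib_left)

lemma lie_diff: "lie a (\<lambda>\<alpha>. F \<alpha> - G \<alpha>) = (\<lambda>\<alpha>. lie a F \<alpha> - lie a G \<alpha>)"
  using lie_add[of a F "\<lambda>\<alpha>. - 1 * G \<alpha>"] lie_cmult[of a "-1" G] by simp

lemma lie_sum: "lie a (\<lambda>\<alpha>. \<Sum>j\<in>I. F j \<alpha>) = (\<lambda>\<alpha>. \<Sum>j\<in>I. lie a (F j) \<alpha>)"
  by (simp add: lie_def fun_eq_iff psderiv_sum gmult_sum_left, intro allI, rule sum.swap)

lemma lie_gmult: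
  fixes F G :: "nat^'n \<Rightarrow> 'a::real_normed_field"
  shows "lie a (gmult F G) = (\<lambda>\<alpha>. gmult (lie a F) G \<alpha> + gmult F (lie a G) \<alpha>)"
  by (rule hfps_inject)
     (simp add: hfps_add hfps_gmult hfps_lie psderiv_gmult algebra_simps sum_distrib_left sum.distrib)

definition gone :: "nat^'n::finite \<Rightarrow> 'a::comm_ring_1" where
  "gone \<alpha> = (if \<alpha> = 0 then 1 else 0)"

fun gpow :: "(nat^'n::finite \<Rightarrow> 'a::comm_ring_1) \<Rightarrow> nat \<Rightarrow> nat^'n \<Rightarrow> 'a" where
  "gpow F 0 = gone"
| "gpow F (Suc k) = gmult F (gpow F k)"

lemma hpart_gone: "hpart gone d e = (if d = 0 then 1 else 0)"
proof (cases "d = 0")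
  case False
  then show ?thesis unfolding hpart_def gone_def by (intro sum.neutral[THEN trans]) auto
qed (simp add: gone_def)

lemma hfps_gone [simp]: "hfps gone e = 1"
  by (simp add: fps_eq_iff hpart_gone)

lemma hfps_gpow: "hfps (gpow F k) e = hfps F e ^ k"
  by (induction k) (simp_all add: hfps_gmult)

lemma psderiv_gone [simp]: "psderiv i gone = (\<lambda>_. 0)" for i :: "'n::finite"
proof -
  have "\<alpha> + axis i 1 \<noteq> 0" for \<alpha> :: "nat^'n" by (metis add_is_0 mdeg_0 mdeg_add mdeg_axis one_neq_zero)
  then show ?thesis by (simp add: psderiv_def gone_def fun_eq_iff)
qed

lemma lie_gpow:
  fixes F :: "nat^'n \<Rightarrow> 'a::real_normed_field"
  assumes "lie a F = (\<lambda>_. 0)"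
  shows "lie a (gpow F k) = (\<lambda>_. 0)"
proof (induction k)
  case 0
  then show ?case by (simp add: lie_def gmult_def)
next
  case (Suc k)
  then show ?case using assms by (simp add: lie_gmult) (simp add: gmult_def)
qed

section \<open>Linear forms and linear vector fields\<close>

definition lf :: "('n::finite \<Rightarrow> 'a) \<Rightarrow> nat^'n \<Rightarrow> 'a::comm_ring_1" where
  "lf \<xi> \<alpha> = (\<Sum>i\<in>UNIV. if \<alpha> = axis i 1 then \<xi> i else 0)"

lemma lf_axis [simp]: "lf \<xi> (axis i 1) = \<xi> i"
  unfolding lf_def by (simp add: axis_eq_axis)

lemma lf_eq_0: "mdeg \<alpha> \<noteq> 1 \<Longrightarrow> lf \<xi> \<alpha> = 0"
  unfolding lf_def by (intro sum.neutral) auto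

lemma hpart_lf: "hpart (lf \<xi>) d e = (if d = 1 then \<Sum>i\<in>UNIV. \<xi> i * e i else 0)"
proof (cases "d = 1")
  case True
  then show ?thesis by (simp only: hpart_degree_1 lf_axis) simp
next
  case False
  then show ?thesis unfolding hpart_def by (auto intro!: sum.neutral simp: lf_eq_0)
qed

lemma hpart_gmult_lf:
  "hpart (gmult (lf \<xi>) c) (Suc d) e = (\<Sum>i\<in>UNIV. \<xi> i * e i) * hpart c d e"
proof -
  have "hpart (gmult (lf \<xi>) c) (Suc d) e = (\<Sum>j\<le>Suc d. if j = 1 then (\<Sum>i\<in>UNIV. \<xi> i * e i) * hpart c (Suc d - 1) e else 0)"
    unfolding hpart_gmult hpart_lf by (intro sum.cong) auto
  then show ?thesis by (simp add: sum.delta)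
qed

lemma hpart_gmult_lf_right:
  "hpart (gmult c (lf \<xi>)) (Suc d) e = hpart c d e * (\<Sum>i\<in>UNIV. \<xi> i * e i)"
proof -
  have "hpart (gmult c (lf \<xi>)) (Suc d) e = (\<Sum>j\<le>Suc d. if j = d then hpart c d e * (\<Sum>i\<in>UNIV. \<xi> i * e i) else 0)"
    unfolding hpart_gmult hpart_lf by (intro sum.cong) auto
  then show ?thesis by (simp add: sum.delta)
qed

lemma hpart_gmult_lf_right_0 [simp]: "hpart (gmult c (lf \<xi>)) 0 e = 0"
  unfolding hpart_gmult hpart_lf by simp

lemma psderiv_lf: "psderiv l (lf \<xi>) = (\<lambda>\<alpha>. \<xi> l * gone \<alpha>)"
proof
  fix \<alpha> :: "nat^'a"
  show "psderiv l (lf \<xi>) \<alpha> = \<xi> l * gone \<alpha>"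
  proof (cases "\<alpha> = 0")
    case True
    then show ?thesis by (simp add: psderiv_def gone_def lf_axis[simplified])
  next
    case False
    then have "mdeg (\<alpha> + axis l 1) \<noteq> 1" by simp
    from lf_eq_0[OF this, of \<xi>] show ?thesis using False by (simp add: psderiv_def gone_def)
  qed
qed

definition lieA :: "('n::finite \<Rightarrow> 'n \<Rightarrow> 'a::comm_ring_1) \<Rightarrow> (nat^'n \<Rightarrow> 'a) \<Rightarrow> nat^'n \<Rightarrow> 'a" where
  "lieA A = lie (\<lambda>i. lf (A i))"

lemma hpart_lieA_Suc:
  "hpart (lieA A h) (Suc d) e = (\<Sum>i\<in>UNIV. hpart (psderiv i h) d e * (\<Sum>j\<in>UNIV. A i j * e j))"
  unfolding lieA_def lie_def hpart_sum hpart_gmult_lf_right ..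

lemma hpart_lieA_0 [simp]: "hpart (lieA A h) 0 e = 0"
  unfolding lieA_def lie_def hpart_sum hpart_gmult_lf_right_0 by simp

lemma lieA_coeff_0 [simp]: "lieA A h 0 = 0"
  using hpart_lieA_0[of A h "\<lambda>_. 0"] by (simp only: hpart_degree_0)

text \<open>The derivation sends the linear form with row \<xi> to the form with row \<xi> A; the
  rest is the Leibniz rule. For rows that triangularize A this becomes a recursion over the
  degree.\<close>

lemma hpart_lieA_gmult_lf:
  fixes h :: "nat^'n \<Rightarrow> 'a::real_normed_field"
  shows "hpart (lieA A (gmult (lf \<xi>) h)) (Suc d) e =
     (\<Sum>i\<in>UNIV. \<xi> i * e i) * hpart (lieA A h) d e + (\<Sum>j\<in>UNIV. (\<Sum>i\<in>UNIV. \<xi> i * A i j) * e j) * hpart h d e"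
proof -
  have "lieA A (lf \<xi>) = lf (\<lambda>j. \<Sum>i\<in>UNIV. \<xi> i * A i j)"
  proof (rule hfps_inject)
    fix e
    show "hfps (lieA A (lf \<xi>)) e = hfps (lf (\<lambda>j. \<Sum>i\<in>UNIV. \<xi> i * A i j)) e"
    proof (rule fps_ext)
      fix d
      show "fps_nth (hfps (lieA A (lf \<xi>)) e) d = fps_nth (hfps (lf (\<lambda>j. \<Sum>i\<in>UNIV. \<xi> i * A i j)) e) d"
      proof (cases d)
        case 0
        then show ?thesis by (simp add: hpart_lf del: hpart_degree_0)
      next
        case (Suc d')
        have "(\<Sum>i\<in>UNIV. \<xi> i * (\<Sum>j\<in>UNIV. A i j * e j)) = (\<Sum>j\<in>UNIV. (\<Sum>i\<in>UNIV. \<xi> i * A i j) * e j)"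
          unfolding sum_distrib_left sum_distrib_right by (subst sum.swap) (simp add: mult.assoc)
        then show ?thesis
          by (simp add: Suc hpart_lieA_Suc psderiv_lf hpart_cmult hpart_gone hpart_lf)
      qed
    qed
  qed
  then have "lieA A (gmult (lf \<xi>) h) = (\<lambda>\<alpha>. gmult (lf (\<lambda>j. \<Sum>i\<in>UNIV. \<xi> i * A i j)) h \<alpha> + gmult (lf \<xi>) (lieA A h) \<alpha>)"
    unfolding lieA_def lie_gmult by simp
  then show ?thesis by (simp add: hpart_add hpart_gmult_lf)
qed

text \<open>Differentiation along e at the point e itself, where homogeneity gives the factor (1 +
  s)^(d+1).\<close>

lemma euler_hpart:
  fixes c :: "nat^'n \<Rightarrow> 'a::real_normed_field"
  shows "of_nat (Suc d) * hpart c (Suc d) e = (\<Sum>i\<in>UNIV. e i * hpart (psderiv i c) d e)"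
proof -
  have "((\<lambda>s. hpart c (Suc d) (\<lambda>i. e i + s * e i)) has_field_derivative
           (\<Sum>i\<in>UNIV. e i * hpart (psderiv i c) d e)) (at 0)"
    by (rule DERIV_hpart)
  moreover have "hpart c (Suc d) (\<lambda>i. e i + s * e i) = (1 + s) ^ Suc d * hpart c (Suc d) e" for s
    using hpart_scale[of c "Suc d" "1 + s" e] by (simp add: distrib_right)
  moreover have "((\<lambda>s. (1 + s) ^ Suc d * hpart c (Suc d) e) has_field_derivative
      of_nat (Suc d) * hpart c (Suc d) e) (at 0)"
    by (rule derivative_eq_intros refl | simp)+
  ultimately show ?thesis using DERIV_unique by (metis (no_types, lifting) ext)
qed

text \<open>A partial derivative commutes with the derivation up to the term in which it hits the
  linear coefficients of the field; the second derivatives of h match by symmetry.\<close>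

lemma psderiv_lieA:
  fixes h :: "nat^'n \<Rightarrow> 'a::real_normed_field"
  shows "psderiv l (lieA A h) = (\<lambda>\<alpha>. lieA A (psderiv l h) \<alpha> + (\<Sum>i\<in>UNIV. A i l * psderiv i h \<alpha>))"
proof -
  have g: "gmult F (\<lambda>\<alpha>. c * gone \<alpha>) = (\<lambda>\<alpha>. c * F \<alpha>)" for F :: "nat^'n \<Rightarrow> 'a" and c
    by (rule hfps_inject) (simp add: hfps_gmult hfps_cmult mult.commute)
  show ?thesis
    unfolding lieA_def lie_def psderiv_sum psderiv_gmult psderiv_lf g
    by (simp add: sum.distrib psderiv_commute[of l])
qed

section \<open>Passage between real and complex coefficients\<close>

lemma psderiv_of_real: "psderiv i (\<lambda>\<alpha>. of_real (F \<alpha>)) = (\<lambda>\<alpha>. of_real (psderiv i F \<alpha>) :: complex)"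
  by (simp add: psderiv_def fun_eq_iff)

lemma gmult_of_real: "gmult (\<lambda>\<alpha>. of_real (F \<alpha>)) (\<lambda>\<alpha>. of_real (G \<alpha>)) = (\<lambda>\<alpha>. of_real (gmult F G \<alpha>) :: complex)"
  by (simp add: gmult_def fun_eq_iff case_prod_beta)

lemma lie_of_real: "lie (\<lambda>i \<alpha>. of_real (a i \<alpha>)) (\<lambda>\<alpha>. of_real (F \<alpha>)) = (\<lambda>\<alpha>. of_real (lie a F \<alpha>) :: complex)"
  by (simp add: lie_def psderiv_of_real gmult_of_real fun_eq_iff)

lemma lf_of_real: "lf (\<lambda>i. of_real (\<xi> i)) = (\<lambda>\<alpha>. of_real (lf \<xi> \<alpha>) :: complex)"
  by (simp add: lf_def fun_eq_iff if_distrib cong: if_cong)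

lemma lieA_of_real: "lieA (\<lambda>i j. of_real (A i j)) (\<lambda>\<alpha>. of_real (F \<alpha>)) = (\<lambda>\<alpha>. of_real (lieA A F \<alpha>) :: complex)"
  unfolding lieA_def lf_of_real lie_of_real ..

lemma mmon_of_real: "mmon (\<lambda>i. of_real (e i)) \<alpha> = (of_real (mmon e \<alpha>) :: complex)"
  by (simp add: mmon_def)

lemma hpart_of_real: "hpart (\<lambda>\<alpha>. of_real (F \<alpha>)) d (\<lambda>i. of_real (e i)) = (of_real (hpart F d e) :: complex)"
  by (simp add: hpart_def mmon_of_real)

lemma Re_hpart: "Re (hpart F d (\<lambda>i. of_real (e i))) = hpart (\<lambda>\<alpha>. Re (F \<alpha>)) d e"
  by (simp add: hpart_def mmon_of_real)

text \<open>As the entries of A are real, the real part of a complex solution solves the equation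
  with the real part on the right.\<close>

lemma Re_lieA: "Re (lieA (\<lambda>i j. of_real (A i j)) F \<alpha>) = lieA A (\<lambda>\<alpha>. Re (F \<alpha>)) \<alpha>"
proof -
  have "Re (psderiv i F \<beta>) = psderiv i (\<lambda>\<alpha>. Re (F \<alpha>)) \<beta>" for i \<beta>
    by (simp add: psderiv_def)
  moreover have "Re (gmult G (\<lambda>\<alpha>. of_real (H \<alpha>)) \<beta>) = gmult (\<lambda>\<alpha>. Re (G \<alpha>)) H \<beta>"
    for G H and \<beta> :: "nat^'a"
    by (simp add: gmult_def case_prod_beta)
  ultimately show ?thesis unfolding lieA_def lie_def lf_of_real by simp
qed

section \<open>The derivation of a nonresonant linear vector field\<close>

abbreviation lin :: "('n::finite \<Rightarrow> 'a::comm_ring_1) \<Rightarrow> ('n \<Rightarrow> 'a) \<Rightarrow> 'a" where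
  "lin \<xi> e \<equiv> \<Sum>i\<in>UNIV. \<xi> i * e i"

definition dirderiv :: "('n::finite \<Rightarrow> 'a) \<Rightarrow> (nat^'n \<Rightarrow> 'a::comm_ring_1) \<Rightarrow> nat^'n \<Rightarrow> 'a" where
  "dirderiv y h = (\<lambda>\<alpha>. \<Sum>l\<in>UNIV. y l * psderiv l h \<alpha>)"

lemma hpart_dirderiv: "hpart (dirderiv y h) d e = (\<Sum>l\<in>UNIV. y l * hpart (psderiv l h) d e)"
  by (simp add: dirderiv_def hpart_sum hpart_cmult)

text \<open>Differentiating the equation along a constant vector y gives the same equation for the
  directional derivative, with an extra derivative along A y because the field is linear. For y in a
  flag invariant under A the extra term shifts \<mu> by a diagonal entry, up to derivatives along
  earlier members of the flag.\<close>

lemma lieA_dirderiv: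
  fixes h :: "nat^'n \<Rightarrow> 'a::real_normed_field"
  assumes z: "\<And>e. hpart (lieA A h) (Suc d) e + \<mu> * hpart h (Suc d) e = 0"
  shows "hpart (lieA A (dirderiv y h)) d e + \<mu> * hpart (dirderiv y h) d e
    + hpart (dirderiv (\<lambda>k. \<Sum>l\<in>UNIV. A k l * y l) h) d e = 0"
proof -
  define G where "G = (\<lambda>\<alpha>. lieA A h \<alpha> + \<mu> * h \<alpha>)"
  have "hpart G (Suc d) e = 0" for e
    using z by (simp add: G_def hpart_add hpart_cmult)
  then have G0: "G \<alpha> = 0" if "mdeg \<alpha> = Suc d" for \<alpha>
    using that by (rule hpart_eq_0_imp_coeff_0)
  have "hpart (psderiv l G) d e = 0" for l
  proof -
    have "hpart (psderiv l G) d e = hpart (\<lambda>_. 0) d e"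
      by (rule hpart_cong) (simp add: psderiv_def G0)
    then show ?thesis by simp
  qed
  moreover have "psderiv l G = (\<lambda>\<alpha>. (lieA A (psderiv l h) \<alpha> + (\<Sum>i\<in>UNIV. A i l * psderiv i h \<alpha>)) + \<mu> * psderiv l h \<alpha>)" for l
    unfolding G_def psderiv_add psderiv_cmult psderiv_lieA ..
  ultimately have 0: "hpart (lieA A (psderiv l h)) d e + (\<Sum>i\<in>UNIV. A i l * hpart (psderiv i h) d e) + \<mu> * hpart (psderiv l h) d e = 0" for l
    by (simp add: hpart_add hpart_sum hpart_cmult)
  have "hpart (lieA A (dirderiv y h)) d e = (\<Sum>l\<in>UNIV. y l * hpart (lieA A (psderiv l h)) d e)"
    by (simp add: lieA_def dirderiv_def lie_sum lie_cmult hpart_sum hpart_cmult)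
  moreover have "hpart (dirderiv (\<lambda>k. \<Sum>l\<in>UNIV. A k l * y l) h) d e
      = (\<Sum>l\<in>UNIV. y l * (\<Sum>i\<in>UNIV. A i l * hpart (psderiv i h) d e))"
    unfolding hpart_dirderiv sum_distrib_left sum_distrib_right
    by (subst sum.swap) (simp add: mult_ac)
  ultimately have "hpart (lieA A (dirderiv y h)) d e + \<mu> * hpart (dirderiv y h) d e
    + hpart (dirderiv (\<lambda>k. \<Sum>l\<in>UNIV. A k l * y l) h) d e
    = (\<Sum>l\<in>UNIV. y l * (hpart (lieA A (psderiv l h)) d e + (\<Sum>i\<in>UNIV. A i l * hpart (psderiv i h) d e) + \<mu> * hpart (psderiv l h) d e))"
    by (simp add: hpart_dirderiv sum.distrib sum_distrib_left distrib_left mult_ac)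
  then show ?thesis using 0 by simp
qed

text \<open>The y_j and the \<xi>_i are dual bases in which A is upper triangular with matrix T. The
  zero eigenvalue stands last, so \<xi>_(N-1) is a left null vector, while the spans of y_0, ...,
  y_j are invariant.\<close>

locale nonresonant_flag =
  fixes A :: "'n::finite \<Rightarrow> 'n \<Rightarrow> complex" and y \<xi> :: "nat \<Rightarrow> 'n \<Rightarrow> complex"
    and T :: "nat \<Rightarrow> nat \<Rightarrow> complex" and N :: nat
  assumes N: "N \<ge> 1"
    and dual1: "\<And>i j. i < N \<Longrightarrow> j < N \<Longrightarrow> lin (\<xi> i) (y j) = (if i = j then 1 else 0)"
    and dual2: "\<And>l k. (\<Sum>i<N. y i l * \<xi> i k) = (if l = k then 1 else 0)"
    and Ay: "\<And>j k. j < N \<Longrightarrow> (\<Sum>l\<in>UNIV. A k l * y j l) = (\<Sum>i\<le>j. T i j * y i k)"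
    and \<xi>A: "\<And>i k. i < N \<Longrightarrow> (\<Sum>l\<in>UNIV. \<xi> i l * A l k) = (\<Sum>j\<in>{i..<N}. T i j * \<xi> j k)"
    and T0: "T (N - 1) (N - 1) = 0"
    and nonres: "\<And>k :: nat \<Rightarrow> nat. (\<Sum>j<N - 1. k j) \<ge> 1 \<Longrightarrow> (\<Sum>j<N - 1. of_nat (k j) * T j j) \<noteq> 0"
begin

text \<open>The eigenvalues of the derivation on monomials that contain some coordinate other than
  the last one. The inductions rest on two facts: 0 is not among them, and adding any diagonal entry
  of T does not leave the set.\<close>

definition weights :: "complex set" where
  "weights = {\<mu>. \<exists>k :: nat \<Rightarrow> nat. (\<Sum>j<N - 1. k j) \<ge> 1 \<and> \<mu> = (\<Sum>j<N - 1. of_nat (k j) * T j j)}"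

lemma weights_nonzero: "\<mu> \<in> weights \<Longrightarrow> \<mu> \<noteq> 0"
  using nonres by (auto simp: weights_def)

lemma T_in_weights:
  assumes "j < N - 1" shows "T j j \<in> weights"
  unfolding weights_def using assms
  by (intro CollectI exI[of _ "\<lambda>i. if i = j then 1 else 0"]) (auto simp: sum.delta if_distrib if_distribR cong: if_cong)

lemma weights_add_T:
  assumes \<mu>: "\<mu> \<in> weights" and j: "j < N" shows "\<mu> + T j j \<in> weights"
proof (cases "j = N - 1")
  case True
  then show ?thesis using T0 \<mu> by simp
next
  case False
  with j have j': "j < N - 1" by simp
  obtain k where k: "(\<Sum>j<N - 1. k j) \<ge> 1" "\<mu> = (\<Sum>j<N - 1. of_nat (k j) * T j j)"
    using \<mu> by (auto simp: weights_def)
  have "(\<Sum>i<N - 1. of_nat (k i + (if i = j then 1 else 0)) * T i i) = \<mu> + (\<Sum>i<N - 1. if i = j then T i i else 0)"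
    unfolding k(2) by (subst sum.distrib[symmetric]) (intro sum.cong refl, simp add: distrib_right)
  also have "\<dots> = \<mu> + T j j" using j' by (simp add: sum.delta)
  finally show ?thesis
    unfolding weights_def using k(1)
    by (intro CollectI exI[of _ "\<lambda>i. k i + (if i = j then 1 else 0)"]) (auto simp: sum.distrib)
qed

lemma lin_\<xi>A:
  assumes "i < N"
  shows "lin (\<lambda>j. \<Sum>l\<in>UNIV. \<xi> i l * A l j) e = T i i * lin (\<xi> i) e + (\<Sum>k\<in>{Suc i..<N}. T i k * lin (\<xi> k) e)"
proof -
  have "lin (\<lambda>j. \<Sum>l\<in>UNIV. \<xi> i l * A l j) e = (\<Sum>k\<in>{i..<N}. T i k * lin (\<xi> k) e)"
    unfolding \<xi>A[OF assms] sum_distrib_left sum_distrib_right by (subst sum.swap) (simp add: mult.assoc)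
  then show ?thesis using assms by (simp add: sum.atLeast_Suc_lessThan)
qed

lemma coordinate_eq: "e l = (\<Sum>i<N. y i l * lin (\<xi> i) e)"
proof -
  have "(\<Sum>i<N. y i l * lin (\<xi> i) e) = (\<Sum>k\<in>UNIV. (\<Sum>i<N. y i l * \<xi> i k) * e k)"
    unfolding sum_distrib_left sum_distrib_right by (subst sum.swap) (simp add: mult.assoc)
  then show ?thesis by (simp add: dual2 sum.delta if_distrib if_distribR cong: if_cong)
qed

text \<open>By Euler's identity every form of degree d + 1 is a combination of products of some
  \<xi>_j with a form of degree d. Such a product need only be known to lie in I up to products with
  later \<xi>_k, as triangularity supplies; descending induction on j, with the form left arbitrary,
  removes those.\<close>

lemma homogeneous_span:
  fixes I :: "(('n \<Rightarrow> complex) \<Rightarrow> complex) set"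
  assumes z: "(\<lambda>_. 0) \<in> I" and add: "\<And>f g. f \<in> I \<Longrightarrow> g \<in> I \<Longrightarrow> (\<lambda>e. f e + g e) \<in> I"
    and scal: "\<And>f c. f \<in> I \<Longrightarrow> (\<lambda>e. c * f e) \<in> I"
    and step: "\<And>j c. j < N \<Longrightarrow> \<exists>h. (\<lambda>e. lin (\<xi> j) e * hpart c d e
        + (\<Sum>k\<in>{Suc j..<N}. T j k * (lin (\<xi> k) e * hpart h d e))) \<in> I"
  shows "hpart c (Suc d) \<in> I"
proof -
  have sum: "(\<lambda>e. \<Sum>i\<in>J. f i e) \<in> I" if "\<And>i. i \<in> J \<Longrightarrow> f i \<in> I" for J :: "'x set" and f
    using that by (induction J rule: infinite_finite_induct) (auto intro: z add)
  have *: "(\<lambda>e. lin (\<xi> j) e * hpart c d e) \<in> I" if "j < N" for j c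
    using that
  proof (induction "N - j" arbitrary: j c rule: less_induct)
    case less
    from step[OF less.prems, of c] obtain h where
      h: "(\<lambda>e. lin (\<xi> j) e * hpart c d e + (\<Sum>k\<in>{Suc j..<N}. T j k * (lin (\<xi> k) e * hpart h d e))) \<in> I" ..
    have "(\<lambda>e. \<Sum>k\<in>{Suc j..<N}. T j k * (lin (\<xi> k) e * hpart h d e)) \<in> I"
      by (intro sum scal less.hyps) auto
    from add[OF h scal[OF this, of "-1"]] show ?case by simp
  qed
  have "(\<lambda>e. (1 / of_nat (Suc d)) * (\<Sum>l\<in>UNIV. \<Sum>i<N. y i l * (lin (\<xi> i) e * hpart (psderiv l c) d e))) \<in> I"
    by (intro scal sum *) auto
  moreover have "(1 / of_nat (Suc d)) * (\<Sum>l\<in>UNIV. \<Sum>i<N. y i l * (lin (\<xi> i) e * hpart (psderiv l c) d e)) = hpart c (Suc d) e" for e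
  proof -
    have "(\<Sum>l\<in>UNIV. \<Sum>i<N. y i l * (lin (\<xi> i) e * hpart (psderiv l c) d e)) = (\<Sum>l\<in>UNIV. e l * hpart (psderiv l c) d e)"
      by (subst (2) coordinate_eq) (simp add: sum_distrib_right mult.assoc)
    also have "\<dots> = of_nat (Suc d) * hpart c (Suc d) e" by (rule euler_hpart[symmetric])
    finally show ?thesis by (simp del: of_nat_Suc)
  qed
  ultimately show ?thesis by simp
qed

section \<open>Solvability of the homological equation\<close>

lemma lieA_gmult_\<xi>:
  assumes "j < N"
  shows "hpart (lieA A (gmult (lf (\<xi> j)) h)) (Suc d) e
     = lin (\<xi> j) e * (hpart (lieA A h) d e + T j j * hpart h d e)
       + (\<Sum>k\<in>{Suc j..<N}. T j k * (lin (\<xi> k) e * hpart h d e))"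
  unfolding hpart_lieA_gmult_lf lin_\<xi>A[OF assms]
  by (simp add: distrib_left distrib_right sum_distrib_left sum_distrib_right mult_ac)

text \<open>Applied to \<xi>_j h, the operator with shift \<mu> gives \<xi>_j times the operator
  with shift \<mu> + T j j on h, plus products with later \<xi>_k. So degree d + 1 follows from
  degree d for another weight.\<close>

lemma shifted_surjective:
  assumes "\<mu> \<in> weights"
  shows "\<exists>h. \<forall>e. hpart (lieA A h) d e + \<mu> * hpart h d e = hpart c d e"
  using assms
proof (induction d arbitrary: \<mu> c)
  case 0
  then show ?case
    using weights_nonzero[OF 0] by (intro exI[of _ "\<lambda>\<alpha>. c \<alpha> / \<mu>"]) simp
next
  case (Suc d)
  define I where "I = {g. \<exists>h. \<forall>e. hpart (lieA A h) (Suc d) e + \<mu> * hpart h (Suc d) e = g e}"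
  have "hpart c (Suc d) \<in> I"
  proof (rule homogeneous_span)
    show "(\<lambda>_. 0) \<in> I"
      unfolding I_def by (intro CollectI exI[of _ "\<lambda>_. 0"]) (simp add: hpart_lieA_Suc psderiv_def)
  next
    fix f g assume "f \<in> I" "g \<in> I"
    then obtain h k where "\<forall>e. hpart (lieA A h) (Suc d) e + \<mu> * hpart h (Suc d) e = f e"
       "\<forall>e. hpart (lieA A k) (Suc d) e + \<mu> * hpart k (Suc d) e = g e" by (auto simp: I_def)
    then show "(\<lambda>e. f e + g e) \<in> I"
      unfolding I_def by (intro CollectI exI[of _ "\<lambda>\<alpha>. h \<alpha> + k \<alpha>"]) (simp add: lieA_def lie_add hpart_add algebra_simps)
  next
    fix f b assume "f \<in> I"
    then obtain h where "\<forall>e. hpart (lieA A h) (Suc d) e + \<mu> * hpart h (Suc d) e = f e" by (auto simp: I_def)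
    then have "\<forall>e. b * (hpart (lieA A h) (Suc d) e + \<mu> * hpart h (Suc d) e) = b * f e" by simp
    then show "(\<lambda>e. b * f e) \<in> I"
      unfolding I_def by (intro CollectI exI[of _ "\<lambda>\<alpha>. b * h \<alpha>"]) (simp add: lieA_def lie_cmult hpart_cmult algebra_simps)
  next
    fix j c assume j: "j < N"
    obtain h where h: "\<And>e. hpart (lieA A h) d e + (\<mu> + T j j) * hpart h d e = hpart c d e"
      using Suc.IH[OF weights_add_T[OF Suc.prems j]] by blast
    have "hpart (lieA A (gmult (lf (\<xi> j)) h)) (Suc d) e + \<mu> * hpart (gmult (lf (\<xi> j)) h) (Suc d) e
        = lin (\<xi> j) e * hpart c d e + (\<Sum>k\<in>{Suc j..<N}. T j k * (lin (\<xi> k) e * hpart h d e))" for e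
      unfolding h[symmetric] lieA_gmult_\<xi>[OF j] hpart_gmult_lf by (simp add: algebra_simps)
    then show "\<exists>h. (\<lambda>e. lin (\<xi> j) e * hpart c d e
        + (\<Sum>k\<in>{Suc j..<N}. T j k * (lin (\<xi> k) e * hpart h d e))) \<in> I"
      unfolding I_def by blast
  qed
  then show ?case by (simp add: I_def)
qed

text \<open>The same recursion from shift 0. Multiplication by the last form keeps the shift 0 and
  carries the defect from its d-th power to the next one; multiplication by any other \<xi>_j leads
  to the nonzero shift T j j, where there is no defect.\<close>

lemma surjective_mod_power:
  "\<exists>h \<kappa>. \<forall>e. hpart (lieA A h) d e + \<kappa> * lin (\<xi> (N - 1)) e ^ d = hpart c d e"
proof (induction d arbitrary: c)
  case 0
  show ?case by (intro exI[of _ "\<lambda>_. 0"] exI[of _ "c 0"]) simp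
next
  case (Suc d)
  define I where "I = {g. \<exists>h \<kappa>. \<forall>e. hpart (lieA A h) (Suc d) e + \<kappa> * lin (\<xi> (N - 1)) e ^ Suc d = g e}"
  have "hpart c (Suc d) \<in> I"
  proof (rule homogeneous_span)
    show "(\<lambda>_. 0) \<in> I"
      unfolding I_def by (intro CollectI exI[of _ "\<lambda>_. 0"] exI[of _ 0]) (simp add: hpart_lieA_Suc psderiv_def)
  next
    fix f g assume "f \<in> I" "g \<in> I"
    then obtain h k \<kappa> \<kappa>' where f: "\<And>e. hpart (lieA A h) (Suc d) e + \<kappa> * lin (\<xi> (N - 1)) e ^ Suc d = f e"
       and g: "\<And>e. hpart (lieA A k) (Suc d) e + \<kappa>' * lin (\<xi> (N - 1)) e ^ Suc d = g e"
      unfolding I_def by blast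
    have "hpart (lieA A (\<lambda>\<alpha>. h \<alpha> + k \<alpha>)) (Suc d) e + (\<kappa> + \<kappa>') * lin (\<xi> (N - 1)) e ^ Suc d = f e + g e" for e
      by (simp only: f[symmetric] g[symmetric] lieA_def lie_add hpart_add distrib_right add_ac)
    then show "(\<lambda>e. f e + g e) \<in> I" unfolding I_def by blast
  next
    fix f b assume "f \<in> I"
    then obtain h \<kappa> where f: "\<And>e. hpart (lieA A h) (Suc d) e + \<kappa> * lin (\<xi> (N - 1)) e ^ Suc d = f e"
      unfolding I_def by blast
    have "hpart (lieA A (\<lambda>\<alpha>. b * h \<alpha>)) (Suc d) e + (b * \<kappa>) * lin (\<xi> (N - 1)) e ^ Suc d = b * f e" for e
      by (simp only: f[symmetric] lieA_def lie_cmult hpart_cmult distrib_left mult.assoc)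
    then show "(\<lambda>e. b * f e) \<in> I" unfolding I_def by blast
  next
    fix j c assume j: "j < N"
    show "\<exists>h. (\<lambda>e. lin (\<xi> j) e * hpart c d e
        + (\<Sum>k\<in>{Suc j..<N}. T j k * (lin (\<xi> k) e * hpart h d e))) \<in> I"
    proof (cases "j = N - 1")
      case True
      obtain h \<kappa> where h: "\<And>e. hpart (lieA A h) d e + \<kappa> * lin (\<xi> (N - 1)) e ^ d = hpart c d e"
        using Suc.IH by blast
      have "hpart (lieA A (gmult (lf (\<xi> j)) h)) (Suc d) e + \<kappa> * lin (\<xi> (N - 1)) e ^ Suc d
          = lin (\<xi> j) e * hpart c d e + (\<Sum>k\<in>{Suc j..<N}. T j k * (lin (\<xi> k) e * hpart h d e))" for e
        unfolding h[symmetric] lieA_gmult_\<xi>[OF j] using True T0 by (simp add: algebra_simps)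
      then show ?thesis unfolding I_def by blast
    next
      case False
      with j have "T j j \<in> weights" by (intro T_in_weights) simp
      from shifted_surjective[OF this] obtain h where
        h: "\<And>e. hpart (lieA A h) d e + T j j * hpart h d e = hpart c d e" by blast
      have "hpart (lieA A (gmult (lf (\<xi> j)) h)) (Suc d) e + 0 * lin (\<xi> (N - 1)) e ^ Suc d
          = lin (\<xi> j) e * hpart c d e + (\<Sum>k\<in>{Suc j..<N}. T j k * (lin (\<xi> k) e * hpart h d e))" for e
        unfolding h[symmetric] lieA_gmult_\<xi>[OF j] by simp
      then show ?thesis unfolding I_def by blast
    qed
  qed
  then show ?case by (simp add: I_def)
qed

section \<open>Uniqueness for the homological equation, and the two kernels\<close>

lemma dirderiv_Ay:
  assumes "j < N"
  shows "hpart (dirderiv (\<lambda>k. \<Sum>l\<in>UNIV. A k l * y j l) h) d e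
     = T j j * hpart (dirderiv (y j) h) d e + (\<Sum>i<j. T i j * hpart (dirderiv (y i) h) d e)"
proof -
  have "hpart (dirderiv (\<lambda>k. \<Sum>l\<in>UNIV. A k l * y j l) h) d e = (\<Sum>i\<le>j. T i j * hpart (dirderiv (y i) h) d e)"
    unfolding hpart_dirderiv Ay[OF assms] sum_distrib_left sum_distrib_right
    by (subst sum.swap) (simp add: mult.assoc)
  also have "{..j} = insert j {..<j}" by auto
  finally show ?thesis by simp
qed

lemma hpart_psderiv_eq: "hpart (psderiv l h) d e = (\<Sum>j<N. \<xi> j l * hpart (dirderiv (y j) h) d e)"
proof -
  have "(\<Sum>j<N. \<xi> j l * hpart (dirderiv (y j) h) d e) = (\<Sum>k\<in>UNIV. (\<Sum>j<N. y j k * \<xi> j l) * hpart (psderiv k h) d e)"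
    unfolding hpart_dirderiv sum_distrib_left sum_distrib_right by (subst sum.swap) (simp add: mult_ac)
  then show ?thesis by (simp add: dual2 sum.delta if_distrib if_distribR cong: if_cong)
qed

lemma hpart_Suc_eq_0:
  assumes "\<And>j e. j < N \<Longrightarrow> hpart (dirderiv (y j) h) d e = 0"
  shows "hpart h (Suc d) e = 0"
proof -
  have "hpart (psderiv l h) d e = 0" for l
    unfolding hpart_psderiv_eq using assms by (intro sum.neutral) simp
  then have "of_nat (Suc d) * hpart h (Suc d) e = 0" unfolding euler_hpart by simp
  then show ?thesis by (simp del: of_nat_Suc)
qed

text \<open>Derivatives of a solution along the y_j, taken in increasing order of j, satisfy the
  equation one degree lower with shift \<mu> + T j j, since the contributions of earlier y_i already
  vanish. A form all of whose derivatives vanish is 0 in positive degree.\<close>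

lemma shifted_injective:
  assumes "\<mu> \<in> weights" "\<And>e. hpart (lieA A h) d e + \<mu> * hpart h d e = 0"
  shows "hpart h d e = 0"
  using assms
proof (induction d arbitrary: \<mu> h e)
  case 0
  then show ?case using weights_nonzero by simp
next
  case (Suc d)
  have "hpart (dirderiv (y j) h) d e = 0" if "j < N" for j e
    using that
  proof (induction j arbitrary: e rule: less_induct)
    case (less j)
    have "hpart (lieA A (dirderiv (y j) h)) d e + (\<mu> + T j j) * hpart (dirderiv (y j) h) d e = 0" for e
    proof -
      have "hpart (dirderiv (\<lambda>k. \<Sum>l\<in>UNIV. A k l * y j l) h) d e = T j j * hpart (dirderiv (y j) h) d e"
        unfolding dirderiv_Ay[OF less.prems] using less by simp
      then show ?thesis
        using lieA_dirderiv[OF Suc.prems(2), of "y j" e] by (simp add: algebra_simps)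
    qed
    then show ?case by (rule Suc.IH[OF weights_add_T[OF Suc.prems(1) less.prems]])
  qed
  then show ?case by (rule hpart_Suc_eq_0)
qed

text \<open>Along y_j with j < N - 1 the shift is nonzero and \<open>shifted_injective\<close>
  applies. Along v the shift stays 0, but the derivative again vanishes at v by Euler's identity, so
  the induction on the degree applies. As v has a component along the last y, these directions
  span.\<close>

lemma injective_mod_v:
  assumes v: "\<And>k. (\<Sum>l\<in>UNIV. A k l * v l) = 0" "lin (\<xi> (N - 1)) v \<noteq> 0"
    and "\<And>e. hpart (lieA A h) d e = 0" "hpart h d v = 0"
  shows "hpart h d e = 0"
  using assms(3,4)
proof (induction d arbitrary: h e)
  case 0
  then show ?case by simp
next
  case (Suc d)
  have z: "hpart (lieA A h) (Suc d) e + 0 * hpart h (Suc d) e = 0" for e using Suc.prems by simp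
  have q: "hpart (dirderiv (y j) h) d e = 0" if "j < N - 1" for j e
    using that
  proof (induction j arbitrary: e rule: less_induct)
    case (less j)
    have "hpart (lieA A (dirderiv (y j) h)) d e + T j j * hpart (dirderiv (y j) h) d e = 0" for e
    proof -
      have "hpart (dirderiv (\<lambda>k. \<Sum>l\<in>UNIV. A k l * y j l) h) d e = T j j * hpart (dirderiv (y j) h) d e"
        using less by (subst dirderiv_Ay) auto
      then show ?thesis
        using lieA_dirderiv[OF z, of "y j" e] by simp
    qed
    then show ?case by (rule shifted_injective[OF T_in_weights[OF less.prems]])
  qed
  have qv: "hpart (dirderiv v h) d e = 0" for e
  proof (rule Suc.IH)
    fix e
    have "hpart (dirderiv (\<lambda>k. \<Sum>l\<in>UNIV. A k l * v l) h) d e = 0"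
      unfolding v(1) by (simp add: hpart_dirderiv)
    then show "hpart (lieA A (dirderiv v h)) d e = 0"
      using lieA_dirderiv[OF z, of v e] by simp
    have "hpart (dirderiv v h) d v = of_nat (Suc d) * hpart h (Suc d) v"
      unfolding hpart_dirderiv euler_hpart ..
    then show "hpart (dirderiv v h) d v = 0" using Suc.prems by simp
  qed
  have "hpart (dirderiv (y (N - 1)) h) d e = 0" for e
  proof -
    have "hpart (dirderiv v h) d e = (\<Sum>j<N. lin (\<xi> j) v * hpart (dirderiv (y j) h) d e)"
      unfolding hpart_dirderiv[of v] hpart_psderiv_eq sum_distrib_left sum_distrib_right
      by (subst sum.swap) (simp add: mult_ac)
    also have "\<dots> = (\<Sum>j<N. if j = N - 1 then lin (\<xi> j) v * hpart (dirderiv (y j) h) d e else 0)"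
      using q by (intro sum.cong) auto
    also have "\<dots> = lin (\<xi> (N - 1)) v * hpart (dirderiv (y (N - 1)) h) d e"
      using N by (simp add: sum.delta)
    finally show ?thesis using qv v(2) by simp
  qed
  then have "hpart (dirderiv (y j) h) d e = 0" if "j < N" for j e
    using q[of j e] that by (cases "j = N - 1") auto
  then show ?case by (rule hpart_Suc_eq_0)
qed

text \<open>On a null vector the relation for \<xi>_j A, read from j = N - 1 downwards, gives T j j
  times \<xi>_j x = 0 with T j j nonzero, so the last coordinate alone detects the kernel.\<close>

lemma kernel_trivial:
  assumes x: "\<And>k. (\<Sum>l\<in>UNIV. A k l * x l) = 0" "lin (\<xi> (N - 1)) x = 0"
  shows "x l = 0"
proof -
  have "lin (\<xi> j) x = 0" if "j < N" for j
    using that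
  proof (induction "N - j" arbitrary: j rule: less_induct)
    case less
    show ?case
    proof (cases "j = N - 1")
      case True
      then show ?thesis using x(2) by simp
    next
      case False
      have "lin (\<lambda>k. \<Sum>l\<in>UNIV. \<xi> j l * A l k) x = (\<Sum>l\<in>UNIV. \<xi> j l * (\<Sum>k\<in>UNIV. A l k * x k))"
        unfolding sum_distrib_left sum_distrib_right by (subst sum.swap) (simp add: mult.assoc)
      then have "lin (\<lambda>k. \<Sum>l\<in>UNIV. \<xi> j l * A l k) x = 0" using x(1) by simp
      then have "T j j * lin (\<xi> j) x + (\<Sum>k\<in>{Suc j..<N}. T j k * lin (\<xi> k) x) = 0"
        unfolding lin_\<xi>A[OF less.prems] .
      moreover have "(\<Sum>k\<in>{Suc j..<N}. T j k * lin (\<xi> k) x) = 0"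
        using less by (intro sum.neutral) auto
      moreover have "T j j \<noteq> 0" using False less.prems by (intro weights_nonzero T_in_weights) simp
      ultimately show ?thesis by simp
    qed
  qed
  then show ?thesis by (subst coordinate_eq) simp
qed

text \<open>The left kernel is spanned by \<xi>_(N-1). This identifies a real left null vector with
  a multiple of the complex one.\<close>

lemma left_kernel:
  assumes u: "\<And>k. (\<Sum>l\<in>UNIV. u l * A l k) = 0"
  shows "u k = lin u (y (N - 1)) * \<xi> (N - 1) k"
proof -
  have z: "lin u (y j) = 0" if "j < N - 1" for j
    using that
  proof (induction j rule: less_induct)
    case (less j)
    have "0 = (\<Sum>k\<in>UNIV. (\<Sum>l\<in>UNIV. u l * A l k) * y j k)" using u by simp
    also have "\<dots> = (\<Sum>l\<in>UNIV. u l * (\<Sum>k\<in>UNIV. A l k * y j k))"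
      unfolding sum_distrib_left sum_distrib_right by (subst sum.swap) (simp add: mult.assoc)
    also have "\<dots> = (\<Sum>l\<in>UNIV. u l * (\<Sum>i\<le>j. T i j * y i l))"
      using less.prems by (subst Ay) auto
    also have "\<dots> = (\<Sum>i\<le>j. T i j * lin u (y i))"
      unfolding sum_distrib_left by (subst sum.swap) (simp add: mult_ac)
    also have "{..j} = insert j {..<j}" by auto
    finally have "T j j * lin u (y j) = 0" using less by simp
    moreover have "T j j \<noteq> 0" using less.prems by (intro weights_nonzero T_in_weights)
    ultimately show ?case by simp
  qed
  have "(\<Sum>j<N. lin u (y j) * \<xi> j k) = (\<Sum>l\<in>UNIV. u l * (\<Sum>j<N. y j l * \<xi> j k))"
    unfolding sum_distrib_left sum_distrib_right by (subst sum.swap) (simp add: mult.assoc)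
  then have "u k = (\<Sum>j<N. lin u (y j) * \<xi> j k)"
    by (simp add: dual2 sum.delta' if_distrib cong: if_cong)
  also have "\<dots> = (\<Sum>j<N. if j = N - 1 then lin u (y j) * \<xi> j k else 0)"
    using z by (intro sum.cong) auto
  also have "\<dots> = lin u (y (N - 1)) * \<xi> (N - 1) k" using N by (simp add: sum.delta)
  finally show ?thesis .
qed

end


section \<open>Triangular form of the linear part\<close>

text \<open>A bijection of the index sets carries permutations to permutations of the same sign, so
  both determinant formulas agree term by term.\<close>

lemma char_poly_reindex:
  fixes A :: "real^'n^'n" and b :: "nat \<Rightarrow> 'n"
  assumes b: "bij_betw b {0..<CARD('n)} UNIV"
  defines "M \<equiv> Matrix.mat CARD('n) CARD('n) (\<lambda>(i, j). complex_of_real (A $ b i $ b j))"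
  shows "char_poly M = char_polynomial A"
proof -
  let ?N = "{0..<CARD('n)}"
  define E where "E = (\<lambda>i j. (if i = j then [:0, 1:] else 0) - [:complex_of_real (A $ i $ j):])"
  have bin: "inj_on b ?N" and bim: "b ` ?N = UNIV"
    using b by (auto simp: bij_betw_def)
  have bij: "bij_betw (map_permutation ?N b) {p. p permutes ?N} {p. p permutes UNIV}"
    using bij_betw_permutations[OF b]
    by (rule bij_betw_cong[THEN iffD1, rotated])
       (auto simp: map_permutation_def restrict_id_def fun_eq_iff bim)
  have entry: "char_poly_matrix M $$ (i, p i) = E (b i) (b (p i))" if "p permutes ?N" "i \<in> ?N" for p i
  proof -
    have "p i \<in> ?N" using that by (simp add: permutes_in_image)
    then show ?thesis
      using that unfolding char_poly_matrix_def M_def E_def by (auto simp: inj_on_eq_iff[OF bin])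
  qed
  have "dim_row (char_poly_matrix M) = CARD('n)" "dim_col (char_poly_matrix M) = CARD('n)"
    by (auto simp: char_poly_matrix_def M_def)
  then have "char_poly M = (\<Sum>p | p permutes ?N. signof p * (\<Prod>i\<in>?N. E (b i) (b (p i))))"
    unfolding char_poly_def Determinant.det_def by (auto simp: entry intro!: sum.cong prod.cong)
  also have "\<dots> = (\<Sum>p | p permutes ?N. of_int (sign (map_permutation ?N b p)) *
                      (\<Prod>x\<in>UNIV. E x (map_permutation ?N b p x)))"
  proof (intro sum.cong refl arg_cong2[where f = "(*)"])
    fix p assume "p \<in> {p. p permutes ?N}"
    then have p: "p permutes ?N" by simp
    show "signof p = of_int (sign (map_permutation ?N b p))"
      using sign_map_permutation[OF bin p] by (simp add: sign_def)
    have "(\<Prod>i\<in>?N. E (b i) (b (p i))) = (\<Prod>i\<in>?N. E (b i) (map_permutation ?N b p (b i)))"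
      using map_permutation_apply[OF bin] by (intro prod.cong) auto
    also have "\<dots> = (\<Prod>x\<in>UNIV. E x (map_permutation ?N b p x))"
      by (rule prod.reindex_bij_betw[OF b])
    finally show "(\<Prod>i\<in>?N. E (b i) (b (p i))) = (\<Prod>x\<in>UNIV. E x (map_permutation ?N b p x))" .
  qed
  also have "\<dots> = (\<Sum>p | p permutes UNIV. of_int (sign p) * (\<Prod>x\<in>UNIV. E x (p x)))"
    by (rule sum.reindex_bij_betw[OF bij])
  also have "\<dots> = char_polynomial A"
    unfolding char_polynomial_def Determinants.det_def E_def by simp
  finally show ?thesis .
qed

lemma triangular_form:
  fixes A :: "real^'n^'n" and lam :: "nat \<Rightarrow> complex"
  assumes N: "CARD('n) \<ge> 1"
    and cp: "char_polynomial A = (\<Prod>i=1..CARD('n). [:- lam i, 1:])"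
  obtains y \<xi> :: "nat \<Rightarrow> complex^'n" and T :: "nat \<Rightarrow> nat \<Rightarrow> complex" where
    "\<And>i j. i < CARD('n) \<Longrightarrow> j < CARD('n) \<Longrightarrow> (\<Sum>l\<in>UNIV. \<xi> i $ l * y j $ l) = (if i = j then 1 else 0)"
    "\<And>l k. (\<Sum>i<CARD('n). y i $ l * \<xi> i $ k) = (if l = k then 1 else 0)"
    "\<And>j k. j < CARD('n) \<Longrightarrow>
        (\<Sum>l\<in>UNIV. complex_of_real (A $ k $ l) * y j $ l) = (\<Sum>i\<le>j. T i j * y i $ k)"
    "\<And>i k. i < CARD('n) \<Longrightarrow>
        (\<Sum>l\<in>UNIV. \<xi> i $ l * complex_of_real (A $ l $ k)) = (\<Sum>j\<in>{i..<CARD('n)}. T i j * \<xi> j $ k)"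
    "\<And>j. j < CARD('n) \<Longrightarrow> T j j = (if j = CARD('n) - 1 then lam 1 else lam (j + 2))"
proof -
  let ?n = "CARD('n)"
  obtain b :: "nat \<Rightarrow> 'n" where b: "bij_betw b {0..<?n} UNIV"
    using ex_bij_betw_nat_finite[of "UNIV :: 'n set"] by auto
  define g where "g = the_inv_into {0..<?n} b"
  have g: "bij_betw g UNIV {0..<?n}"
    unfolding g_def by (rule bij_betw_the_inv_into[OF b])
  have bg: "b (g x) = x" for x
    unfolding g_def using b by (simp add: f_the_inv_into_f_bij_betw)
  have gl: "g x < ?n" for x using bij_betwE[OF g] by auto
  have gi: "g x = g y \<longleftrightarrow> x = y" for x y using bij_betw_imp_inj_on[OF g] by (auto simp: inj_on_def)
  define M where "M = Matrix.mat ?n ?n (\<lambda>(i, j). complex_of_real (A $ b i $ b j))"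
  \<comment> \<open>Schur decomposition puts the eigenvalues on the diagonal in the order of this
    list. With the distinguished one last, the last row of Q is its left eigenvector; the columns of
    P and the rows of Q = P^(-1) are the dual bases.\<close>
  define es where "es = map lam [2..<?n + 1] @ [lam 1]"
  have len: "length es = ?n" by (simp add: es_def, use N in linarith)
  have Mc: "M \<in> carrier_mat ?n ?n" by (simp add: M_def)
  have "(\<Prod>i=1..?n. [:- lam i, 1:]) = [:- lam 1, 1:] * (\<Prod>i=2..?n. [:- lam i, 1:])"
    using N by (simp add: prod.atLeast_Suc_atMost numeral_2_eq_2)
  also have "(\<Prod>i=2..?n. [:- lam i, 1:]) = (\<Prod>i\<leftarrow>[2..<?n+1]. [:- lam i, 1:])"
    by (simp add: prod.distinct_set_conv_list[symmetric] atLeastLessThanSuc_atLeastAtMost del: upt_Suc)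
  finally have "char_poly M = (\<Prod>e\<leftarrow>es. [:- e, 1:])"
    using char_poly_reindex[OF b, of A] cp by (simp add: M_def es_def o_def mult.commute)
  moreover obtain B P Q where BPQ: "schur_decomposition M es = (B, P, Q)" by (metis prod_cases3)
  ultimately have sim: "similar_mat_wit M B P Q" and ut: "upper_triangular B" and dg: "diag_mat B = es"
    using schur_decomposition[OF Mc] by auto
  have c: "B \<in> carrier_mat ?n ?n" "P \<in> carrier_mat ?n ?n" "Q \<in> carrier_mat ?n ?n"
    and PQ: "P * Q = 1\<^sub>m ?n" "Q * P = 1\<^sub>m ?n" and M: "M = P * B * Q"
    using similar_mat_witD2[OF Mc sim] by auto
  have MP: "M * P = P * B"
    using c PQ unfolding M by (simp add: assoc_mult_mat[of _ ?n ?n _ ?n _ ?n])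
  have QM: "Q * M = B * Q"
  proof -
    have "Q * M = (Q * P) * (B * Q)"
      using c unfolding M by (simp add: assoc_mult_mat[of _ ?n ?n _ ?n _ ?n])
    then show ?thesis using c PQ by simp
  qed
  have sumg: "(\<Sum>l\<in>UNIV. f (g l)) = (\<Sum>i<?n. f i)" for f :: "nat \<Rightarrow> complex"
    using sum.reindex_bij_betw[OF g, of f] by (simp add: lessThan_atLeast0)
  have mm: "(X * Y) $$ (i, j) = (\<Sum>k<?n. X $$ (i, k) * Y $$ (k, j))"
    if "X \<in> carrier_mat ?n ?n" "Y \<in> carrier_mat ?n ?n" "i < ?n" "j < ?n" for X Y :: "complex Matrix.mat" and i j
    using that by (auto simp: scalar_prod_def lessThan_atLeast0)
  have MA: "M $$ (g k, g l) = complex_of_real (A $ k $ l)" for k l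
    using gl by (simp add: M_def bg)
  define y where "y = (\<lambda>j. \<chi> l. P $$ (g l, j))"
  define \<xi> where "\<xi> = (\<lambda>i. \<chi> l. Q $$ (i, g l))"
  have B0: "B $$ (i, j) = 0" if "j < i" "i < ?n" for i j
    using ut that c by (auto simp: upper_triangular_def)
  show ?thesis
  proof (rule that[of \<xi> y "\<lambda>i j. B $$ (i, j)"])
    show "(\<Sum>l\<in>UNIV. \<xi> i $ l * y j $ l) = (if i = j then 1 else 0)" if "i < ?n" "j < ?n" for i j
    proof -
      have "(\<Sum>l\<in>UNIV. \<xi> i $ l * y j $ l) = (\<Sum>k<?n. Q $$ (i, k) * P $$ (k, j))"
        by (simp add: \<xi>_def y_def sumg[of "\<lambda>k. Q $$ (i, k) * P $$ (k, j)"])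
      also have "\<dots> = (Q * P) $$ (i, j)" using mm c that by simp
      finally show ?thesis using that by (simp add: PQ)
    qed
    show "(\<Sum>i<?n. y i $ l * \<xi> i $ k) = (if l = k then 1 else 0)" for l k
    proof -
      have "(\<Sum>i<?n. y i $ l * \<xi> i $ k) = (P * Q) $$ (g l, g k)"
        using mm c gl by (simp add: \<xi>_def y_def)
      then show ?thesis using gl by (simp add: PQ gi)
    qed
    show "(\<Sum>l\<in>UNIV. complex_of_real (A $ k $ l) * y j $ l) = (\<Sum>i\<le>j. B $$ (i, j) * y i $ k)"
      if j: "j < ?n" for j k
    proof -
      have "(\<Sum>l\<in>UNIV. complex_of_real (A $ k $ l) * y j $ l) = (M * P) $$ (g k, j)"
        using mm[OF Mc c(2) gl j] sumg[of "\<lambda>i. M $$ (g k, i) * P $$ (i, j)"] by (simp add: y_def MA)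
      also have "\<dots> = (\<Sum>i<?n. P $$ (g k, i) * B $$ (i, j))" unfolding MP using mm c gl j by simp
      also have "\<dots> = (\<Sum>i\<le>j. P $$ (g k, i) * B $$ (i, j))"
        using j B0 by (intro sum.mono_neutral_right) auto
      finally show ?thesis by (simp add: y_def mult.commute)
    qed
    show "(\<Sum>l\<in>UNIV. \<xi> i $ l * complex_of_real (A $ l $ k)) = (\<Sum>j\<in>{i..<?n}. B $$ (i, j) * \<xi> j $ k)"
      if i: "i < ?n" for i k
    proof -
      have "(\<Sum>l\<in>UNIV. \<xi> i $ l * complex_of_real (A $ l $ k)) = (Q * M) $$ (i, g k)"
        using mm[OF c(3) Mc i gl] sumg[of "\<lambda>j. Q $$ (i, j) * M $$ (j, g k)"] by (simp add: \<xi>_def MA)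
      also have "\<dots> = (\<Sum>j<?n. B $$ (i, j) * Q $$ (j, g k))" unfolding QM using mm c gl i by simp
      also have "\<dots> = (\<Sum>j\<in>{i..<?n}. B $$ (i, j) * Q $$ (j, g k))"
        using i B0 by (intro sum.mono_neutral_right) (auto simp: not_le)
      finally show ?thesis by (simp add: \<xi>_def)
    qed
    show "B $$ (j, j) = (if j = ?n - 1 then lam 1 else lam (j + 2))" if "j < ?n" for j
    proof -
      have "B $$ (j, j) = diag_mat B ! j" using that c by (simp add: diag_mat_def)
      then show ?thesis using that unfolding dg by (auto simp: es_def nth_append simp del: upt_Suc)
    qed
  qed
qed

text \<open>The flag is complex, but A is real: the real or the imaginary part of the left null
  vector \<xi>_(N-1) is a nonzero real left null vector u. It is a complex multiple of \<xi>_(N-1),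
  so it does not vanish on a real null vector v and can be scaled to l with l(v) = 1.\<close>

lemma nonresonant_linear_part:
  fixes A :: "real^'n^'n" and lam :: "nat \<Rightarrow> complex"
  assumes card: "CARD('n) \<ge> 2"
    and cp: "char_polynomial A = (\<Prod>i=1..CARD('n). [:- lam i, 1:])"
    and lam1: "lam 1 = 0"
    and nr: "\<forall>k :: nat \<Rightarrow> nat. (\<Sum>i=2..CARD('n). k i) \<ge> 2 \<longrightarrow>
           (\<Sum>i=2..CARD('n). of_nat (k i) * lam i) \<noteq> 0"
  obtains v l :: "'n \<Rightarrow> real" where
    "\<And>k. (\<Sum>j\<in>UNIV. A $ k $ j * v j) = 0" "\<And>k. (\<Sum>i\<in>UNIV. l i * A $ i $ k) = 0" "lin l v = 1"
    "\<And>x i. (\<And>k. (\<Sum>j\<in>UNIV. A $ k $ j * x j) = 0) \<Longrightarrow> lin l x = 0 \<Longrightarrow> x i = 0"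
    "\<And>c d. \<exists>h. \<forall>e. hpart (lieA (\<lambda>i j. A $ i $ j) h) d e = hpart c d e - hpart c d v * lin l e ^ d"
    "\<And>h d e. (\<And>e. hpart (lieA (\<lambda>i j. A $ i $ j) h) d e = 0) \<Longrightarrow> hpart h d v = 0 \<Longrightarrow> hpart h d e = 0"
proof -
  let ?N = "CARD('n)"
  have card1: "?N \<ge> 1" using card by simp
  obtain y' \<xi>' :: "nat \<Rightarrow> complex^'n" and T where
    d1: "\<And>i j. i < ?N \<Longrightarrow> j < ?N \<Longrightarrow> (\<Sum>l\<in>UNIV. \<xi>' i $ l * y' j $ l) = (if i = j then 1 else 0)" and
    d2: "\<And>l k. (\<Sum>i<?N. y' i $ l * \<xi>' i $ k) = (if l = k then 1 else 0)" and
    ay: "\<And>j k. j < ?N \<Longrightarrow> (\<Sum>l\<in>UNIV. complex_of_real (A $ k $ l) * y' j $ l) = (\<Sum>i\<le>j. T i j * y' i $ k)" and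
    xa: "\<And>i k. i < ?N \<Longrightarrow> (\<Sum>l\<in>UNIV. \<xi>' i $ l * complex_of_real (A $ l $ k)) = (\<Sum>j\<in>{i..<?N}. T i j * \<xi>' j $ k)" and
    tt: "\<And>j. j < ?N \<Longrightarrow> T j j = (if j = ?N - 1 then lam 1 else lam (j + 2))"
    by (rule triangular_form[OF card1 cp]) blast
  define y where "y = (\<lambda>j l. y' j $ l)"
  define \<xi> where "\<xi> = (\<lambda>j l. \<xi>' j $ l)"
  define Ac where "Ac = (\<lambda>i j. complex_of_real (A $ i $ j))"
  have nonres: "(\<Sum>j<?N - 1. of_nat (k j) * T j j) \<noteq> 0" if k: "(\<Sum>j<?N - 1. k j) \<ge> 1" for k :: "nat \<Rightarrow> nat"
  proof -
    have shift: "(\<Sum>i=2..?N. f i) = (\<Sum>j<?N - 1. f (j + 2))" for f :: "nat \<Rightarrow> 'z::comm_monoid_add"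
      by (rule sum.reindex_bij_witness[of _ "\<lambda>j. j + 2" "\<lambda>i. i - 2"])
         (auto intro!: arg_cong[where f = f])
    \<comment> \<open>The assumption concerns total degree at least 2. Doubling the exponents
      excludes a vanishing combination of total degree 1 too, so the remaining eigenvalues are
      nonzero.\<close>
    have "(\<Sum>i=2..?N. 2 * k (i - 2)) = 2 * (\<Sum>j<?N - 1. k j)"
      unfolding shift by (simp add: sum_distrib_left)
    then have "(\<Sum>i=2..?N. 2 * k (i - 2)) \<ge> 2" using k by simp
    then have "(\<Sum>i=2..?N. of_nat (2 * k (i - 2)) * lam i) \<noteq> 0" using nr by blast
    moreover have "(\<Sum>i=2..?N. of_nat (2 * k (i - 2)) * lam i) = 2 * (\<Sum>j<?N - 1. of_nat (k j) * T j j)"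
      unfolding shift sum_distrib_left by (intro sum.cong) (auto simp: tt)
    ultimately show ?thesis by auto
  qed
  interpret nonresonant_flag Ac y \<xi> T ?N
    by unfold_locales
       (use card1 d1 d2 ay xa nonres tt[of "?N - 1"] lam1 in \<open>simp_all add: y_def \<xi>_def Ac_def\<close>)
  let ?L = "\<xi> (?N - 1)"
  have L0: "(\<Sum>l\<in>UNIV. ?L l * Ac l k) = 0" for k
  proof -
    have "{?N - 1..<?N} = {?N - 1}" using card1 by auto
    then show ?thesis using \<xi>A[of "?N - 1" k] T0 card1 by simp
  qed
  have Re0: "(\<Sum>l\<in>UNIV. Re (?L l) * A $ l $ k) = 0" and Im0: "(\<Sum>l\<in>UNIV. Im (?L l) * A $ l $ k) = 0" for k
    using arg_cong[OF L0[of k], of Re] arg_cong[OF L0[of k], of Im] by (simp_all add: Ac_def)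
  have "?L \<noteq> (\<lambda>_. 0)"
  proof
    assume "?L = (\<lambda>_. 0)"
    then have "lin ?L (y (?N - 1)) = 0" by simp
    then show False using dual1[of "?N - 1" "?N - 1"] card1 by simp
  qed
  then obtain l0 where "?L l0 \<noteq> 0" by (auto simp: fun_eq_iff)
  then have "Re (?L l0) \<noteq> 0 \<or> Im (?L l0) \<noteq> 0" by (simp add: complex_eq_iff)
  then obtain u :: "'n \<Rightarrow> real" where u: "\<And>k. (\<Sum>i\<in>UNIV. u i * A $ i $ k) = 0" "u l0 \<noteq> 0"
  proof
    assume "Re (?L l0) \<noteq> 0"
    with Re0 show ?thesis by (intro that[of "\<lambda>i. Re (?L i)"])
  next
    assume "Im (?L l0) \<noteq> 0"
    with Im0 show ?thesis by (intro that[of "\<lambda>i. Im (?L i)"])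
  qed
  have "transpose A *v (\<chi> i. u i) = 0"
    using u(1) by (simp add: vec_eq_iff matrix_vector_mult_def transpose_def mult.commute zero_vec_def)
  moreover have "(\<chi> i. u i) \<noteq> 0" using u(2) by (auto simp: vec_eq_iff)
  ultimately have nu: "\<not> (\<forall>x. transpose A *v x = 0 \<longrightarrow> x = 0)" by blast
  \<comment> \<open>A left inverse of A would be two-sided, and its transpose would invert the
    transpose of A, which has the kernel vector u.\<close>
  have "\<not> (\<forall>x. A *v x = 0 \<longrightarrow> x = 0)"
  proof
    assume "\<forall>x. A *v x = 0 \<longrightarrow> x = 0"
    then obtain B where "B ** A = Finite_Cartesian_Product.mat 1"
      unfolding matrix_left_invertible_ker[symmetric] by blast
    then have "transpose (A ** B) = transpose (Finite_Cartesian_Product.mat 1)"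
      by (simp only: matrix_left_right_inverse)
    then have "transpose B ** transpose A = Finite_Cartesian_Product.mat 1"
      by (simp add: matrix_transpose_mul)
    then show False using nu matrix_left_invertible_ker by blast
  qed
  then obtain v0 where v0: "v0 \<noteq> 0" "A *v v0 = 0" by blast
  define v where "v = (\<lambda>i. v0 $ i)"
  have Av: "(\<Sum>j\<in>UNIV. A $ k $ j * v j) = 0" for k
    using arg_cong[OF v0(2), of "\<lambda>x. x $ k"] by (simp add: matrix_vector_mult_def v_def)
  define vc where "vc = (\<lambda>i. complex_of_real (v i))"
  have Avc: "(\<Sum>j\<in>UNIV. Ac k j * vc j) = 0" for k
    using arg_cong[OF Av[of k], of complex_of_real] by (simp add: Ac_def vc_def)
  have Lv: "lin ?L vc \<noteq> 0"
  proof
    assume "lin ?L vc = 0"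
    then have "vc i = 0" for i by (rule kernel_trivial[OF Avc])
    then have "v0 = 0" by (simp add: vec_eq_iff vc_def v_def)
    then show False using v0 by simp
  qed
  define c where "c = lin (\<lambda>i. complex_of_real (u i)) (y (?N - 1))"
  have "(\<Sum>l\<in>UNIV. complex_of_real (u l) * Ac l k) = 0" for k
    using arg_cong[OF u(1)[of k], of complex_of_real] by (simp add: Ac_def)
  then have uc: "complex_of_real (u k) = c * ?L k" for k
    unfolding c_def by (rule left_kernel)
  have c0: "c \<noteq> 0" using uc[of l0] u(2) by auto
  have lin_u: "complex_of_real (lin u x) = c * lin ?L (\<lambda>i. complex_of_real (x i))" for x
    by (simp add: uc sum_distrib_left mult.assoc)
  have uv: "lin u v \<noteq> 0"
  proof
    assume "lin u v = 0"
    then have "c * lin ?L vc = 0" unfolding vc_def lin_u[symmetric] by (simp only: of_real_0)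
    then show False using c0 Lv by simp
  qed
  define l where "l = (\<lambda>i. u i / lin u v)"
  have lin_l: "lin l x = lin u x / lin u v" for x
    by (simp add: l_def sum_divide_distrib)
  have lv: "lin l v = 1" using uv lin_l[of v] by simp
  have lin_L: "lin ?L (\<lambda>i. complex_of_real (x i)) = complex_of_real (lin l x) * lin ?L vc" for x
  proof -
    have "c * lin ?L (\<lambda>i. complex_of_real (x i)) = complex_of_real (lin u x)"
      by (rule lin_u[symmetric])
    also have "\<dots> = complex_of_real (lin l x) * complex_of_real (lin u v)"
    proof -
      have "lin u x = lin l x * lin u v" using uv by (simp add: lin_l)
      then show ?thesis by (simp only: of_real_mult[symmetric])
    qed
    also have "\<dots> = c * (complex_of_real (lin l x) * lin ?L vc)" by (simp only: lin_u vc_def mult_ac)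
    finally show ?thesis using c0 by simp
  qed
  show ?thesis
  proof (rule that[OF Av _ lv])
    show "(\<Sum>i\<in>UNIV. l i * A $ i $ k) = 0" for k
      using u(1)[of k] by (simp add: l_def sum_divide_distrib[symmetric])
  next
    fix x :: "'n \<Rightarrow> real" and i
    assume x: "\<And>k. (\<Sum>j\<in>UNIV. A $ k $ j * x j) = 0" "lin l x = 0"
    have "(\<Sum>j\<in>UNIV. Ac k j * complex_of_real (x j)) = 0" for k
      using arg_cong[OF x(1)[of k], of complex_of_real] by (simp add: Ac_def)
    then have "complex_of_real (x i) = 0"
      by (rule kernel_trivial[where x = "\<lambda>i. complex_of_real (x i)"]) (simp only: lin_L x(2) of_real_0 mult_zero_left)
    then show "x i = 0" by simp
  next
    fix g :: "nat^'n \<Rightarrow> real" and d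
    define gc where "gc = (\<lambda>\<alpha>. complex_of_real (g \<alpha>))"
    obtain h \<kappa> where h: "\<And>e. hpart (lieA Ac h) d e + \<kappa> * lin ?L e ^ d = hpart gc d e"
      using surjective_mod_power[of d gc] by blast
    \<comment> \<open>At v the field A x vanishes and so does every derivative along it; evaluation
      there determines \<kappa>.\<close>
    have "hpart (lieA Ac h) d vc = 0"
    proof (cases d)
      case (Suc d')
      then show ?thesis by (simp add: hpart_lieA_Suc Avc)
    qed simp
    then have \<kappa>: "\<kappa> * lin ?L vc ^ d = complex_of_real (hpart g d v)"
      using h[of vc] by (simp add: gc_def vc_def hpart_of_real)
    have "hpart (lieA (\<lambda>i j. A $ i $ j) (\<lambda>\<alpha>. Re (h \<alpha>))) d e = hpart g d e - hpart g d v * lin l e ^ d" for e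
    proof -
      have "hpart (lieA Ac h) d (\<lambda>i. complex_of_real (e i))
          = complex_of_real (hpart g d e) - \<kappa> * (complex_of_real (lin l e) * lin ?L vc) ^ d"
        using h[of "\<lambda>i. complex_of_real (e i)"] by (simp only: gc_def hpart_of_real lin_L) (simp add: algebra_simps)
      also have "\<kappa> * (complex_of_real (lin l e) * lin ?L vc) ^ d = complex_of_real (lin l e) ^ d * (\<kappa> * lin ?L vc ^ d)"
        by (simp only: power_mult_distrib mult_ac)
      also have "\<dots> = complex_of_real (lin l e ^ d * hpart g d v)" by (simp only: \<kappa> of_real_mult of_real_power)
      finally have "Re (hpart (lieA Ac h) d (\<lambda>i. complex_of_real (e i))) = hpart g d e - lin l e ^ d * hpart g d v"
        by (simp only: of_real_diff[symmetric] Re_complex_of_real)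
      then show ?thesis unfolding Re_hpart Ac_def Re_lieA by (simp only: mult.commute)
    qed
    then show "\<exists>h. \<forall>e. hpart (lieA (\<lambda>i j. A $ i $ j) h) d e = hpart g d e - hpart g d v * lin l e ^ d"
      by blast
  next
    fix h :: "nat^'n \<Rightarrow> real" and d e
    assume z: "\<And>e. hpart (lieA (\<lambda>i j. A $ i $ j) h) d e = 0" and hv: "hpart h d v = 0"
    have "lieA Ac (\<lambda>\<alpha>. complex_of_real (h \<alpha>)) \<alpha> = 0" if "mdeg \<alpha> = d" for \<alpha>
      using hpart_eq_0_imp_coeff_0[OF z that] by (simp add: Ac_def lieA_of_real)
    then have "hpart (lieA Ac (\<lambda>\<alpha>. complex_of_real (h \<alpha>))) d e' = hpart (\<lambda>_. 0) d e'" for e'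
      by (intro hpart_cong)
    then have lz: "hpart (lieA Ac (\<lambda>\<alpha>. complex_of_real (h \<alpha>))) d e' = 0" for e' by simp
    have "hpart (\<lambda>\<alpha>. complex_of_real (h \<alpha>)) d vc = 0" by (simp add: vc_def hpart_of_real hv)
    with lz have "hpart (\<lambda>\<alpha>. complex_of_real (h \<alpha>)) d (\<lambda>i. complex_of_real (e i)) = 0"
      by (rule injective_mod_v[OF Avc Lv])
    then show "hpart h d e = 0" by (simp add: hpart_of_real)
  qed
qed

section \<open>Truncated weighted norms of power series in one variable\<close>

text \<open>A weighted absolute sum, cut off at degree m so that it is finite for every formal
  series. It is submultiplicative at each fixed m.\<close>

definition tnorm :: "real \<Rightarrow> nat \<Rightarrow> complex fps \<Rightarrow> real" where
  "tnorm \<epsilon> m f = (\<Sum>i\<le>m. cmod (fps_nth f i) * \<epsilon> ^ i)"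

lemma tnorm_nonneg: "\<epsilon> \<ge> 0 \<Longrightarrow> tnorm \<epsilon> m f \<ge> 0"
  unfolding tnorm_def by (intro sum_nonneg) auto

lemma tnorm_diff: "\<epsilon> \<ge> 0 \<Longrightarrow> tnorm \<epsilon> m (f - g) \<le> tnorm \<epsilon> m f + tnorm \<epsilon> m g"
  unfolding tnorm_def sum.distrib[symmetric] distrib_right[symmetric]
  by (intro sum_mono mult_right_mono) (auto intro: norm_triangle_ineq4)

lemma tnorm_sum: "\<epsilon> \<ge> 0 \<Longrightarrow> tnorm \<epsilon> m (\<Sum>l\<in>I. f l) \<le> (\<Sum>l\<in>I. tnorm \<epsilon> m (f l))"
proof -
  assume e: "\<epsilon> \<ge> 0"
  have "tnorm \<epsilon> m (\<Sum>l\<in>I. f l) \<le> (\<Sum>i\<le>m. \<Sum>l\<in>I. cmod (fps_nth (f l) i) * \<epsilon> ^ i)"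
    unfolding tnorm_def sum_distrib_right[symmetric] fps_sum_nth using e
    by (intro sum_mono mult_right_mono norm_sum) auto
  also have "\<dots> = (\<Sum>l\<in>I. tnorm \<epsilon> m (f l))" unfolding tnorm_def by (rule sum.swap)
  finally show ?thesis .
qed

lemma convolution_sum_le:
  fixes a b :: "nat \<Rightarrow> real"
  assumes "\<And>i. a i \<ge> 0" "\<And>i. b i \<ge> 0"
  shows "(\<Sum>i\<le>m. \<Sum>k\<le>i. a k * b (i - k)) \<le> (\<Sum>k\<le>m. a k) * (\<Sum>k\<le>m. b k)"
proof -
  have "(\<Sum>i\<le>m. \<Sum>k\<le>i. a k * b (i - k)) = (\<Sum>(i, k)\<in>(SIGMA i:{..m}. {..i}). a k * b (i - k))"
    by (subst sum.Sigma) auto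
  also have "\<dots> = (\<Sum>(k, l)\<in>{(k, l). k + l \<le> m}. a k * b l)"
    by (rule sum.reindex_bij_witness[of _ "\<lambda>(k, l). (k + l, k)" "\<lambda>(i, k). (k, i - k)"]) auto
  also have "\<dots> \<le> (\<Sum>(k, l)\<in>{..m} \<times> {..m}. a k * b l)"
    using assms by (intro sum_mono2) auto
  also have "\<dots> = (\<Sum>k\<le>m. a k) * (\<Sum>k\<le>m. b k)"
    by (simp add: sum_product sum.cartesian_product)
  finally show ?thesis .
qed

lemma tnorm_mult: assumes "\<epsilon> \<ge> 0" shows "tnorm \<epsilon> m (f * g) \<le> tnorm \<epsilon> m f * tnorm \<epsilon> m g"
proof -
  have "tnorm \<epsilon> m (f * g) \<le> (\<Sum>i\<le>m. \<Sum>k\<le>i. (cmod (fps_nth f k) * \<epsilon> ^ k) * (cmod (fps_nth g (i - k)) * \<epsilon> ^ (i - k)))"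
    unfolding tnorm_def
  proof (intro sum_mono)
    fix i
    have "cmod (fps_nth (f * g) i) \<le> (\<Sum>k\<le>i. cmod (fps_nth f k) * cmod (fps_nth g (i - k)))"
      unfolding fps_mult_nth atLeast0AtMost norm_mult[symmetric] by (rule norm_sum)
    then have "cmod (fps_nth (f * g) i) * \<epsilon> ^ i \<le> (\<Sum>k\<le>i. cmod (fps_nth f k) * cmod (fps_nth g (i - k))) * \<epsilon> ^ i"
      using assms by (intro mult_right_mono) auto
    also have "\<dots> = (\<Sum>k\<le>i. (cmod (fps_nth f k) * \<epsilon> ^ k) * (cmod (fps_nth g (i - k)) * \<epsilon> ^ (i - k)))"
      unfolding sum_distrib_right
    proof (intro sum.cong refl)
      fix k assume "k \<in> {..i}"
      then have "\<epsilon> ^ i = \<epsilon> ^ k * \<epsilon> ^ (i - k)" by (simp flip: power_add)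
      then show "cmod (fps_nth f k) * cmod (fps_nth g (i - k)) * \<epsilon> ^ i
          = (cmod (fps_nth f k) * \<epsilon> ^ k) * (cmod (fps_nth g (i - k)) * \<epsilon> ^ (i - k))" by simp
    qed
    finally show "cmod (fps_nth (f * g) i) * \<epsilon> ^ i
        \<le> (\<Sum>k\<le>i. (cmod (fps_nth f k) * \<epsilon> ^ k) * (cmod (fps_nth g (i - k)) * \<epsilon> ^ (i - k)))" .
  qed
  also have "\<dots> \<le> tnorm \<epsilon> m f * tnorm \<epsilon> m g"
    unfolding tnorm_def using assms by (intro convolution_sum_le) auto
  finally show ?thesis .
qed

text \<open>Read from right to left, this is the price of dividing by the q-th power of the
  variable: a factor \<epsilon>^(-q), and q more terms in the truncation.\<close>

lemma tnorm_X_power_mult: "tnorm \<epsilon> (m + q) (fps_X ^ q * f) = \<epsilon> ^ q * tnorm \<epsilon> m f"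
proof -
  have "tnorm \<epsilon> (m + q) (fps_X ^ q * f) = (\<Sum>i\<in>{q..m + q}. cmod (fps_nth f (i - q)) * \<epsilon> ^ i)"
    unfolding tnorm_def by (rule sum.mono_neutral_cong_right) (auto simp: fps_X_power_mult_nth)
  also have "\<dots> = (\<Sum>i\<le>m. cmod (fps_nth f i) * \<epsilon> ^ (i + q))"
    by (rule sum.reindex_bij_witness[of _ "\<lambda>i. i + q" "\<lambda>i. i - q"]) auto
  also have "\<dots> = \<epsilon> ^ q * tnorm \<epsilon> m f"
    unfolding tnorm_def sum_distrib_left by (intro sum.cong) (auto simp: power_add mult_ac)
  finally show ?thesis .
qed

lemma geometric_sum_le_2:
  fixes x :: real assumes "0 \<le> x" "x \<le> 1/2" shows "(\<Sum>i\<le>m. x ^ i) \<le> 2"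
proof -
  have "(\<Sum>i\<le>m. x ^ i) \<le> (\<Sum>i\<le>m. (1/2) ^ i)" using assms by (intro sum_mono power_mono) auto
  also have "\<dots> = 2 - (1/2) ^ m" by (induction m) auto
  also have "\<dots> \<le> 2" by simp
  finally show ?thesis .
qed

lemma tnorm_geometric:
  assumes "\<And>i. cmod (fps_nth f i) \<le> c / \<rho> ^ i" "0 \<le> \<epsilon>" "\<epsilon> \<le> \<rho> / 2" "\<rho> > 0" "c \<ge> 0"
  shows "tnorm \<epsilon> m f \<le> 2 * c"
proof -
  have "tnorm \<epsilon> m f \<le> (\<Sum>i\<le>m. c * (\<epsilon> / \<rho>) ^ i)"
    unfolding tnorm_def
  proof (intro sum_mono)
    fix i
    have "cmod (fps_nth f i) * \<epsilon> ^ i \<le> c / \<rho> ^ i * \<epsilon> ^ i" using assms by (intro mult_right_mono) auto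
    then show "cmod (fps_nth f i) * \<epsilon> ^ i \<le> c * (\<epsilon> / \<rho>) ^ i" by (simp add: power_divide)
  qed
  also have "\<dots> = c * (\<Sum>i\<le>m. (\<epsilon> / \<rho>) ^ i)" by (simp add: sum_distrib_left)
  also have "\<dots> \<le> c * 2" using assms by (intro mult_left_mono geometric_sum_le_2) (auto simp: field_simps)
  finally show ?thesis by simp
qed

text \<open>The inverse of a convergent series with nonzero constant term converges near 0; its
  absolute sum at any radius below the radius of convergence dominates every truncation, uniformly
  in m.\<close>

lemma tnorm_inverse_bounded:
  assumes f: "\<And>i. cmod (fps_nth f i) \<le> c / \<rho> ^ i" and \<rho>: "\<rho> > 0" and f0: "fps_nth f 0 \<noteq> 0"
  obtains e u where "e > 0" "u \<ge> 0" "\<And>\<epsilon> m. 0 \<le> \<epsilon> \<Longrightarrow> \<epsilon> \<le> e \<Longrightarrow> tnorm \<epsilon> m (inverse f) \<le> u"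
proof -
  have "summable (\<lambda>i. fps_nth f i * complex_of_real (\<rho> / 2) ^ i)"
  proof (rule summable_comparison_test')
    show "summable (\<lambda>i. c * (1/2) ^ i)" by (intro summable_mult summable_geometric) auto
    fix i :: nat
    have "norm (fps_nth f i * complex_of_real (\<rho> / 2) ^ i) = cmod (fps_nth f i) * (\<rho> / 2) ^ i"
      using \<rho> by (simp add: norm_mult norm_power)
    also have "\<dots> \<le> c / \<rho> ^ i * (\<rho> / 2) ^ i" using \<rho> f by (intro mult_right_mono) auto
    also have "\<dots> = c * (1/2) ^ i" using \<rho> by (simp add: power_divide)
    finally show "norm (fps_nth f i * complex_of_real (\<rho> / 2) ^ i) \<le> c * (1/2) ^ i" .
  qed
  then have "fps_conv_radius f \<ge> norm (complex_of_real (\<rho> / 2))"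
    unfolding fps_conv_radius_def by (rule conv_radius_geI)
  moreover have "ereal (norm (complex_of_real (\<rho> / 2))) > 0" using \<rho> by simp
  ultimately have "fps_conv_radius f > 0" by (rule less_le_trans[rotated])
  then have pos: "fps_conv_radius (inverse f) > 0" by (rule fps_conv_radius_inverse_pos[OF f0])
  then obtain e where e: "0 < ereal e" "ereal e < fps_conv_radius (inverse f)"
    using ereal_dense2 by blast
  have e0: "e > 0" using e by simp
  have "summable (\<lambda>i. norm (fps_nth (inverse f) i * complex_of_real e ^ i))"
    using e e0 by (intro abs_summable_in_conv_radius) (simp add: fps_conv_radius_def)
  then have s: "summable (\<lambda>i. cmod (fps_nth (inverse f) i) * e ^ i)"
    using e0 by (simp add: norm_mult norm_power)
  show ?thesis
  proof (rule that[OF e0])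
    show "suminf (\<lambda>i. cmod (fps_nth (inverse f) i) * e ^ i) \<ge> 0" using e0 by (intro suminf_nonneg s) auto
    fix \<epsilon> m assume \<epsilon>: "0 \<le> \<epsilon>" "\<epsilon> \<le> e"
    have "tnorm \<epsilon> m (inverse f) \<le> (\<Sum>i\<le>m. cmod (fps_nth (inverse f) i) * e ^ i)"
      unfolding tnorm_def using \<epsilon> by (intro sum_mono mult_left_mono power_mono) auto
    also have "\<dots> \<le> suminf (\<lambda>i. cmod (fps_nth (inverse f) i) * e ^ i)"
      using e0 by (intro sum_le_suminf s) auto
    finally show "tnorm \<epsilon> m (inverse f) \<le> suminf (\<lambda>i. cmod (fps_nth (inverse f) i) * e ^ i)" .
  qed
qed

section \<open>Solving \<open>\<phi> \<circ> G = F\<close> for a convergent \<open>G\<close>\<close>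

text \<open>The series in s of the l-th derivative of \<phi> divided by l factorial, so that
  \<phi>(s + h) is the sum of \<open>taylor_shift \<phi> l\<close> times the l-th power of
  h.\<close>

definition taylor_shift :: "(nat \<Rightarrow> complex) \<Rightarrow> nat \<Rightarrow> complex fps" where
  "taylor_shift \<phi> l = Abs_fps (\<lambda>i. of_nat ((l + i) choose l) * \<phi> (l + i))"

lemma fps_power_nth_0_eq_0: "fps_nth h 0 = 0 \<Longrightarrow> j < l \<Longrightarrow> fps_nth (h ^ l) j = (0 :: 'a::comm_ring_1)"
  using startsby_zero_power_prefix by blast

text \<open>The inner variable is s, the outer one u, and G reduces to s at u = 0. Every term of G
  has positive total degree, so only k <= i + j matters at u^j s^i. Regrouping the binomial
  expansion of (s + h)^k by powers of h yields a sum over l <= j only, as h is divisible by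
  u.\<close>

lemma composition_expansion:
  fixes G :: "complex fps fps"
  assumes G0: "fps_nth G 0 = fps_X"
    and F: "fps_nth (fps_nth F j) i = (\<Sum>k\<le>i + j. \<phi> k * fps_nth (fps_nth (G ^ k) j) i)"
  shows "fps_nth (fps_nth F j) i
    = fps_nth (\<Sum>l\<le>j. taylor_shift \<phi> l * fps_nth ((G - fps_const fps_X) ^ l) j) i"
proof -
  define h where "h = G - fps_const fps_X"
  have h0: "fps_nth h 0 = 0" by (simp add: h_def G0)
  have G: "G = fps_const fps_X + h" by (simp add: h_def)
  have Gk: "fps_nth (fps_nth (G ^ k) j) i
     = (\<Sum>l\<le>k. of_nat (k choose l) * (if i < k - l then 0 else fps_nth (fps_nth (h ^ l) j) (i - (k - l))))" for k
  proof -
    have "G ^ k = (\<Sum>l\<le>k. of_nat (k choose l) * h ^ l * fps_const (fps_X ^ (k - l)))"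
      unfolding G by (subst add.commute) (simp add: binomial_ring fps_const_power)
    also have "\<dots> = (\<Sum>l\<le>k. fps_const (fps_X ^ (k - l) * of_nat (k choose l)) * h ^ l)"
      by (intro sum.cong) (auto simp: fps_of_nat[symmetric] mult_ac simp flip: fps_const_mult)
    finally have "fps_nth (G ^ k) j = (\<Sum>l\<le>k. fps_X ^ (k - l) * of_nat (k choose l) * fps_nth (h ^ l) j)"
      by (simp add: fps_sum_nth)
    also have "\<dots> = (\<Sum>l\<le>k. fps_X ^ (k - l) * (fps_const (of_nat (k choose l)) * fps_nth (h ^ l) j))"
      by (simp add: fps_of_nat mult.assoc)
    finally show ?thesis
      by (simp add: fps_sum_nth fps_X_power_mult_nth if_distrib cong: if_cong)
  qed
  have hl: "fps_nth (h ^ l) j = 0" if "j < l" for l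
    using fps_power_nth_0_eq_0[OF h0 that] .
  have "fps_nth (fps_nth F j) i = (\<Sum>k\<le>i + j. \<Sum>l\<le>k. \<phi> k * (of_nat (k choose l) *
      (if i < k - l then 0 else fps_nth (fps_nth (h ^ l) j) (i - (k - l)))))"
    unfolding F Gk sum_distrib_left ..
  also have "\<dots> = (\<Sum>(k, l)\<in>(SIGMA k:{..i + j}. {..k}). \<phi> k * (of_nat (k choose l) *
      (if i < k - l then 0 else fps_nth (fps_nth (h ^ l) j) (i - (k - l)))))"
    by (subst sum.Sigma) auto
  also have "\<dots> = (\<Sum>(k, l)\<in>{(k, l). l \<le> j \<and> l \<le> k \<and> k - l \<le> i}. \<phi> k * (of_nat (k choose l) *
      (if i < k - l then 0 else fps_nth (fps_nth (h ^ l) j) (i - (k - l)))))"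
  proof (rule sum.mono_neutral_right)
    show "\<forall>x\<in>(SIGMA k:{..i + j}. {..k}) - {(k, l). l \<le> j \<and> l \<le> k \<and> k - l \<le> i}.
        (case x of (k, l) \<Rightarrow> \<phi> k * (of_nat (k choose l) *
          (if i < k - l then 0 else fps_nth (fps_nth (h ^ l) j) (i - (k - l))))) = 0"
    proof
      fix x assume "x \<in> (SIGMA k:{..i + j}. {..k}) - {(k, l). l \<le> j \<and> l \<le> k \<and> k - l \<le> i}"
      then obtain k l where "x = (k, l)" "j < l \<or> i < k - l" by force
      then show "(case x of (k, l) \<Rightarrow> \<phi> k * (of_nat (k choose l) *
          (if i < k - l then 0 else fps_nth (fps_nth (h ^ l) j) (i - (k - l))))) = 0"
        using hl by auto
    qed
  qed auto
  also have "\<dots> = (\<Sum>(l, a)\<in>{..j} \<times> {..i}. of_nat ((l + a) choose l) * \<phi> (l + a) * fps_nth (fps_nth (h ^ l) j) (i - a))"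
    by (rule sum.reindex_bij_witness[of _ "\<lambda>(l, a). (l + a, l)" "\<lambda>(k, l). (l, k - l)"]) auto
  also have "\<dots> = (\<Sum>l\<le>j. \<Sum>a\<le>i. of_nat ((l + a) choose l) * \<phi> (l + a) * fps_nth (fps_nth (h ^ l) j) (i - a))"
    by (simp add: sum.cartesian_product)
  also have "\<dots> = fps_nth (\<Sum>l\<le>j. taylor_shift \<phi> l * fps_nth (h ^ l) j) i"
    by (simp add: fps_sum_nth fps_mult_nth taylor_shift_def atLeast0AtMost)
  finally show ?thesis unfolding h_def .
qed

text \<open>Bounding the binomial coefficient by 2^(l+i) halves the radius \<rho>, and \<epsilon> <=
  \<rho>/4 is half of what is left, so the geometric series costs a factor 2.\<close>

lemma tnorm_taylor_shift:
  assumes \<phi>: "\<And>k. cmod (\<phi> k) \<le> C / \<rho> ^ k" and \<rho>: "\<rho> > 0" and C: "C \<ge> 0" and \<epsilon>: "0 \<le> \<epsilon>" "\<epsilon> \<le> \<rho> / 4"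
  shows "tnorm \<epsilon> m (taylor_shift \<phi> l) \<le> 2 * (C * (2 / \<rho>) ^ l)"
proof (rule tnorm_geometric[where \<rho> = "\<rho> / 2"])
  fix i
  have b: "real ((l + i) choose l) \<le> 2 ^ (l + i)"
    using binomial_le_pow2[of "l + i" l] by (metis of_nat_le_iff of_nat_numeral of_nat_power)
  have "cmod (fps_nth (taylor_shift \<phi> l) i) \<le> 2 ^ (l + i) * (C / \<rho> ^ (l + i))"
    unfolding taylor_shift_def fps_nth_Abs_fps norm_mult norm_of_nat by (intro mult_mono b \<phi>) auto
  also have "\<dots> = C * (2 / \<rho>) ^ l / (\<rho> / 2) ^ i" by (simp add: power_add power_divide)
  finally show "cmod (fps_nth (taylor_shift \<phi> l) i) \<le> C * (2 / \<rho>) ^ l / (\<rho> / 2) ^ i" .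
qed (use assms in auto)

text \<open>This closes the recursion in u: since h has no term in u^0, each factor in a product of
  at least two contributes only up to u^n to the coefficients up to u^(n+1).\<close>

lemma graded_power_bound:
  fixes h :: "complex fps fps"
  assumes h0: "fps_nth h 0 = 0" and \<epsilon>: "\<epsilon> \<ge> 0" and \<delta>: "\<delta> \<ge> 0" and l: "l \<ge> 2"
  shows "(\<Sum>j\<le>Suc n. tnorm \<epsilon> m (fps_nth (h ^ l) j) * \<delta> ^ j) \<le> (\<Sum>j\<le>n. tnorm \<epsilon> m (fps_nth h j) * \<delta> ^ j) ^ l"
proof -
  have t0: "tnorm \<epsilon> m f \<ge> 0" for f using \<epsilon> by (rule tnorm_nonneg)
  have conv: "tnorm \<epsilon> m (fps_nth (f * g) j) * \<delta> ^ j
      \<le> (\<Sum>k\<le>j. (tnorm \<epsilon> m (fps_nth f k) * \<delta> ^ k) * (tnorm \<epsilon> m (fps_nth g (j - k)) * \<delta> ^ (j - k)))" for f g :: "complex fps fps" and j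
  proof -
    have "tnorm \<epsilon> m (fps_nth (f * g) j) \<le> (\<Sum>k\<le>j. tnorm \<epsilon> m (fps_nth f k) * tnorm \<epsilon> m (fps_nth g (j - k)))"
      unfolding fps_mult_nth atLeast0AtMost
      by (rule order_trans[OF tnorm_sum[OF \<epsilon>]]) (intro sum_mono tnorm_mult \<epsilon>)
    then have "tnorm \<epsilon> m (fps_nth (f * g) j) * \<delta> ^ j \<le> (\<Sum>k\<le>j. tnorm \<epsilon> m (fps_nth f k) * tnorm \<epsilon> m (fps_nth g (j - k))) * \<delta> ^ j"
      using \<delta> by (intro mult_right_mono) auto
    also have "\<dots> = (\<Sum>k\<le>j. (tnorm \<epsilon> m (fps_nth f k) * \<delta> ^ k) * (tnorm \<epsilon> m (fps_nth g (j - k)) * \<delta> ^ (j - k)))"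
      unfolding sum_distrib_right
    proof (intro sum.cong refl)
      fix k assume "k \<in> {..j}"
      then have "\<delta> ^ j = \<delta> ^ k * \<delta> ^ (j - k)" by (simp flip: power_add)
      then show "tnorm \<epsilon> m (fps_nth f k) * tnorm \<epsilon> m (fps_nth g (j - k)) * \<delta> ^ j
        = (tnorm \<epsilon> m (fps_nth f k) * \<delta> ^ k) * (tnorm \<epsilon> m (fps_nth g (j - k)) * \<delta> ^ (j - k))" by simp
    qed
    finally show ?thesis .
  qed
  define S where "S = (\<lambda>f. \<Sum>j\<le>n. tnorm \<epsilon> m (fps_nth f j) * \<delta> ^ j)"
  have S0: "S f \<ge> 0" for f unfolding S_def using t0 \<delta> by (intro sum_nonneg) auto
  have S_mult: "S (f * g) \<le> S f * S g" for f g
    unfolding S_def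
    by (rule order_trans[OF sum_mono[OF conv] convolution_sum_le]) (use t0 \<delta> in auto)
  have S_mult_Suc: "(\<Sum>j\<le>Suc n. tnorm \<epsilon> m (fps_nth (f * g) j) * \<delta> ^ j) \<le> S f * S g"
    if f0: "fps_nth f 0 = 0" and g0: "fps_nth g 0 = 0" for f g
  proof -
    define a where "a = (\<lambda>k. if k \<le> n then tnorm \<epsilon> m (fps_nth f k) * \<delta> ^ k else 0)"
    define b where "b = (\<lambda>k. if k \<le> n then tnorm \<epsilon> m (fps_nth g k) * \<delta> ^ k else 0)"
    have z: "tnorm \<epsilon> m 0 = 0" by (simp add: tnorm_def)
    have "(\<Sum>j\<le>Suc n. tnorm \<epsilon> m (fps_nth (f * g) j) * \<delta> ^ j) \<le> (\<Sum>j\<le>Suc n. \<Sum>k\<le>j. a k * b (j - k))"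
    proof (intro sum_mono order_trans[OF conv])
      fix j k assume jk: "j \<in> {..Suc n}" "k \<in> {..j}"
      show "(tnorm \<epsilon> m (fps_nth f k) * \<delta> ^ k) * (tnorm \<epsilon> m (fps_nth g (j - k)) * \<delta> ^ (j - k)) \<le> a k * b (j - k)"
      proof (cases "k = 0 \<or> k = j")
        case True
        then show ?thesis using f0 g0 z t0 \<delta> by (auto simp: a_def b_def)
      next
        case False
        then have "k \<le> n" "j - k \<le> n" using jk by auto
        then show ?thesis by (simp add: a_def b_def)
      qed
    qed
    also have "\<dots> \<le> (\<Sum>k\<le>Suc n. a k) * (\<Sum>k\<le>Suc n. b k)"
      by (rule convolution_sum_le) (use t0 \<delta> in \<open>auto simp: a_def b_def\<close>)
    also have "\<dots> = S f * S g" by (simp add: a_def b_def S_def)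
    finally show ?thesis .
  qed
  have S_pow: "S (h ^ Suc p) \<le> S h ^ Suc p" for p
  proof (induction p)
    case (Suc p)
    have "S (h ^ Suc (Suc p)) \<le> S h * S (h ^ Suc p)" using S_mult[of h "h ^ Suc p"] by simp
    also have "\<dots> \<le> S h * S h ^ Suc p" by (intro mult_left_mono Suc S0)
    finally show ?case by simp
  qed simp
  obtain p where p: "l = Suc (Suc p)" using l by (metis add_2_eq_Suc le_Suc_ex)
  have "(\<Sum>j\<le>Suc n. tnorm \<epsilon> m (fps_nth (h ^ l) j) * \<delta> ^ j) \<le> S h * S (h ^ Suc p)"
    unfolding p power_Suc[of h "Suc p"] by (rule S_mult_Suc) (simp_all add: h0)
  also have "\<dots> \<le> S h * S h ^ Suc p" by (intro mult_left_mono S_pow S0)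
  finally show ?thesis by (simp add: p S_def)
qed

lemma sum_shift_power2:
  fixes c z :: real
  shows "(\<Sum>l\<in>{2..Suc (Suc n)}. c * z ^ l) = c * z\<^sup>2 * (\<Sum>l\<le>n. z ^ l)"
proof -
  have "c * z\<^sup>2 * (\<Sum>l\<le>n. z ^ l) = (\<Sum>l\<le>n. c * (z\<^sup>2 * z ^ l))"
    by (simp add: sum_distrib_left mult.assoc)
  also have "\<dots> = (\<Sum>l\<in>{2..Suc (Suc n)}. c * z ^ l)"
    by (rule sum.reindex_bij_witness[of _ "\<lambda>l. l - 2" "\<lambda>l. l + 2"])
       (auto simp: power2_eq_square mult.assoc)
  finally show ?thesis by simp
qed

text \<open>
  With \<open>h = G - s\<close>, Taylor expansion at \<open>s\<close> gives \<open>F = \<phi>(s) + \<phi>'(s) h + O(h\<^sup>2)\<close>. The order \<open>q\<close> of vanishing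
  of \<open>\<phi>'\<close> at \<open>0\<close> may be positive, so that every step of the recursion for \<open>h\<close> loses \<open>q\<close> powers of \<open>s\<close>;
  this is absorbed by working with truncations in \<open>s\<close> whose length shrinks along the recursion.
\<close>

lemma composition_root_bound:
  fixes \<phi> :: "nat \<Rightarrow> complex"
  assumes \<phi>: "\<And>k. cmod (\<phi> k) \<le> C / \<rho> ^ k" and \<rho>: "\<rho> > 0" and C: "C \<ge> 0" and nz: "\<phi> k0 \<noteq> 0" "k0 \<ge> 1"
  obtains \<eta> \<delta> where "\<eta> > 0" "\<delta> > 0"
    "\<And>G F j. fps_nth G 0 = fps_X \<Longrightarrow>
        (\<And>i j. cmod (fps_nth (fps_nth F j) i) \<le> C / \<rho> ^ (i + j)) \<Longrightarrow>
        (\<And>i j. fps_nth (fps_nth F j) i = (\<Sum>k\<le>i + j. \<phi> k * fps_nth (fps_nth (G ^ k) j) i)) \<Longrightarrow>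
        j \<ge> 1 \<Longrightarrow> cmod (fps_nth (fps_nth G j) 0) \<le> \<eta> / \<delta> ^ j"
proof -
  define P where "P = taylor_shift \<phi> 1"
  have Pn: "fps_nth P i = of_nat (Suc i) * \<phi> (Suc i)" for i by (simp add: P_def taylor_shift_def)
  have P0: "P \<noteq> 0"
  proof
    assume "P = 0"
    then have "fps_nth P (k0 - 1) = 0" by simp
    then show False using nz by (simp add: Pn del: of_nat_Suc)
  qed
  define q where "q = subdegree P"
  define U where "U = fps_shift q P"
  have PU: "P = fps_X ^ q * U" unfolding U_def q_def by (metis mult.commute subdegree_decompose)
  have U0: "fps_nth U 0 \<noteq> 0" using P0 by (simp add: U_def q_def nth_subdegree_nonzero)
  have Ub: "cmod (fps_nth U i) \<le> (C * (2 / \<rho>) ^ Suc q) / (\<rho> / 2) ^ i" for i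
  proof -
    have "real (Suc (i + q)) \<le> 2 ^ Suc (i + q)"
      using of_nat_less_two_power[of "Suc (i + q)", where 'a = real] by linarith
    then have "cmod (fps_nth U i) \<le> 2 ^ Suc (i + q) * (C / \<rho> ^ Suc (i + q))"
      unfolding U_def fps_shift_nth Pn norm_mult norm_of_nat by (intro mult_mono \<phi>) auto
    also have "\<dots> = (C * (2 / \<rho>) ^ Suc q) / (\<rho> / 2) ^ i" by (simp add: power_add power_divide mult_ac)
    finally show ?thesis .
  qed
  obtain e u where e: "e > 0" and u: "u \<ge> 0" "\<And>\<epsilon> m. 0 \<le> \<epsilon> \<Longrightarrow> \<epsilon> \<le> e \<Longrightarrow> tnorm \<epsilon> m (inverse U) \<le> u"
    using tnorm_inverse_bounded[OF Ub _ U0] \<rho> by auto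
  define \<epsilon> where "\<epsilon> = min e (\<rho> / 4)"
  have \<epsilon>: "\<epsilon> > 0" "\<epsilon> \<le> e" "\<epsilon> \<le> \<rho> / 4" "\<epsilon> \<ge> 0" using e \<rho> by (auto simp: \<epsilon>_def)
  define W where "W = u / \<epsilon> ^ q"
  have W: "W \<ge> 0" using u \<epsilon> by (simp add: W_def)
  \<comment> \<open>The linear terms of the recursion contribute at most 4 W C \<delta>/\<rho> and
    the nonlinear ones at most 16 W C (\<eta>/\<rho>)^2. The choices of \<eta> and \<delta> make
    each at most \<eta>/2, and \<eta> <= \<rho>/4 keeps the geometric ratio 2 \<eta>/\<rho> at most
    1/2. The summands 1 in the denominators cover W C = 0.\<close>
  define \<eta> where "\<eta> = min (\<rho> / 4) (\<rho>\<^sup>2 / (32 * W * C + 1))"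
  have WC: "W * C \<ge> 0" using W C by simp
  have \<eta>: "\<eta> > 0" using \<rho> WC by (auto simp: \<eta>_def intro!: divide_pos_pos add_nonneg_pos)
  have \<eta>4: "\<eta> \<le> \<rho> / 4" unfolding \<eta>_def by (rule min.cobounded1)
  have \<eta>2: "32 * (W * C) * \<eta> \<le> \<rho>\<^sup>2"
  proof -
    have "32 * (W * C) * \<eta> \<le> 32 * (W * C) * (\<rho>\<^sup>2 / (32 * W * C + 1))"
      using WC by (intro mult_left_mono) (auto simp: \<eta>_def)
    also have "\<dots> = \<rho>\<^sup>2 * (32 * (W * C) / (32 * (W * C) + 1))" by (simp add: mult_ac)
    also have "\<dots> \<le> \<rho>\<^sup>2 * 1" using WC by (intro mult_left_mono) (auto simp: divide_le_eq)
    finally show ?thesis by simp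
  qed
  define \<delta> where "\<delta> = min (\<rho> / 2) (\<eta> * \<rho> / (8 * W * C + 1))"
  have "\<delta> > 0" using \<rho> \<eta> WC by (auto simp: \<delta>_def intro!: divide_pos_pos add_nonneg_pos mult_pos_pos)
  moreover have "\<delta> \<le> \<rho> / 2" unfolding \<delta>_def by (rule min.cobounded1)
  ultimately have \<delta>: "\<delta> > 0" "\<delta> \<le> \<rho> / 2" "\<delta> \<ge> 0" by auto
  have \<delta>2: "8 * (W * C) * \<delta> \<le> \<eta> * \<rho>"
  proof -
    have "8 * (W * C) * \<delta> \<le> 8 * (W * C) * (\<eta> * \<rho> / (8 * W * C + 1))"
      using WC by (intro mult_left_mono) (auto simp: \<delta>_def)
    also have "\<dots> = (\<eta> * \<rho>) * (8 * (W * C) / (8 * (W * C) + 1))" by (simp add: mult_ac)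
    also have "\<dots> \<le> (\<eta> * \<rho>) * 1" using WC \<eta> \<rho> by (intro mult_left_mono) (auto simp: divide_le_eq)
    finally show ?thesis by simp
  qed
  show ?thesis
  proof (rule that[OF \<eta> \<delta>(1)])
    fix G F :: "complex fps fps" and j :: nat
    assume G0: "fps_nth G 0 = fps_X"
      and Fb: "\<And>i j. cmod (fps_nth (fps_nth F j) i) \<le> C / \<rho> ^ (i + j)"
      and F: "\<And>i j. fps_nth (fps_nth F j) i = (\<Sum>k\<le>i + j. \<phi> k * fps_nth (fps_nth (G ^ k) j) i)"
      and j1: "j \<ge> 1"
    define h where "h = G - fps_const fps_X"
    have h0: "fps_nth h 0 = 0" by (simp add: h_def G0)
    have t0: "tnorm \<epsilon> m f \<ge> 0" for m f using \<epsilon>(4) by (rule tnorm_nonneg)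
    have Fj: "tnorm \<epsilon> m (fps_nth F j) \<le> 2 * (C / \<rho> ^ j)" for m j
    proof (rule tnorm_geometric[of _ _ \<rho>])
      show "cmod (fps_nth (fps_nth F j) i) \<le> C / \<rho> ^ j / \<rho> ^ i" for i
        using Fb[of j i] by (simp add: power_add mult.commute)
    qed (use \<epsilon> \<rho> C in auto)
    have eq: "P * fps_nth h j = fps_nth F j - (\<Sum>l\<in>{2..j}. taylor_shift \<phi> l * fps_nth (h ^ l) j)" if j: "j \<ge> 1" for j
    proof -
      have "fps_nth F j = (\<Sum>l\<le>j. taylor_shift \<phi> l * fps_nth (h ^ l) j)"
        unfolding h_def by (rule fps_ext) (rule composition_expansion[OF G0 F])
      also have "{..j} = insert 0 (insert 1 {2..j})" using j by auto
      finally show ?thesis using j by (simp add: P_def)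
    qed
    have hb: "tnorm \<epsilon> m (fps_nth h j) \<le> W * (2 * (C / \<rho> ^ j)
        + (\<Sum>l\<in>{2..j}. 2 * (C * (2 / \<rho>) ^ l) * tnorm \<epsilon> (m + q) (fps_nth (h ^ l) j)))" if j: "j \<ge> 1" for m j
    proof -
      have "U * fps_nth h j * inverse U = fps_nth h j"
        using inverse_mult_eq_1[OF U0] by (simp add: mult_ac)
      then have "tnorm \<epsilon> m (fps_nth h j) \<le> tnorm \<epsilon> m (U * fps_nth h j) * tnorm \<epsilon> m (inverse U)"
        using tnorm_mult[OF \<epsilon>(4)] by metis
      also have "\<dots> \<le> tnorm \<epsilon> m (U * fps_nth h j) * u" by (intro mult_left_mono u \<epsilon> t0)
      also have "tnorm \<epsilon> m (U * fps_nth h j) = tnorm \<epsilon> (m + q) (P * fps_nth h j) / \<epsilon> ^ q"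
        unfolding PU using \<epsilon>(1) by (simp add: mult.assoc tnorm_X_power_mult)
      also have "tnorm \<epsilon> (m + q) (P * fps_nth h j) / \<epsilon> ^ q * u = W * tnorm \<epsilon> (m + q) (P * fps_nth h j)"
        by (simp add: W_def)
      also have "\<dots> \<le> W * (2 * (C / \<rho> ^ j)
          + (\<Sum>l\<in>{2..j}. 2 * (C * (2 / \<rho>) ^ l) * tnorm \<epsilon> (m + q) (fps_nth (h ^ l) j)))"
      proof (rule mult_left_mono[OF _ W])
        have "tnorm \<epsilon> (m + q) (P * fps_nth h j) \<le> tnorm \<epsilon> (m + q) (fps_nth F j)
           + tnorm \<epsilon> (m + q) (\<Sum>l\<in>{2..j}. taylor_shift \<phi> l * fps_nth (h ^ l) j)"
          unfolding eq[OF j] by (rule tnorm_diff[OF \<epsilon>(4)])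
        also have "\<dots> \<le> 2 * (C / \<rho> ^ j) + (\<Sum>l\<in>{2..j}. tnorm \<epsilon> (m + q) (taylor_shift \<phi> l * fps_nth (h ^ l) j))"
          by (intro add_mono Fj tnorm_sum \<epsilon>(4))
        also have "\<dots> \<le> 2 * (C / \<rho> ^ j) + (\<Sum>l\<in>{2..j}. 2 * (C * (2 / \<rho>) ^ l) * tnorm \<epsilon> (m + q) (fps_nth (h ^ l) j))"
          by (intro add_left_mono sum_mono order_trans[OF tnorm_mult[OF \<epsilon>(4)]] mult_right_mono
               tnorm_taylor_shift \<phi> \<rho> C \<epsilon> t0)
        finally show "tnorm \<epsilon> (m + q) (P * fps_nth h j) \<le> 2 * (C / \<rho> ^ j)
          + (\<Sum>l\<in>{2..j}. 2 * (C * (2 / \<rho>) ^ l) * tnorm \<epsilon> (m + q) (fps_nth (h ^ l) j))" .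
      qed
      finally show ?thesis .
    qed
    \<comment> \<open>All truncations are treated at once, since step n + 1 at length m calls step n
      at length m + q. The constant coefficients in s correspond to m = 0.\<close>
    have Q: "(\<Sum>j\<le>n. tnorm \<epsilon> m (fps_nth h j) * \<delta> ^ j) \<le> \<eta>" for n m
    proof (induction n arbitrary: m)
      case 0
      then show ?case using \<eta> by (simp add: h0 tnorm_def)
    next
      case (Suc n)
      let ?t = "\<lambda>l j. tnorm \<epsilon> (m + q) (fps_nth (h ^ l) j)"
      have "(\<Sum>j\<le>Suc n. tnorm \<epsilon> m (fps_nth h j) * \<delta> ^ j) = (\<Sum>j\<in>{1..Suc n}. tnorm \<epsilon> m (fps_nth h j) * \<delta> ^ j)"
        by (rule sum.mono_neutral_right) (auto simp: h0 tnorm_def not_le)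
      also have "\<dots> \<le> (\<Sum>j\<in>{1..Suc n}. W * (2 * (C / \<rho> ^ j) + (\<Sum>l\<in>{2..j}. 2 * (C * (2 / \<rho>) ^ l) * ?t l j)) * \<delta> ^ j)"
        using \<delta> by (intro sum_mono mult_right_mono hb) auto
      also have "\<dots> \<le> (\<Sum>j\<in>{1..Suc n}. W * (2 * (C / \<rho> ^ j) + (\<Sum>l\<in>{2..Suc n}. 2 * (C * (2 / \<rho>) ^ l) * ?t l j)) * \<delta> ^ j)"
        using \<delta> W C \<rho> t0 by (intro sum_mono mult_right_mono mult_left_mono add_left_mono sum_mono2) auto
      also have "\<dots> = W * ((\<Sum>j\<in>{1..Suc n}. 2 * C * (\<delta> / \<rho>) ^ j)
          + (\<Sum>l\<in>{2..Suc n}. 2 * (C * (2 / \<rho>) ^ l) * (\<Sum>j\<in>{1..Suc n}. ?t l j * \<delta> ^ j)))"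
        unfolding sum_distrib_left distrib_left distrib_right sum.distrib sum_distrib_right
        by (intro arg_cong2[where f = "(+)"] sum.cong refl trans[OF sum.swap]) (simp_all add: power_divide mult_ac)
      also have "\<dots> \<le> W * (4 * C * (\<delta> / \<rho>) + 16 * C * (\<eta> / \<rho>)\<^sup>2)"
      proof (intro mult_left_mono add_mono W)
        have "(\<Sum>j\<in>{1..Suc n}. 2 * C * (\<delta> / \<rho>) ^ j) = 2 * C * (\<delta> / \<rho>) * (\<Sum>j\<le>n. (\<delta> / \<rho>) ^ j)"
          unfolding sum_distrib_left
          by (rule sum.reindex_bij_witness[of _ Suc "\<lambda>j. j - 1"]) (auto simp: power_eq_if)
        also have "\<dots> \<le> 2 * C * (\<delta> / \<rho>) * 2"
          using \<delta> \<rho> C by (intro mult_left_mono geometric_sum_le_2) (auto simp: field_simps)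
        finally show "(\<Sum>j\<in>{1..Suc n}. 2 * C * (\<delta> / \<rho>) ^ j) \<le> 4 * C * (\<delta> / \<rho>)" by simp
        have x: "0 \<le> 2 * \<eta> / \<rho>" "2 * \<eta> / \<rho> \<le> 1 / 2" using \<eta> \<eta>4 \<rho> by (auto simp: field_simps)
        have "(\<Sum>l\<in>{2..Suc n}. 2 * (C * (2 / \<rho>) ^ l) * (\<Sum>j\<in>{1..Suc n}. ?t l j * \<delta> ^ j))
            \<le> (\<Sum>l\<in>{2..Suc n}. 2 * (C * (2 / \<rho>) ^ l) * \<eta> ^ l)"
        proof (intro sum_mono mult_left_mono)
          fix l assume l: "l \<in> {2..Suc n}"
          have "(\<Sum>j\<in>{1..Suc n}. ?t l j * \<delta> ^ j) \<le> (\<Sum>j\<le>Suc n. ?t l j * \<delta> ^ j)"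
            using t0 \<delta> by (intro sum_mono2) auto
          also have "\<dots> \<le> (\<Sum>j\<le>n. tnorm \<epsilon> (m + q) (fps_nth h j) * \<delta> ^ j) ^ l"
            using l by (intro graded_power_bound h0 \<epsilon> \<delta>) auto
          also have "\<dots> \<le> \<eta> ^ l"
            using t0 \<delta> by (intro power_mono Suc.IH sum_nonneg) auto
          finally show "(\<Sum>j\<in>{1..Suc n}. ?t l j * \<delta> ^ j) \<le> \<eta> ^ l" .
        qed (use C \<rho> in auto)
        also have "\<dots> = (\<Sum>l\<in>{2..Suc n}. 2 * C * (2 * \<eta> / \<rho>) ^ l)"
          by (intro sum.cong refl) (simp add: power_mult_distrib power_divide mult_ac)
        also have "\<dots> \<le> (\<Sum>l\<in>{2..Suc (Suc n)}. 2 * C * (2 * \<eta> / \<rho>) ^ l)"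
          using C x by (intro sum_mono2) auto
        also have "\<dots> = 2 * C * (2 * \<eta> / \<rho>)\<^sup>2 * (\<Sum>l\<le>n. (2 * \<eta> / \<rho>) ^ l)"
          by (rule sum_shift_power2)
        also have "\<dots> \<le> 2 * C * (2 * \<eta> / \<rho>)\<^sup>2 * 2"
          using C x by (intro mult_left_mono geometric_sum_le_2) auto
        finally show "(\<Sum>l\<in>{2..Suc n}. 2 * (C * (2 / \<rho>) ^ l) * (\<Sum>j\<in>{1..Suc n}. ?t l j * \<delta> ^ j)) \<le> 16 * C * (\<eta> / \<rho>)\<^sup>2"
          by (simp add: power_mult_distrib power_divide)
      qed
      also have "\<dots> \<le> \<eta>"
      proof -
        have "W * (4 * C * (\<delta> / \<rho>)) = (8 * (W * C) * \<delta>) / (2 * \<rho>)" by simp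
        also have "\<dots> \<le> (\<eta> * \<rho>) / (2 * \<rho>)" using \<delta>2 \<rho> by (intro divide_right_mono) auto
        also have "\<dots> = \<eta> / 2" using \<rho> by simp
        finally have 1: "W * (4 * C * (\<delta> / \<rho>)) \<le> \<eta> / 2" .
        have "W * (16 * C * (\<eta> / \<rho>)\<^sup>2) = (32 * (W * C) * \<eta>) * (\<eta> / (2 * \<rho>\<^sup>2))"
          by (simp add: power2_eq_square)
        also have "\<dots> \<le> \<rho>\<^sup>2 * (\<eta> / (2 * \<rho>\<^sup>2))" using \<eta>2 \<eta> by (intro mult_right_mono) auto
        also have "\<dots> = \<eta> / 2" using \<rho> by simp
        finally show ?thesis using 1 by (simp add: distrib_left)
      qed
      finally show ?case .
    qed
    have "cmod (fps_nth (fps_nth G j) 0) * \<delta> ^ j = tnorm \<epsilon> 0 (fps_nth h j) * \<delta> ^ j"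
      using j1 by (simp add: tnorm_def h_def)
    also have "\<dots> \<le> (\<Sum>j\<le>j. tnorm \<epsilon> 0 (fps_nth h j) * \<delta> ^ j)"
      using t0 \<delta> by (intro member_le_sum) auto
    also have "\<dots> \<le> \<eta>" by (rule Q)
    finally show "cmod (fps_nth (fps_nth G j) 0) \<le> \<eta> / \<delta> ^ j" using \<delta> by (simp add: field_simps)
  qed
qed

section \<open>Restriction of a power series to a plane\<close>

text \<open>The restriction of the form of degree d to the points w + s v, as a polynomial in s. By
  homogeneity its coefficient at s^i is the coefficient of u^(d-i) s^i on the plane u w + s
  v.\<close>

definition plane_part :: "('n::finite \<Rightarrow> complex) \<Rightarrow> ('n \<Rightarrow> complex) \<Rightarrow> (nat^'n \<Rightarrow> complex) \<Rightarrow> nat \<Rightarrow> complex poly" where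
  "plane_part w v c d = hpart (\<lambda>\<alpha>. [:c \<alpha>:]) d (\<lambda>l. [:w l, v l:])"

text \<open>The coefficient of \<open>u\<^sup>j s\<^sup>i\<close> in the restriction of the series \<open>c\<close> to the plane \<open>u w + s v\<close>.\<close>

definition plane_series :: "('n::finite \<Rightarrow> complex) \<Rightarrow> ('n \<Rightarrow> complex) \<Rightarrow> (nat^'n \<Rightarrow> complex) \<Rightarrow> complex fps fps" where
  "plane_series w v c = Abs_fps (\<lambda>j. Abs_fps (\<lambda>i. poly.coeff (plane_part w v c (i + j)) i))"

lemma plane_series_nth [simp]:
  "fps_nth (fps_nth (plane_series w v c) j) i = poly.coeff (plane_part w v c (i + j)) i"
  by (simp add: plane_series_def)

lemma degree_mmon_le:
  fixes \<alpha> :: "nat^'n"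
  shows "degree (mmon (\<lambda>l. [:w l, v l :: complex:]) \<alpha>) \<le> mdeg \<alpha>"
proof -
  have "degree (mmon (\<lambda>l. [:w l, v l:]) \<alpha>) \<le> sum (degree \<circ> (\<lambda>l. [:w l, v l:] ^ (\<alpha> $ l))) UNIV"
    unfolding mmon_def by (rule degree_prod_sum_le) simp
  also have "\<dots> \<le> mdeg \<alpha>"
    unfolding mdeg_def o_def
  proof (rule sum_mono)
    fix l
    have "degree ([:w l, v l:] ^ (\<alpha> $ l)) \<le> degree [:w l, v l:] * \<alpha> $ l" by (rule degree_power_le)
    also have "\<dots> \<le> 1 * \<alpha> $ l" by (intro mult_right_mono) auto
    finally show "degree ([:w l, v l:] ^ (\<alpha> $ l)) \<le> \<alpha> $ l" by simp
  qed
  finally show ?thesis .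
qed

lemma degree_plane_part: "degree (plane_part w v c d) \<le> d"
  unfolding plane_part_def hpart_def
proof (rule degree_sum_le)
  fix \<alpha> :: "nat^'a" assume "\<alpha> \<in> {\<alpha>. mdeg \<alpha> = d}"
  then show "degree ([:c \<alpha>:] * mmon (\<lambda>l. [:w l, v l:]) \<alpha>) \<le> d"
    using degree_mmon_le[of w v \<alpha>] by simp
qed simp

lemma coeff_mult_top:
  fixes p q :: "'a::comm_ring_1 poly"
  assumes "degree p \<le> m" "degree q \<le> n"
  shows "poly.coeff (p * q) (m + n) = poly.coeff p m * poly.coeff q n"
proof -
  have "poly.coeff (p * q) (m + n) = (\<Sum>i\<le>m + n. poly.coeff p i * poly.coeff q (m + n - i))"
    by (rule coeff_mult)
  also have "\<dots> = (\<Sum>i\<in>{m}. poly.coeff p i * poly.coeff q (m + n - i))"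
  proof (rule sum.mono_neutral_right)
    show "\<forall>i\<in>{..m + n} - {m}. poly.coeff p i * poly.coeff q (m + n - i) = 0"
    proof
      fix i assume "i \<in> {..m + n} - {m}"
      then have "m < i \<or> n < m + n - i" by auto
      then show "poly.coeff p i * poly.coeff q (m + n - i) = 0"
        using assms by (auto simp: coeff_eq_0)
    qed
  qed auto
  finally show ?thesis by simp
qed

lemma coeff_prod_top:
  fixes p :: "'i \<Rightarrow> 'a::idom poly"
  assumes "finite S" "\<And>l. l \<in> S \<Longrightarrow> degree (p l) \<le> m l"
  shows "poly.coeff (\<Prod>l\<in>S. p l) (\<Sum>l\<in>S. m l) = (\<Prod>l\<in>S. poly.coeff (p l) (m l))"
  using assms
proof (induction S rule: finite_induct)
  case (insert x S)
  have "degree (\<Prod>l\<in>S. p l) \<le> (\<Sum>l\<in>S. m l)"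
    using insert.prems insert.hyps by (intro order_trans[OF degree_prod_sum_le] sum_mono) auto
  then show ?case using insert by (simp add: coeff_mult_top)
qed simp

lemma coeff_mmon_top: "poly.coeff (mmon (\<lambda>l. [:w l, v l :: complex:]) \<alpha>) (mdeg \<alpha>) = mmon v \<alpha>"
proof -
  have pw: "degree ([:a, b:] ^ k) \<le> k \<and> poly.coeff ([:a, b:] ^ k) k = b ^ k" for a b :: complex and k
  proof (induction k)
    case (Suc k)
    have 1: "degree [:a, b:] \<le> 1" by simp
    have "degree ([:a, b:] * [:a, b:] ^ k) \<le> 1 + k"
      using Suc 1 by (intro order_trans[OF degree_mult_le] add_mono) auto
    moreover have "poly.coeff ([:a, b:] * [:a, b:] ^ k) (1 + k) = poly.coeff [:a, b:] 1 * poly.coeff ([:a, b:] ^ k) k"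
      using Suc 1 by (intro coeff_mult_top) auto
    ultimately show ?case using Suc by simp
  qed simp
  show ?thesis
    unfolding mmon_def mdeg_def by (subst coeff_prod_top) (use pw in auto)
qed

lemma poly_plane_part: "poly (plane_part w v c d) s = hpart c d (\<lambda>l. w l + s * v l)"
  unfolding plane_part_def hpart_def mmon_def by (simp add: poly_sum poly_prod)

lemma plane_series_nth_0: "fps_nth (fps_nth (plane_series w v c) j) 0 = hpart c j w"
  using poly_plane_part[of w v c j 0] by (simp add: poly_0_coeff_0)

lemma plane_series_0_nth: "fps_nth (fps_nth (plane_series w v c) 0) i = hpart c i v"
  unfolding plane_series_nth plane_part_def hpart_def
  by (simp add: coeff_sum) (intro sum.cong, auto simp: coeff_mmon_top)

lemma plane_part_gmult: "plane_part w v (gmult a b) d = (\<Sum>j\<le>d. plane_part w v a j * plane_part w v b (d - j))"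
proof -
  have s: "(\<Sum>x\<in>S. [:f x:]) = [:\<Sum>x\<in>S. f x:]" for f :: "'x \<Rightarrow> complex" and S
    by (induction S rule: infinite_finite_induct) auto
  have "(\<lambda>\<alpha>. [:gmult a b \<alpha>:]) = gmult (\<lambda>\<alpha>. [:a \<alpha>:]) (\<lambda>\<alpha>. [:b \<alpha>:])"
    by (simp add: gmult_def fun_eq_iff s[symmetric] case_prod_beta mult.commute)
  then show ?thesis unfolding plane_part_def by (simp add: hpart_gmult)
qed

lemma plane_series_gmult: "plane_series w v (gmult a b) = plane_series w v a * plane_series w v b"
proof (intro fps_ext)
  fix j i
  let ?a = "\<lambda>m p. poly.coeff (plane_part w v a m) p" and ?b = "\<lambda>m p. poly.coeff (plane_part w v b m) p"
  have z: "?a m p = 0" "?b m p = 0" if "m < p" for m p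
    using le_less_trans[OF degree_plane_part that] by (auto intro: coeff_eq_0)
  have "fps_nth (fps_nth (plane_series w v (gmult a b)) j) i = (\<Sum>m\<le>i + j. \<Sum>p\<le>i. ?a m p * ?b (i + j - m) (i - p))"
    by (simp add: plane_part_gmult coeff_sum coeff_mult)
  also have "\<dots> = (\<Sum>(m, p)\<in>{..i + j} \<times> {..i}. ?a m p * ?b (i + j - m) (i - p))"
    by (simp add: sum.cartesian_product)
  \<comment> \<open>A form of degree m contributes no power of s above m, so outside this region one
    of the two factors vanishes; inside it m - p is the exponent of u.\<close>
  also have "\<dots> = (\<Sum>(m, p)\<in>{(m, p). p \<le> i \<and> p \<le> m \<and> m \<le> p + j}. ?a m p * ?b (i + j - m) (i - p))"
  proof (rule sum.mono_neutral_right)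
    show "\<forall>x\<in>{..i + j} \<times> {..i} - {(m, p). p \<le> i \<and> p \<le> m \<and> m \<le> p + j}.
       (case x of (m, p) \<Rightarrow> ?a m p * ?b (i + j - m) (i - p)) = 0"
    proof
      fix x assume x: "x \<in> {..i + j} \<times> {..i} - {(m, p). p \<le> i \<and> p \<le> m \<and> m \<le> p + j}"
      then obtain m p where mp: "x = (m, p)" "m \<le> i + j" "p \<le> i" "m < p \<or> p + j < m" by force
      then have "m < p \<or> i + j - m < i - p" by auto
      then show "(case x of (m, p) \<Rightarrow> ?a m p * ?b (i + j - m) (i - p)) = 0"
        using z mp(1) by auto
    qed
  qed auto
  also have "\<dots> = (\<Sum>(q, p)\<in>{..j} \<times> {..i}. ?a (p + q) p * ?b (i + j - (p + q)) (i - p))"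
    by (rule sum.reindex_bij_witness[of _ "\<lambda>(q, p). (p + q, p)" "\<lambda>(m, p). (m - p, p)"]) auto
  also have "\<dots> = (\<Sum>q\<le>j. \<Sum>p\<le>i. ?a (p + q) p * ?b (i + j - (p + q)) (i - p))"
    by (simp add: sum.cartesian_product)
  also have "\<dots> = (\<Sum>q\<le>j. \<Sum>p\<le>i. ?a (p + q) p * ?b ((i - p) + (j - q)) (i - p))"
  proof (intro sum.cong refl)
    fix q p assume "q \<in> {..j}" "p \<in> {..i}"
    then have "i + j - (p + q) = (i - p) + (j - q)" by simp
    then show "?a (p + q) p * ?b (i + j - (p + q)) (i - p) = ?a (p + q) p * ?b ((i - p) + (j - q)) (i - p)" by simp
  qed
  also have "\<dots> = fps_nth (fps_nth (plane_series w v a * plane_series w v b) j) i"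
    by (simp add: fps_mult_nth fps_sum_nth atLeast0AtMost)
  finally show "fps_nth (fps_nth (plane_series w v (gmult a b)) j) i = fps_nth (fps_nth (plane_series w v a * plane_series w v b) j) i" .
qed

lemma plane_series_gone:
  fixes w v :: "'n::finite \<Rightarrow> complex"
  shows "plane_series w v gone = 1"
proof (intro fps_ext)
  fix j i
  have g: "(\<lambda>\<alpha> :: nat^'n. [:gone \<alpha> :: complex:]) = gone" by (simp add: gone_def fun_eq_iff)
  have "plane_part w v gone d = (if d = 0 then 1 else 0)" for d
    unfolding plane_part_def g by (rule hpart_gone)
  then show "fps_nth (fps_nth (plane_series w v gone) j) i = fps_nth (fps_nth 1 j) i" by simp
qed

lemma plane_series_gpow: "plane_series w v (gpow a k) = plane_series w v a ^ k"
  by (induction k) (simp_all add: plane_series_gone plane_series_gmult)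

text \<open>Each factor w + v s multiplies the largest coefficient by at most 1 + V.\<close>

lemma coeff_linear_power_le:
  fixes w v :: complex
  assumes "cmod w \<le> 1" "cmod v \<le> V" "\<And>i. cmod (poly.coeff p i) \<le> B"
  shows "cmod (poly.coeff ([:w, v:] ^ k * p) i) \<le> (1 + V) ^ k * B"
proof (induction k arbitrary: i)
  case (Suc k)
  let ?q = "[:w, v:] ^ k * p"
  have B: "B \<ge> 0" using assms(3)[of 0] norm_ge_zero order_trans by blast
  have V: "V \<ge> 0" using assms(2) norm_ge_zero order_trans by blast
  have "poly.coeff ([:w, v:] ^ Suc k * p) i = w * poly.coeff ?q i + v * (if i = 0 then 0 else poly.coeff ?q (i - 1))"
  proof -
    have "poly.coeff ([:w, v:] * q) i = w * poly.coeff q i + v * (if i = 0 then 0 else poly.coeff q (i - 1))" for q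
      by (cases i) simp_all
    then show ?thesis by (simp only: power_Suc mult.assoc)
  qed
  also have "cmod \<dots> \<le> cmod w * cmod (poly.coeff ?q i) + cmod v * cmod (if i = 0 then 0 else poly.coeff ?q (i - 1))"
    by (metis norm_mult norm_triangle_ineq)
  also have "\<dots> \<le> 1 * ((1 + V) ^ k * B) + V * ((1 + V) ^ k * B)"
    using assms Suc B V by (intro add_mono mult_mono) auto
  finally show ?case by (simp add: algebra_simps)
qed (use assms in simp)

lemma coeff_mmon_le:
  fixes w v :: "'n::finite \<Rightarrow> complex" and \<alpha> :: "nat^'n"
  assumes "\<And>l. cmod (w l) \<le> 1" "\<And>l. cmod (v l) \<le> V"
  shows "cmod (poly.coeff (mmon (\<lambda>l. [:w l, v l:]) \<alpha>) i) \<le> (1 + V) ^ mdeg \<alpha>"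
proof -
  have "cmod (poly.coeff (\<Prod>l\<in>S. [:w l, v l:] ^ (\<alpha> $ l)) i) \<le> (1 + V) ^ (\<Sum>l\<in>S. \<alpha> $ l)" if "finite S" for S i
    using that
  proof (induction S arbitrary: i rule: finite_induct)
    case (insert x S)
    then show ?case
      using coeff_linear_power_le[OF assms(1)[of x] assms(2)[of x], of "\<Prod>l\<in>S. [:w l, v l:] ^ (\<alpha> $ l)"]
      by (simp add: power_add)
  qed (simp add: coeff_1)
  then show ?thesis unfolding mmon_def mdeg_def by simp
qed

text \<open>The bound does not depend on w in the unit polydisc. This uniformity is what later
  allows Cauchy's estimate in w.\<close>

lemma plane_series_bound:
  fixes w v :: "'n::finite \<Rightarrow> complex"
  assumes "\<And>l. cmod (w l) \<le> 1" "\<And>l. cmod (v l) \<le> V" and V: "V \<ge> 0" and r: "r > 0"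
    and S: "\<And>d. (\<Sum>\<alpha> | mdeg \<alpha> = d. cmod (c \<alpha>)) * r ^ d \<le> S"
  shows "cmod (fps_nth (fps_nth (plane_series w v c) j) i) \<le> S / (r / (1 + V)) ^ (i + j)"
proof -
  have "cmod (poly.coeff (plane_part w v c (i + j)) i)
      \<le> (\<Sum>\<alpha> | mdeg \<alpha> = i + j. cmod (c \<alpha> * poly.coeff (mmon (\<lambda>l. [:w l, v l:]) \<alpha>) i))"
    unfolding plane_part_def hpart_def by (simp add: coeff_sum) (rule norm_sum)
  also have "\<dots> \<le> (\<Sum>\<alpha> | mdeg \<alpha> = i + j. cmod (c \<alpha>) * (1 + V) ^ (i + j))"
  proof (intro sum_mono)
    fix \<alpha> :: "nat^'n" assume "\<alpha> \<in> {\<alpha>. mdeg \<alpha> = i + j}"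
    then show "cmod (c \<alpha> * poly.coeff (mmon (\<lambda>l. [:w l, v l:]) \<alpha>) i) \<le> cmod (c \<alpha>) * (1 + V) ^ (i + j)"
      using coeff_mmon_le[OF assms(1,2), where \<alpha> = \<alpha> and i = i] unfolding norm_mult by (intro mult_left_mono) auto
  qed
  also have "\<dots> = ((\<Sum>\<alpha> | mdeg \<alpha> = i + j. cmod (c \<alpha>)) * r ^ (i + j)) / (r / (1 + V)) ^ (i + j)"
    using r V by (simp add: sum_distrib_right[symmetric] power_divide)
  also have "\<dots> \<le> S / (r / (1 + V)) ^ (i + j)"
    using S r V by (intro divide_right_mono) auto
  finally show ?thesis by simp
qed

section \<open>Coefficient estimates\<close>

text \<open>Cauchy's estimate, with averages over roots of unity in place of integrals over circles.\<close>

lemma hpart_coeff_bound: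
  fixes c :: "nat^'n \<Rightarrow> complex"
  assumes bd: "\<And>w. (\<And>l. cmod (w l) \<le> 1) \<Longrightarrow> cmod (hpart c d w) \<le> B" and \<alpha>: "mdeg \<alpha> = d"
  shows "cmod (c \<alpha>) \<le> B"
proof -
  \<comment> \<open>All exponents in degree d are smaller than N, so distinct ones stay orthogonal
    over the N-th roots of unity.\<close>
  define N where "N = Suc d"
  define z where "z = (\<lambda>k. cis (2 * pi * real k / real N))"
  have N: "N > 0" by (simp add: N_def)
  have bij: "bij_betw z {..<N} {x. x ^ N = 1}" unfolding z_def by (rule Complex.bij_betw_roots_unity[OF N])
  have zn: "cmod (z k) = 1" for k by (simp add: z_def)
  have z0: "z k \<noteq> 0" for k by (simp add: z_def)
  have z_pow: "z k ^ m = z m ^ k" for k m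
    unfolding z_def Complex.DeMoivre by (rule arg_cong[of _ _ cis]) simp
  have ortho: "(\<Sum>k<N. z k ^ b * cnj (z k) ^ a) = (if a = b then of_nat N else 0)" if ab: "a < N" "b < N" for a b
  proof -
    define q where "q = z b * cnj (z a)"
    have e: "z k ^ b * cnj (z k) ^ a = q ^ k" for k
      unfolding q_def power_mult_distrib complex_cnj_power[symmetric] z_pow[of k] ..
    show ?thesis
    proof (cases "a = b")
      case True
      have "q = 1" unfolding q_def True using complex_norm_square[of "z b"] zn[of b] by simp
      then show ?thesis unfolding e using True by simp
    next
      case False
      have "z a ^ N = 1" "z b ^ N = 1" using bij ab by (auto simp: bij_betw_def)
      then have qN: "q ^ N = 1" by (simp add: q_def power_mult_distrib flip: complex_cnj_power)
      have "q \<noteq> 1"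
      proof
        assume "q = 1"
        then have "z b * (cnj (z a) * z a) = z a" unfolding q_def by (simp add: mult.assoc[symmetric])
        moreover have "cnj (z a) * z a = 1" using zn[of a] by (metis complex_norm_square mult.commute of_real_1 one_power2)
        ultimately have "z b = z a" by simp
        then show False using bij ab False by (auto simp: bij_betw_def inj_on_def)
      qed
      then have "(\<Sum>k<N. q ^ k) = 0" using qN by (simp add: geometric_sum)
      then show ?thesis using False by (simp add: e)
    qed
  qed
  let ?G = "PiE (UNIV :: 'n set) (\<lambda>_. {..<N})"
  have fin: "finite ?G" by (intro finite_PiE) auto
  have card: "card ?G = N ^ CARD('n)" by (simp add: card_PiE)
  have "(\<Sum>g\<in>?G. hpart c d (\<lambda>l. z (g l)) * mmon (\<lambda>l. cnj (z (g l))) \<alpha>)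
     = (\<Sum>\<beta> | mdeg \<beta> = d. c \<beta> * (\<Sum>g\<in>?G. \<Prod>l\<in>UNIV. z (g l) ^ (\<beta> $ l) * cnj (z (g l)) ^ (\<alpha> $ l)))"
    unfolding hpart_def sum_distrib_right sum_distrib_left
    by (subst sum.swap) (simp add: mmon_def prod.distrib mult.assoc)
  also have "\<dots> = (\<Sum>\<beta> | mdeg \<beta> = d. c \<beta> * (\<Prod>l\<in>UNIV. \<Sum>k<N. z k ^ (\<beta> $ l) * cnj (z k) ^ (\<alpha> $ l)))"
    by (subst prod_sum_PiE) auto
  also have "\<dots> = (\<Sum>\<beta> | mdeg \<beta> = d. if \<beta> = \<alpha> then c \<beta> * of_nat N ^ CARD('n) else 0)"
  proof (intro sum.cong refl)
    fix \<beta> :: "nat^'n" assume \<beta>: "\<beta> \<in> {\<beta>. mdeg \<beta> = d}"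
    have lt: "\<beta> $ l < N" "\<alpha> $ l < N" for l
      using nth_le_mdeg[of \<beta> l] nth_le_mdeg[of \<alpha> l] \<alpha> \<beta> by (auto simp: N_def)
    have "(\<Prod>l\<in>UNIV. \<Sum>k<N. z k ^ (\<beta> $ l) * cnj (z k) ^ (\<alpha> $ l)) = (\<Prod>l\<in>UNIV. if \<alpha> $ l = \<beta> $ l then of_nat N else 0)"
      by (intro prod.cong refl ortho lt)
    also have "\<dots> = (if \<beta> = \<alpha> then of_nat N ^ CARD('n) else 0)"
      by (auto simp: vec_eq_iff)
    finally show "c \<beta> * (\<Prod>l\<in>UNIV. \<Sum>k<N. z k ^ (\<beta> $ l) * cnj (z k) ^ (\<alpha> $ l)) = (if \<beta> = \<alpha> then c \<beta> * of_nat N ^ CARD('n) else 0)"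
      by simp
  qed
  also have "\<dots> = c \<alpha> * of_nat N ^ CARD('n)" using \<alpha> by (simp add: sum.delta)
  finally have eq: "c \<alpha> * of_nat N ^ CARD('n) = (\<Sum>g\<in>?G. hpart c d (\<lambda>l. z (g l)) * mmon (\<lambda>l. cnj (z (g l))) \<alpha>)" ..
  have "cmod (c \<alpha>) * real N ^ CARD('n) = cmod (c \<alpha> * of_nat N ^ CARD('n))"
    by (simp add: norm_mult norm_power)
  also have "\<dots> \<le> (\<Sum>g\<in>?G. cmod (hpart c d (\<lambda>l. z (g l)) * mmon (\<lambda>l. cnj (z (g l))) \<alpha>))"
    unfolding eq by (rule norm_sum)
  also have "\<dots> \<le> (\<Sum>g\<in>?G. B)"
  proof (rule sum_mono)
    fix g
    have "cmod (mmon (\<lambda>l. cnj (z (g l))) \<alpha>) = 1" by (simp only: norm_mmon complex_mod_cnj zn) (simp add: mmon_def)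
    then show "cmod (hpart c d (\<lambda>l. z (g l)) * mmon (\<lambda>l. cnj (z (g l))) \<alpha>) \<le> B"
      using bd[of "\<lambda>l. z (g l)"] zn by (simp add: norm_mult)
  qed
  also have "\<dots> = B * real N ^ CARD('n)" by (simp add: card)
  finally show ?thesis using N by simp
qed

lemma geometric_mmon_summable:
  fixes x :: real
  assumes x: "0 \<le> x" "x < 1"
  shows "(\<lambda>\<alpha> :: nat^'n. x ^ mdeg \<alpha>) summable_on UNIV"
proof (rule nonneg_bdd_above_summable_on)
  show "bdd_above (sum (\<lambda>\<alpha> :: nat^'n. x ^ mdeg \<alpha>) ` {F. F \<subseteq> UNIV \<and> finite F})"
  proof (rule bdd_aboveI2)
    fix F assume F: "F \<in> {F :: (nat^'n) set. F \<subseteq> UNIV \<and> finite F}"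
    define m where "m = Max (insert 0 (mdeg ` F))"
    have m: "mdeg \<alpha> \<le> m" if "\<alpha> \<in> F" for \<alpha> using that F by (auto simp: m_def)
    have "sum (\<lambda>\<alpha>. x ^ mdeg \<alpha>) F \<le> sum (\<lambda>\<alpha>. x ^ mdeg \<alpha>) ((\<lambda>f. \<chi> i. f i) ` PiE (UNIV :: 'n set) (\<lambda>_. {..m}))"
    proof (rule sum_mono2)
      show "finite ((\<lambda>f. \<chi> i. f i) ` PiE (UNIV :: 'n set) (\<lambda>_. {..m}))" by (intro finite_imageI finite_PiE) auto
      show "F \<subseteq> (\<lambda>f. \<chi> i. f i) ` PiE (UNIV :: 'n set) (\<lambda>_. {..m})"
      proof
        fix \<alpha> assume "\<alpha> \<in> F"
        then have "\<alpha> $ i \<le> m" for i using m nth_le_mdeg order_trans by blast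
        then show "\<alpha> \<in> (\<lambda>f. \<chi> i. f i) ` PiE (UNIV :: 'n set) (\<lambda>_. {..m})"
          by (intro image_eqI[of _ _ "vec_nth \<alpha>"]) auto
      qed
    qed (use x in auto)
    also have "\<dots> = (\<Sum>f\<in>PiE (UNIV :: 'n set) (\<lambda>_. {..m}). \<Prod>i\<in>UNIV. x ^ f i)"
      by (subst sum.reindex) (auto simp: inj_on_def vec_eq_iff fun_eq_iff mdeg_def power_sum)
    also have "\<dots> = (\<Prod>i\<in>(UNIV :: 'n set). \<Sum>k\<le>m. x ^ k)"
      by (rule prod_sum_PiE[symmetric]) auto
    also have "\<dots> \<le> (\<Prod>i\<in>(UNIV :: 'n set). 1 / (1 - x))"
    proof (intro prod_mono conjI sum_nonneg)
      have "(\<Sum>k\<le>m. x ^ k) \<le> suminf (\<lambda>k. x ^ k)" using x by (intro sum_le_suminf summable_geometric) auto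
      then show "(\<Sum>k\<le>m. x ^ k) \<le> 1 / (1 - x)" using x by (simp add: suminf_geometric)
    qed (use x in auto)
    finally show "sum (\<lambda>\<alpha>. x ^ mdeg \<alpha>) F \<le> (\<Prod>i\<in>(UNIV :: 'n set). 1 / (1 - x))" .
  qed
qed (use x in auto)

lemma mps_conv_geometric:
  fixes H :: "nat^'n \<Rightarrow> real"
  assumes H: "\<And>\<alpha>. \<alpha> \<noteq> 0 \<Longrightarrow> \<bar>H \<alpha>\<bar> \<le> K ^ mdeg \<alpha>"
  obtains r where "mps_conv H r"
proof -
  define L where "L = max 1 \<bar>K\<bar>"
  define B where "B = max 1 \<bar>H 0\<bar>"
  have L: "L \<ge> 1" by (simp add: L_def)
  have b: "\<bar>H \<alpha>\<bar> \<le> B * L ^ mdeg \<alpha>" for \<alpha>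
  proof (cases "\<alpha> = 0")
    case False
    have "\<bar>H \<alpha>\<bar> \<le> \<bar>K\<bar> ^ mdeg \<alpha>" using H[OF False] by (metis abs_ge_self order_trans power_abs)
    also have "\<dots> \<le> 1 * L ^ mdeg \<alpha>" by (auto simp: L_def intro: power_mono)
    also have "\<dots> \<le> B * L ^ mdeg \<alpha>" using L by (intro mult_right_mono) (auto simp: B_def)
    finally show ?thesis .
  qed (simp add: B_def)
  define r where "r = 1 / (2 * L)"
  have r: "r > 0" using L by (simp add: r_def)
  have "(\<lambda>\<alpha> :: nat^'n. B * (1/2) ^ mdeg \<alpha>) summable_on UNIV"
    by (intro summable_on_cmult_right geometric_mmon_summable) auto
  then have "(\<lambda>\<alpha>. \<bar>H \<alpha>\<bar> * r ^ mdeg \<alpha>) summable_on UNIV"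
  proof (rule summable_on_comparison_test)
    fix \<alpha> :: "nat^'n"
    have "\<bar>H \<alpha>\<bar> * r ^ mdeg \<alpha> \<le> B * L ^ mdeg \<alpha> * r ^ mdeg \<alpha>" using r by (intro mult_right_mono b) auto
    also have "\<dots> = B * (L * r) ^ mdeg \<alpha>" by (simp add: power_mult_distrib)
    also have "L * r = 1 / 2" using L by (simp add: r_def)
    finally show "\<bar>H \<alpha>\<bar> * r ^ mdeg \<alpha> \<le> B * (1/2) ^ mdeg \<alpha>" .
  qed (use r in auto)
  then show ?thesis using r by (intro that[of r]) (simp add: mps_conv_def)
qed

text \<open>On each plane spanned by w and v the restriction of H solves \<phi>(G) = F, where \<phi>
  is the restriction of F to the line of v and does not depend on w. The coefficients of pure powers
  u^j of G are the values of the forms of H at w, so \<open>composition_root_bound\<close> bounds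
  these uniformly on the polydisc and \<open>hpart_coeff_bound\<close> bounds the
  coefficients.\<close>

lemma root_of_convergent_composition:
  fixes F H :: "nat^'n \<Rightarrow> real" and v :: "'n \<Rightarrow> real"
  assumes F: "mps_conv F r" "\<alpha>0 \<noteq> 0" "F \<alpha>0 \<noteq> 0"
    and H: "\<And>d. hpart H d v = (if d = 1 then 1 else 0)"
    and comp: "\<And>\<alpha>. F \<alpha> = (\<Sum>k\<le>mdeg \<alpha>. hpart F k v * gpow H k \<alpha>)"
  shows "\<exists>K. \<forall>\<alpha>. \<alpha> \<noteq> 0 \<longrightarrow> \<bar>H \<alpha>\<bar> \<le> K ^ mdeg \<alpha>"
proof -
  have r: "r > 0" using F by (simp add: mps_conv_def)
  define S where "S = (\<Sum>\<^sub>\<infinity>\<alpha>. \<bar>F \<alpha>\<bar> * r ^ mdeg \<alpha>)"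
  have hs: "((\<lambda>\<alpha>. \<bar>F \<alpha>\<bar> * r ^ mdeg \<alpha>) has_sum S) UNIV"
    unfolding S_def using F by (intro has_sum_infsum) (simp add: mps_conv_def)
  have S: "(\<Sum>\<alpha> | mdeg \<alpha> = d. \<bar>F \<alpha>\<bar>) * r ^ d \<le> S" for d
  proof -
    have "(\<Sum>\<alpha> | mdeg \<alpha> = d. \<bar>F \<alpha>\<bar>) * r ^ d = (\<Sum>\<alpha> | mdeg \<alpha> = d. \<bar>F \<alpha>\<bar> * r ^ mdeg \<alpha>)"
      by (simp add: sum_distrib_right)
    also have "\<dots> \<le> S"
      by (rule has_sum_mono2[OF has_sum_finite hs]) (use r in auto)
    finally show ?thesis .
  qed
  have S0: "S \<ge> 0" unfolding S_def using r by (intro infsum_nonneg) auto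
  define V where "V = (\<Sum>l\<in>UNIV. \<bar>v l\<bar>)"
  have V: "V \<ge> 0" "\<bar>v l\<bar> \<le> V" for l
    unfolding V_def using member_le_sum[of l UNIV "\<lambda>l. \<bar>v l\<bar>"] by (auto intro: sum_nonneg)
  define \<rho> where "\<rho> = r / (1 + V)"
  have \<rho>: "\<rho> > 0" using r V(1) by (simp add: \<rho>_def)
  define Fc where "Fc = (\<lambda>\<alpha>. complex_of_real (F \<alpha>))"
  define Hc where "Hc = (\<lambda>\<alpha>. complex_of_real (H \<alpha>))"
  define vc where "vc = (\<lambda>l. complex_of_real (v l))"
  define \<phi> where "\<phi> = (\<lambda>k. complex_of_real (hpart F k v))"
  have vV: "cmod (vc l) \<le> V" for l using V(2)[of l] by (simp add: vc_def)
  have FS: "(\<Sum>\<alpha> | mdeg \<alpha> = d. cmod (Fc \<alpha>)) * r ^ d \<le> S" for d using S by (simp add: Fc_def)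
  have Fb: "cmod (fps_nth (fps_nth (plane_series w vc Fc) j) i) \<le> S / \<rho> ^ (i + j)"
    if "\<And>l. cmod (w l) \<le> 1" for w i j
    unfolding \<rho>_def by (rule plane_series_bound[OF that vV V(1) r FS])
  have \<phi>b: "cmod (\<phi> k) \<le> S / \<rho> ^ k" for k
    using Fb[of "\<lambda>_. 0" 0 k] plane_series_0_nth[of "\<lambda>_. 0" vc Fc k]
    by (simp add: \<phi>_def Fc_def vc_def hpart_of_real)
  \<comment> \<open>If \<phi> had no term of positive degree, \<open>comp\<close> would leave only
    the constant term of F, contradicting the nonzero coefficient at \<alpha>0.\<close>
  obtain k0 where k0: "\<phi> k0 \<noteq> 0" "k0 \<ge> 1"
  proof (rule ccontr)
    assume no: "\<not> thesis"
    note root = that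
    have z: "hpart F k v = 0" if k: "k \<ge> 1" for k
    proof (rule ccontr)
      assume "hpart F k v \<noteq> 0"
      then have "\<phi> k \<noteq> 0" by (simp add: \<phi>_def)
      then show False using no k root by blast
    qed
    have "F \<alpha>0 = (\<Sum>k\<le>mdeg \<alpha>0. if k = 0 then hpart F k v * gpow H k \<alpha>0 else 0)"
      unfolding comp[of \<alpha>0] by (intro sum.cong) (auto simp: z)
    also have "\<dots> = 0" using F(2) by (simp add: gone_def)
    finally show False using F(3) by simp
  qed
  have gpow_c: "gpow Hc k \<alpha> = complex_of_real (gpow H k \<alpha>)" for k \<alpha>
  proof -
    have "gpow Hc k = (\<lambda>\<alpha>. complex_of_real (gpow H k \<alpha>))"
      by (induction k) (auto simp: gone_def Hc_def gmult_of_real)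
    then show ?thesis by simp
  qed
  have compc: "fps_nth (fps_nth (plane_series w vc Fc) j) i
      = (\<Sum>k\<le>i + j. \<phi> k * fps_nth (fps_nth (plane_series w vc Hc ^ k) j) i)" for w i j
  proof -
    have "plane_part w vc Fc (i + j) = hpart (\<lambda>\<alpha>. \<Sum>k\<le>i + j. [:\<phi> k:] * [:gpow Hc k \<alpha>:]) (i + j) (\<lambda>l. [:w l, vc l:])"
      unfolding plane_part_def
    proof (rule hpart_cong)
      fix \<alpha> :: "nat^'n" assume \<alpha>: "mdeg \<alpha> = i + j"
      have s: "(\<Sum>x\<in>A. [:f x:]) = [:\<Sum>x\<in>A. f x:]" for f :: "nat \<Rightarrow> complex" and A
        by (induction A rule: infinite_finite_induct) auto
      have "Fc \<alpha> = (\<Sum>k\<le>i + j. \<phi> k * gpow Hc k \<alpha>)"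
        unfolding Fc_def comp[of \<alpha>] \<alpha> by (simp add: \<phi>_def gpow_c)
      then show "[:Fc \<alpha>:] = (\<Sum>k\<le>i + j. [:\<phi> k:] * [:gpow Hc k \<alpha>:])" by (simp add: s mult.commute)
    qed
    also have "\<dots> = (\<Sum>k\<le>i + j. [:\<phi> k:] * plane_part w vc (gpow Hc k) (i + j))"
      unfolding hpart_sum hpart_cmult plane_part_def ..
    finally show ?thesis
      by (simp add: coeff_sum plane_series_gpow[symmetric])
  qed
  \<comment> \<open>The normalization of H on the line of v says exactly that G reduces to s at u =
    0.\<close>
  have G0: "fps_nth (plane_series w vc Hc) 0 = fps_X" for w
    by (rule fps_ext) (simp add: plane_series_0_nth Hc_def vc_def hpart_of_real H del: plane_series_nth)
  obtain \<eta> \<delta> where \<eta>: "\<eta> > 0" and \<delta>: "\<delta> > 0" and bd: "\<And>G F j. fps_nth G 0 = fps_X \<Longrightarrow>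
        (\<And>i j. cmod (fps_nth (fps_nth F j) i) \<le> S / \<rho> ^ (i + j)) \<Longrightarrow>
        (\<And>i j. fps_nth (fps_nth F j) i = (\<Sum>k\<le>i + j. \<phi> k * fps_nth (fps_nth (G ^ k) j) i)) \<Longrightarrow>
        j \<ge> 1 \<Longrightarrow> cmod (fps_nth (fps_nth G j) 0) \<le> \<eta> / \<delta> ^ j"
    using composition_root_bound[of \<phi> S \<rho> k0, OF \<phi>b \<rho> S0 k0] by blast
  have hb: "cmod (hpart Hc j w) \<le> \<eta> / \<delta> ^ j" if "j \<ge> 1" "\<And>l. cmod (w l) \<le> 1" for j w
    using bd[OF G0 Fb[OF that(2)] compc that(1)] by (simp only: plane_series_nth_0)
  have "\<bar>H \<alpha>\<bar> \<le> (max 1 \<eta> / \<delta>) ^ mdeg \<alpha>" if "\<alpha> \<noteq> 0" for \<alpha>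
  proof -
    have m: "mdeg \<alpha> \<ge> 1" using that by (metis One_nat_def Suc_leI mdeg_eq_0_iff neq0_conv)
    have "cmod (Hc \<alpha>) \<le> \<eta> / \<delta> ^ mdeg \<alpha>"
      by (rule hpart_coeff_bound[OF hb[OF m] refl])
    also have "\<dots> \<le> max 1 \<eta> ^ mdeg \<alpha> / \<delta> ^ mdeg \<alpha>"
    proof (rule divide_right_mono)
      have "\<eta> \<le> max 1 \<eta> ^ 1" by simp
      also have "\<dots> \<le> max 1 \<eta> ^ mdeg \<alpha>" using m by (intro power_increasing) auto
      finally show "\<eta> \<le> max 1 \<eta> ^ mdeg \<alpha>" .
    qed (use \<delta> in simp)
    finally show ?thesis by (simp add: Hc_def power_divide)
  qed
  then show ?thesis by blast
qed

section \<open>The normalized formal first integral\<close>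

text \<open>A field of order at least q raises the degree by at least q - 1. With q = 2 the
  derivative depends only on lower degrees, which makes the recursion possible; q = 1 covers the
  full field with its linear part.\<close>

lemma lie_cong:
  assumes a: "\<And>i \<alpha>. mdeg \<alpha> < q \<Longrightarrow> a i \<alpha> = 0"
    and FG: "\<And>\<alpha>. mdeg \<alpha> + q \<le> Suc (mdeg \<gamma>) \<Longrightarrow> F \<alpha> = G \<alpha>"
  shows "lie a F \<gamma> = lie a G \<gamma>"
  unfolding lie_def gmult_def
proof (intro sum.cong refl)
  fix i p assume "p \<in> {(\<alpha>, \<beta>). \<alpha> + \<beta> = \<gamma>}"
  then have d: "mdeg (fst p) + mdeg (snd p) = mdeg \<gamma>" by auto
  have "psderiv i F (fst p) * a i (snd p) = psderiv i G (fst p) * a i (snd p)"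
  proof (cases "mdeg (snd p) < q")
    case False
    then have "F (fst p + axis i 1) = G (fst p + axis i 1)" using d by (intro FG) simp
    then show ?thesis by (simp add: psderiv_def)
  qed (simp add: a)
  then show "(case p of (\<alpha>, \<beta>) \<Rightarrow> psderiv i F \<alpha> * a i \<beta>) = (case p of (\<alpha>, \<beta>) \<Rightarrow> psderiv i G \<alpha> * a i \<beta>)"
    by (simp add: case_prod_beta)
qed

lemma lie_zero [simp]: "lie a (\<lambda>_. 0) = (\<lambda>_. 0)"
  by (simp add: lie_def gmult_def psderiv_def)

lemma lie_add_field: "lie (\<lambda>i \<alpha>. a i \<alpha> + b i \<alpha>) F = (\<lambda>\<gamma>. lie a F \<gamma> + lie b F \<gamma>)"
  by (simp add: lie_def gmult_def distrib_left sum.distrib case_prod_beta)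

lemma hpart_lieA_cong:
  assumes "\<And>\<alpha>. mdeg \<alpha> = d \<Longrightarrow> F \<alpha> = G \<alpha>"
  shows "hpart (lieA A F) d e = hpart (lieA A G) d e"
proof (cases d)
  case (Suc k)
  have "hpart (psderiv i F) k e = hpart (psderiv i G) k e" for i
    by (rule hpart_cong) (simp add: psderiv_def assms Suc)
  then show ?thesis unfolding Suc hpart_lieA_Suc by simp
qed (simp only: hpart_lieA_0)

lemma hpart_gpow_lf:
  fixes l :: "'n::finite \<Rightarrow> 'a::real_normed_field"
  shows "hpart (gpow (lf l) k) d e = (if d = k then lin l e ^ k else 0)"
proof -
  have "hfps (lf l) e = fps_const (lin l e) * fps_X"
  proof (rule fps_ext)
    show "fps_nth (hfps (lf l) e) m = fps_nth (fps_const (lin l e) * fps_X) m" for m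
      unfolding hfps_nth hpart_lf by (auto simp: fps_X_nth)
  qed
  then have "hfps (gpow (lf l) k) e = fps_const (lin l e ^ k) * fps_X ^ k"
    by (simp add: hfps_gpow power_mult_distrib fps_const_power)
  then have "fps_nth (hfps (gpow (lf l) k) e) d = fps_nth (fps_const (lin l e ^ k) * fps_X ^ k) d"
    by (rule arg_cong)
  then show ?thesis by (simp add: fps_X_power_nth)
qed

lemma gpow_eq_0:
  fixes H :: "nat^'n \<Rightarrow> 'a::real_normed_field"
  assumes H0: "H 0 = 0" and d: "mdeg \<alpha> < k"
  shows "gpow H k \<alpha> = 0"
proof (rule hpart_eq_0_imp_coeff_0[OF _ refl])
  fix e
  have "fps_nth (hfps H e ^ k) (mdeg \<alpha>) = 0"
    by (rule fps_power_nth_0_eq_0) (use H0 d in auto)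
  then show "hpart (gpow H k) (mdeg \<alpha>) e = 0" by (simp flip: hfps_gpow)
qed

text \<open>The degree bound is carried by a complex polynomial extending the real function, because
  pluripolarity concerns the complex parameter space.\<close>

definition real_poly_deg :: "nat \<Rightarrow> (real^'m \<Rightarrow> real) \<Rightarrow> bool" where
  "real_poly_deg d g \<longleftrightarrow>
     (\<exists>P. poly_deg d P \<and> (\<forall>t. P (\<chi> j. complex_of_real (t $ j)) = complex_of_real (g t)))"

lemma real_poly_deg_const: "real_poly_deg d (\<lambda>_. c)"
  unfolding real_poly_deg_def using poly_deg_const by blast

lemma real_poly_deg_var: "real_poly_deg 1 (\<lambda>t. t $ j)"
  unfolding real_poly_deg_def by (intro exI[of _ "\<lambda>z. z $ j"] conjI poly_deg.var) simp

lemma real_poly_deg_add: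
  assumes "real_poly_deg d f" "real_poly_deg d g"
  shows "real_poly_deg d (\<lambda>t. f t + g t)"
proof -
  obtain P Q where P: "poly_deg d P" "\<And>t. P (\<chi> j. complex_of_real (t $ j)) = complex_of_real (f t)"
    and Q: "poly_deg d Q" "\<And>t. Q (\<chi> j. complex_of_real (t $ j)) = complex_of_real (g t)"
    using assms unfolding real_poly_deg_def by blast
  show ?thesis unfolding real_poly_deg_def
    by (intro exI[of _ "\<lambda>z. P z + Q z"] conjI allI poly_deg.add P(1) Q(1)) (simp add: P(2) Q(2))
qed

lemma real_poly_deg_mult:
  assumes "real_poly_deg d f" "real_poly_deg e g" "d + e \<le> k"
  shows "real_poly_deg k (\<lambda>t. f t * g t)"
proof -
  obtain P Q where P: "poly_deg d P" "\<And>t. P (\<chi> j. complex_of_real (t $ j)) = complex_of_real (f t)"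
    and Q: "poly_deg e Q" "\<And>t. Q (\<chi> j. complex_of_real (t $ j)) = complex_of_real (g t)"
    using assms unfolding real_poly_deg_def by blast
  have "poly_deg k (\<lambda>z. P z * Q z)" by (rule poly_deg.mono[OF poly_deg.mult[OF P(1) Q(1)] assms(3)])
  then show ?thesis unfolding real_poly_deg_def
    by (intro exI[of _ "\<lambda>z. P z * Q z"] conjI allI) (simp_all add: P(2) Q(2))
qed

lemma real_poly_deg_sum:
  "(\<And>i. i \<in> I \<Longrightarrow> real_poly_deg d (p i)) \<Longrightarrow> real_poly_deg d (\<lambda>t. \<Sum>i\<in>I. p i t)"
  by (induction I rule: infinite_finite_induct) (auto intro: real_poly_deg_const real_poly_deg_add)

text \<open>The real consequences of nonresonance. From here on the eigenvalues no longer
  appear.\<close>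

locale simple_kernel =
  fixes A :: "'n::finite \<Rightarrow> 'n \<Rightarrow> real" and v l :: "'n \<Rightarrow> real"
  assumes left_kernel: "\<And>k. (\<Sum>i\<in>UNIV. l i * A i k) = 0"
    and lin_v: "lin l v = 1"
    and kernel_trivial: "\<And>x i. (\<And>k. (\<Sum>j\<in>UNIV. A k j * x j) = 0) \<Longrightarrow> lin l x = 0 \<Longrightarrow> x i = 0"
    and solvable: "\<And>c d. \<exists>h. \<forall>e. hpart (lieA A h) d e = hpart c d e - hpart c d v * lin l e ^ d"
    and unique: "\<And>h d e. (\<And>e. hpart (lieA A h) d e = 0) \<Longrightarrow> hpart h d v = 0 \<Longrightarrow> hpart h d e = 0"
begin

lemma lieA_lf: "lieA A (lf l) = (\<lambda>_. 0)"
proof (rule hfps_inject, rule fps_ext)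
  fix e d
  have "hpart (lieA A (lf l)) d e = 0"
  proof (cases d)
    case (Suc k)
    have "hpart (lieA A (lf l)) d e = hpart gone k e * (\<Sum>i\<in>UNIV. \<Sum>j\<in>UNIV. l i * A i j * e j)"
      unfolding Suc hpart_lieA_Suc psderiv_lf hpart_cmult by (simp add: sum_distrib_left mult_ac)
    also have "(\<Sum>i\<in>UNIV. \<Sum>j\<in>UNIV. l i * A i j * e j) = (\<Sum>j\<in>UNIV. (\<Sum>i\<in>UNIV. l i * A i j) * e j)"
      by (subst sum.swap) (simp add: sum_distrib_right)
    finally show ?thesis by (simp add: left_kernel)
  qed (simp only: hpart_lieA_0)
  then show "fps_nth (hfps (lieA A (lf l)) e) d = fps_nth (hfps (\<lambda>_. 0) e) d" by simp
qed

text \<open>Powers of l are annihilated by the derivation and have value 1 at v, so subtracting a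
  multiple of the d-th power normalizes a solution; the other degrees are then cut off.\<close>

lemma exists_normalized_solution:
  "\<exists>h. (\<forall>\<alpha>. mdeg \<alpha> \<noteq> d \<longrightarrow> h \<alpha> = 0) \<and> hpart h d v = 0 \<and>
     (\<forall>e. hpart (lieA A h) d e = hpart c d e - hpart c d v * lin l e ^ d)"
proof -
  obtain h where h: "\<And>e. hpart (lieA A h) d e = hpart c d e - hpart c d v * lin l e ^ d"
    using solvable[of d c] by blast
  define g where "g = (\<lambda>\<alpha>. h \<alpha> - hpart h d v * gpow (lf l) d \<alpha>)"
  define h1 where "h1 = (\<lambda>\<alpha>. if mdeg \<alpha> = d then g \<alpha> else 0)"
  have "hpart h1 d v = hpart g d v" by (rule hpart_cong) (simp add: h1_def)
  then have 1: "hpart h1 d v = 0" by (simp add: g_def hpart_diff hpart_cmult hpart_gpow_lf lin_v)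
  have "lieA A g = lieA A h"
    unfolding g_def lieA_def lie_diff lie_cmult lie_gpow[OF lieA_lf[unfolded lieA_def]] by simp
  moreover have "hpart (lieA A h1) d e = hpart (lieA A g) d e" for e
    by (rule hpart_lieA_cong) (simp add: h1_def)
  ultimately show ?thesis using 1 h by (intro exI[of _ h1]) (auto simp: h1_def)
qed

text \<open>One solution is fixed per monomial. Superposing these makes the solution linear in the
  right-hand side, so that polynomial dependence on the parameter is preserved.\<close>

definition monomial_solution :: "nat^'n \<Rightarrow> nat^'n \<Rightarrow> real" where
  "monomial_solution \<gamma> = (SOME h. (\<forall>\<alpha>. mdeg \<alpha> \<noteq> mdeg \<gamma> \<longrightarrow> h \<alpha> = 0) \<and> hpart h (mdeg \<gamma>) v = 0 \<and>
     (\<forall>e. hpart (lieA A h) (mdeg \<gamma>) e = mmon e \<gamma> - mmon v \<gamma> * lin l e ^ mdeg \<gamma>))"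

lemma monomial_solution:
  "hpart (monomial_solution \<gamma>) (mdeg \<gamma>) v = 0"
  "hpart (lieA A (monomial_solution \<gamma>)) (mdeg \<gamma>) e = mmon e \<gamma> - mmon v \<gamma> * lin l e ^ mdeg \<gamma>"
proof -
  let ?c = "\<lambda>\<alpha>. if \<alpha> = \<gamma> then 1 else 0 :: real"
  have "hpart ?c (mdeg \<gamma>) e = mmon e \<gamma>" for e
  proof -
    have "hpart ?c (mdeg \<gamma>) e = (\<Sum>\<alpha> | mdeg \<alpha> = mdeg \<gamma>. if \<alpha> = \<gamma> then mmon e \<alpha> else 0)"
      unfolding hpart_def by (intro sum.cong) auto
    then show ?thesis by simp
  qed
  then have "\<exists>h. (\<forall>\<alpha>. mdeg \<alpha> \<noteq> mdeg \<gamma> \<longrightarrow> h \<alpha> = 0) \<and> hpart h (mdeg \<gamma>) v = 0 \<and>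
     (\<forall>e. hpart (lieA A h) (mdeg \<gamma>) e = mmon e \<gamma> - mmon v \<gamma> * lin l e ^ mdeg \<gamma>)"
    using exists_normalized_solution[of "mdeg \<gamma>" ?c] by simp
  from someI_ex[OF this] show "hpart (monomial_solution \<gamma>) (mdeg \<gamma>) v = 0"
    "hpart (lieA A (monomial_solution \<gamma>)) (mdeg \<gamma>) e = mmon e \<gamma> - mmon v \<gamma> * lin l e ^ mdeg \<gamma>"
    unfolding monomial_solution_def by blast+
qed

text \<open>The coefficients of degree n + 1 need all those of lower degree through
  \<open>lie b\<close>, so the recursion builds the series up to a given degree as a whole;
  \<open>formal_integral\<close> reads off the diagonal.\<close>

primrec integral_upto :: "('n \<Rightarrow> nat^'n \<Rightarrow> real) \<Rightarrow> nat \<Rightarrow> nat^'n \<Rightarrow> real" where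
  "integral_upto b 0 = (\<lambda>_. 0)"
| "integral_upto b (Suc n) = (\<lambda>\<alpha>. if mdeg \<alpha> = Suc n
     then if n = 0 then lf l \<alpha>
       else - (\<Sum>\<gamma> | mdeg \<gamma> = Suc n. lie b (integral_upto b n) \<gamma> * monomial_solution \<gamma> \<alpha>)
     else integral_upto b n \<alpha>)"

definition formal_integral :: "('n \<Rightarrow> nat^'n \<Rightarrow> real) \<Rightarrow> nat^'n \<Rightarrow> real" where
  "formal_integral b \<alpha> = integral_upto b (mdeg \<alpha>) \<alpha>"

lemma integral_upto_eq: "mdeg \<alpha> \<le> n \<Longrightarrow> integral_upto b n \<alpha> = formal_integral b \<alpha>"
proof (induction n)
  case 0
  then show ?case by (simp add: formal_integral_def)
next
  case (Suc n)
  show ?case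
  proof (cases "mdeg \<alpha> = Suc n")
    case True
    then show ?thesis by (simp only: formal_integral_def)
  next
    case False
    then show ?thesis using Suc by simp
  qed
qed

lemma formal_integral_0: "formal_integral b 0 = 0"
  by (simp add: formal_integral_def)

lemma formal_integral_1: "mdeg \<alpha> = 1 \<Longrightarrow> formal_integral b \<alpha> = lf l \<alpha>"
  by (simp add: formal_integral_def)

context
  fixes b :: "'n \<Rightarrow> nat^'n \<Rightarrow> real"
  assumes b: "\<And>i \<alpha>. mdeg \<alpha> < 2 \<Longrightarrow> b i \<alpha> = 0"
begin

lemma formal_integral_rec:
  assumes "mdeg \<alpha> = d" "d \<ge> 2"
  shows "formal_integral b \<alpha> = - (\<Sum>\<gamma> | mdeg \<gamma> = d. lie b (formal_integral b) \<gamma> * monomial_solution \<gamma> \<alpha>)"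
proof -
  obtain n where n: "d = Suc n" "n \<noteq> 0" using assms(2) by (cases d) auto
  have "lie b (integral_upto b n) \<gamma> = lie b (formal_integral b) \<gamma>" if "mdeg \<gamma> = d" for \<gamma>
    by (rule lie_cong[OF b]) (use that n in \<open>auto intro: integral_upto_eq\<close>)
  then show ?thesis using assms(1) n by (simp add: formal_integral_def)
qed

lemma hpart_formal_integral_v: "hpart (formal_integral b) d v = (if d = 1 then 1 else 0)"
proof -
  consider "d = 0" | "d = 1" | "d \<ge> 2" by linarith
  then show ?thesis
  proof cases
    case 1
    then show ?thesis by (simp add: formal_integral_0)
  next
    case 2
    have "hpart (formal_integral b) d v = hpart (lf l) d v"
      by (rule hpart_cong) (simp add: 2 formal_integral_1)
    then show ?thesis using 2 by (simp only: hpart_lf lin_v)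
  next
    case 3
    have "hpart (formal_integral b) d v
        = hpart (\<lambda>\<alpha>. - 1 * (\<Sum>\<gamma> | mdeg \<gamma> = d. lie b (formal_integral b) \<gamma> * monomial_solution \<gamma> \<alpha>)) d v"
      by (rule hpart_cong) (simp add: formal_integral_rec[OF _ 3])
    also have "\<dots> = 0"
      unfolding hpart_cmult hpart_sum using monomial_solution(1) by (auto intro!: sum.neutral)
    finally show ?thesis using 3 by simp
  qed
qed

text \<open>The form of degree d of the integral was chosen so that its derivative along A x cancels
  that along the perturbation, except for the unsolvable multiple of the d-th power of l. Its factor
  is found by evaluation at v.\<close>

lemma lie_formal_integral_resonant:
  "hpart (lie (\<lambda>i \<alpha>. lf (A i) \<alpha> + b i \<alpha>) (formal_integral b)) d e
     = hpart (lie (\<lambda>i \<alpha>. lf (A i) \<alpha> + b i \<alpha>) (formal_integral b)) d v * lin l e ^ d"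
proof -
  define R where "R = lie b (formal_integral b)"
  have s: "hpart (lie (\<lambda>i \<alpha>. lf (A i) \<alpha> + b i \<alpha>) (formal_integral b)) d e
      = hpart (lieA A (formal_integral b)) d e + hpart R d e" for e
    unfolding lie_add_field hpart_add lieA_def R_def ..
  consider "d = 0" | "d = 1" | "d \<ge> 2" by linarith
  then show ?thesis
  proof cases
    case 1
    then show ?thesis by simp
  next
    case 2
    have "hpart (lieA A (formal_integral b)) d e = hpart (lieA A (lf l)) d e" for e
      by (rule hpart_lieA_cong) (simp add: 2 formal_integral_1)
    then have 1: "hpart (lieA A (formal_integral b)) d e = 0" for e by (simp add: lieA_lf)
    have "R \<gamma> = lie b (\<lambda>_. 0) \<gamma>" if "mdeg \<gamma> = d" for \<gamma>
      unfolding R_def by (rule lie_cong[OF b]) (use 2 that in \<open>auto simp: formal_integral_0\<close>)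
    then have "hpart R d e = hpart (\<lambda>_. 0) d e" for e by (intro hpart_cong) simp
    then show ?thesis unfolding s 1 by simp
  next
    case 3
    have "hpart (lieA A (formal_integral b)) d e = hpart R d v * lin l e ^ d - hpart R d e" for e
    proof -
      have "hpart (lieA A (formal_integral b)) d e
          = hpart (lieA A (\<lambda>\<alpha>. - 1 * (\<Sum>\<gamma> | mdeg \<gamma> = d. R \<gamma> * monomial_solution \<gamma> \<alpha>))) d e"
        by (rule hpart_lieA_cong) (simp add: formal_integral_rec[OF _ 3] R_def)
      also have "\<dots> = - (\<Sum>\<gamma> | mdeg \<gamma> = d. R \<gamma> * hpart (lieA A (monomial_solution \<gamma>)) d e)"
        unfolding lieA_def lie_cmult lie_sum hpart_cmult hpart_sum by simp
      also have "(\<Sum>\<gamma> | mdeg \<gamma> = d. R \<gamma> * hpart (lieA A (monomial_solution \<gamma>)) d e)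
          = (\<Sum>\<gamma> | mdeg \<gamma> = d. R \<gamma> * mmon e \<gamma> - R \<gamma> * mmon v \<gamma> * lin l e ^ d)"
      proof (intro sum.cong refl)
        fix \<gamma> :: "nat^'n" assume "\<gamma> \<in> {\<gamma>. mdeg \<gamma> = d}"
        then have d: "d = mdeg \<gamma>" by simp
        show "R \<gamma> * hpart (lieA A (monomial_solution \<gamma>)) d e = R \<gamma> * mmon e \<gamma> - R \<gamma> * mmon v \<gamma> * lin l e ^ d"
          unfolding d monomial_solution(2) by (simp only: right_diff_distrib mult.assoc)
      qed
      finally show ?thesis by (simp add: sum_subtractf hpart_def sum_distrib_right)
    qed
    then show ?thesis unfolding s by (simp add: lin_v)
  qed
qed

text \<open>The linear map x to (A x, l(x)) is injective by \<open>kernel_trivial\<close>, hence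
  bounded below in finite dimension.\<close>

lemma linear_part_bounded_below:
  obtains B where "B > 0" "\<And>x :: real^'n. B * norm x \<le> (\<Sum>i\<in>UNIV. \<bar>\<Sum>j\<in>UNIV. A i j * x $ j\<bar>) + \<bar>lin l (vec_nth x)\<bar>"
proof -
  let ?f = "\<lambda>x :: real^'n. ((\<chi> i. \<Sum>j\<in>UNIV. A i j * x $ j) :: real^'n, lin l (vec_nth x))"
  have lin: "linear ?f"
    by (rule linearI)
       (simp_all add: vec_eq_iff algebra_simps sum.distrib sum_distrib_left)
  have "inj ?f"
  proof (subst linear_injective_0[OF lin], intro allI impI)
    fix x :: "real^'n" assume x: "?f x = 0"
    have "x $ i = 0" for i
      by (rule kernel_trivial) (use x in \<open>simp_all add: zero_prod_def vec_eq_iff\<close>)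
    then show "x = 0" by (simp add: vec_eq_iff)
  qed
  then obtain B where B: "B > 0" "\<And>x. B * norm x \<le> norm (?f x)"
    using linear_inj_bounded_below_pos[OF lin] by blast
  have "norm (?f x) \<le> (\<Sum>i\<in>UNIV. \<bar>\<Sum>j\<in>UNIV. A i j * x $ j\<bar>) + \<bar>lin l (vec_nth x)\<bar>" for x
  proof -
    have "norm (?f x) \<le> norm (\<chi> i. \<Sum>j\<in>UNIV. A i j * x $ j) + norm (lin l (vec_nth x))"
      using norm_Pair_le[of "\<chi> i. \<Sum>j\<in>UNIV. A i j * x $ j" "lin l (vec_nth x)"] by simp
    also have "norm (\<chi> i. \<Sum>j\<in>UNIV. A i j * x $ j) \<le> (\<Sum>i\<in>UNIV. \<bar>\<Sum>j\<in>UNIV. A i j * x $ j\<bar>)"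
      using norm_le_l1_cart[of "\<chi> i. \<Sum>j\<in>UNIV. A i j * x $ j"] by simp
    finally show ?thesis by simp
  qed
  then show ?thesis using B order_trans by (intro that[of B]) blast+
qed

text \<open>
  The zeros of \<open>X\<close> are tangent to the kernel of \<open>A\<close>, so \<open>l\<close> is bounded below by a multiple of the norm on
  them. A lowest nonzero resonant term \<open>\<kappa> l\<^sup>d\<close> of the derivative along \<open>X\<close>, which vanishes wherever \<open>X\<close> does,
  would therefore contradict the bound on the terms of higher order.
\<close>

lemma lie_formal_integral_eq_0:
  fixes X :: "real^'n \<Rightarrow> real^'n"
  defines "a \<equiv> \<lambda>i \<alpha>. lf (A i) \<alpha> + b i \<alpha>"
  assumes X: "\<And>i. has_power_series_at (\<lambda>x. X x $ i) (a i) 0"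
    and zeros: "0 islimpt {x. X x = 0}"
  shows "lie a (formal_integral b) \<gamma> = 0"
proof -
  define \<kappa> where "\<kappa> = (\<lambda>d. hpart (lie a (formal_integral b)) d v)"
  have res: "hpart (lie a (formal_integral b)) d e = \<kappa> d * lin l e ^ d" for d e
    unfolding \<kappa>_def a_def by (rule lie_formal_integral_resonant)
  have a0: "a i \<alpha> = 0" if "mdeg \<alpha> < 1" for i \<alpha>
    using that b[of \<alpha> i] by (simp add: a_def lf_eq_0)
  have a1: "a i (axis j 1) = A i j" for i j
    using b[of "axis j 1" i] by (simp only: a_def lf_axis) simp
  have "\<kappa> d = 0" for d
  proof (induction d rule: less_induct)
    case (less d)
    \<comment> \<open>The truncation converges, being a polynomial, and its derivative agrees with
      that of the full series up to degree d because the field has no constant term.\<close>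
    define T where "T = (\<lambda>\<alpha>. if mdeg \<alpha> \<le> d then formal_integral b \<alpha> else 0)"
    have TH: "lie a T \<gamma> = lie a (formal_integral b) \<gamma>" if "mdeg \<gamma> \<le> d" for \<gamma>
      by (rule lie_cong[where q = 1, OF a0]) (use that in \<open>auto simp: T_def\<close>)
    have hT: "hpart (lie a T) k e = \<kappa> k * lin l e ^ k" if "k \<le> d" for k e
      using hpart_cong[of k "lie a T" "lie a (formal_integral b)" e] TH that by (simp add: res)
    have low: "lie a T \<alpha> = 0" if "mdeg \<alpha> < d" for \<alpha>
      by (rule hpart_eq_0_imp_coeff_0[OF _ refl]) (use hT[of "mdeg \<alpha>"] less that in simp)
    obtain r where r: "r > 0" "\<And>i. mps_conv (a i) r"
      "\<And>x i. (\<And>j. \<bar>x $ j\<bar> \<le> r) \<Longrightarrow> X x $ i = mps (a i) (\<lambda>j. x $ j)"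
      using common_radius[OF X] by blast
    have Tc: "mps_conv T r"
      by (rule mps_conv_finite_support[OF finite_subset[OF _ finite_mdeg_le[of d]] r(1)]) (auto simp: T_def)
    have s: "0 < r / 2" "r / 2 < r" using r(1) by auto
    note L = mps_lie[where a = a, OF Tc r(2) s]
    obtain C where C: "C \<ge> 0" "\<And>x m. m \<le> r / 2 \<Longrightarrow> (\<And>i. \<bar>x i\<bar> \<le> m) \<Longrightarrow>
        \<bar>mps (lie a T) x - (\<Sum>\<alpha> | mdeg \<alpha> < Suc d. lie a T \<alpha> * mmon x \<alpha>)\<bar> \<le> C * m ^ Suc d"
      by (rule mps_remainder[OF L(1)]) blast
    have "\<forall>i. \<exists>D. D \<ge> 0 \<and> (\<forall>x m. m \<le> r \<longrightarrow> (\<forall>i. \<bar>x i\<bar> \<le> m) \<longrightarrow>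
        \<bar>mps (a i) x - (\<Sum>\<alpha> | mdeg \<alpha> < 2. a i \<alpha> * mmon x \<alpha>)\<bar> \<le> D * m ^ 2)"
    proof
      fix i
      obtain D where "D \<ge> 0" "\<And>x m. m \<le> r \<Longrightarrow> (\<And>i. \<bar>x i\<bar> \<le> m) \<Longrightarrow>
        \<bar>mps (a i) x - (\<Sum>\<alpha> | mdeg \<alpha> < 2. a i \<alpha> * mmon x \<alpha>)\<bar> \<le> D * m ^ 2"
        by (rule mps_remainder[OF r(2)]) blast
      then show "\<exists>D. D \<ge> 0 \<and> (\<forall>x m. m \<le> r \<longrightarrow> (\<forall>i. \<bar>x i\<bar> \<le> m) \<longrightarrow>
        \<bar>mps (a i) x - (\<Sum>\<alpha> | mdeg \<alpha> < 2. a i \<alpha> * mmon x \<alpha>)\<bar> \<le> D * m ^ 2)"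
        by (intro exI[of _ D]) simp
    qed
    then obtain D where D': "\<forall>i. D i \<ge> 0 \<and> (\<forall>x m. m \<le> r \<longrightarrow> (\<forall>i. \<bar>x i\<bar> \<le> m) \<longrightarrow>
        \<bar>mps (a i) x - (\<Sum>\<alpha> | mdeg \<alpha> < 2. a i \<alpha> * mmon x \<alpha>)\<bar> \<le> D i * m ^ 2)"
      by (rule choice[THEN exE])
    then have D: "D i \<ge> 0" "m \<le> r \<Longrightarrow> (\<And>i. \<bar>x i\<bar> \<le> m) \<Longrightarrow>
        \<bar>mps (a i) x - (\<Sum>\<alpha> | mdeg \<alpha> < 2. a i \<alpha> * mmon x \<alpha>)\<bar> \<le> D i * m ^ 2" for i x m
      by auto
    obtain B where B: "B > 0" "\<And>x :: real^'n. B * norm x \<le> (\<Sum>i\<in>UNIV. \<bar>\<Sum>j\<in>UNIV. A i j * x $ j\<bar>) + \<bar>lin l (vec_nth x)\<bar>"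
      by (rule linear_part_bounded_below) blast
    define S where "S = (\<Sum>i\<in>UNIV. D i)"
    have S: "S \<ge> 0" unfolding S_def by (intro sum_nonneg D)
    have key: "\<bar>\<kappa> d\<bar> * (B / 2) ^ d \<le> C * norm x"
      if x: "X x = 0" "x \<noteq> 0" "norm x \<le> r / 2" "norm x * (2 * S) \<le> B" for x
    proof -
      have xi: "\<bar>x $ i\<bar> \<le> norm x" for i by (rule component_le_norm_cart)
      have nx: "norm x > 0" using x by simp
      have xr: "\<bar>x $ i\<bar> \<le> r" for i using xi[of i] x r(1) by linarith
      have z: "mps (a i) (\<lambda>j. x $ j) = 0" for i using r(3)[OF xr, of i] x by simp
      have "\<bar>\<Sum>j\<in>UNIV. A i j * x $ j\<bar> \<le> D i * norm x ^ 2" for i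
      proof -
        have "\<bar>mps (a i) (\<lambda>j. x $ j) - (\<Sum>\<alpha> | mdeg \<alpha> < 2. a i \<alpha> * mmon (\<lambda>j. x $ j) \<alpha>)\<bar> \<le> D i * norm x ^ 2"
          by (rule D(2)) (use x r(1) xi in auto)
        then show ?thesis unfolding z sum_mdeg_less_2 by (simp only: a1) (simp add: a0)
      qed
      then have "(\<Sum>i\<in>UNIV. \<bar>\<Sum>j\<in>UNIV. A i j * x $ j\<bar>) \<le> (\<Sum>i\<in>UNIV. D i * norm x ^ 2)"
        by (intro sum_mono)
      also have "\<dots> = norm x * S * norm x" by (simp add: S_def sum_distrib_left sum_distrib_right power2_eq_square mult_ac)
      also have "\<dots> \<le> (B / 2) * norm x" using x(4) by (intro mult_right_mono) auto
      finally have "(B / 2) * norm x \<le> \<bar>lin l (vec_nth x)\<bar>" using B(2)[of x] by simp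
      then have "((B / 2) * norm x) ^ d \<le> \<bar>lin l (vec_nth x)\<bar> ^ d"
        using B(1) by (intro power_mono) auto
      then have "\<bar>\<kappa> d\<bar> * ((B / 2) * norm x) ^ d \<le> \<bar>\<kappa> d\<bar> * \<bar>lin l (vec_nth x)\<bar> ^ d"
        by (intro mult_left_mono) auto
      also have "\<dots> = \<bar>hpart (lie a T) d (\<lambda>j. x $ j)\<bar>"
        by (simp add: hT abs_mult power_abs)
      also have "\<dots> = \<bar>mps (lie a T) (\<lambda>j. x $ j) - (\<Sum>\<alpha> | mdeg \<alpha> < Suc d. lie a T \<alpha> * mmon (\<lambda>j. x $ j) \<alpha>)\<bar>"
      proof -
        have "mps (lie a T) (\<lambda>j. x $ j) = 0"
          using L(2)[of "\<lambda>j. x $ j"] order_trans[OF xi x(3)] by (simp add: z)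
        moreover have "(\<Sum>\<alpha> | mdeg \<alpha> < Suc d. lie a T \<alpha> * mmon (vec_nth x) \<alpha>) = hpart (lie a T) d (vec_nth x)"
          by (rule sum_mdeg_less_Suc_lowest) (rule low)
        ultimately show ?thesis by simp
      qed
      also have "\<dots> \<le> C * norm x ^ Suc d" by (rule C(2)) (use x xi in auto)
      finally have "(\<bar>\<kappa> d\<bar> * (B / 2) ^ d) * norm x ^ d \<le> (C * norm x) * norm x ^ d"
        by (simp add: power_mult_distrib power_divide mult_ac)
      then show ?thesis by (rule mult_right_le_imp_le) (use nx in simp)
    qed
    show "\<kappa> d = 0"
    proof (rule ccontr)
      assume nz: "\<kappa> d \<noteq> 0"
      define c where "c = \<bar>\<kappa> d\<bar> * (B / 2) ^ d"
      have c: "c > 0" using nz B(1) by (simp add: c_def)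
      \<comment> \<open>The first bound stays where the expansions hold, the second makes |l(x)| at
        least (B/2)|x| at zeros of X, and the third makes the remainder C |x| smaller than c. Each
        summand 1 avoids division by 0.\<close>
      define \<epsilon> where "\<epsilon> = min (r / 2) (min (B / (2 * S + 1)) (c / (C + 1)))"
      have \<epsilon>: "\<epsilon> > 0" using r(1) B(1) S c C(1) by (simp add: \<epsilon>_def)
      obtain x where x: "X x = 0" "x \<noteq> 0" "norm x < \<epsilon>"
        using zeros \<epsilon> unfolding islimpt_approachable by (auto simp: dist_norm)
      have "norm x < B / (2 * S + 1)" "norm x < c / (C + 1)" "norm x \<le> r / 2"
        using x(3) by (auto simp: \<epsilon>_def)
      then have le: "norm x * (2 * S + 1) < B" "norm x * (C + 1) < c"
        using S C(1) by (auto simp: pos_less_divide_eq)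
      have "norm x * (2 * S) \<le> B" using le(1) norm_ge_zero[of x] unfolding distrib_left by linarith
      then have "c \<le> C * norm x" unfolding c_def using x \<open>norm x \<le> r / 2\<close> by (intro key) auto
      then show False using le(2) norm_ge_zero[of x] unfolding distrib_left mult.commute[of C] by linarith
    qed
  qed
  then have "hpart (lie a (formal_integral b)) (mdeg \<gamma>) e = 0" for e by (simp add: res)
  then show ?thesis by (rule hpart_eq_0_imp_coeff_0) simp
qed

text \<open>Subtracting the polynomial in H with the same restriction to the line of v leaves a
  first integral E without terms below degree d. Its form of degree d is killed by the derivation
  along A x and vanishes at v, so it is 0 by uniqueness.\<close>

lemma first_integral_composition:
  defines "a \<equiv> \<lambda>i \<alpha>. lf (A i) \<alpha> + b i \<alpha>"
  assumes H: "\<And>\<gamma>. lie a (formal_integral b) \<gamma> = 0" and F: "\<And>\<gamma>. lie a F \<gamma> = 0"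
  shows "F \<alpha> = (\<Sum>k\<le>mdeg \<alpha>. hpart F k v * gpow (formal_integral b) k \<alpha>)"
proof (induction "mdeg \<alpha>" arbitrary: \<alpha> rule: less_induct)
  case less
  define d where "d = mdeg \<alpha>"
  define E where "E = (\<lambda>\<beta>. F \<beta> - (\<Sum>k\<le>d. hpart F k v * gpow (formal_integral b) k \<beta>))"
  have H': "lie a (formal_integral b) = (\<lambda>_. 0)" using H by blast
  have gz: "gpow (formal_integral b) k \<beta> = 0" if "mdeg \<beta> < k" for k \<beta>
    by (rule gpow_eq_0[of "formal_integral b", OF formal_integral_0 that])
  have low: "E \<beta> = 0" if "mdeg \<beta> < d" for \<beta>
  proof -
    have "(\<Sum>k\<le>d. hpart F k v * gpow (formal_integral b) k \<beta>) = (\<Sum>k\<le>mdeg \<beta>. hpart F k v * gpow (formal_integral b) k \<beta>)"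
      by (rule sum.mono_neutral_right) (use that in \<open>auto simp: gz\<close>)
    then show ?thesis using less[of \<beta>] that by (simp add: E_def d_def)
  qed
  have "lie a E \<gamma> = 0" for \<gamma>
    unfolding E_def lie_diff lie_sum lie_cmult lie_gpow[OF H'] by (simp add: F)
  then have "lieA A E \<gamma> + lie b E \<gamma> = 0" for \<gamma>
    unfolding a_def lie_add_field lieA_def by blast
  moreover have "lie b E \<gamma> = 0" if "mdeg \<gamma> = d" for \<gamma>
  proof -
    have "lie b E \<gamma> = lie b (\<lambda>_. 0) \<gamma>"
      by (rule lie_cong[OF b]) (use that in \<open>auto intro: low\<close>)
    then show ?thesis by simp
  qed
  ultimately have "lieA A E \<gamma> = 0" if "mdeg \<gamma> = d" for \<gamma> using that by (metis add.right_neutral)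
  then have 1: "hpart (lieA A E) d e = 0" for e
    using hpart_cong[of d "lieA A E" "\<lambda>_. 0" e] by simp
  have "hfps (formal_integral b) v = fps_X"
    by (rule fps_ext) (auto simp: hpart_formal_integral_v fps_X_nth)
  then have g: "hpart (gpow (formal_integral b) k) d v = (if d = k then 1 else 0)" for k
    using hfps_nth[of "gpow (formal_integral b) k" v d] by (simp add: hfps_gpow fps_X_power_nth del: hfps_nth)
  have "hpart E d v = 0"
    unfolding E_def hpart_diff hpart_sum hpart_cmult g
    by (simp add: if_distrib[of "\<lambda>x. _ * x"] cong: if_cong)
  then have "hpart E d e = 0" for e using unique[OF 1] by blast
  then have "E \<alpha> = 0" by (rule hpart_eq_0_imp_coeff_0) (simp add: d_def)
  then show ?case by (simp add: E_def d_def)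
qed

end

text \<open>The perturbation is affine in t and starts in degree 2. A term of \<open>lie b\<close>
  in degree d pairs a coefficient of degree at most d - 1, by induction a polynomial of that degree
  in t, with one further factor affine in t.\<close>

lemma formal_integral_poly:
  fixes f0 :: "'n \<Rightarrow> nat^'n \<Rightarrow> real" and f :: "'m::finite \<Rightarrow> 'n \<Rightarrow> nat^'n \<Rightarrow> real"
  defines "b \<equiv> \<lambda>(t :: real^'m) i \<alpha>. f0 i \<alpha> + (\<Sum>j\<in>UNIV. t $ j * f j i \<alpha>)"
  assumes f0: "\<And>i \<alpha>. mdeg \<alpha> < 2 \<Longrightarrow> f0 i \<alpha> = 0" and f: "\<And>j i \<alpha>. mdeg \<alpha> < 2 \<Longrightarrow> f j i \<alpha> = 0"
  shows "real_poly_deg (mdeg \<alpha>) (\<lambda>t. formal_integral (b t) \<alpha>)"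
proof (induction "mdeg \<alpha>" arbitrary: \<alpha> rule: less_induct)
  case less
  have bz: "b t i \<alpha> = 0" if "mdeg \<alpha> < 2" for t i \<alpha> using that by (simp add: b_def f0 f)
  consider "\<alpha> = 0" | "mdeg \<alpha> = 1" | "mdeg \<alpha> \<ge> 2" by (metis One_nat_def Suc_leI le_neq_implies_less less_2_cases_iff mdeg_eq_0_iff not_less)
  then show ?case
  proof cases
    case 1
    then show ?thesis by (simp add: formal_integral_0 real_poly_deg_const)
  next
    case 2
    then show ?thesis using formal_integral_1[OF 2] by (simp add: real_poly_deg_const)
  next
    case 3
    have b1: "real_poly_deg 1 (\<lambda>t. b t i \<beta>)" for i \<beta>
      unfolding b_def
      by (intro real_poly_deg_add real_poly_deg_sum real_poly_deg_const
          real_poly_deg_mult[OF real_poly_deg_var real_poly_deg_const[of 0]]) simp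
    have L: "real_poly_deg (mdeg \<alpha>) (\<lambda>t. lie (b t) (formal_integral (b t)) \<gamma>)" if \<gamma>: "mdeg \<gamma> = mdeg \<alpha>" for \<gamma>
      unfolding lie_def gmult_def case_prod_beta
    proof (intro real_poly_deg_sum)
      fix i p assume "p \<in> {p :: (nat^'n) \<times> (nat^'n). fst p + snd p = \<gamma>}"
      then have d: "mdeg (fst p) + mdeg (snd p) = mdeg \<alpha>" using \<gamma> by auto
      show "real_poly_deg (mdeg \<alpha>) (\<lambda>t. psderiv i (formal_integral (b t)) (fst p) * b t i (snd p))"
      proof (cases "mdeg (snd p) < 2")
        case True
        then show ?thesis by (simp add: bz real_poly_deg_const)
      next
        case False
        then have "real_poly_deg (mdeg (fst p + axis i 1)) (\<lambda>t. formal_integral (b t) (fst p + axis i 1))"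
          using d by (intro less) simp
        then have "real_poly_deg (mdeg (fst p) + 1) (\<lambda>t. psderiv i (formal_integral (b t)) (fst p))"
          unfolding psderiv_def by (intro real_poly_deg_mult[OF real_poly_deg_const[of 0]]) auto
        then show ?thesis by (rule real_poly_deg_mult[OF _ b1]) (use d False in simp)
      qed
    qed
    have "(\<lambda>t. formal_integral (b t) \<alpha>)
        = (\<lambda>t. \<Sum>\<gamma> | mdeg \<gamma> = mdeg \<alpha>. lie (b t) (formal_integral (b t)) \<gamma> * (- monomial_solution \<gamma> \<alpha>))"
      using formal_integral_rec[OF bz refl 3] by (simp add: fun_eq_iff sum_negf)
    then show ?thesis
      by (simp only:) (intro real_poly_deg_sum real_poly_deg_mult[OF L real_poly_deg_const[of 0]]; simp)
  qed
qed

end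

section \<open>Affine families of systems\<close>

lemma has_power_series_at_add:
  assumes "has_power_series_at f a p" "has_power_series_at g b p"
  shows "has_power_series_at (\<lambda>x. f x + g x) (\<lambda>\<alpha>. a \<alpha> + b \<alpha>) p"
proof -
  obtain r s where r: "r > 0" "\<And>x. x \<in> ball p r \<Longrightarrow> ((\<lambda>\<alpha>. a \<alpha> * (\<Prod>i\<in>UNIV. (x $ i - p $ i) ^ (\<alpha> $ i))) has_sum f x) UNIV"
    and s: "s > 0" "\<And>x. x \<in> ball p s \<Longrightarrow> ((\<lambda>\<alpha>. b \<alpha> * (\<Prod>i\<in>UNIV. (x $ i - p $ i) ^ (\<alpha> $ i))) has_sum g x) UNIV"
    using assms unfolding has_power_series_at_def by blast
  have "((\<lambda>\<alpha>. (a \<alpha> + b \<alpha>) * (\<Prod>i\<in>UNIV. (x $ i - p $ i) ^ (\<alpha> $ i))) has_sum (f x + g x)) UNIV"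
    if "x \<in> ball p (min r s)" for x
    unfolding distrib_right using that by (intro has_sum_add r(2) s(2)) auto
  then show ?thesis unfolding has_power_series_at_def using r(1) s(1) by (intro exI[of _ "min r s"]) auto
qed

lemma has_power_series_at_cmult:
  assumes "has_power_series_at f a p"
  shows "has_power_series_at (\<lambda>x. c * f x) (\<lambda>\<alpha>. c * a \<alpha>) p"
proof -
  obtain r where r: "r > 0" "\<And>x. x \<in> ball p r \<Longrightarrow> ((\<lambda>\<alpha>. a \<alpha> * (\<Prod>i\<in>UNIV. (x $ i - p $ i) ^ (\<alpha> $ i))) has_sum f x) UNIV"
    using assms unfolding has_power_series_at_def by blast
  have "((\<lambda>\<alpha>. c * a \<alpha> * (\<Prod>i\<in>UNIV. (x $ i - p $ i) ^ (\<alpha> $ i))) has_sum c * f x) UNIV" if "x \<in> ball p r" for x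
    unfolding mult.assoc by (rule has_sum_cmult_right[OF r(2)[OF that]])
  then show ?thesis unfolding has_power_series_at_def using r(1) by (intro exI[of _ r]) simp
qed

lemma has_power_series_at_sum:
  assumes "finite I" "\<And>j. j \<in> I \<Longrightarrow> has_power_series_at (f j) (a j) p"
  shows "has_power_series_at (\<lambda>x. \<Sum>j\<in>I. f j x) (\<lambda>\<alpha>. \<Sum>j\<in>I. a j \<alpha>) p"
  using assms
proof (induction I rule: finite_induct)
  case empty
  then show ?case by (auto simp: has_power_series_at_def intro!: exI[of _ "1::real"])
qed (simp add: has_power_series_at_add)

lemma has_power_series_at_linear:
  "has_power_series_at (\<lambda>x :: real^'n. \<Sum>j\<in>UNIV. \<xi> j * x $ j) (lf \<xi>) 0"
proof -
  have "mps_conv (lf \<xi>) 1"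
    by (rule mps_conv_finite_support[OF finite_subset[OF _ finite_mdeg[of 1]]]) (auto intro: ccontr simp: lf_eq_0)
  moreover have "(\<Sum>j\<in>UNIV. \<xi> j * x $ j) = mps (lf \<xi>) (vec_nth x)" for x :: "real^'n"
    using mps_finite_support[OF finite_mdeg[of 1], of "lf \<xi>" "vec_nth x"] hpart_lf[of \<xi> 1 "vec_nth x"]
    by (simp add: lf_eq_0 hpart_def)
  ultimately show ?thesis unfolding has_power_series_at_iff by (intro exI[of _ 1]) simp
qed

text \<open>Along a coordinate axis a component is c_0 + c_1 u + O(u^2) and also o(u), so |c_0 + c_1
  u| <= \<epsilon> |u| near 0 for every \<epsilon> > 0. First u tending to 0 gives c_0 = 0, then
  |c_1| <= \<epsilon>.\<close>

lemma higher_order_field_coeffs: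
  fixes f :: "real^'n \<Rightarrow> real^'n"
  assumes "higher_order_field f"
  obtains c where "\<And>i. has_power_series_at (\<lambda>x. f x $ i) (c i) 0" "\<And>i \<alpha>. mdeg \<alpha> < 2 \<Longrightarrow> c i \<alpha> = 0"
proof -
  obtain U where U: "0 \<in> U" "\<And>i. real_analytic_on (\<lambda>x. f x $ i) U"
    and o: "(\<lambda>x. norm (f x)) \<in> o[at 0](\<lambda>x. norm x)"
    using assms by (auto simp: higher_order_field_def analytic_near_origin_def)
  have "\<forall>i. \<exists>a. has_power_series_at (\<lambda>x. f x $ i) a 0" using U by (auto simp: real_analytic_on_def)
  then obtain c where c: "\<And>i. has_power_series_at (\<lambda>x. f x $ i) (c i) 0" by metis
  obtain r where r: "r > 0" "\<And>i. mps_conv (c i) r" "\<And>x i. (\<And>j. \<bar>x $ j\<bar> \<le> r) \<Longrightarrow> f x $ i = mps (c i) (\<lambda>j. x $ j)"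
    using common_radius[OF c] by blast
  have bound: "\<forall>\<^sub>F u in at 0. \<bar>c i 0 + c i (axis j 1) * u\<bar> \<le> \<epsilon> * \<bar>u\<bar>" if \<epsilon>: "\<epsilon> > 0" for i j \<epsilon>
  proof -
    obtain C where C: "C \<ge> 0" "\<And>x m. m \<le> r \<Longrightarrow> (\<And>i. \<bar>x i\<bar> \<le> m) \<Longrightarrow>
        \<bar>mps (c i) x - (\<Sum>\<alpha> | mdeg \<alpha> < 2. c i \<alpha> * mmon x \<alpha>)\<bar> \<le> C * m ^ 2"
      by (rule mps_remainder[OF r(2)]) blast
    have "\<forall>\<^sub>F x in at 0. norm (norm (f x)) \<le> \<epsilon> / 2 * norm (norm x)"
      by (rule landau_o.smallD[OF o]) (use \<epsilon> in simp)
    then obtain \<delta> where \<delta>: "\<delta> > 0" "\<And>x. x \<noteq> 0 \<Longrightarrow> dist x 0 < \<delta> \<Longrightarrow> norm (f x) \<le> \<epsilon> / 2 * norm x"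
      unfolding eventually_at by auto
    define \<eta> where "\<eta> = min \<delta> (min r (\<epsilon> / (2 * (C + 1))))"
    have \<eta>: "\<eta> > 0" using \<delta> r(1) \<epsilon> C(1) by (simp add: \<eta>_def)
    have "\<bar>c i 0 + c i (axis j 1) * u\<bar> \<le> \<epsilon> * \<bar>u\<bar>" if u: "u \<noteq> 0" "\<bar>u\<bar> < \<eta>" for u
    proof -
      let ?x = "axis j u :: real^'n"
      have ux: "\<bar>?x $ k\<bar> \<le> \<bar>u\<bar>" for k by (simp add: axis_def)
      have "?x = u *\<^sub>R axis j 1" by (simp add: vec_eq_iff axis_def)
      then have nx: "norm ?x = \<bar>u\<bar>" by simp
      have x0: "?x \<noteq> 0" using u by simp
      have le: "\<bar>u\<bar> \<le> r" "\<bar>u\<bar> < \<delta>" "\<bar>u\<bar> < \<epsilon> / (2 * (C + 1))" using u by (auto simp: \<eta>_def)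
      have s: "(\<Sum>k\<in>UNIV. c i (axis k 1) * ?x $ k) = c i (axis j 1) * u"
      proof -
        have "(\<Sum>k\<in>UNIV. c i (axis k 1) * ?x $ k) = (\<Sum>k\<in>UNIV. if k = j then c i (axis k 1) * u else 0)"
          by (intro sum.cong) (auto simp: axis_def)
        then show ?thesis by simp
      qed
      have "\<bar>mps (c i) (\<lambda>k. ?x $ k) - (\<Sum>\<alpha> | mdeg \<alpha> < 2. c i \<alpha> * mmon (\<lambda>k. ?x $ k) \<alpha>)\<bar> \<le> C * \<bar>u\<bar> ^ 2"
        by (rule C(2)[OF le(1) ux])
      moreover have "mps (c i) (\<lambda>k. ?x $ k) = f ?x $ i"
        by (rule r(3)[symmetric]) (use ux le order_trans in blast)
      ultimately have 1: "\<bar>f ?x $ i - (c i 0 + c i (axis j 1) * u)\<bar> \<le> C * \<bar>u\<bar> ^ 2"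
        unfolding sum_mdeg_less_2 s by simp
      have 2: "\<bar>f ?x $ i\<bar> \<le> \<epsilon> / 2 * \<bar>u\<bar>"
        using order_trans[OF component_le_norm_cart[of "f ?x" i] \<delta>(2)[OF x0]] le nx by (simp add: dist_norm)
      have "C * \<bar>u\<bar> \<le> \<epsilon> / 2"
      proof -
        have "\<bar>u\<bar> * (2 * (C + 1)) < \<epsilon>" using le(3) C(1) by (simp add: pos_less_divide_eq)
        then show ?thesis using abs_ge_zero[of u] by (simp add: algebra_simps)
      qed
      then have "C * \<bar>u\<bar> ^ 2 \<le> \<epsilon> / 2 * \<bar>u\<bar>"
        using mult_right_mono[of "C * \<bar>u\<bar>" "\<epsilon> / 2" "\<bar>u\<bar>"] by (simp add: power2_eq_square mult.assoc)
      then show ?thesis using 1 2 by linarith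
    qed
    then show ?thesis unfolding eventually_at using \<eta> by (intro exI[of _ \<eta>]) (auto simp: dist_real_def)
  qed
  have c0: "c i 0 = 0" for i
  proof -
    fix j :: 'n
    have "((\<lambda>u. \<bar>c i 0 + c i (axis j 1) * u\<bar>) \<longlongrightarrow> \<bar>c i 0 + c i (axis j 1) * 0\<bar>) (at 0)"
      by (intro tendsto_intros)
    moreover have "((\<lambda>u :: real. 1 * \<bar>u\<bar>) \<longlongrightarrow> 1 * \<bar>0\<bar>) (at 0)" by (intro tendsto_intros)
    ultimately have "\<bar>c i 0 + c i (axis j 1) * 0\<bar> \<le> 1 * \<bar>0 :: real\<bar>"
      using bound[of 1 i j] by (intro tendsto_le[of "at (0::real)"]) auto
    then show ?thesis by simp
  qed
  have c1: "c i (axis j 1) = 0" for i j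
  proof -
    have "\<bar>c i (axis j 1)\<bar> \<le> 0 + \<epsilon>" if "\<epsilon> > 0" for \<epsilon>
    proof -
      have "\<forall>\<^sub>F u in at (0::real). \<bar>c i 0 + c i (axis j 1) * u\<bar> \<le> \<epsilon> * \<bar>u\<bar> \<and> u \<noteq> 0"
        using bound[OF that] by (intro eventually_conj) (auto simp: eventually_at_filter)
      then obtain u :: real where "\<bar>c i (axis j 1) * u\<bar> \<le> \<epsilon> * \<bar>u\<bar>" "u \<noteq> 0"
        using eventually_happens'[OF trivial_limit_at] c0 by force
      then show ?thesis by (simp add: abs_mult)
    qed
    then have "\<bar>c i (axis j 1)\<bar> \<le> 0" by (rule field_le_epsilon)
    then show ?thesis by simp
  qed
  have "c i \<alpha> = 0" if "mdeg \<alpha> < 2" for i \<alpha>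
  proof -
    from that have "mdeg \<alpha> = 0 \<or> mdeg \<alpha> = 1" by linarith
    then show ?thesis using c0 c1 unfolding mdeg_eq_0_iff mdeg_eq_1_iff by blast
  qed
  then show ?thesis using c by (intro that[of c])
qed

lemma affine_family_coeffs:
  fixes A :: "real^'n^'n" and Y :: "'m::finite \<Rightarrow> real^'n \<Rightarrow> real^'n"
  assumes "is_affine_family A Y0 Y"
  obtains f0 f where
    "\<And>t i. has_power_series_at (\<lambda>x. system_family Y0 Y t x $ i)
        (\<lambda>\<alpha>. lf (\<lambda>j. A $ i $ j) \<alpha> + (f0 i \<alpha> + (\<Sum>j\<in>UNIV. t $ j * f j i \<alpha>))) 0"
    "\<And>i \<alpha>. mdeg \<alpha> < 2 \<Longrightarrow> f0 i \<alpha> = 0" "\<And>j i \<alpha>. mdeg \<alpha> < 2 \<Longrightarrow> f j i \<alpha> = 0"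
proof -
  obtain g where g: "higher_order_field g" "\<And>x. Y0 x = A *v x + g x" and Y: "\<And>j. higher_order_field (Y j)"
    using assms by (auto simp: is_affine_family_def analytic_systems_def)
  obtain f0 where f0: "\<And>i. has_power_series_at (\<lambda>x. g x $ i) (f0 i) 0" "\<And>i \<alpha>. mdeg \<alpha> < 2 \<Longrightarrow> f0 i \<alpha> = 0"
    using higher_order_field_coeffs[OF g(1)] by blast
  have "\<forall>j. \<exists>c. (\<forall>i. has_power_series_at (\<lambda>x. Y j x $ i) (c i) 0) \<and> (\<forall>i \<alpha>. mdeg \<alpha> < 2 \<longrightarrow> c i \<alpha> = 0)"
    using higher_order_field_coeffs[OF Y] by metis
  then obtain f where f: "\<And>j i. has_power_series_at (\<lambda>x. Y j x $ i) (f j i) 0" "\<And>j i \<alpha>. mdeg \<alpha> < 2 \<Longrightarrow> f j i \<alpha> = 0"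
    by metis
  have "has_power_series_at (\<lambda>x. system_family Y0 Y t x $ i)
        (\<lambda>\<alpha>. lf (\<lambda>j. A $ i $ j) \<alpha> + (f0 i \<alpha> + (\<Sum>j\<in>UNIV. t $ j * f j i \<alpha>))) 0" for t i
  proof -
    have "(\<lambda>x. system_family Y0 Y t x $ i) = (\<lambda>x. (\<Sum>j\<in>UNIV. A $ i $ j * x $ j) + (g x $ i + (\<Sum>j\<in>UNIV. t $ j * Y j x $ i)))"
      by (simp add: system_family_def g(2) matrix_vector_mult_def fun_eq_iff)
    then show ?thesis
      by (simp only:) (rule has_power_series_at_add[OF has_power_series_at_linear
          has_power_series_at_add[OF f0(1) has_power_series_at_sum[OF finite has_power_series_at_cmult[OF f(1)]]]])
  qed
  then show ?thesis using f0(2) f(2) by (rule that)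
qed

lemma analytic_first_integral_exists:
  fixes X :: "real^'n \<Rightarrow> real^'n"
  assumes "\<And>i. has_power_series_at (\<lambda>x. X x $ i) (a i) 0" "has_analytic_first_integral X"
  shows "\<exists>F r \<alpha>. mps_conv F r \<and> \<alpha> \<noteq> 0 \<and> F \<alpha> \<noteq> 0 \<and> (\<forall>\<gamma>. lie a F \<gamma> = 0)"
  by (rule analytic_first_integral_coeffs[where X = X and a = a, OF assms]) blast

lemma formal_first_integralI:
  fixes X :: "real^'n \<Rightarrow> real^'n"
  assumes "\<And>i. has_power_series_at (\<lambda>x. X x $ i) (a i) 0" "\<alpha> \<noteq> 0" "H \<alpha> \<noteq> 0" "\<And>\<gamma>. lie a H \<gamma> = 0"
  shows "has_formal_first_integral X"
proof -
  have "\<forall>\<gamma>. (\<Sum>i\<in>UNIV. mfps_mult (mfps_deriv i H) (a i) \<gamma>) = 0"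
    unfolding mfps_mult_eq_gmult mfps_deriv_eq_psderiv using assms(4) unfolding lie_def by (rule allI)
  then show ?thesis using assms(1-3) unfolding has_formal_first_integral_def by blast
qed

theorem theorem2:
  fixes A :: "real^'n^'n"
    and lam :: "nat \<Rightarrow> complex"
    and Y0 :: "real^'n \<Rightarrow> real^'n"
    and Y :: "'m::finite \<Rightarrow> real^'n \<Rightarrow> real^'n"
  assumes "CARD('n) \<ge> 2"
    and "char_polynomial A = (\<Prod>i=1..CARD('n). [:- lam i, 1:])"
    and "lam 1 = 0"
    and "\<forall>k :: nat \<Rightarrow> nat. (\<Sum>i=2..CARD('n). k i) \<ge> 2 \<longrightarrow>
           (\<Sum>i=2..CARD('n). of_nat (k i) * lam i) \<noteq> 0"
    and "is_affine_family A Y0 Y"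
    and "\<forall>t :: real^'m. origin_nonisolated_singularity (system_family Y0 Y t)"
  shows "((\<exists>t :: real^'m. has_formal_first_integral (system_family Y0 Y t) \<and>
               \<not> has_analytic_first_integral (system_family Y0 Y t)) \<longrightarrow>
           (\<exists>S :: (real^'m) set. pluripolar (complex_points S) \<and>
               (\<forall>t. t \<notin> S \<longrightarrow> has_formal_first_integral (system_family Y0 Y t) \<and>
                   \<not> has_analytic_first_integral (system_family Y0 Y t)))) \<and>
         ((\<exists>S :: (real^'m) set. \<not> pluripolar (complex_points S) \<and>
               (\<forall>t\<in>S. has_analytic_first_integral (system_family Y0 Y t))) \<longrightarrow>
           (\<forall>t :: real^'m. has_analytic_first_integral (system_family Y0 Y t)))"
proof -
  let ?X = "system_family Y0 Y"
  obtain v l where "simple_kernel (\<lambda>i j. A $ i $ j) v l"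
  proof (rule nonresonant_linear_part[OF assms(1-4)], goal_cases)
    case (1 v l)
    have "simple_kernel (\<lambda>i j. A $ i $ j) v l"
      by (rule simple_kernel.intro) (fact 1)+
    then show ?case by (rule that)
  qed
  then interpret simple_kernel "\<lambda>i j. A $ i $ j" v l .
  obtain f0 f where Yps: "\<And>t i. has_power_series_at (\<lambda>x. ?X t x $ i)
        (\<lambda>\<alpha>. lf (\<lambda>j. A $ i $ j) \<alpha> + (f0 i \<alpha> + (\<Sum>j\<in>UNIV. t $ j * f j i \<alpha>))) 0"
    and f: "\<And>i \<alpha>. mdeg \<alpha> < 2 \<Longrightarrow> f0 i \<alpha> = 0" "\<And>j i \<alpha>. mdeg \<alpha> < 2 \<Longrightarrow> f j i \<alpha> = 0"
  proof (rule affine_family_coeffs[OF assms(5)], goal_cases)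
    case (1 f0 f)
    show ?case by (rule that) (fact 1)+
  qed
  define b where "b = (\<lambda>t i \<alpha>. f0 i \<alpha> + (\<Sum>j\<in>UNIV. t $ j * f j i \<alpha>))"
  have b: "b t i \<alpha> = 0" if "mdeg \<alpha> < 2" for t i \<alpha> using that by (simp add: b_def f)
  have ps: "has_power_series_at (\<lambda>x. ?X t x $ i) (\<lambda>\<alpha>. lf (\<lambda>j. A $ i $ j) \<alpha> + b t i \<alpha>) 0" for t i
    unfolding b_def by (rule Yps)
  define H where "H = (\<lambda>t. formal_integral (b t))"
  have lieH: "lie (\<lambda>i \<alpha>. lf (\<lambda>j. A $ i $ j) \<alpha> + b t i \<alpha>) (H t) \<gamma> = 0" for t \<gamma>
    unfolding H_def
    by (rule lie_formal_integral_eq_0[OF b ps]) (use assms(6) in \<open>simp_all add: origin_nonisolated_singularity_def\<close>)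
  have Hv: "hpart (H t) d v = (if d = 1 then 1 else 0)" for t d
    unfolding H_def by (rule hpart_formal_integral_v[OF b])
  have nz: "\<exists>\<alpha>. \<alpha> \<noteq> 0 \<and> H t \<alpha> \<noteq> 0" for t
  proof (rule ccontr)
    assume "\<not> ?thesis"
    then have "H t \<alpha> = 0" if "mdeg \<alpha> = 1" for \<alpha> using that by (metis mdeg_0 zero_neq_one)
    then have "hpart (H t) 1 v = hpart (\<lambda>_. 0) 1 v" by (rule hpart_cong)
    then show False by (simp only: Hv hpart_0) simp
  qed
  have formal: "has_formal_first_integral (?X t)" for t
  proof -
    obtain \<alpha> where "\<alpha> \<noteq> 0" "H t \<alpha> \<noteq> 0" using nz by blast
    then show ?thesis by (rule formal_first_integralI[where X = "?X t" and a = "\<lambda>i \<alpha>. lf (\<lambda>j. A $ i $ j) \<alpha> + b t i \<alpha>", OF ps _ _ lieH])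
  qed
  have analytic_iff: "has_analytic_first_integral (?X t) \<longleftrightarrow> (\<exists>K. \<forall>\<alpha>. \<alpha> \<noteq> 0 \<longrightarrow> \<bar>H t \<alpha>\<bar> \<le> K ^ mdeg \<alpha>)" for t
  proof
    assume "has_analytic_first_integral (?X t)"
    from analytic_first_integral_exists[where X = "?X t" and a = "\<lambda>i \<alpha>. lf (\<lambda>j. A $ i $ j) \<alpha> + b t i \<alpha>", OF ps this]
    obtain F r \<alpha>0 where F: "mps_conv F r" "\<alpha>0 \<noteq> 0" "F \<alpha>0 \<noteq> 0"
      and lieF: "\<forall>\<gamma>. lie (\<lambda>i \<alpha>. lf (\<lambda>j. A $ i $ j) \<alpha> + b t i \<alpha>) F \<gamma> = 0"
      by (elim exE conjE)
    show "\<exists>K. \<forall>\<alpha>. \<alpha> \<noteq> 0 \<longrightarrow> \<bar>H t \<alpha>\<bar> \<le> K ^ mdeg \<alpha>"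
    proof (rule root_of_convergent_composition[OF F(1-3) Hv])
      show "F \<alpha> = (\<Sum>k\<le>mdeg \<alpha>. hpart F k v * gpow (H t) k \<alpha>)" for \<alpha>
        unfolding H_def by (rule first_integral_composition[where b = "b t", OF b lieH[unfolded H_def] lieF[rule_format]])
    qed
  next
    assume "\<exists>K. \<forall>\<alpha>. \<alpha> \<noteq> 0 \<longrightarrow> \<bar>H t \<alpha>\<bar> \<le> K ^ mdeg \<alpha>"
    then obtain K where "\<And>\<alpha>. \<alpha> \<noteq> 0 \<Longrightarrow> \<bar>H t \<alpha>\<bar> \<le> K ^ mdeg \<alpha>" by blast
    then obtain r where r: "mps_conv (H t) r" by (rule mps_conv_geometric)
    obtain \<alpha> where "\<alpha> \<noteq> 0" "H t \<alpha> \<noteq> 0" using nz by blast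
    then show "has_analytic_first_integral (?X t)"
      by (rule convergent_first_integral[where X = "?X t" and a = "\<lambda>i \<alpha>. lf (\<lambda>j. A $ i $ j) \<alpha> + b t i \<alpha>", OF ps r _ _ lieH])
  qed
  have "real_poly_deg (mdeg \<alpha>) (\<lambda>t. H t \<alpha>)" for \<alpha>
    unfolding H_def b_def by (rule formal_integral_poly) (fact f)+
  then obtain P where P: "\<And>\<alpha>. poly_deg (mdeg \<alpha>) (P \<alpha>)"
    "\<And>\<alpha> t. P \<alpha> (\<chi> j. complex_of_real (t $ j)) = complex_of_real (H t \<alpha>)"
    unfolding real_poly_deg_def by (metis (no_types))
  \<comment> \<open>The real points of \<open>Z\<close> are exactly the parameters with an analytic
    first integral, while \<open>Z\<close> itself lies in the complex parameter space, where the
    growth dichotomy applies. Index 0 is left out because that dichotomy asks for positive degree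
    bounds.\<close>
  define Z where "Z = {z. \<exists>K. \<forall>\<alpha>\<in>{\<alpha>. \<alpha> \<noteq> 0}. cmod (P \<alpha> z) \<le> K ^ mdeg \<alpha>}"
  have Z_iff: "(\<chi> j. complex_of_real (t $ j)) \<in> Z \<longleftrightarrow> has_analytic_first_integral (?X t)" for t
    unfolding Z_def analytic_iff by (simp add: P(2))
  have Z: "pluripolar Z" if "\<not> has_analytic_first_integral (?X t)" for t
    unfolding Z_def
  proof (rule pluripolar_geometric_bound)
    show "\<not> (\<exists>K. \<forall>\<alpha>\<in>{\<alpha>. \<alpha> \<noteq> 0}. cmod (P \<alpha> (\<chi> j. complex_of_real (t $ j))) \<le> K ^ mdeg \<alpha>)"
      using that Z_iff[of t] by (simp add: Z_def)
    show "1 \<le> mdeg \<alpha>" if "\<alpha> \<in> {\<alpha>. \<alpha> \<noteq> 0}" for \<alpha> :: "nat^'n"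
      using that by (metis One_nat_def Suc_leI mdeg_eq_0_iff mem_Collect_eq neq0_conv)
  qed (rule P(1))
  have sub: "complex_points S \<subseteq> Z" if "\<And>t. t \<in> S \<Longrightarrow> has_analytic_first_integral (?X t)" for S
    unfolding complex_points_def using that Z_iff by (intro image_subsetI) simp
  show ?thesis
  proof (intro conjI impI allI)
    assume "\<exists>t. has_formal_first_integral (?X t) \<and> \<not> has_analytic_first_integral (?X t)"
    then obtain t where "\<not> has_analytic_first_integral (?X t)" by blast
    then have "pluripolar (complex_points {t. has_analytic_first_integral (?X t)})"
      by (rule pluripolar_subset[OF Z sub]) simp
    then show "\<exists>S. pluripolar (complex_points S) \<and>
        (\<forall>t. t \<notin> S \<longrightarrow> has_formal_first_integral (?X t) \<and> \<not> has_analytic_first_integral (?X t))"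
      by (intro exI[of _ "{t. has_analytic_first_integral (?X t)}"]) (simp add: formal)
  next
    fix t
    assume "\<exists>S. \<not> pluripolar (complex_points S) \<and> (\<forall>t\<in>S. has_analytic_first_integral (?X t))"
    then obtain S where S: "\<not> pluripolar (complex_points S)" "\<And>t. t \<in> S \<Longrightarrow> has_analytic_first_integral (?X t)"
      by blast
    show "has_analytic_first_integral (?X t)"
    proof (rule ccontr)
      assume "\<not> ?thesis"
      then have "pluripolar (complex_points S)" by (rule pluripolar_subset[OF Z sub]) (rule S(2))
      with S(1) show False ..
    qed
  qed
qed

end
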